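(* Consider the random dynamical system of the context, satisfying the complex perturbation assumption and the decay assumption stated there, and suppose $\sigma>0$. Let $\|\cdot\|_{1,\omega}$ be a (possibly different) norm on functions on $\mathcal E_\omega$ with $\|\cdot\|_{1,\omega}\ge\|\cdot\|_\infty$, and for every $t\ne0$ let $\|\cdot\|_{\omega,(t)}$ be a norm such that $$c_1\|g\|_{\omega,(t)}\le\|g\|_{1,\omega}\le c(1+|t|)\|g\|_{\omega,(t)}\quad\text{and}\quad\|\mathcal L_\omega^{it,n}\|_{\theta^n\omega,(t)}\le C$$ for constants $c_1,c,C>0$ not depending on $\omega,n,t$. Assume also that there are positive random variables $\rho_\omega,\gamma(\omega),b_\omega$ such that, $\mathbb P$-a.s., for every $t\in\mathbb R$ with $|t|\ge b_\omega$, $$\|\mathcal L_\omega^{it,n_\omega(t)}\|_{\theta^{n_\omega(t)}\omega,(t)}\le e^{-n_\omega(t)\gamma(\omega)},\qquad n_\omega(t)=[\rho_\omega\ln|t|].$$ Then for $\mathbb P$-a.e. $\omega$ and every $m\ge3$, with $f_n(t)=\mathbb E_{\mu_\omega}[e^{it(S_n^\omega-\mu_\omega(S_n^\omega))/\sigma_{\omega,n}}]$, for every $c>0$ (small enough) and $B>0$ (large enough), $$\int_{c\sigma_{\omega,n}\le|t|\le B\sigma_{\omega,n}^{m-2}}\left|\frac{f_n^{(m)}(t)}{t}\right|dt=o(\sigma_{\omega,n}^{-(m-2)}).$$ Thus, for $\mathbb P$-a.e. $\omega$, the Edgeworth expansions with parameter $m$ (defined in the context) hold for $S_n=S_n^\omega-\mu_\omega(S_n^\omega)$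 for every $m\ge3$.
   Context: $(\Omega,\mathcal F,\mathbb P)$ is a probability space, $\theta:\Omega\to\Omega$ an ergodic invertible (measure preserving) map, $(\mathcal X,d)$ a metric space, $\mathcal E_\omega\subset\mathcal X$ a measurable family of compact sets, $\mathcal E=\{(\omega,x):x\in\mathcal E_\omega\}$, and $T(\omega,x)=(\theta\omega,T_\omega x)$ a measurable map of $\mathcal E$ with $T_\omega:\mathcal E_\omega\to\mathcal E_{\theta\omega}$. $\mu=\int\mu_\omega\,d\mathbb P(\omega)$ is a $T$-invariant probability measure, $(T_\omega)_*\mu_\omega=\mu_{\theta\omega}$. $\mathcal L_\omega$ is defined by $\int g\cdot(f\circ T_\omega)d\mu_\omega=\int f\cdot(\mathcal L_\omega g)d\mu_{\theta\omega}$ for bounded $f,g$. $(B_\omega,\|\cdot\|_\omega)$ are normed (Banach) spaces of functions on $\mathcal E_\omega$, and $f:\mathcal E\to\mathbb R$ is measurable with $\operatorname{ess\,sup}_\omega\|f(\omega,\cdot)\|_\omega<\infty$; $f_\omega=f(\omega,\cdot)$. $S_n^\omega=\sum_{j=0}^{n-1}f_{\theta^j\omega}\circ T_{\theta^{j-1}\omega}\circ\cdots\circ T_\omega$, regarded as a random variable on $(\mathcal E_\omega,\mu_\omega)$; $\sigma_{\omega,n}=\|S_n^\omega-\mu_\omega(S_n^\omega)\|_{L^2(\mu_\omega)}$. For $z\in\mathbb C$, $\mathcal L_\omega^z(g)=\mathcal L_\omega(ge^{zf_\omega})$ and $\mathcal L_\omega^{z,n}=\mathcal L_{\theta^{n-1}\omega}^z\circ\cdots\circ\mathcal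 L_\omega^z$; $\mathcal L_\omega:B_\omega\to B_{\theta\omega}$ is continuous and $z\mapsto e^{zf_\omega}\in B_\omega$ is analytic uniformly in $\omega$. $\|\mathcal L_\omega^{z,n}\|_{\theta^n\omega}$ is the operator norm from $\|\cdot\|_\omega$ to $\|\cdot\|_{\theta^n\omega}$, and $\|\mathcal L_\omega^{z,n}\|_{\theta^n\omega,(t)}$ the operator norm from $\|\cdot\|_{\omega,(t)}$ to $\|\cdot\|_{\theta^n\omega,(t)}$. $[\cdot]$ is the integer part. Complex perturbation assumption: there is $r_0>0$ such that $\mathbb P$-a.s. for every complex $|z|<r_0$ there are $\lambda_\omega(z)\in\mathbb C\setminus\{0\}$, $h_\omega^{(z)}\in B_\omega$, $\nu_\omega^{(z)}\in B_\omega^*$, measurable in $\omega$ and analytic in $z$, with $\lambda_\omega(0)=1$, $h_\omega^{(0)}=\mathbf 1$, $\nu_\omega^{(0)}=\mu_\omega$, $\nu_\omega^{(z)}(h_\omega^{(z)})=1$, and constants $C>0$, $\delta\in(0,1)$ such that, with $\lambda_{\omega,n}(z)=\prod_{j=0}^{n-1}\lambda_{\theta^j\omega}(z)$, $\|(\lambda_{\omega,n}(z))^{-1}\mathcal L_\omega^{z,n}-\nu_\omega^{(z)}\otimes h_{\theta^n\omega}^{(z)}\|_{\theta^n\omega}\le C\delta^n$, where $(\nu\otimes h)(g)=\nu(g)h$. Under this assumption there is $\sigma\ge0$ with $\sigma^2=\lim_n\frac1n\mathrm{Var}_{\mu_\omega}(S_n^\omega)$, $\mathbb P$-a.s. Decay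 assumption: for every compact $K\subset\mathbb R\setminus\{0\}$, $\sup_{t\in K}\sup_{n\ge1}\|\mathcal L_\omega^{it,n}\|_{\theta^n\omega}\le C(K)$ with $C(K)$ depending only on $K$, and, for some $\alpha>0$, $\sup_{t\in K}\|\mathcal L_\omega^{it,n}\|_{\theta^n\omega}\le C_\omega(K)e^{-c_Kn^\alpha}$, where $C_\omega(K)>0$ and $c_K>0$ depend on $K$ and $\omega\mapsto C_\omega(K)$ is measurable. Edgeworth expansions with parameter $m$ hold for centered $(S_n)$, $\sigma_n=\|S_n\|_{L^2}\to\infty$, if: for every bounded real sequence $(A_n)$ and sequence $B_n=\sigma_n+O(1)$, with $W_n=(S_n-A_n)/B_n$ and $F_n(x)=\mathbb P(W_n\le x)$ (probability under the law on which $S_n$ lives), there are polynomials $H_{j,n}$, $1\le j\le m-2$, with bounded coefficients (polynomial functions of $A_n$, $B_n-\sigma_n$ and $\Lambda_n^{(k)}(0)\sigma_n^{k-2}$, $k\ge3$, where $\Lambda_n(t)=\ln\mathbb E[e^{itS_n/\sigma_n}]+t^2/2$) and degrees not depending on $n$, such that with $\Psi_{r,n}(x)=\Phi(x)+\varphi(x)\sum_{j=1}^rB_n^{-j}H_{j,n}(x)$ ($\varphi,\Phi$ standard normal density and distribution function), for all $r=1,\dots,m-2$: (a) $|F_n(x)-\Psi_{r,n}(x)|\le C_nB_n^{-r}(1+|x|)^{-m}$ for all $x\in\mathbb R$, with $C_n\to0$, and in particular $\|F_n-\Psi_{r,n}\|_{L^p(dx)}=o(\sigma_n^{-r})$ for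 all $p>1/m$; (b) $W_p(dF_n,d\Psi_{r,n})=o(B_n^{-r/p})$ for all $1\le p<m-1$; (c) for every a.e. differentiable $h:\mathbb R\to\mathbb R$ with $H_m(h)=\int\frac{|h'(x)|}{(1+|x|)^m}dx<\infty$, $|\mathbb E[h(W_n)]-\int h\,d\Psi_{r,n}|\le C_nH_m(h)B_n^{-r}$ with $C_n\to0$; in particular, for every $q<m$, $|\mathbb E[W_n^q]-\int x^q\,d\Psi_{r,n}(x)|\le R_mC_nB_n^{-r}$ and $|\mathbb E[|W_n|^q]-\int|x|^q\,d\Psi_{r,n}(x)|\le R_mC_nB_n^{-r}$, with $C_n\to0$ and $R_m$ depending only on $m$. Here for $p\ge1$ with conjugate exponent $q$ and finite signed measures with finite absolute $p$-th moments, $W_p(\mu,\nu)=\sup_{u}\int_{\mathbb R}|u(F_\mu(x))-u(F_\nu(x))|dx$, the supremum over differentiable $u$ with $\|u'\|_{L^q(dx)}\le1$, $F_\mu(x)=\mu((-\infty,x])$.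
   Formalization: In the complex perturbation assumption, the moduli or norms of λ_ω(z), h_ω^{(z)}, ν_ω^{(z)} are also assumed bounded uniformly in ω and z; in (c), h is assumed to be the integral of its a.e. derivative (locally absolutely continuous). Without these the claim fails. *)

theory Defs
  imports "HOL-Probability.Probability" "HOL-Complex_Analysis.Complex_Analysis"
    "HOL-Library.Landau_Symbols"
begin

section \<open>Normed spaces of functions\<close>

text \<open>
  A complex function on a set \<open>A\<close> is represented by its extension by zero, so that
  equality of functions on \<open>A\<close> is equality in HOL. Spaces of such functions, and
  likewise their duals, are sets of complex-valued functions on some type, with pointwise
  linear structure and a norm passed as an explicit argument.
\<close>

definition ext0 :: "'a set \<Rightarrow> ('a \<Rightarrow> complex) \<Rightarrow> 'a \<Rightarrow> complex" where
  "ext0 A g = (\<lambda>x. if x \<in> A then g x else 0)"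

definition fun_subspace :: "'a set \<Rightarrow> ('a \<Rightarrow> complex) set \<Rightarrow> bool" where
  "fun_subspace A V \<longleftrightarrow>
     (\<forall>g\<in>V. \<forall>x. x \<notin> A \<longrightarrow> g x = 0) \<and>
     (\<lambda>x. 0) \<in> V \<and>
     (\<forall>g\<in>V. \<forall>h\<in>V. (\<lambda>x. g x + h x) \<in> V) \<and>
     (\<forall>a. \<forall>g\<in>V. (\<lambda>x. a * g x) \<in> V)"

definition is_norm_on :: "('a \<Rightarrow> complex) set \<Rightarrow> (('a \<Rightarrow> complex) \<Rightarrow> real) \<Rightarrow> bool" where
  "is_norm_on V N \<longleftrightarrow>
     (\<forall>g\<in>V. 0 \<le> N g \<and> (N g = 0 \<longleftrightarrow> g = (\<lambda>x. 0))) \<and>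
     (\<forall>g\<in>V. \<forall>h\<in>V. N (\<lambda>x. g x + h x) \<le> N g + N h) \<and>
     (\<forall>a. \<forall>g\<in>V. N (\<lambda>x. a * g x) = cmod a * N g)"

definition complete_norm_on :: "('a \<Rightarrow> complex) set \<Rightarrow> (('a \<Rightarrow> complex) \<Rightarrow> real) \<Rightarrow> bool" where
  "complete_norm_on V N \<longleftrightarrow>
     (\<forall>u :: nat \<Rightarrow> 'a \<Rightarrow> complex.
        (\<forall>n. u n \<in> V) \<and>
        (\<forall>e>0. \<exists>n0. \<forall>i\<ge>n0. \<forall>j\<ge>n0. N (\<lambda>x. u i x - u j x) < e) \<longrightarrow>
        (\<exists>v\<in>V. (\<lambda>n. N (\<lambda>x. u n x - v x)) \<longlonglongrightarrow> 0))"

definition linear_map_on ::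
  "('a \<Rightarrow> complex) set \<Rightarrow> (('a \<Rightarrow> complex) \<Rightarrow> ('b \<Rightarrow> complex)) \<Rightarrow> bool" where
  "linear_map_on V A \<longleftrightarrow>
     (\<forall>g\<in>V. \<forall>h\<in>V. A (\<lambda>x. g x + h x) = (\<lambda>y. A g y + A h y)) \<and>
     (\<forall>a. \<forall>g\<in>V. A (\<lambda>x. a * g x) = (\<lambda>y. a * A g y))"

text \<open>The operator norm is extended-valued: an unbounded operator has norm \<open>\<infinity>\<close>.\<close>

definition op_norm :: "'a set \<Rightarrow> ('a \<Rightarrow> real) \<Rightarrow> ('b \<Rightarrow> real) \<Rightarrow> ('a \<Rightarrow> 'b) \<Rightarrow> ennreal" where
  "op_norm V N N' A = (SUP g\<in>{g\<in>V. N g \<le> 1}. ennreal (N' (A g)))"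

definition dual_space ::
  "('a \<Rightarrow> complex) set \<Rightarrow> (('a \<Rightarrow> complex) \<Rightarrow> real) \<Rightarrow> (('a \<Rightarrow> complex) \<Rightarrow> complex) set" where
  "dual_space V N =
     {\<nu>. (\<forall>g\<in>V. \<forall>h\<in>V. \<nu> (\<lambda>x. g x + h x) = \<nu> g + \<nu> h) \<and>
         (\<forall>a. \<forall>g\<in>V. \<nu> (\<lambda>x. a * g x) = a * \<nu> g) \<and>
         op_norm V N cmod \<nu> < \<infinity>}"

definition dual_norm ::
  "('a \<Rightarrow> complex) set \<Rightarrow> (('a \<Rightarrow> complex) \<Rightarrow> real) \<Rightarrow> (('a \<Rightarrow> complex) \<Rightarrow> complex) \<Rightarrow> real" where
  "dual_norm V N \<nu> = enn2real (op_norm V N cmod \<nu>)"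

definition analytic_into ::
  "('a \<Rightarrow> complex) set \<Rightarrow> (('a \<Rightarrow> complex) \<Rightarrow> real) \<Rightarrow> complex set \<Rightarrow>
    (complex \<Rightarrow> 'a \<Rightarrow> complex) \<Rightarrow> bool" where
  "analytic_into V N U F \<longleftrightarrow>
     (\<forall>z\<in>U. F z \<in> V) \<and>
     (\<forall>z\<in>U. \<exists>D\<in>V. ((\<lambda>w. N (\<lambda>x. (F w x - F z x) / (w - z) - D x)) \<longlongrightarrow> 0) (at z))"


section \<open>Random dynamical systems\<close>

definition ergodic_automorphism :: "'w measure \<Rightarrow> ('w \<Rightarrow> 'w) \<Rightarrow> bool" where
  "ergodic_automorphism P \<theta> \<longleftrightarrow>
     prob_space P \<and>
     bij_betw \<theta> (space P) (space P) \<and>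
     \<theta> \<in> measurable P P \<and> inv_into (space P) \<theta> \<in> measurable P P \<and>
     distr P P \<theta> = P \<and>
     (\<forall>A\<in>sets P. \<theta> -` A \<inter> space P = A \<longrightarrow> measure P A = 0 \<or> measure P A = 1)"

text \<open>The measurable space of pairs \<open>(\<omega>, x)\<close> with \<open>x\<close> in the fibre over \<open>\<omega>\<close>.\<close>

definition fibre_bundle :: "'w measure \<Rightarrow> ('w \<Rightarrow> 'x::metric_space set) \<Rightarrow> ('w \<times> 'x) measure" where
  "fibre_bundle P E = restrict_space (P \<Otimes>\<^sub>M borel) (Sigma (space P) E)"

definition random_dynamical_system ::
  "'w measure \<Rightarrow> ('w \<Rightarrow> 'w) \<Rightarrow> ('w \<Rightarrow> 'x::metric_space set) \<Rightarrow> ('w \<Rightarrow> 'x \<Rightarrow> 'x) \<Rightarrow>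
    ('w \<Rightarrow> 'x measure) \<Rightarrow> ('w \<times> 'x) measure \<Rightarrow> bool" where
  "random_dynamical_system P \<theta> E T \<mu> \<mu>tot \<longleftrightarrow>
     ergodic_automorphism P \<theta> \<and>
     (\<forall>\<omega>\<in>space P. compact (E \<omega>)) \<and>
     Sigma (space P) E \<in> sets (P \<Otimes>\<^sub>M borel) \<and>
     (\<forall>\<omega>\<in>space P. T \<omega> ` E \<omega> \<subseteq> E (\<theta> \<omega>)) \<and>
     (\<lambda>(\<omega>, x). (\<theta> \<omega>, T \<omega> x)) \<in> measurable (fibre_bundle P E) (fibre_bundle P E) \<and>
     (\<forall>\<omega>\<in>space P. prob_space (\<mu> \<omega>) \<and> sets (\<mu> \<omega>) = sets (restrict_space borel (E \<omega>))) \<and>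
     sets \<mu>tot = sets (fibre_bundle P E) \<and>
     (\<forall>A\<in>sets (fibre_bundle P E).
        (\<lambda>\<omega>. emeasure (\<mu> \<omega>) (Pair \<omega> -` A)) \<in> borel_measurable P \<and>
        emeasure \<mu>tot A = (\<integral>\<^sup>+ \<omega>. emeasure (\<mu> \<omega>) (Pair \<omega> -` A) \<partial>P)) \<and>
     distr \<mu>tot \<mu>tot (\<lambda>(\<omega>, x). (\<theta> \<omega>, T \<omega> x)) = \<mu>tot \<and>
     (AE \<omega> in P. distr (\<mu> \<omega>) (\<mu> (\<theta> \<omega>)) (T \<omega>) = \<mu> (\<theta> \<omega>))"

primrec fibre_iter :: "('w \<Rightarrow> 'w) \<Rightarrow> ('w \<Rightarrow> 'x \<Rightarrow> 'x) \<Rightarrow> nat \<Rightarrow> 'w \<Rightarrow> 'x \<Rightarrow> 'x" where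
  "fibre_iter \<theta> T 0 \<omega> x = x"
| "fibre_iter \<theta> T (Suc n) \<omega> x = T ((\<theta> ^^ n) \<omega>) (fibre_iter \<theta> T n \<omega> x)"

definition birkhoff_sum ::
  "('w \<Rightarrow> 'w) \<Rightarrow> ('w \<Rightarrow> 'x \<Rightarrow> 'x) \<Rightarrow> ('w \<Rightarrow> 'x \<Rightarrow> real) \<Rightarrow> 'w \<Rightarrow> nat \<Rightarrow> 'x \<Rightarrow> real" where
  "birkhoff_sum \<theta> T f \<omega> n x = (\<Sum>j<n. f ((\<theta> ^^ j) \<omega>) (fibre_iter \<theta> T j \<omega> x))"

definition centered_sum ::
  "('w \<Rightarrow> 'w) \<Rightarrow> ('w \<Rightarrow> 'x \<Rightarrow> 'x) \<Rightarrow> ('w \<Rightarrow> 'x measure) \<Rightarrow> ('w \<Rightarrow> 'x \<Rightarrow> real) \<Rightarrow>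
    'w \<Rightarrow> nat \<Rightarrow> 'x \<Rightarrow> real" where
  "centered_sum \<theta> T \<mu> f \<omega> n x =
     birkhoff_sum \<theta> T f \<omega> n x - (LINT y|\<mu> \<omega>. birkhoff_sum \<theta> T f \<omega> n y)"

definition l2_norm_seq :: "'x measure \<Rightarrow> (nat \<Rightarrow> 'x \<Rightarrow> real) \<Rightarrow> nat \<Rightarrow> real" where
  "l2_norm_seq M S n = sqrt (LINT x|M. (S n x)\<^sup>2)"


section \<open>Transfer operators\<close>

definition bounded_fibre_functions ::
  "('w \<Rightarrow> 'x::metric_space set) \<Rightarrow> ('w \<Rightarrow> 'x measure) \<Rightarrow> 'w \<Rightarrow> ('x \<Rightarrow> complex) set" where
  "bounded_fibre_functions E \<mu> \<omega> =
     {g \<in> borel_measurable (\<mu> \<omega>). bounded (g ` E \<omega>) \<and> (\<forall>x. x \<notin> E \<omega> \<longrightarrow> g x = 0)}"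

definition transfer_operators ::
  "'w measure \<Rightarrow> ('w \<Rightarrow> 'w) \<Rightarrow> ('w \<Rightarrow> 'x::metric_space set) \<Rightarrow> ('w \<Rightarrow> 'x \<Rightarrow> 'x) \<Rightarrow>
    ('w \<Rightarrow> 'x measure) \<Rightarrow> ('w \<Rightarrow> ('x \<Rightarrow> complex) \<Rightarrow> 'x \<Rightarrow> complex) \<Rightarrow> bool" where
  "transfer_operators P \<theta> E T \<mu> L \<longleftrightarrow>
     (AE \<omega> in P. \<forall>g\<in>bounded_fibre_functions E \<mu> \<omega>.
        integrable (\<mu> (\<theta> \<omega>)) (L \<omega> g) \<and>
        (\<forall>k\<in>bounded_fibre_functions E \<mu> (\<theta> \<omega>).
           (LINT x|\<mu> \<omega>. g x * k (T \<omega> x)) = (LINT y|\<mu> (\<theta> \<omega>). k y * L \<omega> g y)))"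

definition twisted_op ::
  "('w \<Rightarrow> ('x \<Rightarrow> complex) \<Rightarrow> 'x \<Rightarrow> complex) \<Rightarrow> ('w \<Rightarrow> 'x \<Rightarrow> real) \<Rightarrow> complex \<Rightarrow>
    'w \<Rightarrow> ('x \<Rightarrow> complex) \<Rightarrow> 'x \<Rightarrow> complex" where
  "twisted_op L f z \<omega> g = L \<omega> (\<lambda>x. g x * exp (z * complex_of_real (f \<omega> x)))"

primrec twisted_iter ::
  "('w \<Rightarrow> 'w) \<Rightarrow> ('w \<Rightarrow> ('x \<Rightarrow> complex) \<Rightarrow> 'x \<Rightarrow> complex) \<Rightarrow> ('w \<Rightarrow> 'x \<Rightarrow> real) \<Rightarrow> complex \<Rightarrow>
    nat \<Rightarrow> 'w \<Rightarrow> ('x \<Rightarrow> complex) \<Rightarrow> 'x \<Rightarrow> complex" where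
  "twisted_iter \<theta> L f z 0 \<omega> g = g"
| "twisted_iter \<theta> L f z (Suc n) \<omega> g =
     twisted_op L f z ((\<theta> ^^ n) \<omega>) (twisted_iter \<theta> L f z n \<omega> g)"

definition twisted_norm ::
  "('w \<Rightarrow> 'w) \<Rightarrow> ('w \<Rightarrow> ('x \<Rightarrow> complex) \<Rightarrow> 'x \<Rightarrow> complex) \<Rightarrow> ('w \<Rightarrow> 'x \<Rightarrow> real) \<Rightarrow>
    ('w \<Rightarrow> ('x \<Rightarrow> complex) set) \<Rightarrow> ('w \<Rightarrow> ('x \<Rightarrow> complex) \<Rightarrow> real) \<Rightarrow>
    complex \<Rightarrow> nat \<Rightarrow> 'w \<Rightarrow> ennreal" where
  "twisted_norm \<theta> L f B N z n \<omega> =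
     op_norm (B \<omega>) (N \<omega>) (N ((\<theta> ^^ n) \<omega>)) (twisted_iter \<theta> L f z n \<omega>)"

definition fibre_banach_spaces ::
  "'w measure \<Rightarrow> ('w \<Rightarrow> 'x::metric_space set) \<Rightarrow> ('w \<Rightarrow> 'x measure) \<Rightarrow>
    ('w \<Rightarrow> ('x \<Rightarrow> complex) set) \<Rightarrow> ('w \<Rightarrow> ('x \<Rightarrow> complex) \<Rightarrow> real) \<Rightarrow> bool" where
  "fibre_banach_spaces P E \<mu> B N \<longleftrightarrow>
     (\<forall>\<omega>\<in>space P. fun_subspace (E \<omega>) (B \<omega>) \<and> B \<omega> \<subseteq> borel_measurable (\<mu> \<omega>) \<and>
        is_norm_on (B \<omega>) (N \<omega>) \<and> complete_norm_on (B \<omega>) (N \<omega>))"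

definition continuous_transfer ::
  "'w measure \<Rightarrow> ('w \<Rightarrow> 'w) \<Rightarrow> ('w \<Rightarrow> ('x \<Rightarrow> complex) \<Rightarrow> 'x \<Rightarrow> complex) \<Rightarrow>
    ('w \<Rightarrow> ('x \<Rightarrow> complex) set) \<Rightarrow> ('w \<Rightarrow> ('x \<Rightarrow> complex) \<Rightarrow> real) \<Rightarrow> bool" where
  "continuous_transfer P \<theta> L B N \<longleftrightarrow>
     (AE \<omega> in P. L \<omega> ` B \<omega> \<subseteq> B (\<theta> \<omega>) \<and> linear_map_on (B \<omega>) (L \<omega>) \<and>
        op_norm (B \<omega>) (N \<omega>) (N (\<theta> \<omega>)) (L \<omega>) < \<infinity>)"

text \<open>
  Closedness of \<open>B \<omega>\<close> under multiplication by \<open>exp (z f\<^sub>\<omega>)\<close> is what makes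
  the twisted operators act on these spaces. Analyticity uniform in \<open>\<omega>\<close> means analyticity
  together with a bound, on every disc, that does not depend on \<open>\<omega>\<close>.
\<close>

definition admissible_observable ::
  "'w measure \<Rightarrow> ('w \<Rightarrow> 'x::metric_space set) \<Rightarrow> ('w \<Rightarrow> ('x \<Rightarrow> complex) set) \<Rightarrow>
    ('w \<Rightarrow> ('x \<Rightarrow> complex) \<Rightarrow> real) \<Rightarrow> ('w \<Rightarrow> 'x \<Rightarrow> real) \<Rightarrow> bool" where
  "admissible_observable P E B N f \<longleftrightarrow>
     (\<lambda>(\<omega>, x). f \<omega> x) \<in> borel_measurable (fibre_bundle P E) \<and>
     (\<exists>K. AE \<omega> in P. ext0 (E \<omega>) (\<lambda>x. complex_of_real (f \<omega> x)) \<in> B \<omega> \<and>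
        N \<omega> (ext0 (E \<omega>) (\<lambda>x. complex_of_real (f \<omega> x))) \<le> K) \<and>
     (AE \<omega> in P. \<forall>z. \<forall>g\<in>B \<omega>. (\<lambda>x. g x * exp (z * complex_of_real (f \<omega> x))) \<in> B \<omega>) \<and>
     (\<forall>R>0. \<exists>K. AE \<omega> in P.
        analytic_into (B \<omega>) (N \<omega>) (ball 0 R)
          (\<lambda>z. ext0 (E \<omega>) (\<lambda>x. exp (z * complex_of_real (f \<omega> x)))) \<and>
        (\<forall>z\<in>ball 0 R. N \<omega> (ext0 (E \<omega>) (\<lambda>x. exp (z * complex_of_real (f \<omega> x)))) \<le> K))"

text \<open>
  As for \<open>exp (z f\<^sub>\<omega>)\<close>, analyticity in \<open>z\<close> is understood uniformly in
  \<open>\<omega>\<close>: \<open>K\<close> bounds the eigenvalues, eigenfunctions and functionals for all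
  \<open>\<omega>\<close> and \<open>z\<close> at once. The joint constants \<open>C\<close> and \<open>\<delta>\<close> do not imply
  this, because they do not fix the scale of the norms from one fibre to the next.
\<close>

definition complex_perturbation ::
  "'w measure \<Rightarrow> ('w \<Rightarrow> 'w) \<Rightarrow> ('w \<Rightarrow> 'x::metric_space set) \<Rightarrow> ('w \<Rightarrow> 'x measure) \<Rightarrow>
    ('w \<Rightarrow> ('x \<Rightarrow> complex) \<Rightarrow> 'x \<Rightarrow> complex) \<Rightarrow>
    ('w \<Rightarrow> ('x \<Rightarrow> complex) set) \<Rightarrow> ('w \<Rightarrow> ('x \<Rightarrow> complex) \<Rightarrow> real) \<Rightarrow>
    ('w \<Rightarrow> 'x \<Rightarrow> real) \<Rightarrow> bool" where
  "complex_perturbation P \<theta> E \<mu> L B N f \<longleftrightarrow>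
     (\<exists>(r0::real) (lam :: 'w \<Rightarrow> complex \<Rightarrow> complex) (h :: 'w \<Rightarrow> complex \<Rightarrow> 'x \<Rightarrow> complex)
        (\<nu> :: 'w \<Rightarrow> complex \<Rightarrow> ('x \<Rightarrow> complex) \<Rightarrow> complex) (K::real) (C::real) (\<delta>::real).
        0 < r0 \<and> 0 < C \<and> 0 < \<delta> \<and> \<delta> < 1 \<and>
        (\<forall>z\<in>ball 0 r0.
           (\<lambda>\<omega>. lam \<omega> z) \<in> borel_measurable P \<and>
           (\<lambda>(\<omega>, x). h \<omega> z x) \<in> borel_measurable (fibre_bundle P E) \<and>
           (\<forall>G. (\<lambda>(\<omega>, x). G \<omega> x) \<in> borel_measurable (fibre_bundle P E) \<and>
                (\<forall>\<omega>\<in>space P. G \<omega> \<in> B \<omega>) \<longrightarrow>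
                (\<lambda>\<omega>. \<nu> \<omega> z (G \<omega>)) \<in> borel_measurable P)) \<and>
        (AE \<omega> in P.
           lam \<omega> analytic_on ball 0 r0 \<and>
           analytic_into (B \<omega>) (N \<omega>) (ball 0 r0) (h \<omega>) \<and>
           analytic_into (dual_space (B \<omega>) (N \<omega>)) (dual_norm (B \<omega>) (N \<omega>)) (ball 0 r0) (\<nu> \<omega>) \<and>
           lam \<omega> 0 = 1 \<and>
           h \<omega> 0 = ext0 (E \<omega>) (\<lambda>x. 1) \<and>
           (\<forall>g\<in>B \<omega>. \<nu> \<omega> 0 g = (LINT x|\<mu> \<omega>. g x)) \<and>
           (\<forall>z\<in>ball 0 r0.
              lam \<omega> z \<noteq> 0 \<and> \<nu> \<omega> z (h \<omega> z) = 1 \<and>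
              cmod (lam \<omega> z) \<le> K \<and> N \<omega> (h \<omega> z) \<le> K \<and> dual_norm (B \<omega>) (N \<omega>) (\<nu> \<omega> z) \<le> K \<and>
              (\<forall>n\<ge>1. op_norm (B \<omega>) (N \<omega>) (N ((\<theta> ^^ n) \<omega>))
                 (\<lambda>g x. inverse (\<Prod>j<n. lam ((\<theta> ^^ j) \<omega>) z) * twisted_iter \<theta> L f z n \<omega> g x
                        - \<nu> \<omega> z g * h ((\<theta> ^^ n) \<omega>) z x)
                 \<le> ennreal (C * \<delta> ^ n)))))"

definition decay_assumption ::
  "'w measure \<Rightarrow> ('w \<Rightarrow> 'w) \<Rightarrow> ('w \<Rightarrow> ('x \<Rightarrow> complex) \<Rightarrow> 'x \<Rightarrow> complex) \<Rightarrow>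
    ('w \<Rightarrow> ('x \<Rightarrow> complex) set) \<Rightarrow> ('w \<Rightarrow> ('x \<Rightarrow> complex) \<Rightarrow> real) \<Rightarrow>
    ('w \<Rightarrow> 'x \<Rightarrow> real) \<Rightarrow> bool" where
  "decay_assumption P \<theta> L B N f \<longleftrightarrow>
     (\<forall>K::real set. compact K \<and> 0 \<notin> K \<longrightarrow>
        (\<exists>C::real. AE \<omega> in P. \<forall>t\<in>K. \<forall>n\<ge>1.
           twisted_norm \<theta> L f B N (\<i> * complex_of_real t) n \<omega> \<le> ennreal C)) \<and>
     (\<exists>\<alpha>::real. 0 < \<alpha> \<and>
        (\<forall>K::real set. compact K \<and> 0 \<notin> K \<longrightarrow>
           (\<exists>c>0. \<exists>C\<in>borel_measurable P. AE \<omega> in P. 0 < C \<omega> \<and>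
              (\<forall>t\<in>K. \<forall>n\<ge>1. twisted_norm \<theta> L f B N (\<i> * complex_of_real t) n \<omega>
                 \<le> ennreal (C \<omega> * exp (- c * real n powr \<alpha>))))))"


section \<open>Edgeworth expansions\<close>

definition nth_vector_derivative ::
  "nat \<Rightarrow> (real \<Rightarrow> complex) \<Rightarrow> real \<Rightarrow> complex" where
  "nth_vector_derivative k = (\<lambda>g t. vector_derivative g (at t)) ^^ k"

definition normalized_char :: "'x measure \<Rightarrow> (nat \<Rightarrow> 'x \<Rightarrow> real) \<Rightarrow> nat \<Rightarrow> real \<Rightarrow> complex" where
  "normalized_char M S n = char (distr M borel (\<lambda>x. S n x / l2_norm_seq M S n))"

definition log_char_defect :: "'x measure \<Rightarrow> (nat \<Rightarrow> 'x \<Rightarrow> real) \<Rightarrow> nat \<Rightarrow> real \<Rightarrow> complex" where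
  "log_char_defect M S n t = Ln (normalized_char M S n t) + complex_of_real (t\<^sup>2 / 2)"

text \<open>Polynomial functions with complex coefficients in finitely many of the variables \<open>v 0, v 1, \<dots>\<close>.\<close>

inductive_set poly_funs :: "((nat \<Rightarrow> complex) \<Rightarrow> complex) set" where
  const: "(\<lambda>v. c) \<in> poly_funs"
| var: "(\<lambda>v. v i) \<in> poly_funs"
| add: "p \<in> poly_funs \<Longrightarrow> q \<in> poly_funs \<Longrightarrow> (\<lambda>v. p v + q v) \<in> poly_funs"
| mult: "p \<in> poly_funs \<Longrightarrow> q \<in> poly_funs \<Longrightarrow> (\<lambda>v. p v * q v) \<in> poly_funs"

text \<open>
  The quantities on which the coefficients depend polynomially, listed as one sequence of
  variables; the index \<open>2\<close> is not used.
\<close>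

definition edgeworth_vars ::
  "'x measure \<Rightarrow> (nat \<Rightarrow> 'x \<Rightarrow> real) \<Rightarrow> (nat \<Rightarrow> real) \<Rightarrow> (nat \<Rightarrow> real) \<Rightarrow> nat \<Rightarrow> nat \<Rightarrow> complex" where
  "edgeworth_vars M S A B n k =
     (if k = 0 then complex_of_real (A n)
      else if k = 1 then complex_of_real (B n - l2_norm_seq M S n)
      else if k = 2 then 0
      else nth_vector_derivative k (log_char_defect M S n) 0
             * complex_of_real (l2_norm_seq M S n ^ (k - 2)))"

definition edgeworth_approx ::
  "(nat \<Rightarrow> real) \<Rightarrow> (nat \<Rightarrow> nat \<Rightarrow> real poly) \<Rightarrow> nat \<Rightarrow> nat \<Rightarrow> real \<Rightarrow> real" where
  "edgeworth_approx B H r n x =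
     cdf std_normal_distribution x
     + std_normal_density x * (\<Sum>j=1..r. poly (H j n) x / B n ^ j)"

text \<open>
  The transport distance of two (signed) measures, in terms of their distribution functions.
  The condition on \<open>u\<close> is that the derivative of \<open>u\<close> has norm at most one in
  \<open>L\<^sup>q\<close>, with \<open>q\<close> the exponent conjugate to \<open>p\<close>.
\<close>

definition transport_dist :: "real \<Rightarrow> (real \<Rightarrow> real) \<Rightarrow> (real \<Rightarrow> real) \<Rightarrow> ennreal" where
  "transport_dist p F G =
     (SUP u\<in>{u :: real \<Rightarrow> real. (\<forall>y. u differentiable (at y)) \<and>
                (if p = 1 then (AE y in lborel. \<bar>deriv u y\<bar> \<le> 1)
                 else (\<integral>\<^sup>+ y. ennreal (\<bar>deriv u y\<bar> powr (p / (p - 1))) \<partial>lborel) \<le> 1)}.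
        \<integral>\<^sup>+ x. ennreal \<bar>u (F x) - u (G x)\<bar> \<partial>lborel)"

text \<open>
  \<open>h\<close> is differentiable almost everywhere with derivative \<open>h'\<close>, and is recovered
  from \<open>h'\<close> by integration. The second part rules out functions such as step functions
  and the Cantor function, whose almost-everywhere derivative vanishes.
\<close>

definition ae_antiderivative :: "(real \<Rightarrow> real) \<Rightarrow> (real \<Rightarrow> real) \<Rightarrow> bool" where
  "ae_antiderivative h h' \<longleftrightarrow>
     h' \<in> borel_measurable borel \<and>
     (AE x in lborel. (h has_real_derivative h' x) (at x)) \<and>
     (\<forall>a b. a \<le> b \<longrightarrow> set_integrable lborel {a..b} h' \<and>
                      h b - h a = (LINT x:{a..b}|lborel. h' x))"

text \<open>
  \<open>R\<close> is the constant in the moment estimates. The measure with distribution function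
  \<open>edgeworth_approx B H r n\<close> is represented by its density, the derivative of that
  function. The bounds are asserted for those \<open>n\<close> for which \<open>B n\<close> is positive, which
  excludes only finitely many \<open>n\<close>.
\<close>

definition edgeworth_expansions ::
  "nat \<Rightarrow> real \<Rightarrow> 'x measure \<Rightarrow> (nat \<Rightarrow> 'x \<Rightarrow> real) \<Rightarrow> bool" where
  "edgeworth_expansions m R M S \<longleftrightarrow>
     (\<forall>n. (LINT x|M. S n x) = 0) \<and>
     filterlim (l2_norm_seq M S) at_top sequentially \<and>
     (\<exists>(d :: nat \<Rightarrow> nat) (Q :: nat \<Rightarrow> nat \<Rightarrow> (nat \<Rightarrow> complex) \<Rightarrow> complex).
        (\<forall>j i. Q j i \<in> poly_funs) \<and>
        (\<forall>A B. Bseq A \<and> Bseq (\<lambda>n. B n - l2_norm_seq M S n) \<longrightarrow>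
          (\<exists>H :: nat \<Rightarrow> nat \<Rightarrow> real poly.
            (\<forall>j\<in>{1..m-2}.
               (\<forall>n. degree (H j n) \<le> d j) \<and>
               (\<forall>n. \<forall>i\<le>d j. complex_of_real (coeff (H j n) i) = Q j i (edgeworth_vars M S A B n)) \<and>
               (\<exists>K. \<forall>n i. \<bar>coeff (H j n) i\<bar> \<le> K)) \<and>
            (\<forall>r\<in>{1..m-2}.
               (let W = (\<lambda>n x. (S n x - A n) / B n);
                    F = (\<lambda>n. cdf (distr M borel (W n)));
                    \<Psi> = edgeworth_approx B H r
                in
                  (\<exists>C. C \<longlonglongrightarrow> 0 \<and>
                     (\<forall>n. 0 < B n \<longrightarrow>
                        (\<forall>x. \<bar>F n x - \<Psi> n x\<bar> \<le> C n / B n ^ r / (1 + \<bar>x\<bar>) ^ m))) \<and>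
                  (\<forall>p. 1 / real m < p \<longrightarrow>
                     (\<lambda>n. (LINT x|lborel. \<bar>F n x - \<Psi> n x\<bar> powr p) powr (1 / p))
                       \<in> o(\<lambda>n. 1 / l2_norm_seq M S n ^ r)) \<and>
                  (\<forall>p. 1 \<le> p \<and> p < real m - 1 \<longrightarrow>
                     (\<lambda>n. transport_dist p (F n) (\<Psi> n) * ennreal (B n powr (real r / p)))
                       \<longlonglongrightarrow> 0) \<and>
                  (\<exists>C. C \<longlonglongrightarrow> 0 \<and>
                     (\<forall>n. 0 < B n \<longrightarrow>
                        (\<forall>h h'. ae_antiderivative h h' \<and>
                           integrable lborel (\<lambda>x. \<bar>h' x\<bar> / (1 + \<bar>x\<bar>) ^ m) \<longrightarrow>
                           \<bar>(LINT x|M. h (W n x)) - (LINT x|lborel. h x * deriv (\<Psi> n) x)\<bar>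
                             \<le> C n * (LINT x|lborel. \<bar>h' x\<bar> / (1 + \<bar>x\<bar>) ^ m) / B n ^ r) \<and>
                        (\<forall>q<m.
                           \<bar>(LINT x|M. W n x ^ q) - (LINT x|lborel. x ^ q * deriv (\<Psi> n) x)\<bar>
                             \<le> R * C n / B n ^ r \<and>
                           \<bar>(LINT x|M. \<bar>W n x\<bar> ^ q) - (LINT x|lborel. \<bar>x\<bar> ^ q * deriv (\<Psi> n) x)\<bar>
                             \<le> R * C n / B n ^ r))))))))"

end

(*
  On almost every orbit, E exp(z S_n) is the integral of the n-th iterate of the twisted transfer
  operator applied to 1. Near z = 0 the spectral assumption gives a holomorphic logarithm of size O(n),
  that is O(s_n^2). For imaginary z = iu with u in a compact set away from 0, the iterates decay like
  exp(-c n^alpha). For large u, the maximal ergodic inequality provides R such that at least half of the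
  times j < n, for every n, are times at which rho, 1/rho, 1/gamma and b are at most R; disjoint blocks of
  length at most R ln|u| started at such times contract, so that the characteristic function is
  O((1 + |u|) exp(-n / (2 R ln|u|))), which beats every power of n for u polynomially large in n.

  These three bounds suffice for all the expansions. Derivatives of the characteristic function are
  controlled by interpolating with moments. With w = 1/B_n the characteristic function of W_n is the
  exponential of a function analytic in w, and its Taylor polynomial in w is the Fourier transform of the
  expansion. Gaussian smoothing of width B_n^(-r-1) turns the comparison of Fourier transforms into
  |F_n - Psi_r| = O(B_n^(-r)), uniformly in x; since all orders are available, interpolating a high order
  with the moment tails gives the weight (1 + |x|)^(-m) and the rate o(B_n^(-r)).
*)
theory Submission
  imports Defs "HOL-Real_Asymp.Real_Asymp"
begin

section \<open>Integrals of exponentials and Taylor remainders\<close>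

text \<open>The expansions are demanded for all bounded \<open>A\<close> and all \<open>B\<close>
  close to the standard deviations, with polynomial functions fixed beforehand. Therefore
  \<open>1 / B n\<close> is the expansion parameter, and \<open>A n\<close> and
  \<open>B n - s n\<close> enter the exponent as further variables. The leading correction in the
  exponent has size |t|^3 / B, so the Taylor polynomial is useful only for |t| up to a multiple of
  B^(1/3). From there to |t| of order B a Gaussian bound takes over, then up to B^(R+3) the decay of
  the characteristic function, and beyond that only the smoothing factor exp(-(t / B^(R+1))^2 / 2).
  The two exponents are matched: at |t| = B^(R+3) that factor is already exp(-B^4 / 2). Derivatives
  of the characteristic function away from 0 do not enter the expansions; their integral is a second
  consequence of the same decay. On the dynamical side one level R must serve all n along an orbit.
  The maximal inequality gives this directly, because the exceptional set has at most twice the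
  probability of the bad set.\<close>

lemma has_field_derivative_quadratic_bound:
  fixes f :: "complex \<Rightarrow> complex"
  assumes "\<And>h. cmod h \<le> 1 \<Longrightarrow> cmod (f (z + h) - f z - h * D) \<le> K * (cmod h)\<^sup>2"
  shows "(f has_field_derivative D) (at z)"
  unfolding has_field_derivative_def has_derivative_at
proof (intro conjI)
  show "bounded_linear ((*) D)" by (rule bounded_linear_mult_right)
  have "((\<lambda>h. cmod (f (z + h) - f z - D * h) / cmod h) \<longlongrightarrow> 0) (at 0)"
  proof (rule Lim_null_comparison)
    show "\<forall>\<^sub>F h in at 0. norm (cmod (f (z + h) - f z - D * h) / cmod h) \<le> K * cmod h"
      unfolding eventually_at
    proof (intro exI[of _ 1] conjI ballI impI)
      fix h :: complex assume h: "h \<noteq> 0 \<and> dist h 0 < 1"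
      have "cmod (f (z + h) - f z - D * h) / cmod h \<le> (K * (cmod h)\<^sup>2) / cmod h"
        using assms[of h] h by (intro divide_right_mono) (auto simp: mult.commute)
      also have "\<dots> = K * cmod h" using h by (simp add: power2_eq_square)
      finally show "norm (cmod (f (z + h) - f z - D * h) / cmod h) \<le> K * cmod h" by simp
    qed simp
    show "((\<lambda>h. K * cmod h) \<longlongrightarrow> 0) (at 0)"
      by (auto intro!: tendsto_eq_intros)
  qed
  then show "((\<lambda>h. norm (f (z + h) - f z - D * h) / norm h) \<longlongrightarrow> 0) (at 0)" .
qed

lemma norm_integral_le_integral:
  fixes f :: "'a \<Rightarrow> 'b::{banach,second_countable_topology}"
  assumes "integrable M f" "integrable M g" "\<And>x. x \<in> space M \<Longrightarrow> norm (f x) \<le> g x"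
  shows "norm (integral\<^sup>L M f) \<le> integral\<^sup>L M g"
  by (rule order_trans[OF integral_norm_bound integral_mono]) (use assms in auto)

lemma cmod_exp_mult_le: "cmod (exp (z * complex_of_real y)) \<le> exp (cmod z * \<bar>y\<bar>)"
proof -
  have "Re z * y \<le> \<bar>Re z\<bar> * \<bar>y\<bar>" by (simp add: abs_mult[symmetric])
  also have "\<dots> \<le> cmod z * \<bar>y\<bar>" by (intro mult_right_mono abs_Re_le_cmod) simp
  finally show ?thesis by simp
qed

lemma exp_integral_integrable:
  fixes g :: "'a \<Rightarrow> complex" and Y :: "'a \<Rightarrow> real"
  assumes [measurable]: "g \<in> borel_measurable M" "Y \<in> borel_measurable M"
    and int: "\<And>c::real. 0 \<le> c \<Longrightarrow> integrable M (\<lambda>y. cmod (g y) * exp (c * \<bar>Y y\<bar>))"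
  shows "integrable M (\<lambda>y. g y * exp (z * complex_of_real (Y y)))"
proof (rule Bochner_Integration.integrable_bound[OF int[of "cmod z"]])
  show "AE x in M. norm (g x * exp (z * complex_of_real (Y x)))
      \<le> norm (cmod (g x) * exp (cmod z * \<bar>Y x\<bar>))"
    unfolding norm_mult by (intro AE_I2 mult_mono) (auto intro: cmod_exp_mult_le[simplified])
qed auto

lemma abs_le_exp_abs: "\<bar>x\<bar> \<le> exp \<bar>x\<bar>" for x :: real
  using exp_ge_add_one_self[of "\<bar>x\<bar>"] by linarith

text \<open>The hypothesis holds for every exponent \<open>c\<close>, so a factor \<open>Y\<close>
  is paid for by raising \<open>c\<close> by one. This makes differentiation under the integral
  repeatable.\<close>

lemma exp_integral_weight:
  fixes g :: "'a \<Rightarrow> complex" and Y :: "'a \<Rightarrow> real"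
  assumes [measurable]: "g \<in> borel_measurable M" "Y \<in> borel_measurable M"
    and int: "\<And>c::real. 0 \<le> c \<Longrightarrow> integrable M (\<lambda>y. cmod (g y) * exp (c * \<bar>Y y\<bar>))"
    and c: "0 \<le> c"
  shows "integrable M (\<lambda>y. cmod (g y * complex_of_real (Y y)) * exp (c * \<bar>Y y\<bar>))"
proof (rule Bochner_Integration.integrable_bound[OF int[of "c+1"]])
  show "AE x in M. norm (cmod (g x * complex_of_real (Y x)) * exp (c * \<bar>Y x\<bar>))
      \<le> norm (cmod (g x) * exp ((c+1) * \<bar>Y x\<bar>))"
  proof (rule AE_I2)
    fix x
    have "\<bar>Y x\<bar> * exp (c * \<bar>Y x\<bar>) \<le> exp \<bar>Y x\<bar> * exp (c * \<bar>Y x\<bar>)"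
      by (intro mult_right_mono abs_le_exp_abs) auto
    also have "\<dots> = exp ((c+1) * \<bar>Y x\<bar>)" by (simp add: exp_add[symmetric] algebra_simps)
    finally show "norm (cmod (g x * complex_of_real (Y x)) * exp (c * \<bar>Y x\<bar>))
      \<le> norm (cmod (g x) * exp ((c+1) * \<bar>Y x\<bar>))"
      by (auto simp: norm_mult mult.assoc intro!: mult_left_mono)
  qed
qed (use c in auto)

text \<open>The first-order remainder of the exponential is quadratic in \<open>h\<close> with an
  integrable constant, so the quadratic criterion for differentiability applies under the
  integral.\<close>

lemma exp_integral_has_field_derivative:
  fixes g :: "'a \<Rightarrow> complex" and Y :: "'a \<Rightarrow> real"
  assumes [measurable]: "g \<in> borel_measurable M" "Y \<in> borel_measurable M"
    and int: "\<And>c::real. 0 \<le> c \<Longrightarrow> integrable M (\<lambda>y. cmod (g y) * exp (c * \<bar>Y y\<bar>))"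
  shows "((\<lambda>z. LINT y|M. g y * exp (z * complex_of_real (Y y))) has_field_derivative
     (LINT y|M. g y * complex_of_real (Y y) * exp (z * complex_of_real (Y y)))) (at z)"
proof (rule has_field_derivative_quadratic_bound)
  fix h :: complex assume h: "cmod h \<le> 1"
  let ?e = "\<lambda>z y. exp (z * complex_of_real (Y y))"
  have i1: "integrable M (\<lambda>y. g y * ?e z y)" for z by (rule exp_integral_integrable[OF assms])
  have i2: "integrable M (\<lambda>y. g y * complex_of_real (Y y) * ?e z y)" for z
    by (rule exp_integral_integrable[OF _ _ exp_integral_weight[OF assms]]) auto
  have eq: "g y * ?e (z+h) y - g y * ?e z y - h * (g y * complex_of_real (Y y) * ?e z y)
      = g y * ?e z y * (exp (h * Y y) - (\<Sum>k\<le>1. (h * Y y)^k / fact k))" for y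
    by (simp add: algebra_simps exp_add)
  have "(LINT y|M. g y * ?e (z+h) y) - (LINT y|M. g y * ?e z y) -
      h * (LINT y|M. g y * complex_of_real (Y y) * ?e z y)
      = (LINT y|M. g y * ?e (z+h) y - g y * ?e z y - h * (g y * complex_of_real (Y y) * ?e z y))"
    using i1 i2 by simp
  also have "\<dots> = (LINT y|M. g y * ?e z y * (exp (h * Y y) - (\<Sum>k\<le>1. (h * Y y)^k / fact k)))"
    by (simp only: eq)
  also have "cmod \<dots> \<le> (LINT y|M. (cmod h)\<^sup>2 * (cmod (g y) * exp ((cmod z + 3) * \<bar>Y y\<bar>)))"
  proof (rule norm_integral_le_integral)
    show "integrable M (\<lambda>y. g y * ?e z y * (exp (h * Y y) - (\<Sum>k\<le>1. (h * Y y)^k / fact k)))"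
      unfolding eq[symmetric] using i1 i2 by (intro Bochner_Integration.integrable_diff integrable_mult_right)
    show "integrable M (\<lambda>y. (cmod h)\<^sup>2 * (cmod (g y) * exp ((cmod z + 3) * \<bar>Y y\<bar>)))"
      by (intro integrable_mult_right int) simp
    fix y
    have "cmod (exp (h * Y y) - (\<Sum>k\<le>1. (h * Y y)^k / fact k))
       \<le> exp \<bar>Re (h * Y y)\<bar> * cmod (h * Y y) ^ (Suc 1) / fact 1"
      by (rule Taylor_exp)
    also have "\<dots> = exp \<bar>Re h * Y y\<bar> * (cmod h)\<^sup>2 * \<bar>Y y\<bar>\<^sup>2"
      by (simp add: norm_mult power2_eq_square)
    \<comment> \<open>|Y| is at most exp |Y|, so the remainder costs three further factors exp |Y|;
      hence the exponent \<open>cmod z + 3\<close>.\<close>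
    also have "\<dots> \<le> exp \<bar>Y y\<bar> * (cmod h)\<^sup>2 * (exp \<bar>Y y\<bar>)\<^sup>2"
    proof -
      have "\<bar>Re h * Y y\<bar> \<le> 1 * \<bar>Y y\<bar>"
        unfolding abs_mult by (intro mult_right_mono order_trans[OF abs_Re_le_cmod h]) auto
      then show ?thesis
        by (intro mult_mono power_mono abs_le_exp_abs) auto
    qed
    also have "\<dots> = (cmod h)\<^sup>2 * exp (3 * \<bar>Y y\<bar>)"
      by (simp add: power2_eq_square exp_add[symmetric])
    finally have 2: "cmod (exp (h * Y y) - (\<Sum>k\<le>1. (h * Y y)^k / fact k)) \<le> (cmod h)\<^sup>2 * exp (3 * \<bar>Y y\<bar>)" .
    have "norm (g y * ?e z y * (exp (h * Y y) - (\<Sum>k\<le>1. (h * Y y)^k / fact k)))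
      \<le> cmod (g y) * exp (cmod z * \<bar>Y y\<bar>) * ((cmod h)\<^sup>2 * exp (3 * \<bar>Y y\<bar>))"
      unfolding norm_mult[of "_ * _"] norm_mult[of "g y"] 
      by (intro mult_mono 2 cmod_exp_mult_le) auto
    also have "\<dots> = (cmod h)\<^sup>2 * (cmod (g y) * exp ((cmod z + 3) * \<bar>Y y\<bar>))"
    proof -
      have "exp ((cmod z + 3) * \<bar>Y y\<bar>) = exp (cmod z * \<bar>Y y\<bar>) * exp (3 * \<bar>Y y\<bar>)"
        by (simp add: exp_add[symmetric] distrib_right)
      then show ?thesis by (simp only: mult_ac)
    qed
    finally show "norm (g y * ?e z y * (exp (h * Y y) - (\<Sum>k\<le>1. (h * Y y)^k / fact k)))
      \<le> (cmod h)\<^sup>2 * (cmod (g y) * exp ((cmod z + 3) * \<bar>Y y\<bar>))" .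
  qed
  also have "\<dots> = (LINT y|M. cmod (g y) * exp ((cmod z + 3) * \<bar>Y y\<bar>)) * (cmod h)\<^sup>2"
    by simp
  finally show "cmod ((LINT y|M. g y * ?e (z+h) y) - (LINT y|M. g y * ?e z y) -
      h * (LINT y|M. g y * complex_of_real (Y y) * ?e z y))
      \<le> (LINT y|M. cmod (g y) * exp ((cmod z + 3) * \<bar>Y y\<bar>)) * (cmod h)\<^sup>2" .
qed

lemma exp_integral_weight_power:
  fixes g :: "'a \<Rightarrow> complex" and Y :: "'a \<Rightarrow> real"
  assumes [measurable]: "g \<in> borel_measurable M" "Y \<in> borel_measurable M"
    and int: "\<And>c::real. 0 \<le> c \<Longrightarrow> integrable M (\<lambda>y. cmod (g y) * exp (c * \<bar>Y y\<bar>))"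
    and c: "0 \<le> c"
  shows "integrable M (\<lambda>y. cmod (g y * complex_of_real (Y y) ^ k) * exp (c * \<bar>Y y\<bar>))"
  using c
proof (induction k arbitrary: c)
  case 0 then show ?case using int by simp
next
  case (Suc k)
  have "integrable M (\<lambda>y. cmod ((g y * complex_of_real (Y y) ^ k) * complex_of_real (Y y)) * exp (c * \<bar>Y y\<bar>))"
    by (rule exp_integral_weight[OF _ _ Suc.IH Suc.prems]) auto
  then show ?case by (simp add: mult_ac)
qed

lemma exp_integral_higher_deriv:
  fixes g :: "'a \<Rightarrow> complex" and Y :: "'a \<Rightarrow> real"
  assumes [measurable]: "g \<in> borel_measurable M" "Y \<in> borel_measurable M"
    and int: "\<And>c::real. 0 \<le> c \<Longrightarrow> integrable M (\<lambda>y. cmod (g y) * exp (c * \<bar>Y y\<bar>))"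
  shows "(deriv ^^ k) (\<lambda>z. LINT y|M. g y * exp (z * complex_of_real (Y y)))
     = (\<lambda>z. LINT y|M. g y * complex_of_real (Y y) ^ k * exp (z * complex_of_real (Y y)))"
proof (induction k)
  case 0 then show ?case by simp
next
  case (Suc k)
  have "((\<lambda>z. LINT y|M. g y * complex_of_real (Y y) ^ k * exp (z * complex_of_real (Y y)))
     has_field_derivative
     (LINT y|M. g y * complex_of_real (Y y) ^ k * complex_of_real (Y y) * exp (z * complex_of_real (Y y)))) (at z)" for z
    by (rule exp_integral_has_field_derivative[OF _ _ exp_integral_weight_power[OF assms]]) auto
  from DERIV_imp_deriv[OF this] show ?case by (simp add: Suc mult_ac)
qed

text \<open>The definitions differentiate along the real line, while all estimates are made for
  holomorphic functions. Since \<open>T\<close> is open, the identity of \<phi> and \<open>H\<close>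
  on \<open>T\<close> can be differentiated again at each step.\<close>

lemma nth_vector_derivative_of_holomorphic:
  fixes H :: "complex \<Rightarrow> complex"
  assumes H: "H holomorphic_on U" "open U" and T: "open T"
    and eq: "\<And>t. t \<in> T \<Longrightarrow> complex_of_real t \<in> U \<and> \<phi> t = H (complex_of_real t)"
    and t: "t \<in> T"
  shows "nth_vector_derivative k \<phi> t = (deriv ^^ k) H (complex_of_real t)"
  using t
proof (induction k arbitrary: t)
  case 0 then show ?case using eq by (simp add: nth_vector_derivative_def)
next
  case (Suc k)
  have "((deriv ^^ k) H has_field_derivative deriv ((deriv ^^ k) H) (of_real t)) (at (of_real t))"
    using holomorphic_derivI[OF holomorphic_higher_deriv[OF H] H(2)] eq[OF Suc.prems] by blast
  then have "((\<lambda>t. (deriv ^^ k) H (complex_of_real t)) has_vector_derivative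
      deriv ((deriv ^^ k) H) (of_real t)) (at t)"
    by (rule has_vector_derivative_real_field)
  then have "((nth_vector_derivative k \<phi>) has_vector_derivative
      deriv ((deriv ^^ k) H) (of_real t)) (at t)"
    by (rule has_vector_derivative_transform_within_open[OF _ T Suc.prems]) (simp add: Suc.IH)
  then show ?case
    by (simp add: nth_vector_derivative_def vector_derivative_at)
qed

text \<open>The derivative is a limit of difference quotients along real increments, and the reals
  are closed in the complex plane. This makes the cumulants, and with them the Edgeworth
  polynomials, real.\<close>

lemma Reals_higher_deriv:
  fixes H :: "complex \<Rightarrow> complex"
  assumes H: "H holomorphic_on ball 0 r"
    and eq: "\<And>t. \<bar>t\<bar> < r \<Longrightarrow> H (complex_of_real t) \<in> \<real>" and t: "\<bar>t\<bar> < r"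
  shows "(deriv ^^ k) H (complex_of_real t) \<in> \<real>"
  using t
proof (induction k arbitrary: t)
  case 0 then show ?case using eq by simp
next
  case (Suc k)
  let ?G = "(deriv ^^ k) H"
  have "(?G has_field_derivative deriv ?G (of_real t)) (at (of_real t))"
    using holomorphic_derivI[OF holomorphic_higher_deriv[OF H], of "of_real t"] Suc.prems by auto
  then have lim0: "((\<lambda>h. (?G (of_real t + h) - ?G (of_real t)) / h) \<longlongrightarrow> deriv ?G (of_real t)) (at 0)"
    by (simp add: DERIV_def)
  have limc: "(\<lambda>n. complex_of_real (1/real (Suc n))) \<longlonglongrightarrow> 0"
    using tendsto_of_real[OF LIMSEQ_Suc[OF lim_1_over_n[where 'a=real]], where 'a=complex] by simp
  have lim: "((\<lambda>n. (?G (of_real t + of_real (1/real (Suc n))) - ?G (of_real t)) / of_real (1/real (Suc n)))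
      \<longlonglongrightarrow> deriv ?G (of_real t))"
    using tendsto_at_iff_sequentially[THEN iffD1, OF lim0, rule_format, of "\<lambda>n. complex_of_real (1/real (Suc n))"]
      limc by (simp add: o_def del: of_nat_Suc)
  have "deriv ?G (of_real t) \<in> \<real>"
  proof (rule Lim_in_closed_set[OF closed_complex_Reals _ _ lim])
    have "eventually (\<lambda>n. \<bar>t + 1 / real (Suc n)\<bar> < r) sequentially"
    proof (rule order_tendstoD)
      show "(\<lambda>n. \<bar>t + 1 / real (Suc n)\<bar>) \<longlonglongrightarrow> \<bar>t + 0\<bar>"
        by (intro tendsto_intros LIMSEQ_Suc lim_1_over_n)
    qed (use Suc.prems in auto)
    then show "\<forall>\<^sub>F n in sequentially. (?G (of_real t + of_real (1/real (Suc n))) - ?G (of_real t)) / of_real (1/real (Suc n)) \<in> \<real>"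
    proof eventually_elim
      case (elim n)
      then have "?G (of_real (t + 1/real (Suc n))) \<in> \<real>" by (rule Suc.IH)
      then show ?case using Suc.IH[OF Suc.prems]
        by (intro Reals_divide Reals_diff Reals_of_real) (simp_all only: of_real_add)
    qed
  qed simp
  then show ?case by simp
qed

text \<open>Cauchy's inequalities bound the tail of the power series by a geometric series of ratio
  at most 1/2, whence the factor 2.\<close>

lemma taylor_remainder_bound:
  fixes f :: "complex \<Rightarrow> complex"
  assumes f: "f holomorphic_on cball 0 \<rho>" and \<rho>: "0 < \<rho>"
    and M: "\<And>w. cmod w \<le> \<rho> \<Longrightarrow> cmod (f w) \<le> M" and w: "cmod w \<le> \<rho> / 2"
  shows "cmod (f w - (\<Sum>j\<le>R. (deriv ^^ j) f 0 / fact j * w ^ j)) \<le> 2 * M * (cmod w / \<rho>) ^ (Suc R)"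
proof -
  define c where "c j = (deriv ^^ j) f 0 / fact j * w ^ j" for j
  define q where "q = cmod w / \<rho>"
  have q: "0 \<le> q" "q \<le> 1/2" using w \<rho> by (auto simp: field_simps q_def)
  have M0: "0 \<le> M" using M[of 0] \<rho> norm_ge_zero[of "f 0"] by (simp, linarith)
  have hb: "f holomorphic_on ball 0 \<rho>" using f holomorphic_on_subset by auto
  have cj: "cmod (c j) \<le> M * q ^ j" for j
  proof -
    have "cmod ((deriv ^^ j) f 0) \<le> fact j * M / \<rho> ^ j"
      by (rule Cauchy_inequality[OF hb holomorphic_on_imp_continuous_on[OF f] \<rho>]) (auto intro: M)
    then have "cmod ((deriv ^^ j) f 0) / fact j \<le> M / \<rho> ^ j"
      by (simp add: field_simps)
    then have "cmod ((deriv ^^ j) f 0) / fact j * cmod w ^ j \<le> M / \<rho> ^ j * cmod w ^ j"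
      by (intro mult_right_mono) auto
    then show ?thesis by (simp add: c_def q_def norm_mult norm_divide norm_power power_divide)
  qed
  have sums: "c sums f w"
    using holomorphic_power_series[OF hb, of w] w \<rho> by (simp add: c_def[abs_def])
  have gs: "(\<lambda>j. M * q ^ (j + Suc R)) sums (M * q ^ Suc R * (1 / (1 - q)))"
  proof -
    have "(\<lambda>j. q ^ j) sums (1 / (1 - q))" by (rule geometric_sums) (use q in simp)
    from sums_mult[OF this, of "M * q ^ Suc R"] show ?thesis by (simp add: power_add mult_ac)
  qed
  have "(\<lambda>j. c (j + Suc R)) sums (f w - (\<Sum>j<Suc R. c j))"
    by (rule sums_split_initial_segment[OF sums])
  then have "f w - (\<Sum>j\<le>R. c j) = (\<Sum>j. c (j + Suc R))"
    by (simp add: sums_iff lessThan_Suc_atMost)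
  also have "cmod \<dots> \<le> (\<Sum>j. M * q ^ (j + Suc R))"
    by (rule norm_suminf_le[OF cj sums_summable[OF gs]])
  also have "\<dots> = M * q ^ Suc R * (1 / (1 - q))" using gs by (simp add: sums_iff)
  also have "\<dots> \<le> M * q ^ Suc R * 2"
  proof (rule mult_left_mono)
    show "1 / (1 - q) \<le> 2" using q by (subst pos_divide_le_eq) auto
    show "0 \<le> M * q ^ Suc R" using q M0 by (intro mult_nonneg_nonneg zero_le_power)
  qed
  finally show ?thesis by (simp add: c_def q_def mult_ac)
qed

section \<open>Gaussian smoothing\<close>

text \<open>The probabilists' Hermite polynomials. The recursion is the one for which
  \<open>hermite n\<close> times the normal density is, up to sign, the n-th derivative of that
  density.\<close>

primrec hermite :: "nat \<Rightarrow> real poly" where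
  "hermite 0 = 1"
| "hermite (Suc n) = [:0, 1:] * hermite n - pderiv (hermite n)"

lemma std_normal_density_has_derivative:
  "(std_normal_density has_real_derivative - x * std_normal_density x) (at x)"
proof -
  have "((\<lambda>x. c * exp (- x\<^sup>2 / 2)) has_real_derivative - x * (c * exp (- x\<^sup>2 / 2))) (at x)" for c
    by (auto intro!: derivative_eq_intros)
  then show ?thesis unfolding std_normal_density_def .
qed

lemma hermite_density_has_derivative:
  "((\<lambda>x. poly (hermite n) x * std_normal_density x) has_real_derivative
     - (poly (hermite (Suc n)) x * std_normal_density x)) (at x)"
  by (auto intro!: derivative_eq_intros std_normal_density_has_derivative poly_DERIV simp: algebra_simps)

lemma integrable_gauss_quarter: "integrable lborel (\<lambda>t::real. exp (- t\<^sup>2 / 4))"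
proof -
  have "integrable lborel (\<lambda>t. sqrt (2 * pi * (sqrt 2)\<^sup>2) * normal_density 0 (sqrt 2) t)"
    by (intro integrable_mult_right integrable_normal_density) auto
  then show ?thesis by (simp add: normal_density_def)
qed

lemma gauss_exp_integrable:
  "integrable lborel (\<lambda>t::real. cmod (complex_of_real (exp (- t\<^sup>2 / 2))) * exp (c * \<bar>t\<bar>))"
proof (rule Bochner_Integration.integrable_bound)
  show "integrable lborel (\<lambda>t::real. exp (c\<^sup>2) * exp (- t\<^sup>2 / 4))"
    by (intro integrable_mult_right integrable_gauss_quarter)
  show "AE t in lborel. norm (cmod (complex_of_real (exp (- t\<^sup>2 / 2))) * exp (c * \<bar>t\<bar>))
     \<le> norm (exp (c\<^sup>2) * exp (- t\<^sup>2 / 4))"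
  proof (rule AE_I2)
    fix t :: real
    \<comment> \<open>Completing the square trades half of the Gaussian exponent for the linear
      term.\<close>
    have "0 \<le> (c - \<bar>t\<bar> / 2)\<^sup>2" by simp
    then have "- t\<^sup>2 / 2 + c * \<bar>t\<bar> \<le> c\<^sup>2 + - t\<^sup>2 / 4"
      by (simp add: power2_diff power_divide power2_eq_square algebra_simps)
    then show "norm (cmod (complex_of_real (exp (- t\<^sup>2 / 2))) * exp (c * \<bar>t\<bar>))
     \<le> norm (exp (c\<^sup>2) * exp (- t\<^sup>2 / 4))"
      by (simp add: exp_add[symmetric])
  qed
qed auto

lemma gauss_moment_exp_integrable:
  "integrable lborel (\<lambda>t::real. complex_of_real (exp (- t\<^sup>2 / 2)) * complex_of_real t ^ l * exp (z * complex_of_real t))"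
  by (rule exp_integral_integrable[OF _ _ exp_integral_weight_power[OF _ _ gauss_exp_integrable]]) simp_all

text \<open>The Gaussian is its own Fourier transform up to a constant, so its characteristic
  function, read from right to left, is already the inversion formula.\<close>

lemma gauss_fourier:
  "(LINT t|lborel. complex_of_real (exp (- t\<^sup>2 / 2)) * exp (- (\<i> * complex_of_real x) * complex_of_real t))
     = complex_of_real (2 * pi * std_normal_density x)"
proof -
  have "complex_of_real (exp (- (-x)\<^sup>2 / 2)) = char std_normal_distribution (-x)"
    by (simp add: char_std_normal_distribution)
  also have "\<dots> = (LINT t|lborel. std_normal_density t *\<^sub>R iexp (-x * t))"
    unfolding char_def by (subst integral_density) auto
  also have "\<dots> = (LINT t|lborel. complex_of_real (1 / sqrt (2 * pi)) *
     (complex_of_real (exp (- t\<^sup>2 / 2)) * exp (- (\<i> * complex_of_real x) * complex_of_real t)))"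
    by (intro Bochner_Integration.integral_cong) (auto simp: std_normal_density_def scaleR_conv_of_real mult.assoc)
  also have "\<dots> = complex_of_real (1 / sqrt (2 * pi)) * (LINT t|lborel.
     (complex_of_real (exp (- t\<^sup>2 / 2)) * exp (- (\<i> * complex_of_real x) * complex_of_real t)))"
    by simp
  finally have "(LINT t|lborel. complex_of_real (exp (- t\<^sup>2 / 2)) * exp (- (\<i> * complex_of_real x) * complex_of_real t))
     = complex_of_real (sqrt (2 * pi)) * complex_of_real (exp (- x\<^sup>2 / 2))"
    by (simp add: field_simps)
  also have "\<dots> = complex_of_real (2 * pi * std_normal_density x)"
  proof -
    have "sqrt (2 * pi) = 2 * pi * (1 / sqrt (2 * pi))" using real_sqrt_pow2[of "2*pi"]
      by (simp add: field_simps)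
    then have "sqrt (2 * pi) * exp (- x\<^sup>2 / 2) = 2 * pi * (1 / sqrt (2 * pi) * exp (- x\<^sup>2 / 2))"
      by (metis mult.assoc)
    then show ?thesis unfolding std_normal_density_def of_real_mult[symmetric] by (rule arg_cong)
  qed
  finally show ?thesis .
qed

text \<open>Differentiating in \<open>x\<close> under the integral brings down - i t on the left
  and, by the Hermite recursion, minus the next Hermite polynomial on the right; uniqueness of the
  derivative equates the two. Multiplication by i t in Fourier space is thus the step from
  \<open>hermite l\<close> to \<open>hermite (Suc l)\<close>.\<close>

lemma gauss_hermite_fourier:
  "(LINT t|lborel. complex_of_real (exp (- t\<^sup>2 / 2)) * (\<i> * complex_of_real t) ^ l
       * exp (- (\<i> * complex_of_real x) * complex_of_real t))
     = complex_of_real (2 * pi * (poly (hermite l) x * std_normal_density x))"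
proof (induction l arbitrary: x)
  case 0 then show ?case using gauss_fourier by simp
next
  case (Suc l)
  let ?g = "\<lambda>t::real. complex_of_real (exp (- t\<^sup>2 / 2)) * (\<i> * complex_of_real t) ^ l"
  let ?F = "\<lambda>z. LINT t|lborel. ?g t * exp (z * complex_of_real t)"
  have geq: "?g = (\<lambda>t. \<i>^l * (complex_of_real (exp (- t\<^sup>2 / 2)) * complex_of_real t ^ l))"
    by (auto simp: power_mult_distrib)
  have "integrable lborel (\<lambda>t. cmod (?g t) * exp (c * \<bar>t\<bar>))" if "0 \<le> c" for c
  proof -
    have "integrable lborel (\<lambda>t::real. cmod (complex_of_real (exp (- t\<^sup>2 / 2)) * complex_of_real t ^ l) * exp (c * \<bar>t\<bar>))"
      by (rule exp_integral_weight_power[OF _ _ gauss_exp_integrable that]) simp_all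
    then show ?thesis by (simp add: norm_mult norm_power)
  qed
  then have "(?F has_field_derivative
     (LINT t|lborel. ?g t * complex_of_real t * exp (- (\<i> * x) * complex_of_real t))) (at (- (\<i> * complex_of_real x)))" 
    by (intro exp_integral_has_field_derivative) auto
  then have "((\<lambda>z. ?F (- (\<i> * z))) has_field_derivative
     (LINT t|lborel. ?g t * complex_of_real t * exp (- (\<i> * x) * complex_of_real t)) * (- \<i>)) (at (complex_of_real x))"
    by (rule DERIV_chain2) (auto intro!: derivative_eq_intros)
  then have d1: "((\<lambda>x. ?F (- (\<i> * complex_of_real x))) has_vector_derivative
     (LINT t|lborel. ?g t * complex_of_real t * exp (- (\<i> * x) * complex_of_real t)) * (- \<i>)) (at x)"
    by (rule has_vector_derivative_real_field)
  have "((\<lambda>x. 2 * pi * (poly (hermite l) x * std_normal_density x)) has_real_derivative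
       2 * pi * - (poly (hermite (Suc l)) x * std_normal_density x)) (at x)"
    by (intro DERIV_cmult hermite_density_has_derivative)
  then have d2: "((\<lambda>x. complex_of_real (2 * pi * (poly (hermite l) x * std_normal_density x))) has_vector_derivative
       complex_of_real (2 * pi * - (poly (hermite (Suc l)) x * std_normal_density x))) (at x)"
    by (intro has_vector_derivative_of_real) (simp add: has_real_derivative_iff_has_vector_derivative)
  have "(LINT t|lborel. ?g t * complex_of_real t * exp (- (\<i> * x) * complex_of_real t)) * (- \<i>)
     = complex_of_real (2 * pi * - (poly (hermite (Suc l)) x * std_normal_density x))"
    using vector_derivative_unique_at[OF d1[unfolded Suc.IH] d2] .
  moreover have "(LINT t|lborel. ?g t * complex_of_real t * exp (- (\<i> * x) * complex_of_real t)) * (- \<i>)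
     = - (LINT t|lborel. complex_of_real (exp (- t\<^sup>2 / 2)) * (\<i> * complex_of_real t) ^ (Suc l)
       * exp (- (\<i> * complex_of_real x) * complex_of_real t))"
  proof -
    have "(LINT t|lborel. complex_of_real (exp (- t\<^sup>2 / 2)) * (\<i> * complex_of_real t) ^ (Suc l)
       * exp (- (\<i> * complex_of_real x) * complex_of_real t))
      = (LINT t|lborel. \<i> * (?g t * complex_of_real t * exp (- (\<i> * x) * complex_of_real t)))"
      by (simp only: power_Suc mult_ac)
    also have "\<dots> = \<i> * (LINT t|lborel. ?g t * complex_of_real t * exp (- (\<i> * x) * complex_of_real t))"
      by (rule integral_mult_right_zero)
    finally show ?thesis by simp
  qed
  ultimately show ?case by (simp only: of_real_minus mult_minus_right neg_equal_iff_equal)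
qed

lemma gauss_hermite_integrable:
  "integrable lborel (\<lambda>t::real. complex_of_real (exp (- t\<^sup>2 / 2)) * (\<i> * complex_of_real t) ^ l
       * exp (- (\<i> * complex_of_real x) * complex_of_real t))"
proof -
  have "integrable lborel (\<lambda>t::real. \<i> ^ l * (complex_of_real (exp (- t\<^sup>2 / 2)) * complex_of_real t ^ l
       * exp (- (\<i> * complex_of_real x) * complex_of_real t)))"
    by (intro integrable_mult_right gauss_moment_exp_integrable)
  then show ?thesis by (simp add: power_mult_distrib mult_ac)
qed

lemma continuous_std_normal_density: "continuous_on A std_normal_density"
  by (rule continuous_at_imp_continuous_on) (auto intro: DERIV_isCont std_normal_density_has_derivative)

lemma cdf_std_normal_has_derivative:
  "(cdf std_normal_distribution has_real_derivative std_normal_density x) (at x)"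
proof -
  interpret real_distribution std_normal_distribution by (rule real_dist_normal_dist)
  define a where "a = x - 1"
  have eq: "cdf std_normal_distribution y = cdf std_normal_distribution a + integral {a..y} std_normal_density"
    if "y > a" for y
  proof -
    have "cdf std_normal_distribution y - cdf std_normal_distribution a = measure std_normal_distribution {a<..y}"
      by (rule cdf_diff_eq[OF that])
    also have "\<dots> = (LINT t|std_normal_distribution. indicator {a<..y} t)" by simp
    also have "\<dots> = (LINT t|lborel. std_normal_density t *\<^sub>R indicator {a<..y} t)"
      by (subst integral_density) auto
    also have "\<dots> = (LINT t|lborel. indicator {a..y} t *\<^sub>R std_normal_density t)"
    proof (rule integral_cong_AE)
      show "AE t in lborel. std_normal_density t *\<^sub>R indicator {a<..y} t = indicator {a..y} t *\<^sub>R std_normal_density t"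
        using AE_lborel_singleton[of a] by eventually_elim (auto simp: indicator_def)
    qed auto
    also have "\<dots> = integral {a..y} std_normal_density"
      using set_borel_integral_eq_integral(2)[OF borel_integrable_atLeastAtMost'[OF continuous_std_normal_density]]
      unfolding set_lebesgue_integral_def .
    finally show ?thesis by simp
  qed
  have "((\<lambda>y. integral {a..y} std_normal_density) has_real_derivative std_normal_density x) (at x within {a..x+1})"
    by (rule integral_has_real_derivative[OF continuous_std_normal_density]) (simp add: a_def)
  moreover have "at x within {a..x+1} = at x"
    by (rule at_within_interior) (simp add: a_def)
  ultimately have *: "((\<lambda>y. cdf std_normal_distribution a + integral {a..y} std_normal_density) has_real_derivative 0 + std_normal_density x) (at x)"
    by (intro DERIV_add DERIV_const) simp
  show ?thesis
    by (rule has_field_derivative_transform_within[where d=1, OF *[simplified]]) (auto simp: dist_real_def eq a_def)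
qed

section \<open>Smoothed distribution functions and their densities\<close>

lemma integrable_pair_dominated:
  fixes f :: "'a \<Rightarrow> real \<Rightarrow> 'b::{banach,second_countable_topology}"
  assumes "prob_space M" and f[measurable]: "case_prod f \<in> borel_measurable (M \<Otimes>\<^sub>M lborel)"
    and g: "integrable lborel g" and le: "\<And>x y. x \<in> space M \<Longrightarrow> norm (f x y) \<le> g y"
  shows "integrable (M \<Otimes>\<^sub>M lborel) (case_prod f)"
proof -
  interpret prob_space M by fact
  interpret pair_sigma_finite M lborel by unfold_locales
  have [measurable]: "g \<in> borel_measurable lborel" using g by simp
  have "integrable (M \<Otimes>\<^sub>M lborel) (\<lambda>p. g (snd p))"
    by (rule Fubini_integrable) (use g in auto)
  then show ?thesis
    by (rule Bochner_Integration.integrable_bound)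
      (auto simp: space_pair_measure intro!: AE_I2 order_trans[OF le abs_ge_self])
qed

lemma integrable_inverse_1_plus_sq: "integrable lborel (\<lambda>t::real. 1 / (1 + t\<^sup>2))"
  using integrable_inverse_1_plus_square
  by (simp add: set_integrable_def einterval_eq_UNIV divide_inverse)

lemma std_normal_tail:
  "\<exists>K\<ge>0. \<forall>y>0. cdf std_normal_distribution (-y) \<le> K / y ^ k \<and> 1 - cdf std_normal_distribution y \<le> K / y ^ k"
proof (intro exI[of _ "LINT x|std_normal_distribution. \<bar>x\<bar> ^ k"] conjI allI impI)
  interpret real_distribution std_normal_distribution by (rule real_dist_normal_dist)
  show "0 \<le> (LINT x|std_normal_distribution. \<bar>x\<bar> ^ k)" by simp
  fix y :: real assume y: "0 < y"
  have int: "integrable std_normal_distribution (\<lambda>x. \<bar>x\<bar> ^ k)"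
    using integrable_abs[OF integrable_std_normal_distribution_moment[of k]] by (simp add: power_abs)
  have mk: "measure std_normal_distribution {x\<in>space std_normal_distribution. y ^ k \<le> \<bar>x\<bar> ^ k}
      \<le> (LINT x|std_normal_distribution. \<bar>x\<bar> ^ k) / y ^ k"
    by (rule integral_Markov_inequality_measure[OF int sets.top]) (use y in auto)
  have "measure std_normal_distribution {..-y} \<le> measure std_normal_distribution {x\<in>space std_normal_distribution. y ^ k \<le> \<bar>x\<bar> ^ k}"
    by (rule finite_measure_mono) (use y in \<open>auto intro!: power_mono\<close>)
  with mk show "cdf std_normal_distribution (-y) \<le> (LINT x|std_normal_distribution. \<bar>x\<bar> ^ k) / y ^ k"
    by (simp add: cdf_def)
  have "1 - cdf std_normal_distribution y = measure std_normal_distribution (UNIV - {..y})"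
    using prob_compl[of "{..y}"] by (simp add: cdf_def)
  also have "\<dots> \<le> measure std_normal_distribution {x\<in>space std_normal_distribution. y ^ k \<le> \<bar>x\<bar> ^ k}"
    by (rule finite_measure_mono) (use y in \<open>auto intro!: power_mono\<close>)
  finally show "1 - cdf std_normal_distribution y \<le> (LINT x|std_normal_distribution. \<bar>x\<bar> ^ k) / y ^ k"
    using mk by simp
qed

lemma borel_measurable_cdf_std_normal[measurable]: "cdf std_normal_distribution \<in> borel_measurable borel"
proof (rule borel_measurable_continuous_onI, rule continuous_at_imp_continuous_on, rule ballI)
  show "isCont (cdf std_normal_distribution) x" for x
    by (rule DERIV_isCont[OF cdf_std_normal_has_derivative])
qed

lemma scaled_gauss_fourier:
  fixes \<epsilon> y :: real
  assumes "0 < \<epsilon>"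
  shows "(LINT t|lborel. complex_of_real (exp (- (\<epsilon> * t)\<^sup>2 / 2)) * exp (- (\<i> * complex_of_real y) * complex_of_real t))
     = complex_of_real (2 * pi * (std_normal_density (y / \<epsilon>) / \<epsilon>))"
proof -
  have "(LINT t|lborel. complex_of_real (exp (- t\<^sup>2 / 2)) * exp (- (\<i> * complex_of_real (y/\<epsilon>)) * complex_of_real t))
     = \<bar>\<epsilon>\<bar> *\<^sub>R (LINT t|lborel. complex_of_real (exp (- (0 + \<epsilon> * t)\<^sup>2 / 2)) * exp (- (\<i> * complex_of_real (y/\<epsilon>)) * complex_of_real (0 + \<epsilon> * t)))"
    by (rule lborel_integral_real_affine) (use assms in simp)
  then show ?thesis using assms
    unfolding gauss_fourier by (simp add: scaleR_conv_of_real field_simps)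
qed

lemma scaled_gauss_integrable:
  fixes \<epsilon> :: real
  assumes "0 < \<epsilon>" shows "integrable lborel (\<lambda>t. exp (- (\<epsilon> * t)\<^sup>2 / 2))"
proof -
  have "integrable lborel (\<lambda>t. sqrt (2 * pi * (1 / \<epsilon>)\<^sup>2) * normal_density 0 (1 / \<epsilon>) t)"
    by (intro integrable_mult_right integrable_normal_density) (use assms in auto)
  then show ?thesis using assms by (simp add: normal_density_def power_divide power_mult_distrib mult.commute)
qed

lemma cdf_std_normal_bounds: "0 \<le> cdf std_normal_distribution y" "cdf std_normal_distribution y \<le> 1"
proof -
  interpret real_distribution std_normal_distribution by (rule real_dist_normal_dist)
  show "0 \<le> cdf std_normal_distribution y" "cdf std_normal_distribution y \<le> 1"
    by (rule cdf_nonneg cdf_bounded_prob)+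
qed

lemma cdf_std_normal_mono: "x \<le> y \<Longrightarrow> cdf std_normal_distribution x \<le> cdf std_normal_distribution y"
proof -
  interpret real_distribution std_normal_distribution by (rule real_dist_normal_dist)
  show "x \<le> y \<Longrightarrow> cdf std_normal_distribution x \<le> cdf std_normal_distribution y" by (rule cdf_nondecreasing)
qed

lemma std_normal_density_le_1: "std_normal_density x \<le> 1"
proof -
  have "1 \<le> sqrt (2 * pi)" using pi_gt3 by (simp add: real_le_rsqrt)
  then have "1 / sqrt (2 * pi) \<le> 1" by simp
  then have "1 / sqrt (2 * pi) * exp (- x\<^sup>2 / 2) \<le> 1 * 1" by (intro mult_mono) auto
  then show ?thesis by (simp only: std_normal_density_def)
qed

text \<open>The expectations are the distribution function and the density \<open>u\<close> of
  \<open>W\<close> plus an independent centred Gaussian of standard deviation \<epsilon>. On a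
  bounded interval 1 / \<epsilon> is an integrable majorant for Fubini.\<close>

lemma (in prob_space) smoothed_cdf_increment:
  assumes W[measurable]: "random_variable borel W" and \<epsilon>: "0 < \<epsilon>" and ab: "a \<le> b"
  defines "u \<equiv> \<lambda>y. expectation (\<lambda>w. std_normal_density ((y - W w) / \<epsilon>) / \<epsilon>)"
  shows "expectation (\<lambda>w. cdf std_normal_distribution ((b - W w) / \<epsilon>))
       - expectation (\<lambda>w. cdf std_normal_distribution ((a - W w) / \<epsilon>))
     = (LINT y|lborel. indicator {a..b} y * u y)" (is ?eq)
    and "integrable lborel (\<lambda>y. indicator {a..b} y * u y)" (is ?int)
proof -
  interpret pair_sigma_finite M lborel by unfold_locales
  let ?\<Phi> = "cdf std_normal_distribution"
  have i: "integrable M (\<lambda>w. ?\<Phi> ((y - W w) / \<epsilon>))" for y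
    by (rule integrable_const_bound[of _ 1]) (auto simp: cdf_std_normal_bounds)
  have dom: "integrable (M \<Otimes>\<^sub>M lborel) (\<lambda>(w, y). indicator {a..b} y * (std_normal_density ((y - W w) / \<epsilon>) / \<epsilon>) :: real)"
  proof (rule integrable_pair_dominated[where g="\<lambda>y. indicator {a..b} y * (1 / \<epsilon>)"])
    show "prob_space M" by unfold_locales
    fix w y
    show "norm (indicator {a..b} y * (std_normal_density ((y - W w) / \<epsilon>) / \<epsilon>))
       \<le> indicator {a..b} y * (1 / \<epsilon>)"
      using \<epsilon> by (auto simp: indicator_def normal_density_nonneg intro!: divide_right_mono std_normal_density_le_1)
    show "integrable lborel (\<lambda>y. indicator {a..b} y * (1 / \<epsilon>))"
      by (intro integrable_mult_left integrable_real_indicator) (auto simp: emeasure_lborel_Icc_eq)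
  qed measurable
  have FTC: "?\<Phi> ((b - W w) / \<epsilon>) - ?\<Phi> ((a - W w) / \<epsilon>)
     = (LINT y|lborel. indicator {a..b} y * (std_normal_density ((y - W w) / \<epsilon>) / \<epsilon>))" for w
  proof -
    have "(LINT y|lborel. std_normal_density ((y - W w) / \<epsilon>) / \<epsilon> * indicator {a..b} y)
      = ?\<Phi> ((b - W w) / \<epsilon>) - ?\<Phi> ((a - W w) / \<epsilon>)"
    proof (rule integral_FTC_Icc_real[OF ab])
      fix x
      show "((\<lambda>y. ?\<Phi> ((y - W w) / \<epsilon>)) has_real_derivative std_normal_density ((x - W w) / \<epsilon>) / \<epsilon>) (at x)"
      proof -
        have "((\<lambda>y. (y - W w) / \<epsilon>) has_real_derivative 1 / \<epsilon>) (at x)"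
          using \<epsilon> by (auto intro!: derivative_eq_intros)
        from DERIV_chain2[OF cdf_std_normal_has_derivative this] show ?thesis by simp
      qed
      show "isCont (\<lambda>y. std_normal_density ((y - W w) / \<epsilon>) / \<epsilon>) x"
        unfolding std_normal_density_def using \<epsilon> by (intro continuous_intros) auto
    qed
    then show ?thesis by (simp add: mult.commute)
  qed
  have "expectation (\<lambda>w. ?\<Phi> ((b - W w) / \<epsilon>)) - expectation (\<lambda>w. ?\<Phi> ((a - W w) / \<epsilon>))
    = expectation (\<lambda>w. ?\<Phi> ((b - W w) / \<epsilon>) - ?\<Phi> ((a - W w) / \<epsilon>))"
    using i by simp
  also have "\<dots> = (LINT w|M. (LINT y|lborel. indicator {a..b} y * (std_normal_density ((y - W w) / \<epsilon>) / \<epsilon>)))"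
    by (simp only: FTC)
  also have "\<dots> = (LINT y|lborel. (LINT w|M. indicator {a..b} y * (std_normal_density ((y - W w) / \<epsilon>) / \<epsilon>)))"
    by (rule Fubini_integral[symmetric, OF dom])
  finally show ?eq by (simp add: u_def)
  show ?int using integrable_snd[OF dom] by (simp add: u_def)
qed

text \<open>Fourier inversion for the smoothed law: the Gaussian factor alone makes the double
  integral absolutely convergent, whatever the law of \<open>W\<close>.\<close>

lemma (in prob_space) smoothed_density_fourier:
  assumes W[measurable]: "random_variable borel W" and \<epsilon>: "0 < \<epsilon>"
  shows "complex_of_real (2 * pi * expectation (\<lambda>w. std_normal_density ((y - W w) / \<epsilon>) / \<epsilon>))
    = (LINT t|lborel. char (distr M borel W) t * complex_of_real (exp (- (\<epsilon> * t)\<^sup>2 / 2)) * exp (- (\<i> * complex_of_real y) * complex_of_real t))" (is ?eq)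
    and "integrable lborel (\<lambda>t. char (distr M borel W) t * complex_of_real (exp (- (\<epsilon> * t)\<^sup>2 / 2)) * exp (- (\<i> * complex_of_real y) * complex_of_real t))" (is ?int)
proof -
  interpret pair_sigma_finite M lborel by unfold_locales
  let ?h = "\<lambda>w t. complex_of_real (exp (- (\<epsilon> * t)\<^sup>2 / 2)) * exp (- (\<i> * complex_of_real (y - W w)) * complex_of_real t)"
  have dom: "integrable (M \<Otimes>\<^sub>M lborel) (\<lambda>(w, t). ?h w t)"
  proof (rule integrable_pair_dominated[where g="\<lambda>t. exp (- (\<epsilon> * t)\<^sup>2 / 2)"])
    show "prob_space M" by unfold_locales
    fix w t
    show "norm (?h w t) \<le> exp (- (\<epsilon> * t)\<^sup>2 / 2)"
      by (simp add: norm_mult)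
  qed (use scaled_gauss_integrable[OF \<epsilon>] in simp_all)
  have inner: "(LINT w|M. ?h w t) = char (distr M borel W) t * complex_of_real (exp (- (\<epsilon> * t)\<^sup>2 / 2)) * exp (- (\<i> * complex_of_real y) * complex_of_real t)" for t
  proof -
    have "char (distr M borel W) t = (LINT w|M. iexp (t * W w))"
      unfolding char_def by (subst integral_distr) auto
    moreover have "(LINT w|M. ?h w t) = (LINT w|M. (complex_of_real (exp (- (\<epsilon> * t)\<^sup>2 / 2)) * exp (- (\<i> * complex_of_real y) * complex_of_real t)) * iexp (t * W w))"
      by (intro Bochner_Integration.integral_cong refl) (simp add: exp_add[symmetric] algebra_simps)
    ultimately show ?thesis by (simp add: mult_ac)
  qed
  have "complex_of_real (2 * pi * expectation (\<lambda>w. std_normal_density ((y - W w) / \<epsilon>) / \<epsilon>))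
     = (LINT w|M. complex_of_real (2 * pi * (std_normal_density ((y - W w) / \<epsilon>) / \<epsilon>)))"
    by (simp add: integral_complex_of_real[symmetric] del: of_real_mult of_real_divide)
  also have "\<dots> = (LINT w|M. (LINT t|lborel. ?h w t))"
    by (simp only: scaled_gauss_fourier[OF \<epsilon>])
  also have "\<dots> = (LINT t|lborel. (LINT w|M. ?h w t))"
    by (rule Fubini_integral[symmetric, OF dom])
  finally show ?eq unfolding inner .
  show ?int using integrable_snd[OF dom] unfolding inner .
qed

text \<open>The indicator of a half-line lies between Gaussian distribution functions shifted by
  \<delta> to either side, up to the normal tail \<tau> at \<delta> / \<epsilon>. By inversion the
  smoothed density differs from \<psi> by at most \<open>D\<close> times the integral of 1 / (1 +
  t^2), so increments from \<open>a\<close> differ by at most this times the length. Starting from a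
  finite \<open>a\<close> is what makes a uniform bound on the densities enough; the price is the
  two boundary terms at \<open>a\<close>.\<close>

lemma (in prob_space) gaussian_smoothing:
  fixes \<Psi> \<psi> :: "real \<Rightarrow> real" and \<psi>h :: "real \<Rightarrow> complex"
  assumes W[measurable]: "random_variable borel W" and \<epsilon>: "0 < \<epsilon>" and \<delta>: "0 < \<delta>"
    and der: "\<And>y. (\<Psi> has_real_derivative \<psi> y) (at y)"
    and cont: "continuous_on UNIV \<psi>"
    and inv: "\<And>y. complex_of_real (2 * pi * \<psi> y) = (LINT t|lborel. \<psi>h t * exp (- (\<i> * complex_of_real y) * complex_of_real t))"
    and int: "\<And>y. integrable lborel (\<lambda>t. \<psi>h t * exp (- (\<i> * complex_of_real y) * complex_of_real t))"
    and close: "\<And>t. cmod (char (distr M borel W) t * complex_of_real (exp (- (\<epsilon> * t)\<^sup>2 / 2)) - \<psi>h t) \<le> D * (1 / (1 + t\<^sup>2))"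
    and L: "\<And>y. \<bar>\<psi> y\<bar> \<le> L"
    and tail: "cdf std_normal_distribution (- (\<delta> / \<epsilon>)) \<le> \<tau>" "1 - cdf std_normal_distribution (\<delta> / \<epsilon>) \<le> \<tau>"
    and ax: "a \<le> x - \<delta>"
  shows "\<bar>cdf (distr M borel W) x - \<Psi> x\<bar> \<le> 2 * \<tau> + cdf (distr M borel W) (a + \<delta>) + \<bar>\<Psi> a\<bar> + L * \<delta>
     + (x + \<delta> - a) * (D * (LINT t|lborel. 1 / (1 + t\<^sup>2)))"
proof -
  interpret D: real_distribution "distr M borel W" by (rule real_distribution_distr) simp
  let ?\<Phi> = "cdf std_normal_distribution" and ?F = "cdf (distr M borel W)"
  define k where "k y = expectation (\<lambda>w. ?\<Phi> ((y - W w) / \<epsilon>))" for y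
  define u where "u y = expectation (\<lambda>w. std_normal_density ((y - W w) / \<epsilon>) / \<epsilon>)" for y
  define J where "J = (LINT t|lborel. 1 / (1 + t\<^sup>2 :: real))"
  have D0: "0 \<le> D" using order_trans[OF norm_ge_zero close[of 0]] by simp
  have J0: "0 \<le> J" unfolding J_def by (rule Bochner_Integration.integral_nonneg) (simp add: add_nonneg_nonneg)
  have i: "integrable M (\<lambda>w. ?\<Phi> ((y - W w) / \<epsilon>))" for y
    by (rule integrable_const_bound[of _ 1]) (auto simp: cdf_std_normal_bounds)
  have F: "?F y = expectation (\<lambda>w. indicator {..y} (W w))" for y
  proof -
    have "?F y = measure M (W -` {..y} \<inter> space M)" by (simp add: cdf_def measure_distr)
    also have "\<dots> = expectation (indicator (W -` {..y} \<inter> space M))" by simp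
    also have "\<dots> = expectation (\<lambda>w. indicator {..y} (W w))"
      by (intro Bochner_Integration.integral_cong) (auto simp: indicator_def)
    finally show ?thesis .
  qed
  have iF: "integrable M (\<lambda>w. indicator {..y} (W w) :: real)" for y
    by (rule integrable_const_bound[of _ 1]) (auto simp: indicator_def)
  have up: "?F y \<le> k (y + \<delta>) + \<tau>" for y
  proof -
    have "?F y \<le> expectation (\<lambda>w. ?\<Phi> ((y + \<delta> - W w) / \<epsilon>) + \<tau>)"
      unfolding F
    proof (rule integral_mono)
      fix w
      show "indicator {..y} (W w) \<le> ?\<Phi> ((y + \<delta> - W w) / \<epsilon>) + \<tau>"
      proof (cases "W w \<le> y")
        case True
        then have "?\<Phi> (\<delta> / \<epsilon>) \<le> ?\<Phi> ((y + \<delta> - W w) / \<epsilon>)"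
          using \<epsilon> by (intro cdf_std_normal_mono divide_right_mono) auto
        then show ?thesis using tail True by (simp add: indicator_def)
      next
        case False
        have "0 \<le> \<tau>" using tail(1) cdf_std_normal_bounds(1)[of "- (\<delta> / \<epsilon>)"] by linarith
        then show ?thesis using False cdf_std_normal_bounds(1)[of "(y + \<delta> - W w) / \<epsilon>"] by (simp add: indicator_def)
      qed
    qed (use i iF in auto)
    also have "\<dots> = k (y + \<delta>) + \<tau>" using i by (simp add: k_def prob_space)
    finally show ?thesis .
  qed
  have lo: "k (y - \<delta>) \<le> ?F y + \<tau>" for y
  proof -
    have "k (y - \<delta>) \<le> expectation (\<lambda>w. indicator {..y} (W w) + \<tau>)"
      unfolding k_def
    proof (rule integral_mono)
      fix w
      show "?\<Phi> ((y - \<delta> - W w) / \<epsilon>) \<le> indicator {..y} (W w) + \<tau>"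
      proof (cases "W w \<le> y")
        case True
        have "0 \<le> \<tau>" using tail(1) cdf_std_normal_bounds(1)[of "- (\<delta> / \<epsilon>)"] by linarith
        then show ?thesis using True cdf_std_normal_bounds(2)[of "(y - \<delta> - W w) / \<epsilon>"] by (simp add: indicator_def)
      next
        case False
        then have "(y - \<delta> - W w) / \<epsilon> \<le> - \<delta> / \<epsilon>"
          using \<epsilon> by (intro divide_right_mono) auto
        then have "?\<Phi> ((y - \<delta> - W w) / \<epsilon>) \<le> ?\<Phi> (- (\<delta> / \<epsilon>))"
          by (intro cdf_std_normal_mono) simp
        then show ?thesis using tail False by (simp add: indicator_def)
      qed
    qed (use i iF in auto)
    also have "\<dots> = ?F y + \<tau>" using iF by (simp add: F prob_space)
    finally show ?thesis .
  qed
  have dens: "\<bar>u y - \<psi> y\<bar> \<le> D * J" for y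
  proof -
    let ?e = "\<lambda>t. exp (- (\<i> * complex_of_real y) * complex_of_real t)"
    let ?c = "\<lambda>t. char (distr M borel W) t * complex_of_real (exp (- (\<epsilon> * t)\<^sup>2 / 2))"
    have "complex_of_real (2 * pi * u y) - complex_of_real (2 * pi * \<psi> y)
       = (LINT t|lborel. ?c t * ?e t) - (LINT t|lborel. \<psi>h t * ?e t)"
      unfolding u_def smoothed_density_fourier(1)[OF W \<epsilon>] inv ..
    also have "\<dots> = (LINT t|lborel. ?c t * ?e t - \<psi>h t * ?e t)"
      by (rule Bochner_Integration.integral_diff[symmetric, OF smoothed_density_fourier(2)[OF W \<epsilon>] int])
    also have "cmod \<dots> \<le> (LINT t|lborel. D * (1 / (1 + t\<^sup>2)))"
    proof (rule norm_integral_le_integral)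
      show "integrable lborel (\<lambda>t. ?c t * ?e t - \<psi>h t * ?e t)"
        by (intro Bochner_Integration.integrable_diff smoothed_density_fourier(2)[OF W \<epsilon>] int)
      show "integrable lborel (\<lambda>t. D * (1 / (1 + t\<^sup>2)))"
        by (intro integrable_mult_right integrable_inverse_1_plus_sq)
      fix t
      have "norm (?c t * ?e t - \<psi>h t * ?e t) = cmod (?c t - \<psi>h t) * cmod (?e t)"
        by (simp only: norm_mult[symmetric] left_diff_distrib)
      also have "cmod (?e t) = 1" by simp
      finally show "norm (?c t * ?e t - \<psi>h t * ?e t) \<le> D * (1 / (1 + t\<^sup>2))" using close[of t] by simp
    qed
    also have "\<dots> = D * J" by (simp only: integral_mult_right_zero J_def)
    finally have "cmod (complex_of_real (2 * pi * (u y - \<psi> y))) \<le> D * J"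
      by (simp add: algebra_simps)
    then have "2 * pi * \<bar>u y - \<psi> y\<bar> \<le> D * J" unfolding norm_of_real by (simp add: abs_mult)
    \<comment> \<open>The factor 1 / (2 pi) of the inversion formula is simply dropped.\<close>
    moreover have "1 * \<bar>u y - \<psi> y\<bar> \<le> 2 * pi * \<bar>u y - \<psi> y\<bar>"
      using pi_gt3 by (intro mult_right_mono) auto
    ultimately show ?thesis by simp
  qed
  have inc: "\<bar>(k b - k a) - (\<Psi> b - \<Psi> a)\<bar> \<le> (b - a) * (D * J)" if ab: "a \<le> b" for b
  proof -
    have k: "k b - k a = (LINT y|lborel. indicator {a..b} y * u y)"
      unfolding k_def u_def by (rule smoothed_cdf_increment(1)[OF W \<epsilon> ab])
    have ik: "integrable lborel (\<lambda>y. indicator {a..b} y * u y)"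
      unfolding u_def by (rule smoothed_cdf_increment(2)[OF W \<epsilon> ab])
    have hb: "has_bochner_integral lborel (\<lambda>y. \<psi> y * indicator {a..b} y) (\<Psi> b - \<Psi> a)"
      using cont by (intro has_bochner_integral_FTC_Icc_real ab der) (auto simp: continuous_on_eq_continuous_at)
    have p: "\<Psi> b - \<Psi> a = (LINT y|lborel. indicator {a..b} y * \<psi> y)"
      using has_bochner_integral_integral_eq[OF hb] by (simp add: mult.commute)
    have ip: "integrable lborel (\<lambda>y. indicator {a..b} y * \<psi> y)"
      using integrable.intros[OF hb] by (simp add: mult.commute)
    have "(k b - k a) - (\<Psi> b - \<Psi> a) = (LINT y|lborel. indicator {a..b} y * u y - indicator {a..b} y * \<psi> y)"
      unfolding k p by (rule Bochner_Integration.integral_diff[symmetric, OF ik ip])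
    also have "norm \<dots> \<le> (LINT y|lborel. indicator {a..b} y * (D * J))"
    proof (rule norm_integral_le_integral)
      show "integrable lborel (\<lambda>y. indicator {a..b} y * u y - indicator {a..b} y * \<psi> y)"
        by (intro Bochner_Integration.integrable_diff ik ip)
      show "integrable lborel (\<lambda>y. indicator {a..b} y * (D * J))"
        by (intro integrable_mult_left integrable_real_indicator) (auto simp: emeasure_lborel_Icc_eq)
      show "norm (indicator {a..b} y * u y - indicator {a..b} y * \<psi> y) \<le> indicator {a..b} y * (D * J)" for y
        using dens[of y] by (simp add: indicator_def)
    qed
    also have "\<dots> = (b - a) * (D * J)" using ab by simp
    finally show ?thesis by simp
  qed
  have lip: "\<bar>\<Psi> y - \<Psi> z\<bar> \<le> L * \<bar>y - z\<bar>" for y z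
    using field_differentiable_bound[of UNIV \<Psi> \<psi> L y z] der L by simp
  have "0 \<le> ?F (a + \<delta>)" by (rule D.cdf_nonneg)
  have "?F x - \<Psi> x \<le> 2 * \<tau> + ?F (a + \<delta>) + \<bar>\<Psi> a\<bar> + L * \<delta> + (x + \<delta> - a) * (D * J)"
  proof -
    have "k a \<le> ?F (a + \<delta>) + \<tau>" using lo[of "a + \<delta>"] by simp
    moreover have "\<bar>\<Psi> (x + \<delta>) - \<Psi> x\<bar> \<le> L * \<delta>" using lip[of "x+\<delta>" x] \<delta> by simp
    moreover have "\<bar>(k (x+\<delta>) - k a) - (\<Psi> (x+\<delta>) - \<Psi> a)\<bar> \<le> (x + \<delta> - a) * (D * J)"
      using inc[of "x+\<delta>"] ax \<delta> by simp
    ultimately show ?thesis using up[of x] by linarith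
  qed
  moreover have "\<Psi> x - ?F x \<le> 2 * \<tau> + ?F (a + \<delta>) + \<bar>\<Psi> a\<bar> + L * \<delta> + (x + \<delta> - a) * (D * J)"
  proof -
    \<comment> \<open>Downwards \<open>0 \<le> k a\<close> suffices; the term for
      \<open>a + \<delta>\<close> gives both directions one common bound.\<close>
    have "0 \<le> k a" unfolding k_def by (rule Bochner_Integration.integral_nonneg) (simp add: cdf_std_normal_bounds)
    moreover have "0 \<le> \<tau>" using tail(1) cdf_std_normal_bounds(1)[of "- (\<delta> / \<epsilon>)"] by linarith
    moreover have "\<bar>\<Psi> (x - \<delta>) - \<Psi> x\<bar> \<le> L * \<delta>" using lip[of "x-\<delta>" x] \<delta> by simp
    moreover have "\<bar>(k (x-\<delta>) - k a) - (\<Psi> (x-\<delta>) - \<Psi> a)\<bar> \<le> (x - \<delta> - a) * (D * J)"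
      using inc[of "x-\<delta>"] ax by simp
    moreover have "(x - \<delta> - a) * (D * J) \<le> (x + \<delta> - a) * (D * J)"
      using D0 J0 \<delta> by (intro mult_right_mono) auto
    ultimately show ?thesis using lo[of x] \<open>0 \<le> ?F (a + \<delta>)\<close> by linarith
  qed
  ultimately show ?thesis unfolding J_def by linarith
qed

section \<open>Exponentials of power series with polynomial coefficients\<close>

text \<open>In the application \<open>v k\<close> is a derivative in t of a logarithm along i t,
  times a power of the standard deviation; the factor (- i)^k turns it into the k-th cumulant
  divided by the variance. For k = 2 that quotient is 1, and slot 2 of the variables carries no
  information.\<close>

definition cumulant_var :: "(nat \<Rightarrow> complex) \<Rightarrow> nat \<Rightarrow> complex" where
  "cumulant_var v k = (if k = 2 then 1 else (- \<i>) ^ k * v k)"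

text \<open>The coefficient of w^k in s^2 G(s w), as a polynomial in s, where z^2 G(z) is the
  cumulant generating function divided by the variance.\<close>

definition expo_term :: "(nat \<Rightarrow> complex) \<Rightarrow> nat \<Rightarrow> complex poly" where
  "expo_term v k = monom (cumulant_var v (k + 2) / fact (k + 2)) (k + 2)"

text \<open>The coefficient of w^j in (1 - v 1 w)^2 s^2 G(s w) - s v 0 w - s^2 / 2, the exponent of
  the characteristic function at w = 1 / B n with the Gaussian removed. The square contributes 1, -
  2 v 1 and (v 1)^2; for j = 1 there is no term of index j - 2, and the shift by v 0 stands in its
  place.\<close>

definition expo_coeff :: "(nat \<Rightarrow> complex) \<Rightarrow> nat \<Rightarrow> complex poly" where
  "expo_coeff v j =
     (if j = 0 then 0
      else expo_term v j + smult (- 2 * v 1) (expo_term v (j - 1))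
        + (if j = 1 then smult (- v 0) [:0, 1:] else smult (v 1 * v 1) (expo_term v (j - 2))))"

text \<open>Comparison of coefficients in Y' = E' Y for Y = exp E.\<close>

fun exp_coeff :: "(nat \<Rightarrow> complex) \<Rightarrow> nat \<Rightarrow> complex poly" where
  "exp_coeff v 0 = 1"
| "exp_coeff v (Suc j) = smult (1 / of_nat (Suc j))
     (\<Sum>i\<le>j. smult (of_nat (Suc i)) (expo_coeff v (Suc i) * exp_coeff v (j - i)))"

declare exp_coeff.simps(2)[simp del]

text \<open>\<open>expo_term v j\<close> has degree at most j + 2, which is at most 3 j from j = 1
  on. The bound passes through the recursion for \<open>exp_coeff\<close> and makes the degrees of
  the Edgeworth polynomials independent of n.\<close>

lemma degree_expo_coeff: "degree (expo_coeff v j) \<le> 3 * j"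
proof -
  have T: "degree (smult c (expo_term v k)) \<le> d" if "k + 2 \<le> d" for c k d
    unfolding expo_term_def by (rule order_trans[OF degree_smult_le order_trans[OF degree_monom_le that]])
  have T': "degree (expo_term v k) \<le> d" if "k + 2 \<le> d" for k d
    using T[OF that, of 1] by simp
  have X: "degree (smult c [:0, 1:]) \<le> d" if "1 \<le> d" for c :: complex and d
    by (rule order_trans[OF degree_smult_le]) (use that in simp)
  consider "j = 0" | "j = 1" | "2 \<le> j" by linarith
  then show ?thesis
    by cases (simp_all add: expo_coeff_def degree_add_le degree_diff_le T T' X del: smult_pCons)
qed

lemma degree_exp_coeff: "degree (exp_coeff v j) \<le> 3 * j"
proof (induction j rule: less_induct)
  case (less j)
  show ?case
  proof (cases j)
    case (Suc k)
    have "degree (expo_coeff v (Suc i) * exp_coeff v (k - i)) \<le> 3 * j" if "i \<le> k" for i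
    proof -
      have "degree (expo_coeff v (Suc i) * exp_coeff v (k - i)) \<le> 3 * Suc i + 3 * (k - i)"
        by (rule order_trans[OF degree_mult_le add_mono[OF degree_expo_coeff less]]) (use Suc in simp)
      then show ?thesis using Suc that by simp
    qed
    then show ?thesis unfolding Suc exp_coeff.simps(2)
      by (intro order_trans[OF degree_smult_le] degree_sum_le) (auto simp: Suc intro!: order_trans[OF degree_smult_le])
  qed simp
qed

lemma coeff_0_expo_coeff: "coeff (expo_coeff v j) 0 = 0"
  by (simp add: expo_coeff_def expo_term_def)

text \<open>The missing constant term lets every correction of the density be integrated:
  \<open>hermite (Suc l)\<close> times the density has the antiderivative minus
  \<open>hermite l\<close> times the density.\<close>

lemma coeff_0_exp_coeff: "0 < j \<Longrightarrow> coeff (exp_coeff v j) 0 = 0"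
  by (cases j) (simp_all add: exp_coeff.simps(2) coeff_sum coeff_mult coeff_0_expo_coeff)

lemma Reals_coeff_mult:
  fixes p q :: "complex poly"
  assumes "\<And>i. coeff p i \<in> \<real>" "\<And>i. coeff q i \<in> \<real>" shows "coeff (p * q) i \<in> \<real>"
  unfolding coeff_mult by (rule sum_in_Reals) (rule Reals_mult[OF assms])

lemma Reals_expo_coeff:
  assumes "v 0 \<in> \<real>" "v 1 \<in> \<real>" "\<And>k. 3 \<le> k \<Longrightarrow> (- \<i>) ^ k * v k \<in> \<real>"
  shows "coeff (expo_coeff v j) i \<in> \<real>"
proof -
  have "cumulant_var v (k + 2) \<in> \<real>" for k
    using assms(3)[of "k+2"] by (cases "k = 0") (auto simp: cumulant_var_def)
  note cv = this
  have "coeff (expo_term v k) i \<in> \<real>" for k i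
  proof -
    have "(fact (k + 2) :: complex) \<in> \<real>" by (metis Reals_of_nat of_nat_fact)
    with cv[of k] have "cumulant_var v (k + 2) / fact (k + 2) \<in> \<real>"
      by (rule Reals_divide)
    then show ?thesis unfolding expo_term_def coeff_monom by (cases "k + 2 = i") (simp_all only: if_True if_False Reals_0 simp_thms)
  qed
  moreover have "coeff [:0, 1::complex:] i \<in> \<real>"
    by (auto simp: coeff_pCons split: nat.split)
  ultimately show ?thesis unfolding expo_coeff_def
    using assms(1,2) by (simp add: Reals_add Reals_mult Reals_minus del: smult_pCons)
qed

lemma Reals_exp_coeff:
  assumes "v 0 \<in> \<real>" "v 1 \<in> \<real>" "\<And>k. 3 \<le> k \<Longrightarrow> (- \<i>) ^ k * v k \<in> \<real>"
  shows "coeff (exp_coeff v j) i \<in> \<real>"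
proof (induction j arbitrary: i rule: less_induct)
  case (less j)
  show ?case
  proof (cases j)
    case (Suc k)
    have "coeff (smult (of_nat (Suc i)) (expo_coeff v (Suc i) * exp_coeff v (k - i))) l \<in> \<real>" for i l
      unfolding coeff_smult
      by (rule Reals_mult[OF Reals_of_nat Reals_coeff_mult[OF Reals_expo_coeff[OF assms] less]]) (simp_all add: Suc)
    then have "coeff (\<Sum>i\<le>k. smult (of_nat (Suc i)) (expo_coeff v (Suc i) * exp_coeff v (k - i))) i \<in> \<real>"
      unfolding coeff_sum by (intro sum_in_Reals)
    then show ?thesis unfolding Suc exp_coeff.simps(2) coeff_smult
      by (rule Reals_mult[OF Reals_divide[OF Reals_1 Reals_of_nat]])
  qed (simp add: coeff_1)
qed

section \<open>Polynomial dependence of the coefficients on the variables\<close>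

definition poly_fun_coeffs :: "((nat \<Rightarrow> complex) \<Rightarrow> complex poly) \<Rightarrow> bool" where
  "poly_fun_coeffs F \<longleftrightarrow> (\<forall>i. (\<lambda>v. coeff (F v) i) \<in> poly_funs)"

lemma poly_funs_sum: "finite I \<Longrightarrow> (\<And>i. i \<in> I \<Longrightarrow> F i \<in> poly_funs) \<Longrightarrow> (\<lambda>v. \<Sum>i\<in>I. F i v) \<in> poly_funs"
  by (induction I rule: finite_induct) (simp_all add: poly_funs.const poly_funs.add)

lemma poly_fun_coeffs_add: "poly_fun_coeffs F \<Longrightarrow> poly_fun_coeffs G \<Longrightarrow> poly_fun_coeffs (\<lambda>v. F v + G v)"
  by (simp add: poly_fun_coeffs_def poly_funs.add)

lemma poly_fun_coeffs_smult: "c \<in> poly_funs \<Longrightarrow> poly_fun_coeffs F \<Longrightarrow> poly_fun_coeffs (\<lambda>v. smult (c v) (F v))"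
  by (simp add: poly_fun_coeffs_def poly_funs.mult)

lemma poly_fun_coeffs_mult: "poly_fun_coeffs F \<Longrightarrow> poly_fun_coeffs G \<Longrightarrow> poly_fun_coeffs (\<lambda>v. F v * G v)"
  by (simp add: poly_fun_coeffs_def coeff_mult poly_funs_sum poly_funs.mult)

lemma poly_fun_coeffs_sum:
  "finite I \<Longrightarrow> (\<And>i. i \<in> I \<Longrightarrow> poly_fun_coeffs (F i)) \<Longrightarrow> poly_fun_coeffs (\<lambda>v. \<Sum>i\<in>I. F i v)"
  by (simp add: poly_fun_coeffs_def coeff_sum poly_funs_sum)

lemma poly_fun_coeffs_const: "poly_fun_coeffs (\<lambda>v. p)"
  by (simp add: poly_fun_coeffs_def poly_funs.const)

lemma poly_fun_coeffs_expo_term: "poly_fun_coeffs (\<lambda>v. expo_term v k)"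
proof -
  have "(\<lambda>v. cumulant_var v (k + 2) / fact (k + 2)) \<in> poly_funs"
  proof (cases "k = 0")
    case True
    then show ?thesis using poly_funs.const[of "1 / fact 2"] by (simp add: cumulant_var_def)
  next
    case False
    have "(\<lambda>v. ((- \<i>) ^ (k + 2) / fact (k + 2)) * v (k + 2)) \<in> poly_funs"
      by (rule poly_funs.mult[OF poly_funs.const poly_funs.var])
    then show ?thesis using False by (simp add: cumulant_var_def)
  qed
  note * = this
  show ?thesis unfolding poly_fun_coeffs_def expo_term_def coeff_monom
  proof
    show "(\<lambda>v. if k + 2 = i then cumulant_var v (k + 2) / fact (k + 2) else 0) \<in> poly_funs" for i
      using * poly_funs.const[of 0] by (cases "k + 2 = i") (simp_all only: if_True if_False simp_thms)
  qed
qed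

lemma poly_fun_coeffs_expo_coeff: "poly_fun_coeffs (\<lambda>v. expo_coeff v j)"
proof (cases "j = 0")
  case False
  have m: "(\<lambda>v. - 2 * v 1) \<in> poly_funs" "(\<lambda>v. -1 * v 0) \<in> poly_funs" "(\<lambda>v. v 1 * v 1) \<in> poly_funs"
    by (rule poly_funs.mult[OF poly_funs.const poly_funs.var] poly_funs.mult[OF poly_funs.var poly_funs.var])+
  have 1: "poly_fun_coeffs (\<lambda>v. expo_term v j + smult (- 2 * v 1) (expo_term v (j - 1)))"
    by (rule poly_fun_coeffs_add[OF poly_fun_coeffs_expo_term poly_fun_coeffs_smult[OF m(1) poly_fun_coeffs_expo_term]])
  show ?thesis
  proof (cases "j = 1")
    case True
    have "poly_fun_coeffs (\<lambda>v. smult (-1 * v 0) [:0, 1:])"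
      by (rule poly_fun_coeffs_smult[OF m(2) poly_fun_coeffs_const])
    from poly_fun_coeffs_add[OF 1 this] show ?thesis using True by (simp add: expo_coeff_def)
  next
    case J: False
    have "poly_fun_coeffs (\<lambda>v. smult (v 1 * v 1) (expo_term v (j - 2)))"
      by (rule poly_fun_coeffs_smult[OF m(3) poly_fun_coeffs_expo_term])
    from poly_fun_coeffs_add[OF 1 this] show ?thesis using False J by (simp add: expo_coeff_def)
  qed
qed (simp add: expo_coeff_def poly_fun_coeffs_const)

lemma poly_fun_coeffs_exp_coeff: "poly_fun_coeffs (\<lambda>v. exp_coeff v j)"
proof (induction j rule: less_induct)
  case (less j)
  show ?case
  proof (cases j)
    case (Suc k)
    have "poly_fun_coeffs (\<lambda>v. smult (of_nat (Suc i)) (expo_coeff v (Suc i) * exp_coeff v (k - i)))" for i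
      by (rule poly_fun_coeffs_smult[OF poly_funs.const poly_fun_coeffs_mult[OF poly_fun_coeffs_expo_coeff less]])
        (simp add: Suc)
    then have "poly_fun_coeffs (\<lambda>v. \<Sum>i\<le>k. smult (of_nat (Suc i)) (expo_coeff v (Suc i) * exp_coeff v (k - i)))"
      by (intro poly_fun_coeffs_sum) simp_all
    from poly_fun_coeffs_smult[OF poly_funs.const this] show ?thesis unfolding Suc exp_coeff.simps(2) .
  qed (simp add: poly_fun_coeffs_const)
qed

lemma poly_fun_bounded:
  assumes "q \<in> poly_funs" "\<And>i. \<exists>K. \<forall>n::nat. cmod (v n i) \<le> K"
  shows "\<exists>K. \<forall>n. cmod (q (v n)) \<le> K"
  using assms(1)
proof induction
  case (const c) then show ?case by auto
next
  case (var i) then show ?case using assms(2) by simp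
next
  case (add p q)
  then obtain K L where "\<And>n. cmod (p (v n)) \<le> K" "\<And>n. cmod (q (v n)) \<le> L" by auto
  then have "cmod (p (v n) + q (v n)) \<le> K + L" for n by (meson add_mono norm_triangle_le)
  then show ?case by auto
next
  case (mult p q)
  then obtain K L where "\<And>n. cmod (p (v n)) \<le> K" "\<And>n. cmod (q (v n)) \<le> L" by auto
  then have "cmod (p (v n) * q (v n)) \<le> K * L" for n
    unfolding norm_mult by (intro mult_mono order_trans[OF norm_ge_zero]) auto
  then show ?case by auto
qed

text \<open>The double zero is divided out by shifting the power series, so
  \<open>eval_fps G\<close> is holomorphic at 0 as well, with value 1/2 there. The last bound is the
  third-order Taylor remainder of \<open>g\<close> divided by z^2; 16 is 2 * 2^3 because that
  estimate is made on the disc of radius r / 2.\<close>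

lemma removable_square:
  fixes g :: "complex \<Rightarrow> complex"
  assumes g: "g holomorphic_on ball 0 r" and r: "0 < r"
    and bd: "\<And>z. cmod z < r \<Longrightarrow> cmod (g z) \<le> C"
    and 0: "g 0 = 0" "deriv g 0 = 0" "(deriv ^^ 2) g 0 = 1"
  obtains G where "eval_fps G holomorphic_on ball 0 r" "\<And>k. fps_nth G k = (deriv ^^ (k + 2)) g 0 / fact (k + 2)"
    "\<And>z. cmod z < r \<Longrightarrow> g z = z\<^sup>2 * eval_fps G z" "0 < fps_conv_radius G"
    "\<And>z. cmod z \<le> r / 4 \<Longrightarrow> cmod (eval_fps G z - 1/2) \<le> (16 * C / r ^ 3) * cmod z"
proof -
  define F where "F = fps_expansion g 0"
  define G where "G = fps_shift 2 F"
  have gr: "g holomorphic_on eball 0 (ereal r)" using g by simp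
  have cr: "fps_conv_radius F \<ge> ereal r" unfolding F_def by (rule conv_radius_fps_expansion[OF gr])
  have crG: "fps_conv_radius G = fps_conv_radius F" by (simp add: G_def)
  have F0: "fps_nth F 0 = 0" "fps_nth F 1 = 0" using 0 by (simp_all add: F_def fps_expansion_def)
  have sub: "2 \<le> subdegree F \<or> F = 0"
  proof (cases "F = 0")
    case False
    have "subdegree F \<ge> 2"
      by (rule subdegree_geI[OF False]) (use F0 less_2_cases in force)
    then show ?thesis by simp
  qed simp
  have F2: "fps_nth F 2 = 1/2" using 0(3) by (simp add: F_def fps_expansion_def)
  then have Fn: "F \<noteq> 0" by auto
  with sub have sub: "2 \<le> subdegree F" by simp
  have evF: "eval_fps F z = g z" if "cmod z < r" for z
    unfolding F_def using eval_fps_expansion'[OF gr, of z] that by simp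
  have ev: "eval_fps G z = (if z = 0 then 1/2 else g z / z\<^sup>2)" if "cmod z < r" for z
  proof -
    have "ereal (cmod z) < fps_conv_radius F" using that cr by (meson ereal_less_eq(3) le_less_trans less_ereal.simps(1) less_le_trans)
    from eval_fps_shift[OF sub this] show ?thesis using F2 evF[OF that] by (simp add: G_def)
  qed
  show ?thesis
  proof
    show "eval_fps G holomorphic_on ball 0 r"
      by (rule holomorphic_on_eval_fps) (use cr crG ball_eball_mono[of r "fps_conv_radius G"] in auto)
    show "fps_nth G k = (deriv ^^ (k + 2)) g 0 / fact (k + 2)" for k
      by (simp add: G_def F_def fps_expansion_def)
    show "g z = z\<^sup>2 * eval_fps G z" if "cmod z < r" for z using ev[OF that] 0(1) by auto
    show "0 < fps_conv_radius G" using r cr crG by (metis ereal_less(2) less_le_trans)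
    fix z assume z: "cmod z \<le> r / 4"
    show "cmod (eval_fps G z - 1/2) \<le> (16 * C / r ^ 3) * cmod z"
    proof (cases "z = 0")
      case False
      have hc: "g holomorphic_on cball 0 (r/2)" by (rule holomorphic_on_subset[OF g]) (use r in auto)
      have "cmod (g z - (\<Sum>j\<le>2. (deriv ^^ j) g 0 / fact j * z ^ j)) \<le> 2 * C * (cmod z / (r/2)) ^ Suc 2"
        by (rule taylor_remainder_bound[OF hc]) (use r z bd in auto)
      also have "(\<Sum>j\<le>2. (deriv ^^ j) g 0 / fact j * z ^ j) = z\<^sup>2 / 2"
        using 0 by (simp add: numeral_2_eq_2)
      finally have *: "cmod (g z - z\<^sup>2 / 2) \<le> 2 * C * (cmod z / (r/2)) ^ 3" by (simp add: numeral_3_eq_3 numeral_2_eq_2)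
      have "eval_fps G z - 1/2 = (g z - z\<^sup>2 / 2) / z\<^sup>2"
        using ev[of z] z r False by (simp add: field_simps)
      then have "cmod (eval_fps G z - 1/2) = cmod (g z - z\<^sup>2 / 2) / cmod z ^ 2"
        by (simp add: norm_divide norm_power)
      also have "\<dots> \<le> 2 * C * (cmod z / (r/2)) ^ 3 / cmod z ^ 2"
        by (intro divide_right_mono *) simp
      also have "\<dots> = (16 * C / r ^ 3) * cmod z" using False
        by (simp add: power_divide power_mult_distrib field_simps power2_eq_square power3_eq_cube)
      finally show ?thesis .
    qed (use ev[of 0] r in simp)
  qed
qed

text \<open>The formal power series of exp E satisfies Y' = Y E', which is the recursion of
  \<open>exp_coeff\<close>. The composition is legitimate because the series of E has no constant
  term.\<close>

lemma exp_coeff_taylor: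
  fixes v :: "nat \<Rightarrow> complex" and s :: complex
  assumes E: "E has_fps_expansion FE" and coeffs: "\<And>j. fps_nth FE j = poly (expo_coeff v j) s"
  shows "(deriv ^^ j) (\<lambda>w. exp (E w)) 0 / fact j = poly (exp_coeff v j) s"
proof -
  have FE0: "fps_nth FE 0 = 0" by (simp add: coeffs expo_coeff_def)
  define Y where "Y = fps_compose (fps_exp 1) FE"
  have "(exp \<circ> E) has_fps_expansion Y"
    unfolding Y_def by (rule has_fps_expansion_compose[OF has_fps_expansion_exp1 E FE0])
  then have Y: "(\<lambda>w. exp (E w)) has_fps_expansion Y" by (simp add: o_def)
  have dY: "fps_deriv Y = Y * fps_deriv FE"
    unfolding Y_def by (simp add: fps_compose_deriv[OF FE0])
  have "fps_nth Y j = poly (exp_coeff v j) s"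
  proof (induction j rule: less_induct)
    case (less j)
    show ?case
    proof (cases j)
      case 0 then show ?thesis by (simp add: Y_def)
    next
      case (Suc k)
      have "of_nat (Suc k) * fps_nth Y (Suc k) = fps_nth (fps_deriv FE * Y) k"
        using arg_cong[OF dY, of "\<lambda>f. fps_nth f k"] by (simp add: mult.commute)
      also have "\<dots> = (\<Sum>i\<le>k. of_nat (Suc i) * poly (expo_coeff v (Suc i)) s * poly (exp_coeff v (k - i)) s)"
        unfolding fps_mult_nth atLeast0AtMost
        by (intro sum.cong refl) (simp add: coeffs less Suc)
      finally show ?thesis
        unfolding Suc exp_coeff.simps(2) by (simp add: poly_sum field_simps del: of_nat_Suc)
    qed
  qed
  then show ?thesis using fps_nth_fps_expansion[OF Y] by simp
qed

lemma expo_has_fps_expansion: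
  fixes v :: "nat \<Rightarrow> complex" and s :: complex
  assumes G: "0 < fps_conv_radius G" "\<And>k. fps_nth G k = cumulant_var v (k + 2) / fact (k + 2)"
  shows "\<exists>FE. (\<lambda>w. (1 - v 1 * w)\<^sup>2 * (s\<^sup>2 * eval_fps G (s * w)) - s * v 0 * w - s\<^sup>2 / 2) has_fps_expansion FE \<and>
    (\<forall>j. fps_nth FE j = poly (expo_coeff v j) s)"
proof -
  define H where "H = Abs_fps (\<lambda>k. poly (expo_term v k) s)"
  have "(eval_fps G \<circ> (\<lambda>w. s * w)) has_fps_expansion fps_compose G (fps_const s * fps_X)"
    by (rule has_fps_expansion_compose) (auto intro!: fps_expansion_intros eval_fps_has_fps_expansion G)
  then have "(\<lambda>w. s\<^sup>2 * eval_fps G (s * w)) has_fps_expansion fps_const (s\<^sup>2) * fps_compose G (fps_const s * fps_X)"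
    by (intro has_fps_expansion_cmult_left) (simp add: o_def)
  also have "fps_const (s\<^sup>2) * fps_compose G (fps_const s * fps_X) = H"
  proof (rule fps_ext)
    fix n
    have "fps_nth (fps_const (s\<^sup>2) * fps_compose G (fps_const s * fps_X)) n = s\<^sup>2 * (s ^ n * fps_nth G n)"
      by (simp only: fps_mult_left_const_nth fps_nth_compose_linear)
    also have "\<dots> = fps_nth H n"
      by (simp only: H_def expo_term_def G poly_monom power_add fps_nth_Abs_fps mult_ac)
    finally show "fps_nth (fps_const (s\<^sup>2) * fps_compose G (fps_const s * fps_X)) n = fps_nth H n" .
  qed
  finally have H: "(\<lambda>w. s\<^sup>2 * eval_fps G (s * w)) has_fps_expansion H" .
  define FE where "FE = H + fps_const (- 2 * v 1) * (fps_X * H) + fps_const (v 1 * v 1) * (fps_X * (fps_X * H))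
      - fps_const (s * v 0) * fps_X - fps_const (s\<^sup>2 / 2)"
  have X: "(\<lambda>w. w) has_fps_expansion fps_X" by (rule has_fps_expansion_fps_X)
  have "(\<lambda>w. s\<^sup>2 * eval_fps G (s * w) + (- 2 * v 1) * (w * (s\<^sup>2 * eval_fps G (s * w)))
     + (v 1 * v 1) * (w * (w * (s\<^sup>2 * eval_fps G (s * w)))) - (s * v 0) * w - s\<^sup>2 / 2) has_fps_expansion FE"
    unfolding FE_def
    by (intro has_fps_expansion_diff has_fps_expansion_add has_fps_expansion_cmult_left has_fps_expansion_mult X H
        has_fps_expansion_const)
  then have 1: "(\<lambda>w. (1 - v 1 * w)\<^sup>2 * (s\<^sup>2 * eval_fps G (s * w)) - s * v 0 * w - s\<^sup>2 / 2) has_fps_expansion FE"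
    by (simp add: power2_eq_square algebra_simps)
  have "fps_nth FE j = poly (expo_coeff v j) s" for j
  proof -
    consider "j = 0" | "j = 1" | k where "j = Suc (Suc k)" by (metis One_nat_def nat.exhaust)
    then show ?thesis
    proof cases
      case 1
      then show ?thesis by (simp add: FE_def H_def expo_coeff_def expo_term_def cumulant_var_def poly_monom numeral_2_eq_2)
    next
      case 2
      then show ?thesis by (simp add: FE_def H_def expo_coeff_def algebra_simps)
    next
      case 3
      then show ?thesis by (simp add: FE_def H_def expo_coeff_def algebra_simps)
    qed
  qed
  with 1 show ?thesis by blast
qed

text \<open>As a function of w the exponential is holomorphic and bounded on a disc of radius
  proportional to (1 + cmod s)^(-3): once s^2 / 2 is removed, everything left in the exponent is
  controlled by |s|^k |w| with k at most 3. The Taylor estimate on this disc produces the powers of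
  w (1 + cmod s)^3. The constants depend only on \<open>r\<close>, \<open>C\<close>,
  \<open>b\<close> and \<open>R\<close>, not on \<open>g\<close>, \<open>v\<close> or
  \<open>s\<close>.\<close>

lemma edgeworth_taylor:
  fixes r C b :: real and R :: nat
  assumes r: "0 < r" and C: "0 \<le> C" and b: "0 \<le> b"
  shows "\<exists>K \<eta>. 0 \<le> K \<and> 0 < \<eta> \<and> (\<forall>g v s (w::real). g holomorphic_on ball 0 r \<longrightarrow>
     (\<forall>z. cmod z < r \<longrightarrow> cmod (g z) \<le> C) \<longrightarrow> g 0 = 0 \<longrightarrow> deriv g 0 = 0 \<longrightarrow>
     (\<forall>k\<ge>2. (deriv ^^ k) g 0 = cumulant_var v k) \<longrightarrow> cmod (v 0) \<le> b \<longrightarrow> cmod (v 1) \<le> b \<longrightarrow>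
     0 < w \<longrightarrow> w * (1 + cmod s) ^ 3 \<le> \<eta> \<longrightarrow>
     cmod (exp ((1 - v 1 * of_real w)\<^sup>2 * (g (s * of_real w) / (of_real w)\<^sup>2) - s * v 0 * of_real w - s\<^sup>2 / 2)
        - (\<Sum>j\<le>R. poly (exp_coeff v j) s * of_real w ^ j)) \<le> K * (w * (1 + cmod s) ^ 3) ^ Suc R)"
proof -
  define \<eta> where "\<eta> = min 1 (r / 4)"
  have \<eta>: "0 < \<eta>" "\<eta> \<le> 1" "\<eta> \<le> r / 4" using r by (auto simp: \<eta>_def)
  \<comment> \<open>One summand for each of three pieces of the exponent: the deviation of G from
    1/2, the change of the variance through \<open>v 1\<close>, and the shift by
    \<open>v 0\<close>.\<close>
  define B where "B = (1 + b)\<^sup>2 * (16 * C / r ^ 3) + (2 * b + b\<^sup>2) + b"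
  show ?thesis
  proof (rule exI[of _ "2 * exp B / \<eta> ^ Suc R"], rule exI[of _ "\<eta> / 2"], intro conjI allI impI)
    fix g v s and w :: real
    assume g: "g holomorphic_on ball 0 r" "\<forall>z. cmod z < r \<longrightarrow> cmod (g z) \<le> C" "g 0 = 0" "deriv g 0 = 0"
      and gv: "\<forall>k\<ge>2. (deriv ^^ k) g 0 = cumulant_var v k" and v: "cmod (v 0) \<le> b" "cmod (v 1) \<le> b"
      and w: "0 < w" "w * (1 + cmod s) ^ 3 \<le> \<eta> / 2"
    have g2: "(deriv ^^ 2) g 0 = 1" using gv by (simp add: cumulant_var_def)
    obtain G where G: "eval_fps G holomorphic_on ball 0 r" "\<And>k. fps_nth G k = (deriv ^^ (k + 2)) g 0 / fact (k + 2)"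
      "\<And>z. cmod z < r \<Longrightarrow> g z = z\<^sup>2 * eval_fps G z" "0 < fps_conv_radius G"
      "\<And>z. cmod z \<le> r / 4 \<Longrightarrow> cmod (eval_fps G z - 1/2) \<le> (16 * C / r ^ 3) * cmod z"
      using removable_square[OF g(1) r _ g(3,4) g2, of C] g(2) by blast
    define E where "E w = (1 - v 1 * w)\<^sup>2 * (s\<^sup>2 * eval_fps G (s * w)) - s * v 0 * w - s\<^sup>2 / 2" for w
    obtain FE where FE: "E has_fps_expansion FE" "\<And>j. fps_nth FE j = poly (expo_coeff v j) s"
    proof -
      have "fps_nth G k = cumulant_var v (k + 2) / fact (k + 2)" for k
      proof -
        have "2 \<le> k + 2" by simp
        then show ?thesis using G(2)[of k] gv by metis
      qed
      from expo_has_fps_expansion[OF G(4) this, of s] show ?thesis using that unfolding E_def[abs_def] by blast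
    qed
    define S where "S = 1 + cmod s"
    have S: "1 \<le> S" "cmod s \<le> S" by (auto simp: S_def)
    define \<rho> where "\<rho> = \<eta> / S ^ 3"
    have \<rho>: "0 < \<rho>" using \<eta> S by (simp add: \<rho>_def)
    have small: "cmod s ^ 2 * cmod u \<le> \<eta>" "cmod s ^ 3 * cmod u \<le> \<eta>" "cmod s * cmod u \<le> \<eta>" "cmod u \<le> \<eta>"
      if u: "cmod u \<le> \<rho>" for u
    proof -
      have *: "cmod s ^ k * cmod u \<le> \<eta>" if "k \<le> 3" for k
      proof -
        have "cmod s ^ k \<le> S ^ k" using S by (intro power_mono) auto
        also have "\<dots> \<le> S ^ 3" by (rule power_increasing) (use that S in auto)
        finally have "cmod s ^ k * cmod u \<le> S ^ 3 * \<rho>" using u S by (intro mult_mono) auto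
        also have "\<dots> = \<eta>" using S by (simp add: \<rho>_def)
        finally show ?thesis .
      qed
      show "cmod s ^ 2 * cmod u \<le> \<eta>" "cmod s ^ 3 * cmod u \<le> \<eta>" "cmod s * cmod u \<le> \<eta>" "cmod u \<le> \<eta>"
        using *[of 2] *[of 3] *[of 1] *[of 0] by auto
    qed
    have Ebound: "cmod (E u) \<le> B" if u: "cmod u \<le> \<rho>" for u
    proof -
      note sm = small[OF u]
      have u1: "cmod u \<le> 1" using sm \<eta> by linarith
      have v1u: "cmod (v 1 * u) \<le> b" unfolding norm_mult using mult_mono[OF v(2) u1 b] by simp
      have sq: "cmod ((1 - v 1 * u)\<^sup>2) \<le> (1 + b)\<^sup>2"
        unfolding norm_power using norm_triangle_ineq4[of 1 "v 1 * u"] v1u by (intro power_mono) auto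
      have gh: "cmod (eval_fps G (s * u) - 1/2) \<le> (16 * C / r ^ 3) * (cmod s * cmod u)"
        using G(5)[of "s * u"] sm \<eta> by (simp add: norm_mult)
      have 1: "cmod ((1 - v 1 * u)\<^sup>2 * (s\<^sup>2 * (eval_fps G (s * u) - 1/2))) \<le> (1 + b)\<^sup>2 * (16 * C / r ^ 3)"
      proof -
        have "cmod (s\<^sup>2 * (eval_fps G (s * u) - 1/2)) \<le> cmod s ^ 2 * ((16 * C / r ^ 3) * (cmod s * cmod u))"
          unfolding norm_mult norm_power by (intro mult_left_mono gh) auto
        also have "\<dots> = (16 * C / r ^ 3) * (cmod s ^ 3 * cmod u)" by (simp add: power2_eq_square power3_eq_cube)
        also have "\<dots> \<le> (16 * C / r ^ 3) * 1" using sm \<eta> C r by (intro mult_left_mono) auto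
        finally show ?thesis unfolding norm_mult[of "(1 - v 1 * u)\<^sup>2"] using sq by (intro mult_mono) auto
      qed
      have 2: "cmod (s\<^sup>2 / 2 * ((1 - v 1 * u)\<^sup>2 - 1)) \<le> 2 * b + b\<^sup>2"
      proof -
        have "s\<^sup>2 / 2 * ((1 - v 1 * u)\<^sup>2 - 1) = (s\<^sup>2 * u) * (v 1 * (v 1 * u - 2) / 2)"
          by (simp add: power2_eq_square algebra_simps)
        moreover have "cmod (s\<^sup>2 * u) \<le> 1" unfolding norm_mult norm_power using sm \<eta> by linarith
        moreover have "cmod (v 1 * (v 1 * u - 2) / 2) \<le> 2 * b + b\<^sup>2"
        proof -
          have "cmod (v 1 * u - 2) \<le> b + 2" using norm_triangle_ineq4[of "v 1 * u" 2] v1u by simp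
          then have "cmod (v 1) * cmod (v 1 * u - 2) \<le> b * (b + 2)" using v b by (intro mult_mono) auto
          moreover have "b * (b + 2) / 2 \<le> 2 * b + b\<^sup>2" using b by (simp add: power2_eq_square algebra_simps)
          ultimately show ?thesis by (simp add: norm_mult norm_divide)
        qed
        ultimately show ?thesis
          using mult_mono[of "cmod (s\<^sup>2 * u)" 1 "cmod (v 1 * (v 1 * u - 2) / 2)" "2 * b + b\<^sup>2"]
          by (simp only: norm_mult[of "s\<^sup>2 * u"] mult_1 zero_le_one norm_ge_zero simp_thms)
      qed
      have 3: "cmod (s * v 0 * u) \<le> b"
      proof -
        have "cmod (s * v 0 * u) = cmod (v 0) * (cmod s * cmod u)" by (simp add: norm_mult)
        also have "\<dots> \<le> b * 1" using v b sm \<eta> by (intro mult_mono) auto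
        finally show ?thesis by simp
      qed
      \<comment> \<open>Removing s^2 / 2 leaves G - 1/2, which supplies the third factor s together
        with a factor u, and the difference of the square from 1, which supplies a factor u.\<close>
      have "E u = (1 - v 1 * u)\<^sup>2 * (s\<^sup>2 * (eval_fps G (s * u) - 1/2)) + s\<^sup>2 / 2 * ((1 - v 1 * u)\<^sup>2 - 1) - s * v 0 * u"
        by (simp add: E_def algebra_simps)
      also have "cmod \<dots> \<le> B" unfolding B_def
        by (rule order_trans[OF norm_triangle_ineq4 add_mono[OF order_trans[OF norm_triangle_ineq add_mono[OF 1 2]] 3]])
      finally show ?thesis .
    qed
    have hol: "(\<lambda>w. exp (E w)) holomorphic_on cball 0 \<rho>"
    proof -
      have "(\<lambda>w. eval_fps G (s * w)) holomorphic_on cball 0 \<rho>"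
      proof (rule holomorphic_on_compose_gen[OF _ G(1), unfolded o_def])
        show "(*) s ` cball 0 \<rho> \<subseteq> ball 0 r"
        proof safe
          fix u :: complex assume "u \<in> cball 0 \<rho>"
          then have "cmod s * cmod u \<le> \<eta>" using small by simp
          then show "s * u \<in> ball 0 r" using \<eta> r by (simp add: norm_mult)
        qed
      qed (intro holomorphic_intros)
      then show ?thesis unfolding E_def by (intro holomorphic_intros)
    qed
    have "cmod (exp (E w) - (\<Sum>j\<le>R. (deriv ^^ j) (\<lambda>w. exp (E w)) 0 / fact j * complex_of_real w ^ j))
       \<le> 2 * exp B * (cmod (complex_of_real w) / \<rho>) ^ Suc R"
    proof (rule taylor_remainder_bound[OF hol \<rho>])
      show "cmod (exp (E u)) \<le> exp B" if "cmod u \<le> \<rho>" for u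
        using norm_exp[of "E u"] Ebound[OF that] by (meson exp_le_cancel_iff order_trans)
      \<comment> \<open>The hypothesis on \<open>w\<close> carries \<eta> / 2 for the sake of this
        half radius.\<close>
      show "cmod (complex_of_real w) \<le> \<rho> / 2"
        using w S unfolding \<rho>_def S_def[symmetric] by (simp add: field_simps)
    qed
    moreover have "(\<Sum>j\<le>R. (deriv ^^ j) (\<lambda>w. exp (E w)) 0 / fact j * complex_of_real w ^ j) = (\<Sum>j\<le>R. poly (exp_coeff v j) s * of_real w ^ j)"
      by (intro sum.cong refl) (simp add: exp_coeff_taylor[OF FE])
    moreover have "E (of_real w) = (1 - v 1 * of_real w)\<^sup>2 * (g (s * of_real w) / (of_real w)\<^sup>2) - s * v 0 * of_real w - s\<^sup>2 / 2"
    proof -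
      have "0 < w * S ^ 3" using w(1) S by simp
      moreover have "w * S ^ 3 \<le> \<eta> / 2" using w(2) by (simp add: S_def)
      ultimately have "w * S ^ 3 \<le> \<eta>" by linarith
      then have "cmod (complex_of_real w) \<le> \<rho>"
        using w(1) S unfolding \<rho>_def by (simp add: field_simps)
      from small(3)[OF this] have "cmod (s * w) < r" using \<eta> r by (simp add: norm_mult)
      from G(3)[OF this] have "g (s * of_real w) / (of_real w)\<^sup>2 = s\<^sup>2 * eval_fps G (s * of_real w)"
        using w by (simp add: power_mult_distrib)
      then show ?thesis by (simp add: E_def)
    qed
    moreover have "2 * exp B * (cmod (complex_of_real w) / \<rho>) ^ Suc R = 2 * exp B / \<eta> ^ Suc R * (w * (1 + cmod s) ^ 3) ^ Suc R"
    proof -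
      have "cmod (complex_of_real w) / \<rho> = w * S ^ 3 / \<eta>" using w S by (simp add: \<rho>_def)
      then show ?thesis unfolding S_def[symmetric] by (simp add: power_divide)
    qed
    ultimately show "cmod (exp ((1 - v 1 * of_real w)\<^sup>2 * (g (s * of_real w) / (of_real w)\<^sup>2) - s * v 0 * of_real w - s\<^sup>2 / 2)
        - (\<Sum>j\<le>R. poly (exp_coeff v j) s * of_real w ^ j)) \<le> 2 * exp B / \<eta> ^ Suc R * (w * (1 + cmod s) ^ 3) ^ Suc R"
      by simp
  qed (use \<eta> in auto)
qed

section \<open>Logarithms of moment generating functions\<close>

lemma eventually_bounded_imp_bounded:
  fixes x :: "nat \<Rightarrow> real"
  assumes "\<forall>\<^sub>F n in sequentially. x n \<le> K"
  shows "\<exists>K. \<forall>n. x n \<le> K"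
proof -
  from assms obtain n0 where n0: "\<And>n. n0 \<le> n \<Longrightarrow> x n \<le> K" by (auto simp: eventually_sequentially)
  have "x n \<le> max K (Max (x ` {..n0}))" for n
  proof (cases "n0 \<le> n")
    case False
    then have "x n \<le> Max (x ` {..n0})" by (intro Max_ge) auto
    then show ?thesis by (rule max.coboundedI2)
  qed (use n0 in \<open>auto intro: max.coboundedI1\<close>)
  then show ?thesis by blast
qed

text \<open>Near 0 the imaginary part of \<open>G\<close> stays below pi, so there the principal
  logarithm of \<open>f\<close> is \<open>G\<close> itself. Away from 0 the two may differ, but
  derivatives at 0 do not see that.\<close>

lemma higher_deriv_log_eq:
  fixes f G :: "complex \<Rightarrow> complex"
  assumes "G holomorphic_on ball 0 r" "0 < r" "G 0 = 0" "\<And>z. z \<in> ball 0 r \<Longrightarrow> exp (G z) = f z"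
  shows "(deriv ^^ k) (\<lambda>z. Ln (f z)) 0 = (deriv ^^ k) G 0"
proof (rule higher_deriv_cong_ev[OF _ refl])
  have "isCont G 0"
    using holomorphic_on_imp_continuous_on[OF assms(1)] assms(2)
    by (simp add: continuous_on_eq_continuous_at)
  then have "\<forall>\<^sub>F z in nhds 0. dist (G z) (G 0) < pi"
    using pi_gt_zero by (intro tendstoD) (simp_all add: isCont_def tendsto_at_iff_tendsto_nhds)
  moreover have "\<forall>\<^sub>F z in nhds 0. z \<in> ball (0::complex) r"
    by (rule eventually_nhds_in_open) (use assms(2) in auto)
  ultimately show "\<forall>\<^sub>F z in nhds 0. Ln (f z) = G z"
  proof eventually_elim
    case (elim z)
    then have "\<bar>Im (G z)\<bar> < pi" using assms(3) abs_Im_le_cmod[of "G z"] by simp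
    then have "Ln (exp (G z)) = G z" by (intro Ln_exp) auto
    then show ?case using assms(4)[of z] elim by simp
  qed
qed

definition mgf :: "'a measure \<Rightarrow> ('a \<Rightarrow> real) \<Rightarrow> complex \<Rightarrow> complex" where
  "mgf M X z = (LINT x|M. exp (z * complex_of_real (X x)))"

text \<open>The principal branch is harmless: only the germ at 0 matters, where the generating
  function is close to 1.\<close>

definition cumulant :: "'a measure \<Rightarrow> ('a \<Rightarrow> real) \<Rightarrow> nat \<Rightarrow> complex" where
  "cumulant M X k = (deriv ^^ k) (\<lambda>z. Ln (mgf M X z)) 0"

text \<open>The bound may depend on the variable. It makes \<open>mgf\<close> entire and all moments
  finite; uniformity along a sequence comes from other sources.\<close>

locale bounded_rv = prob_space M for M :: "'a measure" +
  fixes X :: "'a \<Rightarrow> real"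
  assumes X_measurable[measurable]: "X \<in> borel_measurable M"
    and X_bounded: "\<exists>b. \<forall>x\<in>space M. \<bar>X x\<bar> \<le> b"
begin

lemma integrable_exp_abs: "0 \<le> c \<Longrightarrow> integrable M (\<lambda>x. cmod (1::complex) * exp (c * \<bar>X x\<bar>))"
proof -
  assume c: "0 \<le> c"
  obtain b where "\<forall>x\<in>space M. \<bar>X x\<bar> \<le> b" using X_bounded by blast
  then show ?thesis
    by (intro integrable_const_bound[of _ "exp (c * b)"]) (use c in \<open>auto intro!: mult_left_mono\<close>)
qed

lemma integrable_power_X: "integrable M (\<lambda>x. X x ^ k)"
proof -
  obtain b where "\<forall>x\<in>space M. \<bar>X x\<bar> \<le> b" using X_bounded by blast
  then show ?thesis
    by (intro integrable_const_bound[of _ "b ^ k"]) (auto simp: power_abs intro!: power_mono)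
qed

lemma higher_deriv_mgf:
  "(deriv ^^ k) (mgf M X) z = (LINT x|M. complex_of_real (X x) ^ k * exp (z * complex_of_real (X x)))"
proof -
  have "(deriv ^^ k) (\<lambda>z. LINT x|M. 1 * exp (z * complex_of_real (X x)))
     = (\<lambda>z. LINT x|M. 1 * complex_of_real (X x) ^ k * exp (z * complex_of_real (X x)))"
    by (rule exp_integral_higher_deriv[OF _ _ integrable_exp_abs]) simp_all
  then show ?thesis by (simp add: mgf_def[abs_def])
qed

lemma mgf_holomorphic: "mgf M X holomorphic_on A"
proof -
  have "((\<lambda>z. LINT x|M. 1 * exp (z * complex_of_real (X x))) has_field_derivative
      (LINT x|M. 1 * complex_of_real (X x) * exp (z * complex_of_real (X x)))) (at z)" for z
    by (rule exp_integral_has_field_derivative[OF _ _ integrable_exp_abs]) simp_all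
  then have "(mgf M X has_field_derivative (LINT x|M. 1 * complex_of_real (X x) * exp (z * complex_of_real (X x)))) (at z)" for z
    by (simp add: mgf_def[abs_def])
  then show ?thesis unfolding holomorphic_on_def field_differentiable_def
    by (meson DERIV_subset subset_UNIV)
qed

lemma mgf_0: "mgf M X 0 = 1"
  by (simp add: mgf_def prob_space)

lemma mgf_of_real: "mgf M X (of_real t) = of_real (LINT x|M. exp (t * X x))"
  unfolding mgf_def by (simp only: of_real_mult[symmetric] exp_of_real integral_complex_of_real)

lemma exp_moment_pos: "0 < (LINT x|M. exp (t * X x))"
proof -
  obtain b where b: "\<forall>x\<in>space M. \<bar>X x\<bar> \<le> b" using X_bounded by blast
  have "integrable M (\<lambda>x. exp (t * X x))"
  proof (rule integrable_const_bound[of _ "exp (\<bar>t\<bar> * b)"])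
    have "t * X x \<le> \<bar>t\<bar> * b" if "x \<in> space M" for x
      using mult_left_mono[of "\<bar>X x\<bar>" b "\<bar>t\<bar>"] that b abs_ge_self[of "t * X x"] by (simp add: abs_mult)
    then show "AE x in M. norm (exp (t * X x)) \<le> exp (\<bar>t\<bar> * b)" by simp
  qed simp
  moreover have "exp (- (\<bar>t\<bar> * b)) \<le> exp (t * X x)" if "x \<in> space M" for x
    using mult_left_mono[of "\<bar>X x\<bar>" b "\<bar>t\<bar>"] that b abs_ge_minus_self[of "t * X x"] by (simp add: abs_mult)
  ultimately have "(LINT x|M. exp (- (\<bar>t\<bar> * b))) \<le> (LINT x|M. exp (t * X x))"
    by (intro integral_mono) auto
  moreover have "(LINT x|M. exp (- (\<bar>t\<bar> * b))) = exp (- (\<bar>t\<bar> * b))" by (simp add: prob_space)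
  ultimately show ?thesis by (metis exp_gt_zero less_le_trans)
qed

lemma local_log_mgf:
  "\<exists>r>0. (\<lambda>z. Ln (mgf M X z)) holomorphic_on ball 0 r \<and> (\<forall>z\<in>ball 0 r. mgf M X z \<noteq> 0) \<and> 
    (\<forall>z\<in>ball 0 r. mgf M X z \<notin> \<real>\<^sub>\<le>\<^sub>0)"
proof -
  have "open {z. 0 < Re (mgf M X z)}"
    by (intro open_Collect_less continuous_intros holomorphic_on_imp_continuous_on[OF mgf_holomorphic])
  moreover have "0 \<in> {z. 0 < Re (mgf M X z)}" by (simp add: mgf_0)
  ultimately obtain r where r: "0 < r" "ball 0 r \<subseteq> {z. 0 < Re (mgf M X z)}"
    by (meson open_contains_ball)
  have n: "mgf M X z \<notin> \<real>\<^sub>\<le>\<^sub>0" if "z \<in> ball 0 r" for z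
    using r that by (auto simp: complex_nonpos_Reals_iff)
  show ?thesis
    using r n by (intro exI[of _ r] conjI holomorphic_on_Ln' mgf_holomorphic) auto
qed

text \<open>On the real axis the generating function is positive, so its principal logarithm is real
  there.\<close>

lemma cumulant_in_Reals: "cumulant M X k \<in> \<real>"
proof -
  obtain r where r: "0 < r" "(\<lambda>z. Ln (mgf M X z)) holomorphic_on ball 0 r" using local_log_mgf by blast
  have "Ln (mgf M X (of_real t)) \<in> \<real>" for t
    unfolding mgf_of_real by (subst Ln_of_real) (use exp_moment_pos in auto)
  from Reals_higher_deriv[OF r(2) this, of 0] show ?thesis using r(1) by (simp add: cumulant_def)
qed

lemma cumulant_low:
  assumes "expectation X = 0"
  shows "cumulant M X 0 = 0" "cumulant M X 1 = 0" "cumulant M X 2 = of_real (LINT x|M. (X x)\<^sup>2)"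
proof -
  obtain r where r: "0 < r" "(\<lambda>z. Ln (mgf M X z)) holomorphic_on ball 0 r"
    "\<And>z. z \<in> ball 0 r \<Longrightarrow> mgf M X z \<noteq> 0" "\<And>z. z \<in> ball 0 r \<Longrightarrow> mgf M X z \<notin> \<real>\<^sub>\<le>\<^sub>0"
    using local_log_mgf by blast
  let ?m = "mgf M X"
  have dm: "(?m has_field_derivative deriv ?m z) (at z)" for z
    by (rule holomorphic_derivI[OF mgf_holomorphic[of UNIV]]) auto
  have dm1: "(deriv ?m has_field_derivative deriv (deriv ?m) z) (at z)" for z
    by (rule holomorphic_derivI[OF holomorphic_deriv[OF mgf_holomorphic[of UNIV]]]) auto
  have m1: "deriv ?m 0 = 0"
    using higher_deriv_mgf[of 1 0] assms by simp
  have m2: "deriv (deriv ?m) 0 = of_real (LINT x|M. (X x)\<^sup>2)"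
    using higher_deriv_mgf[of 2 0] by (simp add: numeral_2_eq_2 integral_complex_of_real[symmetric] del: integral_complex_of_real)
  have d1: "((\<lambda>z. Ln (?m z)) has_field_derivative deriv ?m z / ?m z) (at z)" if "z \<in> ball 0 r" for z
    using DERIV_chain2[OF has_field_derivative_Ln[OF r(4)[OF that]] dm] by (simp add: divide_inverse mult.commute)
  have e1: "deriv (\<lambda>z. Ln (?m z)) z = deriv ?m z / ?m z" if "z \<in> ball 0 r" for z
    using d1[OF that] by (rule DERIV_imp_deriv)
  show "cumulant M X 0 = 0" by (simp add: cumulant_def mgf_0)
  show "cumulant M X 1 = 0" using e1[of 0] r by (simp add: cumulant_def m1)
  have "deriv (deriv (\<lambda>z. Ln (?m z))) 0 = deriv (\<lambda>z. deriv ?m z / ?m z) 0"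
  proof (rule deriv_cong_ev[OF _ refl])
    show "\<forall>\<^sub>F z in nhds 0. deriv (\<lambda>z. Ln (?m z)) z = deriv ?m z / ?m z"
      by (rule eventually_mono[OF eventually_nhds_in_open[of "ball 0 r" 0]]) (use r(1) e1 in auto)
  qed
  also have "\<dots> = deriv (deriv ?m) 0"
    by (rule DERIV_imp_deriv) (rule DERIV_cong[OF DERIV_divide[OF dm1 dm]], use mgf_0 m1 in auto)
  finally show "cumulant M X 2 = of_real (LINT x|M. (X x)\<^sup>2)"
    by (simp add: cumulant_def m2 numeral_2_eq_2)
qed

end

text \<open>What the expansions take from the dynamics, with no dynamics left. After division by the
  variance the logarithms are bounded by \<open>C0\<close> on one ball for all large n, so Cauchy's
  inequalities control each normalised cumulant uniformly in n. The decay is requested for every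
  pair of powers \<open>p\<close> and \<open>k\<close>, and this gives expansions of every
  order.\<close>

locale edgeworth_sequence = prob_space M for M :: "'a measure" +
  fixes S :: "nat \<Rightarrow> 'a \<Rightarrow> real" and s :: "nat \<Rightarrow> real" and r0 C0 :: real
  assumes S_measurable[measurable]: "\<And>n. S n \<in> borel_measurable M"
    and S_bounded: "\<And>n. \<exists>b. \<forall>x\<in>space M. \<bar>S n x\<bar> \<le> b"
    and S_mean: "\<And>n. expectation (S n) = 0"
    and s_eq: "s = l2_norm_seq M S"
    and s_top: "filterlim s at_top sequentially"
    and r0: "0 < r0" and C0: "0 \<le> C0"
    and log_mgf: "\<forall>\<^sub>F n in sequentially. \<exists>G. G holomorphic_on ball 0 r0 \<and> G 0 = 0 \<and>
       (\<forall>z\<in>ball 0 r0. exp (G z) = mgf M (S n) z \<and> cmod (G z) \<le> C0 * (s n)\<^sup>2)"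
    and decay: "\<And>a p k. 0 < a \<Longrightarrow> \<exists>K. \<forall>\<^sub>F n in sequentially. \<forall>u. a \<le> \<bar>u\<bar> \<and> \<bar>u\<bar> \<le> s n ^ p \<longrightarrow>
       cmod (mgf M (S n) (\<i> * complex_of_real u)) \<le> K / s n ^ k"
begin

lemma rv: "bounded_rv M (S n)"
  by unfold_locales (rule S_measurable S_bounded)+

lemma s_sq: "(s n)\<^sup>2 = (LINT x|M. (S n x)\<^sup>2)"
  unfolding s_eq l2_norm_seq_def by (simp add: integral_nonneg_AE)

lemma eventually_s_ge: "\<forall>\<^sub>F n in sequentially. c \<le> s n"
  using s_top by (simp add: filterlim_at_top)

lemma normalized_char_eq: "normalized_char M S n t = mgf M (S n) (\<i> / of_real (s n) * of_real t)"
proof -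
  have "normalized_char M S n t = (LINT x|M. iexp (t * (S n x / s n)))"
    unfolding normalized_char_def char_def s_eq by (subst integral_distr) auto
  then show ?thesis by (simp add: mgf_def mult_ac divide_inverse)
qed

text \<open>By the chain rule with c = i / s the k-th derivative is c^k times the cumulant; the
  added quadratic term is killed by three derivatives, and the factor s^(k - 2) leaves
  s^(-2).\<close>

lemma edgeworth_vars_cumulant:
  assumes "3 \<le> k"
  shows "(- \<i>) ^ k * edgeworth_vars M S A B n k = cumulant M (S n) k / of_real ((s n)\<^sup>2)"
proof -
  interpret X: bounded_rv M "S n" by (rule rv)
  obtain r where r: "0 < r" "(\<lambda>z. Ln (mgf M (S n) z)) holomorphic_on ball 0 r" using X.local_log_mgf by blast
  define c where "c = \<i> / complex_of_real (s n)"
  \<comment> \<open>The added 1 covers the case \<open>c = 0\<close>.\<close>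
  define r' where "r' = r / (cmod c + 1)"
  have r': "0 < r'" using r by (simp add: r'_def add_nonneg_pos)
  have cz: "c * z \<in> ball 0 r" if "z \<in> ball 0 r'" for z
  proof -
    have "cmod c * cmod z \<le> cmod c * r'" using that by (intro mult_left_mono) auto
    also have "\<dots> < r"
    proof -
      have "0 < cmod c + 1" by (simp add: add_nonneg_pos)
      then have "cmod c * r < r * (cmod c + 1)" "0 < cmod c + 1" using r by (simp_all add: algebra_simps)
      then show ?thesis by (simp add: r'_def pos_divide_less_eq)
    qed
    finally show ?thesis by (simp add: norm_mult)
  qed
  have h1: "(\<lambda>z. Ln (mgf M (S n) (c * z))) holomorphic_on ball 0 r'"
  proof (rule holomorphic_on_compose_gen[OF _ r(2), unfolded o_def])
    show "(*) c ` ball 0 r' \<subseteq> ball 0 r" using cz by blast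
  qed (intro holomorphic_intros)
  have h2: "(\<lambda>z::complex. z\<^sup>2 / 2) holomorphic_on ball 0 r'" by (intro holomorphic_intros) auto
  have "nth_vector_derivative k (log_char_defect M S n) 0
     = (deriv ^^ k) (\<lambda>z. Ln (mgf M (S n) (c * z)) + z\<^sup>2 / 2) (complex_of_real 0)"
  proof (rule nth_vector_derivative_of_holomorphic[where T="ball 0 r'"])
    show "(\<lambda>z. Ln (mgf M (S n) (c * z)) + z\<^sup>2 / 2) holomorphic_on ball 0 r'"
      by (intro holomorphic_on_add h1 h2)
  qed (use r' in \<open>auto simp: log_char_defect_def normalized_char_eq c_def\<close>)
  also have "\<dots> = (deriv ^^ k) (\<lambda>z. Ln (mgf M (S n) (c * z))) 0 + (deriv ^^ k) (\<lambda>z. z\<^sup>2 / 2) 0"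
    using higher_deriv_add[OF h1 h2] r' by simp
  also have "(deriv ^^ k) (\<lambda>z. Ln (mgf M (S n) (c * z))) 0 = c ^ k * cumulant M (S n) k"
  proof -
    have "(deriv ^^ k) (\<lambda>z. Ln (mgf M (S n) (c * z))) 0 = c ^ k * (deriv ^^ k) (\<lambda>z. Ln (mgf M (S n) z)) (c * 0)"
      by (rule higher_deriv_compose_linear[OF r(2) open_ball[of 0 r'] open_ball]) (use r' cz in \<open>simp_all del: mem_ball\<close>)
    then show ?thesis by (simp add: cumulant_def)
  qed
  also have "(deriv ^^ k) (\<lambda>z::complex. z\<^sup>2 / 2) 0 = 0"
  proof -
    have "(deriv ^^ 3) (\<lambda>z::complex. z\<^sup>2 / 2) = (\<lambda>z. 0)"
    proof -
      have "deriv (\<lambda>z::complex. z\<^sup>2 / 2) = (\<lambda>z. z)"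
        by (rule ext, rule DERIV_imp_deriv) (auto intro!: derivative_eq_intros)
      then show ?thesis by (simp add: numeral_3_eq_3)
    qed
    moreover have "(deriv ^^ j) (\<lambda>z::complex. 0) = (\<lambda>z. 0)" for j by (induction j) auto
    ultimately have "(deriv ^^ (k - 3 + 3)) (\<lambda>z::complex. z\<^sup>2 / 2) = (\<lambda>z. 0)"
      by (simp only: funpow_add o_def)
    then show ?thesis using assms by simp
  qed
  finally have nv: "nth_vector_derivative k (log_char_defect M S n) 0 = c ^ k * cumulant M (S n) k" by simp
  have "(- \<i>) ^ k * (c ^ k * of_real (s n ^ (k - 2))) = 1 / of_real ((s n)\<^sup>2)"
  proof (cases "s n = 0")
    \<comment> \<open>Both sides are 0 by the convention for division by zero.\<close>
    case True then show ?thesis using assms by (simp add: c_def)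
  next
    case False
    have "k = (k - 2) + 2" using assms by simp
    then have "complex_of_real (s n) ^ k = of_real (s n) ^ (k - 2) * of_real (s n) ^ 2"
      by (metis power_add)
    moreover have "(- \<i>) ^ k * \<i> ^ k = 1" by (simp add: power_mult_distrib[symmetric])
    ultimately show ?thesis using False by (simp add: c_def power_divide)
  qed
  then have "(- \<i>) ^ k * (c ^ k * cumulant M (S n) k * of_real (s n ^ (k - 2))) = cumulant M (S n) k * (1 / of_real ((s n)\<^sup>2))"
    by (metis (no_types, opaque_lifting) mult.assoc mult.commute)
  then show ?thesis
    using assms by (simp add: edgeworth_vars_def nv s_eq[symmetric])
qed

lemma cumulant_var_eq:
  assumes "2 \<le> k" "s n \<noteq> 0"
  shows "cumulant_var (edgeworth_vars M S A B n) k = cumulant M (S n) k / of_real ((s n)\<^sup>2)"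
proof (cases "k = 2")
  case True
  interpret X: bounded_rv M "S n" by (rule rv)
  show ?thesis unfolding True X.cumulant_low(3)[OF S_mean] s_sq[symmetric] using assms by (simp add: cumulant_var_def)
next
  case False
  then show ?thesis using edgeworth_vars_cumulant[of k A B n] assms by (simp add: cumulant_var_def)
qed

lemma edgeworth_vars_real:
  "edgeworth_vars M S A B n 0 \<in> \<real>" "edgeworth_vars M S A B n 1 \<in> \<real>"
  "3 \<le> k \<Longrightarrow> (- \<i>) ^ k * edgeworth_vars M S A B n k \<in> \<real>"
proof -
  interpret X: bounded_rv M "S n" by (rule rv)
  show "edgeworth_vars M S A B n 0 \<in> \<real>" "edgeworth_vars M S A B n 1 \<in> \<real>"
    by (simp_all add: edgeworth_vars_def)
  show "3 \<le> k \<Longrightarrow> (- \<i>) ^ k * edgeworth_vars M S A B n k \<in> \<real>"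
    using X.cumulant_in_Reals[of k] by (simp add: edgeworth_vars_cumulant Reals_divide)
qed

text \<open>Division of the logarithm by s^2 gives functions with a double zero and second
  derivative 1 at 0, all bounded by one constant on one ball. The estimates near frequency 0 see the
  sequence only through this \<open>g\<close> and the factor s^2.\<close>

lemma scaled_log:
  "\<forall>\<^sub>F n in sequentially. 1 \<le> s n \<and> (\<exists>g. g holomorphic_on ball 0 r0 \<and> g 0 = 0 \<and> deriv g 0 = 0 \<and>
     (\<forall>k\<ge>2. (deriv ^^ k) g 0 = cumulant M (S n) k / of_real ((s n)\<^sup>2)) \<and> (deriv ^^ 2) g 0 = 1 \<and>
     (\<forall>z. cmod z < r0 \<longrightarrow> exp (of_real ((s n)\<^sup>2) * g z) = mgf M (S n) z \<and> cmod (g z) \<le> C0))"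
  using log_mgf eventually_s_ge[of 1]
proof eventually_elim
  case (elim n)
  interpret X: bounded_rv M "S n" by (rule rv)
  from elim obtain G where G: "G holomorphic_on ball 0 r0" "G 0 = 0"
     "\<And>z. z \<in> ball 0 r0 \<Longrightarrow> exp (G z) = mgf M (S n) z" "\<And>z. z \<in> ball 0 r0 \<Longrightarrow> cmod (G z) \<le> C0 * (s n)\<^sup>2"
    by blast
  have c: "(deriv ^^ k) G 0 = cumulant M (S n) k" for k
    unfolding cumulant_def by (rule higher_deriv_log_eq[symmetric, OF G(1) r0 G(2,3)])
  define g where "g z = inverse (of_real ((s n)\<^sup>2)) * G z" for z
  have s0: "s n \<noteq> 0" using elim by auto
  have dg: "(deriv ^^ k) g 0 = inverse (of_real ((s n)\<^sup>2)) * (deriv ^^ k) G 0" for k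
  proof -
    have "G analytic_on {0}" using G(1) r0 by (meson analytic_at centre_in_ball open_ball)
    then show ?thesis unfolding g_def[abs_def] by (rule higher_deriv_cmult')
  qed
  show ?case
  proof (intro conjI exI[of _ g] allI impI)
    show "g holomorphic_on ball 0 r0" unfolding g_def by (intro holomorphic_intros G)
    show "g 0 = 0" by (simp add: g_def G)
    show "deriv g 0 = 0" using dg[of 1] c[of 1] X.cumulant_low(2)[OF S_mean] by simp
    show "(deriv ^^ k) g 0 = cumulant M (S n) k / of_real ((s n)\<^sup>2)" for k
      by (simp add: dg c divide_inverse mult.commute)
    show "(deriv ^^ 2) g 0 = 1"
      unfolding dg c X.cumulant_low(3)[OF S_mean] s_sq[symmetric] using s0 by simp
    fix z assume z: "cmod z < r0"
    show "exp (of_real ((s n)\<^sup>2) * g z) = mgf M (S n) z"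
    proof -
      have "of_real ((s n)\<^sup>2) * g z = G z" using s0 by (simp add: g_def)
      then show ?thesis using G(3)[of z] z by simp
    qed
    have "cmod (g z) = cmod (G z) / (s n)\<^sup>2" by (simp add: g_def norm_mult norm_inverse divide_inverse norm_power)
    also have "\<dots> \<le> C0" using G(4)[of z] z s0 by (simp add: divide_le_eq)
    finally show "cmod (g z) \<le> C0" .
  qed (use elim in auto)
qed

end

section \<open>Derivatives of characteristic functions\<close>

lemma power_over_fact_le_exp: "0 \<le> y \<Longrightarrow> y ^ k / fact k \<le> exp y" for y :: real
proof -
  assume y: "0 \<le> y"
  have sm: "(\<lambda>n. y ^ n /\<^sub>R fact n) sums exp y" by (rule exp_converges)
  have "(\<Sum>n\<in>{k}. y ^ n /\<^sub>R fact n) \<le> (\<Sum>n. y ^ n /\<^sub>R fact n)"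
  proof (rule sum_le_suminf[OF sums_summable[OF sm]])
    show "0 \<le> y ^ n /\<^sub>R fact n" for n using y by simp
  qed simp
  then show ?thesis unfolding sums_unique[OF sm, symmetric] by (simp add: divide_inverse mult.commute)
qed

lemma nth_vector_derivative_normalized_char:
  assumes "bounded_rv M (S n)"
  shows "nth_vector_derivative m (normalized_char M S n) t
    = (LINT x|M. (\<i> * complex_of_real (S n x / l2_norm_seq M S n)) ^ m * iexp (t * (S n x / l2_norm_seq M S n)))"
proof -
  interpret X: bounded_rv M "S n" by fact
  define c where "c = \<i> / complex_of_real (l2_norm_seq M S n)"
  have nc: "normalized_char M S n t = mgf M (S n) (c * of_real t)" for t
  proof -
    have "normalized_char M S n t = (LINT x|M. iexp (t * (S n x / l2_norm_seq M S n)))"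
      unfolding normalized_char_def char_def by (subst integral_distr) auto
    then show ?thesis by (simp add: mgf_def c_def mult_ac divide_inverse)
  qed
  have hol: "(\<lambda>z. mgf M (S n) (c * z)) holomorphic_on UNIV"
    by (rule holomorphic_on_compose_gen[OF _ X.mgf_holomorphic[of UNIV], unfolded o_def]) (auto intro!: holomorphic_intros)
  have "nth_vector_derivative m (normalized_char M S n) t = (deriv ^^ m) (\<lambda>z. mgf M (S n) (c * z)) (of_real t)"
    by (rule nth_vector_derivative_of_holomorphic[OF hol open_UNIV open_UNIV]) (auto simp: nc)
  also have "\<dots> = c ^ m * (deriv ^^ m) (mgf M (S n)) (c * of_real t)"
    by (rule higher_deriv_compose_linear[OF X.mgf_holomorphic[of UNIV] open_UNIV open_UNIV]) auto
  also have "\<dots> = (LINT x|M. c ^ m * (complex_of_real (S n x) ^ m * exp (c * of_real t * complex_of_real (S n x))))"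
    unfolding X.higher_deriv_mgf by simp
  also have "\<dots> = (LINT x|M. (\<i> * complex_of_real (S n x / l2_norm_seq M S n)) ^ m * iexp (t * (S n x / l2_norm_seq M S n)))"
    by (intro Bochner_Integration.integral_cong refl) (simp add: c_def power_divide power_mult_distrib mult_ac divide_inverse)
  finally show ?thesis .
qed

context edgeworth_sequence
begin

text \<open>Because g has a double zero, s^2 g(t) stays bounded at t = 1 / s and t = - 1 / s. Hence
  the exponential moments of S n / s n are bounded, and they dominate every absolute moment.\<close>

lemma moments_bounded: "\<exists>K. \<forall>\<^sub>F n in sequentially. expectation (\<lambda>x. \<bar>S n x / s n\<bar> ^ k) \<le> K"
proof (intro exI)
  let ?K = "exp (8 * C0 / r0\<^sup>2)"
  show "\<forall>\<^sub>F n in sequentially. expectation (\<lambda>x. \<bar>S n x / s n\<bar> ^ k) \<le> fact k * (2 * ?K)"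
    \<comment> \<open>From \<open>4 / r0\<close> on, the point 1 / s n lies within half the radius
      of the disc of radius r0 / 2 used for the Taylor estimate.\<close>
    using scaled_log eventually_s_ge[of "4 / r0"]
  proof eventually_elim
    case (elim n)
    interpret X: bounded_rv M "S n" by (rule rv)
    from elim obtain g where g: "g holomorphic_on ball 0 r0" "g 0 = 0" "deriv g 0 = 0"
      "\<And>z. cmod z < r0 \<Longrightarrow> exp (of_real ((s n)\<^sup>2) * g z) = mgf M (S n) z" "\<And>z. cmod z < r0 \<Longrightarrow> cmod (g z) \<le> C0"
      by blast
    have s: "1 \<le> s n" "4 / r0 \<le> s n" using elim by auto
    have hc: "g holomorphic_on cball 0 (r0/2)" by (rule holomorphic_on_subset[OF g(1)]) (use r0 in auto)
    have E: "expectation (\<lambda>x. exp (t * S n x)) \<le> ?K" if t: "\<bar>t\<bar> = 1 / s n" for t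
    proof -
      have "1 / s n \<le> r0 / 4" using s r0 by (simp add: field_simps)
      then have ct: "cmod (complex_of_real t) \<le> r0 / 4" using t by simp
      have "cmod (g (of_real t) - (\<Sum>j\<le>1. (deriv ^^ j) g 0 / fact j * of_real t ^ j)) \<le> 2 * C0 * (cmod (complex_of_real t) / (r0/2)) ^ Suc 1"
        by (rule taylor_remainder_bound[OF hc]) (use ct r0 g(5) in auto)
      then have gt: "cmod (g (of_real t)) \<le> 2 * C0 * (\<bar>t\<bar> / (r0/2))\<^sup>2" using g by (simp add: power2_eq_square)
      have "of_real (expectation (\<lambda>x. exp (t * S n x))) = exp (of_real ((s n)\<^sup>2) * g (of_real t))"
        using g(4)[of "of_real t"] ct r0 X.mgf_of_real[of t] by simp
      then have "\<bar>expectation (\<lambda>x. exp (t * S n x))\<bar> = cmod (exp (of_real ((s n)\<^sup>2) * g (of_real t)))"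
        by (metis norm_of_real)
      also have "\<dots> \<le> exp (cmod (of_real ((s n)\<^sup>2) * g (of_real t)))" by (rule norm_exp)
      also have "cmod (of_real ((s n)\<^sup>2) * g (of_real t)) = (s n)\<^sup>2 * cmod (g (of_real t))"
        by (simp add: norm_mult norm_power)
      also have "(s n)\<^sup>2 * cmod (g (of_real t)) \<le> (s n)\<^sup>2 * (2 * C0 * (\<bar>t\<bar> / (r0/2))\<^sup>2)"
        by (intro mult_left_mono gt) simp
      also have "\<dots> = 8 * C0 / r0\<^sup>2" unfolding t using s r0 by (simp add: power2_eq_square field_simps)
      finally show ?thesis by simp
    qed
    have int: "integrable M (\<lambda>x. exp (t * S n x))" for t
    proof (rule Bochner_Integration.integrable_bound)
      show "integrable M (\<lambda>x. cmod (1::complex) * exp (\<bar>t\<bar> * \<bar>S n x\<bar>))" by (rule X.integrable_exp_abs) simp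
      show "AE x in M. norm (exp (t * S n x)) \<le> norm (cmod (1::complex) * exp (\<bar>t\<bar> * \<bar>S n x\<bar>))"
        by (auto intro!: AE_I2 simp: abs_mult[symmetric])
    qed auto
    have "expectation (\<lambda>x. \<bar>S n x / s n\<bar> ^ k) \<le> expectation (\<lambda>x. fact k * (exp (1 / s n * S n x) + exp (- (1 / s n) * S n x)))"
    proof (rule integral_mono)
      show "integrable M (\<lambda>x. \<bar>S n x / s n\<bar> ^ k)"
        using integrable_abs[OF X.integrable_power_X[of k]] by (simp add: power_abs power_divide abs_divide)
      show "integrable M (\<lambda>x. fact k * (exp (1 / s n * S n x) + exp (- (1 / s n) * S n x)))"
        by (intro integrable_mult_right Bochner_Integration.integrable_add int)
      fix x
      have "\<bar>S n x / s n\<bar> ^ k / fact k \<le> exp \<bar>S n x / s n\<bar>" by (rule power_over_fact_le_exp) simp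
      also have "\<dots> \<le> exp (1 / s n * S n x) + exp (- (1 / s n) * S n x)"
        by (cases "0 \<le> S n x / s n") (auto simp: abs_if)
      finally show "\<bar>S n x / s n\<bar> ^ k \<le> fact k * (exp (1 / s n * S n x) + exp (- (1 / s n) * S n x))"
        by (simp only: pos_divide_le_eq[OF fact_gt_zero] mult.commute)
    qed
    also have "\<dots> = fact k * (expectation (\<lambda>x. exp (1 / s n * S n x)) + expectation (\<lambda>x. exp (- (1 / s n) * S n x)))"
      by (simp only: integral_mult_right_zero Bochner_Integration.integral_add[OF int int])
    also have "\<dots> \<le> fact k * (?K + ?K)"
      using s by (intro mult_left_mono add_mono E) auto
    finally show ?case by simp
  qed
qed

text \<open>Re g(i u) is - u^2 / 2 up to a cubic error, and for small u half of the main term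
  survives.\<close>

lemma mgf_gauss_bound:
  "\<exists>a>0. \<forall>\<^sub>F n in sequentially. \<forall>u. \<bar>u\<bar> \<le> a \<longrightarrow> cmod (mgf M (S n) (\<i> * complex_of_real u)) \<le> exp (- (s n * u)\<^sup>2 / 4)"
proof (intro exI conjI)
  \<comment> \<open>The first bound is for the Taylor estimate, the second makes the cubic error at
    most u^2 / 4; the 1 added to \<open>C0\<close> avoids a zero denominator.\<close>
  define a where "a = min (r0 / 4) (r0 ^ 3 / (64 * (C0 + 1)))"
  show "0 < a" using r0 C0 by (simp add: a_def)
  show "\<forall>\<^sub>F n in sequentially. \<forall>u. \<bar>u\<bar> \<le> a \<longrightarrow> cmod (mgf M (S n) (\<i> * complex_of_real u)) \<le> exp (- (s n * u)\<^sup>2 / 4)"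
    using scaled_log
  proof eventually_elim
    case (elim n)
    from elim obtain g where g: "g holomorphic_on ball 0 r0" "g 0 = 0" "deriv g 0 = 0" "(deriv ^^ 2) g 0 = 1"
      "\<And>z. cmod z < r0 \<Longrightarrow> exp (of_real ((s n)\<^sup>2) * g z) = mgf M (S n) z" "\<And>z. cmod z < r0 \<Longrightarrow> cmod (g z) \<le> C0"
      by blast
    have hc: "g holomorphic_on cball 0 (r0/2)" by (rule holomorphic_on_subset[OF g(1)]) (use r0 in auto)
    show ?case
    proof (intro allI impI)
      fix u :: real assume u: "\<bar>u\<bar> \<le> a"
      define z where "z = \<i> * complex_of_real u"
      have cz: "cmod z = \<bar>u\<bar>" by (simp add: z_def norm_mult)
      have u4: "\<bar>u\<bar> \<le> r0 / 4" and u3: "\<bar>u\<bar> \<le> r0 ^ 3 / (64 * (C0 + 1))" using u by (auto simp: a_def)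
      have "cmod (g z - (\<Sum>j\<le>2. (deriv ^^ j) g 0 / fact j * z ^ j)) \<le> 2 * C0 * (cmod z / (r0/2)) ^ Suc 2"
        by (rule taylor_remainder_bound[OF hc]) (use cz u4 r0 g(6) in auto)
      also have "(\<Sum>j\<le>2. (deriv ^^ j) g 0 / fact j * z ^ j) = z\<^sup>2 / 2"
        using g(2-4) by (simp add: numeral_2_eq_2)
      also have "z\<^sup>2 / 2 = - complex_of_real (u\<^sup>2 / 2)" by (simp add: z_def power_mult_distrib)
      also have "2 * C0 * (cmod z / (r0/2)) ^ Suc 2 = u\<^sup>2 * (\<bar>u\<bar> * (16 * C0 / r0 ^ 3))"
        using r0 unfolding cz by (simp add: power3_eq_cube power2_eq_square numeral_2_eq_2 field_simps)
      also have "\<dots> \<le> u\<^sup>2 * (1/4)"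
      proof (intro mult_left_mono)
        have "\<bar>u\<bar> * (16 * C0 / r0 ^ 3) \<le> r0 ^ 3 / (64 * (C0 + 1)) * (16 * C0 / r0 ^ 3)"
          using C0 r0 by (intro mult_right_mono u3) auto
        also have "\<dots> \<le> 1 / 4" using C0 r0 by (simp add: field_simps)
        finally show "\<bar>u\<bar> * (16 * C0 / r0 ^ 3) \<le> 1 / 4" .
      qed simp
      finally have "cmod (g z - - complex_of_real (u\<^sup>2 / 2)) \<le> u\<^sup>2 * (1/4)" .
      then have "\<bar>Re (g z) + u\<^sup>2 / 2\<bar> \<le> u\<^sup>2 * (1/4)"
        using abs_Re_le_cmod[of "g z - - complex_of_real (u\<^sup>2 / 2)"] by simp
      then have "Re (g z) + u\<^sup>2 / 2 \<le> u\<^sup>2 * (1/4)" by (rule abs_le_D1)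
      then have "Re (g z) \<le> - u\<^sup>2 / 4" by simp
      then have "(s n)\<^sup>2 * Re (g z) \<le> (s n)\<^sup>2 * (- u\<^sup>2 / 4)" by (intro mult_left_mono) auto
      moreover have "Re (of_real ((s n)\<^sup>2) * g z) = (s n)\<^sup>2 * Re (g z)" by (simp only: Re_complex_of_real Im_complex_of_real times_complex.sel mult_zero_left diff_zero)
      ultimately have "cmod (exp (of_real ((s n)\<^sup>2) * g z)) \<le> exp (- (s n * u)\<^sup>2 / 4)"
        unfolding norm_exp_eq_Re by (simp add: power_mult_distrib)
      then show "cmod (mgf M (S n) (\<i> * complex_of_real u)) \<le> exp (- (s n * u)\<^sup>2 / 4)"
      proof -
        have "exp (of_real ((s n)\<^sup>2) * g z) = mgf M (S n) z" by (rule g(5)) (use cz u4 r0 in linarith)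
        then show ?thesis using \<open>cmod (exp (of_real ((s n)\<^sup>2) * g z)) \<le> exp (- (s n * u)\<^sup>2 / 4)\<close>
          unfolding z_def by metis
      qed
    qed
  qed
qed

text \<open>The j-th derivative of the normalised characteristic function in integrated form, so
  that its increments can be estimated under the integral.\<close>

definition char_deriv :: "nat \<Rightarrow> nat \<Rightarrow> real \<Rightarrow> complex" where
  "char_deriv n j t = (LINT x|M. (\<i> * complex_of_real (S n x / s n)) ^ j * iexp (t * (S n x / s n)))"

lemma integrable_char_deriv:
  "integrable M (\<lambda>x. (\<i> * complex_of_real (S n x / s n)) ^ j * iexp (t * (S n x / s n)))"
proof -
  obtain b where b: "\<forall>x\<in>space M. \<bar>S n x\<bar> \<le> b" using S_bounded by blast
  show ?thesis
  proof (rule integrable_const_bound)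
    show "AE x in M. cmod ((\<i> * complex_of_real (S n x / s n)) ^ j * iexp (t * (S n x / s n))) \<le> (b / \<bar>s n\<bar>) ^ j"
    proof (rule AE_I2)
      fix x assume "x \<in> space M"
      then have "\<bar>S n x / s n\<bar> \<le> b / \<bar>s n\<bar>" using b by (auto simp: abs_divide intro: divide_right_mono)
      then have "\<bar>S n x / s n\<bar> ^ j \<le> (b / \<bar>s n\<bar>) ^ j" by (intro power_mono) auto
      then show "cmod ((\<i> * complex_of_real (S n x / s n)) ^ j * iexp (t * (S n x / s n))) \<le> (b / \<bar>s n\<bar>) ^ j"
        by (simp only: norm_mult norm_power norm_ii norm_of_real norm_exp_i_times mult_1 mult_1_right)
    qed
  qed measurable
qed

text \<open>The bound |exp(i x) - 1 - i x| \<le> x^2 / 2 is used under the integral; the square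
  raises the order of the moment by two.\<close>

lemma char_deriv_step:
  "cmod (char_deriv n j (t + h) - char_deriv n j t - of_real h * char_deriv n (Suc j) t)
     \<le> h\<^sup>2 / 2 * expectation (\<lambda>x. \<bar>S n x / s n\<bar> ^ (j + 2))"
proof -
  interpret X: bounded_rv M "S n" by (rule rv)
  let ?V = "\<lambda>x. S n x / s n"
  let ?f = "\<lambda>j t x. (\<i> * complex_of_real (?V x)) ^ j * iexp (t * ?V x)"
  have eq: "char_deriv n j (t + h) - char_deriv n j t - of_real h * char_deriv n (Suc j) t
     = (LINT x|M. ?f j (t + h) x - ?f j t x - of_real h * ?f (Suc j) t x)"
  proof -
    note i = integrable_char_deriv[of n]
    have "(LINT x|M. ?f j (t + h) x - ?f j t x - of_real h * ?f (Suc j) t x)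
      = (LINT x|M. ?f j (t + h) x - ?f j t x) - (LINT x|M. of_real h * ?f (Suc j) t x)"
      by (rule Bochner_Integration.integral_diff[OF Bochner_Integration.integrable_diff[OF i i] integrable_mult_right[OF i]])
    also have "(LINT x|M. ?f j (t + h) x - ?f j t x) = char_deriv n j (t + h) - char_deriv n j t"
      unfolding char_deriv_def by (rule Bochner_Integration.integral_diff[OF i i])
    also have "(LINT x|M. of_real h * ?f (Suc j) t x) = of_real h * char_deriv n (Suc j) t"
      unfolding char_deriv_def by (rule integral_mult_right_zero)
    finally show ?thesis ..
  qed
  have le: "cmod (LINT x|M. ?f j (t + h) x - ?f j t x - of_real h * ?f (Suc j) t x) \<le> (LINT x|M. h\<^sup>2 / 2 * \<bar>?V x\<bar> ^ (j + 2))"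
  proof (rule norm_integral_le_integral)
    show "integrable M (\<lambda>x. ?f j (t + h) x - ?f j t x - of_real h * ?f (Suc j) t x)"
      by (intro Bochner_Integration.integrable_diff integrable_mult_right integrable_char_deriv)
    show "integrable M (\<lambda>x. h\<^sup>2 / 2 * \<bar>?V x\<bar> ^ (j + 2))"
    proof (intro integrable_mult_right)
      have "integrable M (\<lambda>x. \<bar>S n x ^ (j + 2)\<bar> / \<bar>s n\<bar> ^ (j + 2))"
        by (intro integrable_divide integrable_abs X.integrable_power_X)
      then show "integrable M (\<lambda>x. \<bar>?V x\<bar> ^ (j + 2))"
        by (simp only: power_abs power_divide abs_divide)
    qed
    fix x
    have ex: "iexp ((t + h) * ?V x) = iexp (t * ?V x) * iexp (h * ?V x)"
      by (simp only: exp_add[symmetric] distrib_right of_real_add distrib_left)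
    have su: "(\<Sum>k\<le>1. (\<i> * complex_of_real (h * ?V x)) ^ k / fact k) = 1 + of_real h * (\<i> * complex_of_real (?V x))"
      by simp
    have ring: "a * (e * q) - a * e - h' * (v * a * e) = a * e * (q - (1 + h' * v))" for a e q h' v :: complex
      by (simp add: algebra_simps)
    have "?f j (t + h) x - ?f j t x - of_real h * ?f (Suc j) t x
       = (\<i> * complex_of_real (?V x)) ^ j * iexp (t * ?V x) * (iexp (h * ?V x) - (\<Sum>k\<le>1. (\<i> * complex_of_real (h * ?V x)) ^ k / fact k))"
      unfolding ex su power_Suc by (rule ring)
    also have "cmod \<dots> = \<bar>?V x\<bar> ^ j * cmod (iexp (h * ?V x) - (\<Sum>k\<le>1. (\<i> * complex_of_real (h * ?V x)) ^ k / fact k))"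
      by (simp only: norm_mult norm_power norm_ii norm_of_real norm_exp_i_times mult_1 mult_1_right)
    also have "\<dots> \<le> \<bar>?V x\<bar> ^ j * (\<bar>h * ?V x\<bar> ^ Suc 1 / fact (Suc 1))"
      by (intro mult_left_mono iexp_approx1) simp
    also have "\<dots> = h\<^sup>2 / 2 * \<bar>?V x\<bar> ^ (j + 2)"
    proof -
      have "\<bar>v\<bar> ^ j * (\<bar>h * v\<bar> ^ Suc 1 / fact (Suc 1)) = h\<^sup>2 / 2 * \<bar>v\<bar> ^ (j + 2)" for v :: real
      proof -
        have "\<bar>h * v\<bar> ^ Suc 1 = h\<^sup>2 * v\<^sup>2" by (metis Suc_1 power2_abs power_mult_distrib)
        moreover have "\<bar>v\<bar> ^ (j + 2) = \<bar>v\<bar> ^ j * v\<^sup>2" by (simp only: power_add power2_abs)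
        ultimately show ?thesis by (simp add: power2_eq_square)
      qed
      then show ?thesis .
    qed
    finally show "cmod (?f j (t + h) x - ?f j t x - of_real h * ?f (Suc j) t x) \<le> h\<^sup>2 / 2 * \<bar>?V x\<bar> ^ (j + 2)" .
  qed
  show ?thesis unfolding eq by (rule order_trans[OF le]) (simp only: integral_mult_right_zero order_refl)
qed

lemma char_deriv_0: "char_deriv n 0 t = mgf M (S n) (\<i> * complex_of_real (t / s n))"
  by (simp add: char_deriv_def mgf_def mult_ac divide_inverse)

text \<open>Landau-Kolmogorov: smallness of a function and boundedness of its second derivative make the
  first derivative small; the difference quotient uses the step \<open>s n ^ (- k)\<close>.\<close>

lemma char_deriv_decay:
  assumes "0 < a"
  shows "\<exists>K. \<forall>\<^sub>F n in sequentially. \<forall>t. a * s n \<le> \<bar>t\<bar> \<and> \<bar>t\<bar> \<le> s n ^ p \<longrightarrow> cmod (char_deriv n j t) \<le> K / s n ^ k"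
  using assms
proof (induction j arbitrary: a p k)
  case 0
  obtain K where K: "\<forall>\<^sub>F n in sequentially. \<forall>u. a \<le> \<bar>u\<bar> \<and> \<bar>u\<bar> \<le> s n ^ p \<longrightarrow>
       cmod (mgf M (S n) (\<i> * complex_of_real u)) \<le> K / s n ^ k" using decay[OF 0] by blast
  show ?case
  proof (intro exI)
    show "\<forall>\<^sub>F n in sequentially. \<forall>t. a * s n \<le> \<bar>t\<bar> \<and> \<bar>t\<bar> \<le> s n ^ p \<longrightarrow> cmod (char_deriv n 0 t) \<le> K / s n ^ k"
      using K eventually_s_ge[of 1]
    proof eventually_elim
      case (elim n)
      show ?case
      proof (intro allI impI)
        fix t assume t: "a * s n \<le> \<bar>t\<bar> \<and> \<bar>t\<bar> \<le> s n ^ p"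
        have "a \<le> \<bar>t / s n\<bar>" using t elim by (simp add: field_simps)
        moreover have "\<bar>t / s n\<bar> \<le> s n ^ p"
        proof -
          have "\<bar>t\<bar> / s n \<le> \<bar>t\<bar> / 1" using elim by (intro divide_left_mono) auto
          then show ?thesis using t elim by (simp add: abs_divide)
        qed
        ultimately show "cmod (char_deriv n 0 t) \<le> K / s n ^ k" unfolding char_deriv_0 using elim by blast
      qed
    qed
  qed
next
  case (Suc j)
  \<comment> \<open>The range is widened on both sides, to \<open>a / 2\<close> and
    \<open>p + 1\<close>, so that it still contains t + h. The order \<open>2 * k\<close> is asked
    for because division by h = s n^(- k) loses k powers.\<close>
  obtain K where K: "\<forall>\<^sub>F n in sequentially. \<forall>t. a / 2 * s n \<le> \<bar>t\<bar> \<and> \<bar>t\<bar> \<le> s n ^ (p + 1) \<longrightarrow>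
      cmod (char_deriv n j t) \<le> K / s n ^ (2 * k)"
    using Suc.IH[of "a/2" "p+1" "2*k"] Suc.prems by auto
  obtain L where L: "\<forall>\<^sub>F n in sequentially. expectation (\<lambda>x. \<bar>S n x / s n\<bar> ^ (j + 2)) \<le> L"
    using moments_bounded by blast
  show ?case
  proof (intro exI)
    show "\<forall>\<^sub>F n in sequentially. \<forall>t. a * s n \<le> \<bar>t\<bar> \<and> \<bar>t\<bar> \<le> s n ^ p \<longrightarrow> cmod (char_deriv n (Suc j) t) \<le> (2 * K + L) / s n ^ k"
      using K L eventually_s_ge[of "max 2 (2 / a)"]
    proof eventually_elim
      case (elim n)
      have s2: "2 \<le> s n" "2 / a \<le> s n" using elim by auto
      have as: "2 \<le> a * s n" using s2 Suc.prems by (simp add: field_simps)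
      show ?case
      proof (intro allI impI)
        fix t assume t: "a * s n \<le> \<bar>t\<bar> \<and> \<bar>t\<bar> \<le> s n ^ p"
        define h where "h = 1 / s n ^ k"
        have sk: "1 \<le> s n ^ k" "1 \<le> s n ^ p" using s2 by (auto intro!: one_le_power)
        have h: "0 < h" "h \<le> 1" using sk s2 by (auto simp: h_def)
        have p1: "2 * s n ^ p \<le> s n ^ (p + 1)" using s2 sk by simp
        have b1: "cmod (char_deriv n j t) \<le> K / s n ^ (2 * k)"
        proof -
          have "a / 2 * s n \<le> \<bar>t\<bar> \<and> \<bar>t\<bar> \<le> s n ^ (p + 1)" using t as p1 sk by linarith
          then show ?thesis using elim by blast
        qed
        have b2: "cmod (char_deriv n j (t + h)) \<le> K / s n ^ (2 * k)"
        proof -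
          have "a / 2 * s n \<le> \<bar>t + h\<bar> \<and> \<bar>t + h\<bar> \<le> s n ^ (p + 1)" using t as p1 sk h by linarith
          then show ?thesis using elim by blast
        qed
        have EL: "h\<^sup>2 / 2 * expectation (\<lambda>x. \<bar>S n x / s n\<bar> ^ (j + 2)) \<le> h\<^sup>2 / 2 * L"
          using elim by (intro mult_left_mono) auto
        have "0 \<le> expectation (\<lambda>x. \<bar>S n x / s n\<bar> ^ (j + 2))"
          by (rule Bochner_Integration.integral_nonneg) simp
        also have "\<dots> \<le> L" using elim by blast
        finally have L0: "0 \<le> L" .
        have tri: "cmod C \<le> cmod (A - B - C) + (cmod A + cmod B)" for A B C :: complex
          using norm_triangle_ineq4[of "A - B" "A - B - C"] norm_triangle_ineq4[of A B] by simp
        have "cmod (of_real h * char_deriv n (Suc j) t) \<le> 2 * (K / s n ^ (2 * k)) + h\<^sup>2 / 2 * L"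
          using tri[of "of_real h * char_deriv n (Suc j) t" "char_deriv n j (t + h)" "char_deriv n j t"]
            char_deriv_step[of n j t h] b1 b2 EL by linarith
        then have "h * cmod (char_deriv n (Suc j) t) \<le> 2 * (K / s n ^ (2 * k)) + h\<^sup>2 / 2 * L"
          using h by (simp add: norm_mult)
        also have "\<dots> = h * (2 * (K / s n ^ k) + h / 2 * L)"
        proof -
          have "K / s n ^ (2 * k) = h * (K / s n ^ k)"
            by (simp add: h_def mult_2 power_add)
          then show ?thesis by (simp only: power2_eq_square distrib_left) simp
        qed
        finally have "cmod (char_deriv n (Suc j) t) \<le> 2 * (K / s n ^ k) + h / 2 * L"
          using h by simp
        also have "\<dots> \<le> (2 * K + L) / s n ^ k"
        proof -
          have half_le: "x / 2 \<le> x" if "0 \<le> x" for x :: real using that by simp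
          have hL: "h / 2 * L = (L / s n ^ k) / 2" by (simp add: h_def)
          have "0 \<le> s n ^ k" using sk by linarith
          with L0 have "0 \<le> L / s n ^ k" by (rule divide_nonneg_nonneg)
          then have "h / 2 * L \<le> L / s n ^ k" unfolding hL by (rule half_le)
          then show ?thesis by (simp add: add_divide_distrib)
        qed
        finally show "cmod (char_deriv n (Suc j) t) \<le> (2 * K + L) / s n ^ k" .
      qed
    qed
  qed
qed

lemma smallo_inverse_power:
  assumes "\<forall>\<^sub>F n in sequentially. \<bar>f n\<bar> \<le> K / s n ^ Suc k"
  shows "f \<in> o(\<lambda>n. 1 / s n ^ k)"
proof (rule landau_o.smallI)
  fix e :: real assume e: "0 < e"
  show "\<forall>\<^sub>F n in sequentially. norm (f n) \<le> e * norm (1 / s n ^ k)"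
    using assms eventually_s_ge[of "max 1 (K / e)"]
  proof eventually_elim
    case (elim n)
    have "K \<le> e * s n" using elim e by (simp add: field_simps)
    then have "K / s n ^ Suc k \<le> e * s n / s n ^ Suc k" using elim by (intro divide_right_mono) auto
    also have "\<dots> = e * (1 / s n ^ k)" using elim by (simp add: field_simps)
    finally show ?case using elim by simp
  qed
qed

text \<open>Length times supremum: the range has length at most 2 D s^q, the factor 1 / |t| is at
  most 1 / (c s), and decay of order 2 q makes the product s^(- q - 1). The constant
  \<open>D\<close> is absorbed by one more power of s in the admissible range of t.\<close>

lemma char_derivative_integral_small:
  assumes c: "0 < c" and D: "0 < D"
  shows "(\<lambda>n. LINT t:{t. c * s n \<le> \<bar>t\<bar> \<and> \<bar>t\<bar> \<le> D * s n ^ q}|lborel.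
     cmod (nth_vector_derivative m (normalized_char M S n) t / complex_of_real t)) \<in> o(\<lambda>n. 1 / s n ^ q)"
proof -
  obtain K where K: "\<forall>\<^sub>F n in sequentially. \<forall>t. c * s n \<le> \<bar>t\<bar> \<and> \<bar>t\<bar> \<le> s n ^ (q + 1) \<longrightarrow>
      cmod (char_deriv n m t) \<le> K / s n ^ (2 * q)" using char_deriv_decay[OF c] by blast
  show ?thesis
  proof (rule smallo_inverse_power)
    show "\<forall>\<^sub>F n in sequentially. \<bar>LINT t:{t. c * s n \<le> \<bar>t\<bar> \<and> \<bar>t\<bar> \<le> D * s n ^ q}|lborel.
     cmod (nth_vector_derivative m (normalized_char M S n) t / complex_of_real t)\<bar> \<le> (2 * D * \<bar>K\<bar> / c) / s n ^ Suc q"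
      using K eventually_s_ge[of "max 1 D"]
    proof eventually_elim
      case (elim n)
      have s1: "1 \<le> s n" "D \<le> s n" using elim by auto
      define A where "A = {t. c * s n \<le> \<bar>t\<bar> \<and> \<bar>t\<bar> \<le> D * s n ^ q}"
      define Y where "Y = D * s n ^ q"
      define Z where "Z = (\<bar>K\<bar> / s n ^ (2 * q)) / (c * s n)"
      have Z: "0 \<le> Z" using s1 c by (simp add: Z_def)
      have Y: "0 \<le> Y" using s1 D by (simp add: Y_def)
      have eq: "nth_vector_derivative m (normalized_char M S n) t = char_deriv n m t" for t
        using nth_vector_derivative_normalized_char[of M S n m t, OF rv] unfolding char_deriv_def s_eq[symmetric] .
      have "(LINT t:A|lborel. cmod (char_deriv n m t / complex_of_real t)) \<le> (LINT t|lborel. indicator {-Y..Y} t * Z)"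
        unfolding set_lebesgue_integral_def
      proof (rule integral_mono')
        show "integrable lborel (\<lambda>t. indicator {-Y..Y} t * Z)"
          by (intro integrable_mult_left integrable_real_indicator) (auto simp: emeasure_lborel_Icc_eq)
        fix t
        show "0 \<le> indicator {-Y..Y} t * Z" using Z by simp
        show "indicator A t *\<^sub>R cmod (char_deriv n m t / complex_of_real t) \<le> indicator {-Y..Y} t * Z"
        proof (cases "t \<in> A")
          case True
          then have t: "c * s n \<le> \<bar>t\<bar>" "\<bar>t\<bar> \<le> Y" by (auto simp: A_def Y_def)
          have "Y \<le> s n * s n ^ q" unfolding Y_def using s1 by (intro mult_right_mono) auto
          then have "Y \<le> s n ^ (q + 1)" by simp
          then have "cmod (char_deriv n m t) \<le> K / s n ^ (2 * q)" using t elim by auto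
          also have "\<dots> \<le> \<bar>K\<bar> / s n ^ (2 * q)" using s1 by (intro divide_right_mono) auto
          finally have "cmod (char_deriv n m t) / \<bar>t\<bar> \<le> Z"
            unfolding Z_def using t c s1 by (intro frac_le) auto
          moreover have "t \<in> {-Y..Y}" using t by auto
          ultimately show ?thesis using True by (simp add: norm_divide)
        qed (use Z in simp)
      qed
      also have "\<dots> = 2 * Y * Z" using Y by simp
      also have "\<dots> = (2 * D * \<bar>K\<bar> / c) / s n ^ Suc q"
      proof -
        define p where "p = s n ^ q"
        have p: "0 < p" using s1 by (simp add: p_def)
        have "2 * (D * p) * ((\<bar>K\<bar> / (p * p)) / (c * s n)) = (2 * D * \<bar>K\<bar> / c) / (s n * p)"
          using p c s1 by (simp add: field_simps)
        then show ?thesis unfolding Y_def Z_def mult_2[of q] power_add power_Suc p_def .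
      qed
      finally have le: "(LINT t:A|lborel. cmod (char_deriv n m t / complex_of_real t)) \<le> (2 * D * \<bar>K\<bar> / c) / s n ^ Suc q" .
      have "0 \<le> (LINT t:A|lborel. cmod (char_deriv n m t / complex_of_real t))"
        unfolding set_lebesgue_integral_def by (rule Bochner_Integration.integral_nonneg) simp
      with le show ?case unfolding A_def[symmetric] eq by linarith
    qed
  qed
qed

end

section \<open>Comparison of Fourier transforms\<close>

lemma poly_exp_bounded:
  fixes c :: real
  assumes "0 < c"
  shows "\<exists>K\<ge>0. \<forall>t. (1 + \<bar>t\<bar>) ^ k * exp (- (c * t\<^sup>2)) \<le> K"
proof (intro exI conjI allI)
  \<comment> \<open>(1 + |t|)^k is at most k! exp(1 + |t|), and |t| - c t^2 is at most 1 / (4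
    c).\<close>
  let ?K = "fact k * exp (1 + 1 / (4 * c))"
  show "0 \<le> ?K" by simp
  fix t :: real
  have "(1 + \<bar>t\<bar>) ^ k / fact k \<le> exp (1 + \<bar>t\<bar>)" by (rule power_over_fact_le_exp) simp
  then have "(1 + \<bar>t\<bar>) ^ k \<le> exp (1 + \<bar>t\<bar>) * fact k" by (simp only: pos_divide_le_eq[OF fact_gt_zero])
  then have "(1 + \<bar>t\<bar>) ^ k * exp (- (c * t\<^sup>2)) \<le> exp (1 + \<bar>t\<bar>) * fact k * exp (- (c * t\<^sup>2))"
    by (intro mult_right_mono) auto
  also have "\<dots> = fact k * exp (1 + \<bar>t\<bar> - c * t\<^sup>2)"
    by (simp add: exp_diff exp_minus divide_inverse)
  also have "\<dots> \<le> ?K"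
  proof -
    have "0 \<le> c * (\<bar>t\<bar> - 1 / (2 * c))\<^sup>2" using assms by simp
    also have "c * (\<bar>t\<bar> - 1 / (2 * c))\<^sup>2 = c * t\<^sup>2 - \<bar>t\<bar> + 1 / (4 * c)"
      using assms by (simp add: power2_diff power_divide power_mult_distrib field_simps power2_eq_square)
    finally show ?thesis by simp
  qed
  finally show "(1 + \<bar>t\<bar>) ^ k * exp (- (c * t\<^sup>2)) \<le> ?K" .
qed

lemma cmod_poly_le:
  assumes "\<And>i. cmod (coeff q i) \<le> K" "degree q \<le> d"
  shows "cmod (poly q z) \<le> (real d + 1) * K * (1 + cmod z) ^ d"
proof -
  have K: "0 \<le> K" using order_trans[OF norm_ge_zero assms(1)[of 0]] .
  have "cmod (poly q z) \<le> (\<Sum>i\<le>degree q. cmod (coeff q i * z ^ i))"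
    unfolding poly_altdef by (rule norm_sum)
  also have "\<dots> \<le> (\<Sum>i\<le>degree q. K * (1 + cmod z) ^ d)"
  proof (rule sum_mono)
    fix i assume i: "i \<in> {..degree q}"
    have "cmod z ^ i \<le> (1 + cmod z) ^ i" by (intro power_mono) auto
    also have "\<dots> \<le> (1 + cmod z) ^ d" by (rule power_increasing) (use i assms(2) in auto)
    finally show "cmod (coeff q i * z ^ i) \<le> K * (1 + cmod z) ^ d"
      unfolding norm_mult norm_power using assms(1)[of i] K by (intro mult_mono) auto
  qed
  also have "\<dots> = (real (degree q) + 1) * (K * (1 + cmod z) ^ d)" by simp
  also have "\<dots> \<le> (real d + 1) * (K * (1 + cmod z) ^ d)"
    using K assms(2) by (intro mult_right_mono) auto
  finally show ?thesis by (simp add: mult.assoc)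
qed

text \<open>The polynomial functions of the definition are chosen before \<open>A\<close> and
  \<open>B\<close>; accordingly the two sequences influence the coefficients only through
  \<open>vars\<close>. One number \<open>b\<close> bounds both perturbations.\<close>

locale edgeworth_normalized = edgeworth_sequence M S s r0 C0
  for M :: "'a measure" and S s r0 C0 +
  fixes A B :: "nat \<Rightarrow> real" and b :: real
  assumes A_le: "\<And>n. \<bar>A n\<bar> \<le> b" and B_le: "\<And>n. \<bar>B n - s n\<bar> \<le> b"
begin

definition vars :: "nat \<Rightarrow> nat \<Rightarrow> complex" where "vars n = edgeworth_vars M S A B n"

definition W :: "nat \<Rightarrow> 'a \<Rightarrow> real" where "W n x = (S n x - A n) / B n"

text \<open>The Taylor polynomial of order R in 1 / B n, taken at s = i t, with the Gaussian factor
  restored.\<close>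

definition fourier_approx :: "nat \<Rightarrow> nat \<Rightarrow> real \<Rightarrow> complex" where
  "fourier_approx R n t = of_real (exp (- t\<^sup>2 / 2)) * (\<Sum>j\<le>R. poly (exp_coeff (vars n) j) (\<i> * of_real t) * of_real (1 / B n) ^ j)"

lemma b_nonneg: "0 \<le> b" using order_trans[OF abs_ge_zero A_le[of 0]] .

lemma W_measurable[measurable]: "W n \<in> borel_measurable M" unfolding W_def[abs_def] by measurable

lemma eventually_B: "\<forall>\<^sub>F n in sequentially. c \<le> B n \<and> B n \<le> 2 * s n \<and> 3 / 4 * B n \<le> s n"
  using eventually_s_ge[of "\<bar>c\<bar> + 4 * b"]
proof eventually_elim
  case (elim n)
  have "B n \<le> s n + b" "s n - b \<le> B n" using B_le[of n] by (auto simp: abs_le_iff)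
  then show ?case using elim b_nonneg by auto
qed

lemma vars_01: "vars n 0 = of_real (A n)" "vars n 1 = of_real (B n - s n)"
  by (simp_all add: vars_def edgeworth_vars_def s_eq)

text \<open>Cauchy's inequality on a fixed circle bounds the k-th derivative of the normalised
  logarithm independently of n; the finitely many remaining n are absorbed into the
  constant.\<close>

lemma vars_bounded: "\<exists>K. \<forall>n. cmod (vars n k) \<le> K"
proof -
  consider "k = 0" | "k = 1" | "k = 2" | "3 \<le> k" by linarith
  then show ?thesis
  proof cases
    case 1 then show ?thesis using A_le by (auto simp: vars_01)
  next
    case 2 then show ?thesis using B_le by (intro exI[of _ b]) (simp only: vars_01 norm_of_real simp_thms)
  next
    case 3 then show ?thesis by (auto simp: vars_def edgeworth_vars_def)
  next
    case 4
    have "\<forall>\<^sub>F n in sequentially. cmod (vars n k) \<le> fact k * C0 / (r0 / 2) ^ k"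
      using scaled_log
    proof eventually_elim
      case (elim n)
      then obtain g where g: "g holomorphic_on ball 0 r0" "\<And>k. 2 \<le> k \<Longrightarrow> (deriv ^^ k) g 0 = cumulant M (S n) k / of_real ((s n)\<^sup>2)"
        "\<And>z. cmod z < r0 \<Longrightarrow> cmod (g z) \<le> C0" by blast
      have hc: "g holomorphic_on cball 0 (r0/2)" by (rule holomorphic_on_subset[OF g(1)]) (use r0 in auto)
      have "cmod ((deriv ^^ k) g 0) \<le> fact k * C0 / (r0 / 2) ^ k"
      proof (rule Cauchy_inequality[OF _ holomorphic_on_imp_continuous_on[OF hc]])
        show "g holomorphic_on ball 0 (r0/2)" by (rule holomorphic_on_subset[OF hc]) auto
      qed (use r0 g(3) in auto)
      also have "(deriv ^^ k) g 0 = (- \<i>) ^ k * vars n k"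
        using g(2)[of k] 4 by (simp add: vars_def edgeworth_vars_cumulant)
      finally show ?case by (simp add: norm_mult norm_power)
    qed
    then show ?thesis by (rule eventually_bounded_imp_bounded)
  qed
qed

lemma exp_coeff_bounded: "\<exists>K\<ge>0. \<forall>n i. cmod (coeff (exp_coeff (vars n) j) i) \<le> K"
proof -
  have "\<exists>K. \<forall>n. cmod (coeff (exp_coeff (vars n) j) i) \<le> K" for i
  proof (rule poly_fun_bounded[where q="\<lambda>v. coeff (exp_coeff v j) i"])
    show "(\<lambda>v. coeff (exp_coeff v j) i) \<in> poly_funs"
      using poly_fun_coeffs_exp_coeff[of j] unfolding poly_fun_coeffs_def by blast
  qed (rule vars_bounded)
  then obtain K where K: "\<And>n i. cmod (coeff (exp_coeff (vars n) j) i) \<le> K i" by metis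
  have K0: "0 \<le> K i" for i using order_trans[OF norm_ge_zero K] .
  have "cmod (coeff (exp_coeff (vars n) j) i) \<le> (\<Sum>i\<le>3 * j. K i)" for n i
  proof (cases "i \<le> 3 * j")
    case True
    have "K i \<le> (\<Sum>i\<le>3 * j. K i)" by (rule member_le_sum) (use True K0 in auto)
    then show ?thesis using K[of n i] by linarith
  next
    case False
    then have "coeff (exp_coeff (vars n) j) i = 0"
      using degree_exp_coeff[of "vars n" j] by (intro coeff_eq_0) linarith
    then show ?thesis using K0 by (simp add: sum_nonneg)
  qed
  then show ?thesis using K0 by (intro exI[of _ "\<Sum>i\<le>3 * j. K i"]) (auto simp: sum_nonneg)
qed

lemma fourier_approx_le:
  "\<exists>K\<ge>0. \<forall>n t. 1 \<le> B n \<longrightarrow> cmod (fourier_approx R n t) \<le> K * (1 + \<bar>t\<bar>) ^ (3 * R) * exp (- t\<^sup>2 / 2)"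
proof -
  obtain K where K: "\<And>j. 0 \<le> K j" "\<And>n i j. cmod (coeff (exp_coeff (vars n) j) i) \<le> K j"
    using exp_coeff_bounded by metis
  define L where "L = (\<Sum>j\<le>R. (real (3 * j) + 1) * K j)"
  have L0: "0 \<le> L" unfolding L_def using K(1) by (intro sum_nonneg mult_nonneg_nonneg) auto
  have "cmod (fourier_approx R n t) \<le> L * (1 + \<bar>t\<bar>) ^ (3 * R) * exp (- t\<^sup>2 / 2)" if B: "1 \<le> B n" for n t
  proof -
    have "cmod (\<Sum>j\<le>R. poly (exp_coeff (vars n) j) (\<i> * of_real t) * of_real (1 / B n) ^ j)
       \<le> (\<Sum>j\<le>R. (real (3 * j) + 1) * K j * (1 + \<bar>t\<bar>) ^ (3 * R))"
    proof (rule sum_norm_le)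
      fix j assume j: "j \<in> {..R}"
      have "cmod (poly (exp_coeff (vars n) j) (\<i> * of_real t)) \<le> (real (3 * j) + 1) * K j * (1 + cmod (\<i> * of_real t)) ^ (3 * j)"
        by (rule cmod_poly_le[OF K(2) degree_exp_coeff])
      also have "\<dots> \<le> (real (3 * j) + 1) * K j * (1 + \<bar>t\<bar>) ^ (3 * R)"
      proof (rule mult_left_mono)
        have "(1 + \<bar>t\<bar>) ^ (3 * j) \<le> (1 + \<bar>t\<bar>) ^ (3 * R)" by (rule power_increasing) (use j in auto)
        then show "(1 + cmod (\<i> * of_real t)) ^ (3 * j) \<le> (1 + \<bar>t\<bar>) ^ (3 * R)" by (simp add: norm_mult)
      qed (use K(1) in simp)
      finally have 1: "cmod (poly (exp_coeff (vars n) j) (\<i> * of_real t)) \<le> (real (3 * j) + 1) * K j * (1 + \<bar>t\<bar>) ^ (3 * R)" .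
      have 2: "cmod (of_real (1 / B n) ^ j) \<le> 1"
        unfolding norm_power norm_of_real by (rule power_le_one) (use B in auto)
      show "cmod (poly (exp_coeff (vars n) j) (\<i> * of_real t) * of_real (1 / B n) ^ j) \<le> (real (3 * j) + 1) * K j * (1 + \<bar>t\<bar>) ^ (3 * R)"
        unfolding norm_mult[of "poly _ _"] using mult_mono[OF 1 2] order_trans[OF norm_ge_zero 1] by simp
    qed
    also have "\<dots> = L * (1 + \<bar>t\<bar>) ^ (3 * R)" unfolding L_def by (simp only: sum_distrib_right)
    finally have "cmod (\<Sum>j\<le>R. poly (exp_coeff (vars n) j) (\<i> * of_real t) * of_real (1 / B n) ^ j) * exp (- t\<^sup>2 / 2)
       \<le> L * (1 + \<bar>t\<bar>) ^ (3 * R) * exp (- t\<^sup>2 / 2)" by (rule mult_right_mono) simp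
    then show ?thesis unfolding fourier_approx_def norm_mult[of "of_real _"] norm_of_real abs_exp_cancel
      by (simp only: mult.commute)
  qed
  then show ?thesis using L0 by blast
qed

lemma char_W: "char (distr M borel (W n)) t = exp (- (\<i> * of_real (t * A n / B n))) * mgf M (S n) (\<i> * of_real (t / B n))"
proof -
  have "char (distr M borel (W n)) t = (LINT x|M. iexp (t * W n x))"
    unfolding char_def by (subst integral_distr) auto
  also have "\<dots> = (LINT x|M. exp (- (\<i> * of_real (t * A n / B n))) * exp (\<i> * of_real (t / B n) * of_real (S n x)))"
  proof (intro Bochner_Integration.integral_cong refl)
    fix x
    have "\<i> * complex_of_real (t * W n x) = - (\<i> * of_real (t * A n / B n)) + \<i> * of_real (t / B n) * of_real (S n x)"
      by (simp add: W_def diff_divide_distrib right_diff_distrib algebra_simps)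
    then show "iexp (t * W n x) = exp (- (\<i> * of_real (t * A n / B n))) * exp (\<i> * of_real (t / B n) * of_real (S n x))"
      by (simp only: exp_add)
  qed
  also have "\<dots> = exp (- (\<i> * of_real (t * A n / B n))) * mgf M (S n) (\<i> * of_real (t / B n))"
    unfolding mgf_def by (rule integral_mult_right_zero)
  finally show ?thesis .
qed

lemma cmod_char_W: "cmod (char (distr M borel (W n)) t) = cmod (mgf M (S n) (\<i> * of_real (t / B n)))"
proof -
  have "cmod (exp (- (\<i> * complex_of_real (t * A n / B n)))) = 1" by (simp add: norm_exp_eq_Re)
  then show ?thesis unfolding char_W norm_mult by (simp only: mult_1)
qed

lemma char_W_near:
  "\<exists>K\<ge>0. \<exists>\<eta>>0. \<forall>\<^sub>F n in sequentially. \<forall>t. (1 + \<bar>t\<bar>) ^ 3 \<le> \<eta> * B n \<longrightarrow>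
     cmod (char (distr M borel (W n)) t - fourier_approx R n t) \<le> K * ((1 + \<bar>t\<bar>) ^ 3 / B n) ^ Suc R * exp (- t\<^sup>2 / 2)"
proof -
  obtain K \<eta> where K: "0 \<le> K" "0 < \<eta>" and T: "\<And>g v s (w::real). g holomorphic_on ball 0 r0 \<Longrightarrow>
     (\<forall>z. cmod z < r0 \<longrightarrow> cmod (g z) \<le> C0) \<Longrightarrow> g 0 = 0 \<Longrightarrow> deriv g 0 = 0 \<Longrightarrow>
     (\<forall>k\<ge>2. (deriv ^^ k) g 0 = cumulant_var v k) \<Longrightarrow> cmod (v 0) \<le> b \<Longrightarrow> cmod (v 1) \<le> b \<Longrightarrow>
     0 < w \<Longrightarrow> w * (1 + cmod s) ^ 3 \<le> \<eta> \<Longrightarrow>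
     cmod (exp ((1 - v 1 * of_real w)\<^sup>2 * (g (s * of_real w) / (of_real w)\<^sup>2) - s * v 0 * of_real w - s\<^sup>2 / 2)
        - (\<Sum>j\<le>R. poly (exp_coeff v j) s * of_real w ^ j)) \<le> K * (w * (1 + cmod s) ^ 3) ^ Suc R"
    using edgeworth_taylor[OF r0 C0 b_nonneg, of R] by blast
  \<comment> \<open>The second bound keeps i t / B n inside the ball on which the logarithm
    lives.\<close>
  define \<eta>' where "\<eta>' = min \<eta> (r0 / 2)"
  have "\<forall>\<^sub>F n in sequentially. \<forall>t. (1 + \<bar>t\<bar>) ^ 3 \<le> \<eta>' * B n \<longrightarrow>
     cmod (char (distr M borel (W n)) t - fourier_approx R n t) \<le> K * ((1 + \<bar>t\<bar>) ^ 3 / B n) ^ Suc R * exp (- t\<^sup>2 / 2)"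
    using scaled_log eventually_B[of 1]
  proof eventually_elim
    case (elim n)
    then obtain g where g: "g holomorphic_on ball 0 r0" "g 0 = 0" "deriv g 0 = 0"
      "\<And>k. 2 \<le> k \<Longrightarrow> (deriv ^^ k) g 0 = cumulant M (S n) k / of_real ((s n)\<^sup>2)"
      "\<And>z. cmod z < r0 \<Longrightarrow> exp (of_real ((s n)\<^sup>2) * g z) = mgf M (S n) z" "\<And>z. cmod z < r0 \<Longrightarrow> cmod (g z) \<le> C0" by blast
    have s1: "1 \<le> s n" and B1: "1 \<le> B n" using elim by auto
    show ?case
    proof (intro allI impI)
      fix t assume t: "(1 + \<bar>t\<bar>) ^ 3 \<le> \<eta>' * B n"
      have t1: "(1 + \<bar>t\<bar>) ^ 3 \<le> \<eta> * B n"
        by (rule order_trans[OF t mult_right_mono]) (use B1 in \<open>auto simp: \<eta>'_def\<close>)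
      have t2: "(1 + \<bar>t\<bar>) ^ 3 \<le> r0 / 2 * B n"
        by (rule order_trans[OF t mult_right_mono]) (use B1 in \<open>auto simp: \<eta>'_def\<close>)
      have "\<bar>t\<bar> \<le> (1 + \<bar>t\<bar>) ^ 1" by simp
      also have "\<dots> \<le> (1 + \<bar>t\<bar>) ^ 3" by (rule power_increasing) auto
      finally have "\<bar>t / B n\<bar> \<le> r0 / 2" using t2 B1 by (simp add: abs_divide divide_le_eq)
      moreover have "cmod (\<i> * of_real (t / B n)) = \<bar>t / B n\<bar>" by (simp only: norm_mult norm_ii norm_of_real mult_1)
      ultimately have zt: "cmod (\<i> * of_real (t / B n)) < r0" using r0 by linarith
      let ?z = "\<i> * complex_of_real t" and ?w = "1 / B n"
      have "cmod (exp ((1 - vars n 1 * of_real ?w)\<^sup>2 * (g (?z * of_real ?w) / (of_real ?w)\<^sup>2) - ?z * vars n 0 * of_real ?w - ?z\<^sup>2 / 2)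
        - (\<Sum>j\<le>R. poly (exp_coeff (vars n) j) ?z * of_real ?w ^ j)) \<le> K * (?w * (1 + cmod ?z) ^ 3) ^ Suc R"
      proof (rule T[OF g(1) _ g(2,3)])
        show "\<forall>k\<ge>2. (deriv ^^ k) g 0 = cumulant_var (vars n) k"
          using g(4) cumulant_var_eq[of _ n A B] s1 by (auto simp: vars_def)
        show "cmod (vars n 0) \<le> b" "cmod (vars n 1) \<le> b" unfolding vars_01 norm_of_real by (rule A_le B_le)+
        show "?w * (1 + cmod ?z) ^ 3 \<le> \<eta>" using t1 B1 by (simp add: norm_mult divide_le_eq)
      qed (use g(6) B1 in auto)
      \<comment> \<open>With w = 1 / B n the first factor is (s n / B n)^2, so B n cancels and the
        exponent is the logarithm of the generating function itself.\<close>
      moreover have "(1 - vars n 1 * of_real ?w)\<^sup>2 * (g (?z * of_real ?w) / (of_real ?w)\<^sup>2) = of_real ((s n)\<^sup>2) * g (\<i> * of_real (t / B n))"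
      proof -
        have "1 - vars n 1 * complex_of_real ?w = of_real (s n / B n)"
          unfolding vars_01 of_real_mult[symmetric] of_real_1[symmetric, where 'a=complex] of_real_diff[symmetric]
          using B1 by (simp add: field_simps)
        then have "(1 - vars n 1 * complex_of_real ?w)\<^sup>2 * (G / (of_real ?w)\<^sup>2) = of_real ((s n)\<^sup>2) * G" for G
          using B1 by (simp add: power_divide)
        then show ?thesis by (simp add: mult.assoc)
      qed
      moreover have "?z * vars n 0 * of_real ?w = \<i> * of_real (t * A n / B n)"
        by (simp add: vars_01)
      moreover have "?z\<^sup>2 / 2 = of_real (- t\<^sup>2 / 2)" by (simp add: power_mult_distrib)
      moreover have "cmod ?z = \<bar>t\<bar>" by (simp add: norm_mult)
      ultimately have *: "cmod (exp (of_real ((s n)\<^sup>2) * g (\<i> * of_real (t / B n)) - \<i> * of_real (t * A n / B n) - of_real (- t\<^sup>2 / 2))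
        - (\<Sum>j\<le>R. poly (exp_coeff (vars n) j) ?z * of_real ?w ^ j)) \<le> K * (?w * (1 + \<bar>t\<bar>) ^ 3) ^ Suc R"
        by (simp only:)
      have "char (distr M borel (W n)) t - fourier_approx R n t
         = of_real (exp (- t\<^sup>2 / 2)) * (exp (of_real ((s n)\<^sup>2) * g (\<i> * of_real (t / B n)) - \<i> * of_real (t * A n / B n) - of_real (- t\<^sup>2 / 2))
        - (\<Sum>j\<le>R. poly (exp_coeff (vars n) j) ?z * of_real ?w ^ j))"
      proof -
        have "char (distr M borel (W n)) t = exp (- (\<i> * of_real (t * A n / B n))) * exp (of_real ((s n)\<^sup>2) * g (\<i> * of_real (t / B n)))"
          unfolding char_W g(5)[OF zt] ..
        also have "\<dots> = exp (of_real (- t\<^sup>2 / 2) + (of_real ((s n)\<^sup>2) * g (\<i> * of_real (t / B n)) - \<i> * of_real (t * A n / B n) - of_real (- t\<^sup>2 / 2)))"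
          by (simp only: exp_add[symmetric]) (simp add: algebra_simps)
        also have "\<dots> = of_real (exp (- t\<^sup>2 / 2)) * exp (of_real ((s n)\<^sup>2) * g (\<i> * of_real (t / B n)) - \<i> * of_real (t * A n / B n) - of_real (- t\<^sup>2 / 2))"
          by (simp only: exp_add exp_of_real)
        finally show ?thesis unfolding fourier_approx_def by (simp only: right_diff_distrib)
      qed
      then have "cmod (char (distr M borel (W n)) t - fourier_approx R n t) \<le> exp (- t\<^sup>2 / 2) * (K * (?w * (1 + \<bar>t\<bar>) ^ 3) ^ Suc R)"
        using mult_left_mono[OF *, of "exp (- t\<^sup>2 / 2)"] by (simp only: norm_mult[of "of_real _"] norm_of_real abs_exp_cancel exp_ge_zero simp_thms)
      then show "cmod (char (distr M borel (W n)) t - fourier_approx R n t) \<le> K * ((1 + \<bar>t\<bar>) ^ 3 / B n) ^ Suc R * exp (- t\<^sup>2 / 2)"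
        by (simp only: times_divide_eq_left mult_1 mult.commute)
    qed
  qed
  then show ?thesis using K r0 by (intro exI[of _ K] conjI exI[of _ \<eta>']) (auto simp: \<eta>'_def)
qed

lemma char_W_gauss:
  "\<exists>a>0. \<forall>\<^sub>F n in sequentially. \<forall>t. \<bar>t\<bar> \<le> a * B n \<longrightarrow> cmod (char (distr M borel (W n)) t) \<le> exp (- t\<^sup>2 / 8)"
proof -
  obtain a where a: "0 < a" and G: "\<forall>\<^sub>F n in sequentially. \<forall>u. \<bar>u\<bar> \<le> a \<longrightarrow> cmod (mgf M (S n) (\<i> * complex_of_real u)) \<le> exp (- (s n * u)\<^sup>2 / 4)"
    using mgf_gauss_bound by blast
  have "\<forall>\<^sub>F n in sequentially. \<forall>t. \<bar>t\<bar> \<le> a * B n \<longrightarrow> cmod (char (distr M borel (W n)) t) \<le> exp (- t\<^sup>2 / 8)"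
    using G eventually_B[of 1]
  proof eventually_elim
    case (elim n)
    then have B1: "1 \<le> B n" and sB: "3 / 4 * B n \<le> s n" by auto
    show ?case
    proof (intro allI impI)
      fix t assume "\<bar>t\<bar> \<le> a * B n"
      then have "\<bar>t / B n\<bar> \<le> a" using B1 by (simp add: abs_divide divide_le_eq)
      then have "cmod (char (distr M borel (W n)) t) \<le> exp (- (s n * (t / B n))\<^sup>2 / 4)"
        unfolding cmod_char_W using elim by blast
      \<comment> \<open>The ratio s n / B n is at least 3/4, and (3/4)^2 / 4 = 9/64 exceeds
        1/8.\<close>
      also have "\<dots> \<le> exp (- t\<^sup>2 / 8)"
      proof -
        have "3 / 4 \<le> s n / B n" using sB B1 by (simp add: le_divide_eq)
        then have "(3 / 4)\<^sup>2 \<le> (s n / B n)\<^sup>2" by (rule power_mono) simp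
        then have "(3 / 4)\<^sup>2 * t\<^sup>2 \<le> (s n / B n)\<^sup>2 * t\<^sup>2" by (rule mult_right_mono) simp
        moreover have "(s n * (t / B n))\<^sup>2 = (s n / B n)\<^sup>2 * t\<^sup>2" by (simp add: power_mult_distrib power_divide)
        moreover have "(3 / 4 :: real)\<^sup>2 * t\<^sup>2 = 9 / 16 * t\<^sup>2" by (simp add: power2_eq_square)
        moreover have "0 \<le> t\<^sup>2" by simp
        ultimately have "- (s n * (t / B n))\<^sup>2 / 4 \<le> - t\<^sup>2 / 8" by linarith
        then show ?thesis by simp
      qed
      finally show "cmod (char (distr M borel (W n)) t) \<le> exp (- t\<^sup>2 / 8)" .
    qed
  qed
  with a show ?thesis by blast
qed

end

lemma poly_exp_le_inverse_sq:
  fixes c :: real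
  assumes "0 < c"
  shows "\<exists>K\<ge>0. \<forall>t. (1 + \<bar>t\<bar>) ^ k * exp (- (c * t\<^sup>2)) \<le> K * (1 / (1 + t\<^sup>2))"
proof -
  obtain K where K: "0 \<le> K" "\<And>t. (1 + \<bar>t\<bar>) ^ (k + 2) * exp (- (c * t\<^sup>2)) \<le> K"
    using poly_exp_bounded[OF assms] by blast
  have "(1 + \<bar>t\<bar>) ^ k * exp (- (c * t\<^sup>2)) \<le> K * (1 / (1 + t\<^sup>2))" for t
  proof -
    have p: "0 < 1 + t\<^sup>2" by (simp add: add_pos_nonneg)
    have "1 + t\<^sup>2 \<le> (1 + \<bar>t\<bar>)\<^sup>2" by (simp add: power2_sum)
    then have "((1 + \<bar>t\<bar>) ^ k * exp (- (c * t\<^sup>2))) * (1 + t\<^sup>2) \<le> ((1 + \<bar>t\<bar>) ^ k * exp (- (c * t\<^sup>2))) * (1 + \<bar>t\<bar>)\<^sup>2"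
      by (intro mult_left_mono) auto
    also have "\<dots> = (1 + \<bar>t\<bar>) ^ (k + 2) * exp (- (c * t\<^sup>2))" by (simp only: power_add mult_ac)
    also have "\<dots> \<le> K" by (rule K)
    finally show ?thesis using p by (simp add: pos_le_divide_eq)
  qed
  with K(1) show ?thesis by blast
qed

text \<open>Brings all Gaussian terms that occur below, of whatever width up to
  \<open>c = 8\<close>, to the one integrable majorant 1 / (1 + t^2) with a single constant.\<close>

lemma poly_gauss_le_inverse_sq:
  "\<exists>L\<ge>0. \<forall>(j::nat) (t::real) (c::real). j \<le> k \<longrightarrow> 0 < c \<longrightarrow> c \<le> 8 \<longrightarrow>
      (1 + \<bar>t\<bar>) ^ j * exp (- t\<^sup>2 / c) \<le> L * (1 / (1 + t\<^sup>2))" for k :: nat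
proof -
  have "0 < (1/8::real)" by simp
  from poly_exp_le_inverse_sq[OF this, of k]
  obtain L where LL: "0 \<le> L \<and> (\<forall>t::real. (1 + \<bar>t\<bar>) ^ k * exp (- (1/8 * t\<^sup>2)) \<le> L * (1 / (1 + t\<^sup>2)))"
    by (rule exE)
  have "(1 + \<bar>t\<bar>) ^ j * exp (- t\<^sup>2 / c) \<le> L * (1 / (1 + t\<^sup>2))"
    if j: "j \<le> k" and c: "0 < c" "c \<le> 8" for j :: nat and t c :: real
  proof -
    have 1: "(1 + \<bar>t\<bar>) ^ j \<le> (1 + \<bar>t\<bar>) ^ k" by (rule power_increasing[OF j]) simp
    define y where "y = t\<^sup>2"
    have y: "0 \<le> y" by (simp add: y_def)
    have "y / 8 \<le> y / c" by (rule divide_left_mono[OF c(2) y]) (simp add: c)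
    then have "- y / c \<le> - (1/8 * y)" by linarith
    then have 2: "exp (- y / c) \<le> exp (- (1/8 * y))" by (simp only: exp_le_cancel_iff)
    have "(1 + \<bar>t\<bar>) ^ j * exp (- y / c) \<le> (1 + \<bar>t\<bar>) ^ k * exp (- (1/8 * y))"
      by (rule mult_mono[OF 1 2]) simp_all
    with LL show ?thesis unfolding y_def by (meson order_trans)
  qed
  with LL show ?thesis by blast
qed

context edgeworth_normalized
begin

lemma cmod_char_W_le_1: "cmod (char (distr M borel (W n)) t) \<le> 1"
proof -
  interpret D: real_distribution "distr M borel (W n)" by (rule real_distribution_distr) simp
  show ?thesis by (rule D.cmod_char_le_1)
qed

text \<open>Here t is at most a power of B n, so surplus decay in s n can be converted into decay in
  t.\<close>

lemma char_W_middle: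
  assumes a: "0 < a"
  shows "\<exists>K\<ge>0. \<forall>\<^sub>F n in sequentially. \<forall>t. a * B n \<le> \<bar>t\<bar> \<and> \<bar>t\<bar> \<le> B n ^ (R + 3) \<longrightarrow>
     cmod (char (distr M borel (W n)) t) \<le> K / B n ^ Suc R * (1 / (1 + t\<^sup>2))"
proof -
  \<comment> \<open>\<open>Suc R\<close> is the rate to be proved; the other summand pays for 1 +
    t^2, which is at most 2 B^(2 (R + 3)) on this range.\<close>
  let ?k = "Suc R + 2 * (R + 3)"
  obtain K where K: "\<forall>\<^sub>F n in sequentially. \<forall>u. a \<le> \<bar>u\<bar> \<and> \<bar>u\<bar> \<le> s n ^ (2 * (R + 3)) \<longrightarrow>
       cmod (mgf M (S n) (\<i> * complex_of_real u)) \<le> K / s n ^ ?k" using decay[OF a] by blast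
  have "\<forall>\<^sub>F n in sequentially. \<forall>t. a * B n \<le> \<bar>t\<bar> \<and> \<bar>t\<bar> \<le> B n ^ (R + 3) \<longrightarrow>
     cmod (char (distr M borel (W n)) t) \<le> (2 * (\<bar>K\<bar> * 2 ^ ?k)) / B n ^ Suc R * (1 / (1 + t\<^sup>2))"
    using K eventually_B[of 4] eventually_s_ge[of 2]
  proof eventually_elim
    case (elim n)
    then have B: "4 \<le> B n" "B n \<le> 2 * s n" and s2: "2 \<le> s n" by auto
    show ?case
    proof (intro allI impI)
      fix t assume t: "a * B n \<le> \<bar>t\<bar> \<and> \<bar>t\<bar> \<le> B n ^ (R + 3)"
      have u1: "a \<le> \<bar>t / B n\<bar>" using t B by (simp add: abs_divide le_divide_eq)
      have "\<bar>t / B n\<bar> \<le> \<bar>t\<bar> / 1" unfolding abs_divide using B by (intro divide_left_mono) auto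
      also have "\<dots> \<le> B n ^ (R + 3)" using t by simp
      \<comment> \<open>B n is at most 2 s n, hence at most (s n)^2; this is why
        \<open>decay\<close> is called with a doubled exponent.\<close>
      also have "\<dots> \<le> (s n * s n) ^ (R + 3)"
      proof (rule power_mono)
        have "2 * s n \<le> s n * s n" using s2 by (intro mult_right_mono) auto
        then show "B n \<le> s n * s n" using B by linarith
      qed (use B in simp)
      also have "\<dots> = s n ^ (2 * (R + 3))" by (simp only: power_mult power2_eq_square)
      finally have u2: "\<bar>t / B n\<bar> \<le> s n ^ (2 * (R + 3))" .
      have "cmod (char (distr M borel (W n)) t) \<le> K / s n ^ ?k"
        unfolding cmod_char_W using elim u1 u2 by blast
      also have "\<dots> \<le> \<bar>K\<bar> / (B n / 2) ^ ?k"
      proof (rule frac_le)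
        show "(B n / 2) ^ ?k \<le> s n ^ ?k" by (rule power_mono) (use B in auto)
        show "0 < (B n / 2) ^ ?k" using B by simp
      qed auto
      also have "\<dots> = (\<bar>K\<bar> * 2 ^ ?k) / B n ^ Suc R * (1 / (B n ^ (R + 3))\<^sup>2)"
      proof -
        have "B n ^ ?k = B n ^ Suc R * (B n ^ (R + 3))\<^sup>2"
          unfolding power_mult[symmetric] power_add[symmetric] by (simp add: mult.commute)
        then show ?thesis unfolding power_divide by simp
      qed
      also have "\<dots> \<le> (\<bar>K\<bar> * 2 ^ ?k) / B n ^ Suc R * (2 / (1 + t\<^sup>2))"
      proof (rule mult_left_mono)
        have "\<bar>t\<bar>\<^sup>2 \<le> (B n ^ (R + 3))\<^sup>2" by (rule power_mono) (use t in auto)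
        moreover have "1 \<le> (B n ^ (R + 3))\<^sup>2" using B by (intro one_le_power) auto
        ultimately have le: "1 + t\<^sup>2 \<le> 2 * (B n ^ (R + 3))\<^sup>2" by simp
        have "0 < (B n ^ (R + 3))\<^sup>2" using B by simp
        moreover have "0 < 1 + t\<^sup>2" by (simp add: add_pos_nonneg)
        ultimately have "2 / (2 * (B n ^ (R + 3))\<^sup>2) \<le> 2 / (1 + t\<^sup>2)" by (intro divide_left_mono[OF le]) auto
        then show "1 / (B n ^ (R + 3))\<^sup>2 \<le> 2 / (1 + t\<^sup>2)" by simp
        show "0 \<le> (\<bar>K\<bar> * 2 ^ ?k) / B n ^ Suc R" using B by simp
      qed
      finally show "cmod (char (distr M borel (W n)) t) \<le> (2 * (\<bar>K\<bar> * 2 ^ ?k)) / B n ^ Suc R * (1 / (1 + t\<^sup>2))"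
        by (simp only: times_divide_eq_left times_divide_eq_right mult_1_right mult.commute[of 2])
    qed
  qed
  then show ?thesis by (intro exI[of _ "2 * (\<bar>K\<bar> * 2 ^ ?k)"] conjI) simp_all
qed

text \<open>On this range the argument y of the smoothing factor is at least \<beta>, so powers of
  \<beta> and of t are bounded by powers of y, which the Gaussian in y absorbs.\<close>

lemma gauss_far:
  "\<exists>K\<ge>0. \<forall>\<beta> t :: real. 1 \<le> \<beta> \<longrightarrow> \<beta> ^ (R + 3) \<le> \<bar>t\<bar> \<longrightarrow>
     exp (- (1 / \<beta> ^ Suc R * t)\<^sup>2 / 2) \<le> K / \<beta> ^ Suc R * (1 / (1 + t\<^sup>2))" for R :: nat
proof -
  \<comment> \<open>With p = \<beta>^(R + 1), t^2 p equals y^2 p^3, and p is at most y^(R +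
    1).\<close>
  let ?q = "2 + 3 * Suc R"
  obtain K where K: "0 \<le> K" "\<And>y::real. (1 + \<bar>y\<bar>) ^ ?q * exp (- (1/2 * y\<^sup>2)) \<le> K"
    using poly_exp_bounded[of "1/2" ?q] half_gt_zero[OF zero_less_one] by blast
  have "exp (- (1 / \<beta> ^ Suc R * t)\<^sup>2 / 2) \<le> (2 * K) / \<beta> ^ Suc R * (1 / (1 + t\<^sup>2))" if \<beta>: "1 \<le> \<beta>" and t: "\<beta> ^ (R + 3) \<le> \<bar>t\<bar>" for \<beta> t :: real
  proof -
    define p where "p = \<beta> ^ Suc R"
    define y where "y = \<bar>t\<bar> / p"
    have p1: "1 \<le> p" unfolding p_def using \<beta> by (intro one_le_power)
    have "\<beta> * p \<le> \<beta> * \<beta> * p" using \<beta> p1 by simp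
    also have "\<dots> = \<beta> ^ (R + 3)" by (simp add: p_def power_add power3_eq_cube mult_ac)
    also note t
    finally have "\<beta> * p \<le> \<bar>t\<bar>" .
    then have "\<beta> \<le> y" using p1 by (simp add: y_def le_divide_eq)
    have y1: "1 \<le> y" using \<open>\<beta> \<le> y\<close> \<beta> by linarith
    have ty: "t\<^sup>2 = y\<^sup>2 * p\<^sup>2" using p1 by (simp add: y_def power_divide)
    have py: "p \<le> y ^ Suc R" unfolding p_def using \<open>\<beta> \<le> y\<close> \<beta> by (intro power_mono) auto
    have e: "(1 / \<beta> ^ Suc R * t)\<^sup>2 / 2 = 1/2 * y\<^sup>2" unfolding p_def[symmetric] y_def by (simp add: power_divide)
    have "y\<^sup>2 * p ^ 3 \<le> y\<^sup>2 * (y ^ Suc R) ^ 3" using py p1 by (intro mult_left_mono power_mono) auto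
    also have "\<dots> = y ^ ?q" by (simp only: power_add power_mult[symmetric] mult.commute)
    also have "\<dots> \<le> (1 + \<bar>y\<bar>) ^ ?q" using y1 by (intro power_mono) auto
    finally have "y\<^sup>2 * p ^ 3 * exp (- (1/2 * y\<^sup>2)) \<le> (1 + \<bar>y\<bar>) ^ ?q * exp (- (1/2 * y\<^sup>2))" by (intro mult_right_mono) auto
    also have "\<dots> \<le> K" by (rule K)
    finally have *: "t\<^sup>2 * p * exp (- (1/2 * y\<^sup>2)) \<le> K" unfolding ty by (simp add: power3_eq_cube power2_eq_square mult_ac)
    have "1 \<le> y * p" using y1 p1 mult_mono[of 1 y 1 p] by simp
    then have "1 \<le> (y * p)\<^sup>2" by (rule one_le_power)
    then have "1 + t\<^sup>2 \<le> 2 * t\<^sup>2" unfolding ty power_mult_distrib by linarith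
    then have "(1 + t\<^sup>2) * (p * exp (- (1/2 * y\<^sup>2))) \<le> 2 * t\<^sup>2 * (p * exp (- (1/2 * y\<^sup>2)))"
      by (rule mult_right_mono) (use p1 in simp)
    also have "\<dots> = 2 * (t\<^sup>2 * p * exp (- (1/2 * y\<^sup>2)))" by simp
    also have "\<dots> \<le> 2 * K" using * by linarith
    finally have "exp (- (1/2 * y\<^sup>2)) * ((1 + t\<^sup>2) * p) \<le> 2 * K" by (simp only: mult_ac)
    moreover have "0 < (1 + t\<^sup>2) * p" using p1 by (intro mult_pos_pos add_pos_nonneg) auto
    ultimately have "exp (- (1/2 * y\<^sup>2)) \<le> 2 * K / ((1 + t\<^sup>2) * p)" by (simp only: pos_le_divide_eq)
    also have "\<dots> = (2 * K) / p * (1 / (1 + t\<^sup>2))" by (simp add: mult.commute)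
    finally show ?thesis unfolding p_def[symmetric] using e unfolding p_def[symmetric] by simp
  qed
  then show ?thesis using K(1) by (intro exI[of _ "2 * K"]) auto
qed

text \<open>In the central range the error splits into c - \<psi>, controlled by the Taylor
  estimate, and c (1 - g), where 1 - g is of order t^2 / B^(R + 1). Elsewhere the smoothed
  characteristic function and its approximation are small separately. The majorant 1 / (1 + t^2) is
  the same throughout, so that one integral finishes the inversion.\<close>

lemma fourier_comparison:
  "\<exists>K\<ge>0. \<forall>\<^sub>F n in sequentially. \<forall>t. cmod (char (distr M borel (W n)) t * of_real (exp (- (1 / B n ^ Suc R * t)\<^sup>2 / 2)) - fourier_approx R n t)
     \<le> K / B n ^ Suc R * (1 / (1 + t\<^sup>2))"
proof -
  from char_W_near[of R] obtain K1 where KK: "0 \<le> K1 \<and> (\<exists>\<eta>>0. \<forall>\<^sub>F n in sequentially. \<forall>t. (1 + \<bar>t\<bar>) ^ 3 \<le> \<eta> * B n \<longrightarrow>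
     cmod (char (distr M borel (W n)) t - fourier_approx R n t) \<le> K1 * ((1 + \<bar>t\<bar>) ^ 3 / B n) ^ Suc R * exp (- t\<^sup>2 / 2))"
    by (rule exE)
  note K1 = conjunct1[OF KK] and K1' = conjunct2[OF KK]
  from K1' obtain \<eta> where \<eta>: "0 < \<eta>" and near: "\<forall>\<^sub>F n in sequentially. \<forall>t. (1 + \<bar>t\<bar>) ^ 3 \<le> \<eta> * B n \<longrightarrow>
     cmod (char (distr M borel (W n)) t - fourier_approx R n t) \<le> K1 * ((1 + \<bar>t\<bar>) ^ 3 / B n) ^ Suc R * exp (- t\<^sup>2 / 2)"
    by (elim exE conjE) (rule that)
  from char_W_gauss obtain a where a: "0 < a" and ga: "\<forall>\<^sub>F n in sequentially. \<forall>t. \<bar>t\<bar> \<le> a * B n \<longrightarrow> cmod (char (distr M borel (W n)) t) \<le> exp (- t\<^sup>2 / 8)"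
    by (elim exE conjE) (rule that)
  from char_W_middle[OF a, of R] obtain K2 where K2: "0 \<le> K2" and mid: "\<forall>\<^sub>F n in sequentially. \<forall>t. a * B n \<le> \<bar>t\<bar> \<and> \<bar>t\<bar> \<le> B n ^ (R + 3) \<longrightarrow>
     cmod (char (distr M borel (W n)) t) \<le> K2 / B n ^ Suc R * (1 / (1 + t\<^sup>2))"
    by (elim exE conjE) (rule that)
  from gauss_far[of R] obtain K3 where K3: "0 \<le> K3" and far': "\<forall>\<beta> t :: real. 1 \<le> \<beta> \<longrightarrow> \<beta> ^ (R + 3) \<le> \<bar>t\<bar> \<longrightarrow>
     exp (- (1 / \<beta> ^ Suc R * t)\<^sup>2 / 2) \<le> K3 / \<beta> ^ Suc R * (1 / (1 + t\<^sup>2))"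
    by (elim exE conjE) (rule that)
  note far = far'[rule_format]
  from fourier_approx_le[of R] obtain K4 where K4: "0 \<le> K4" and app': "\<forall>n t. 1 \<le> B n \<longrightarrow> cmod (fourier_approx R n t) \<le> K4 * (1 + \<bar>t\<bar>) ^ (3 * R) * exp (- t\<^sup>2 / 2)"
    by (elim exE conjE) (rule that)
  note app = app'[rule_format]
  define k where "k = 3 * Suc R + 3 * R + 2"
  have k: "2 \<le> k" "3 * Suc R \<le> k" "3 * Suc R + 3 * R \<le> k" by (simp_all add: k_def)
  from poly_gauss_le_inverse_sq[of k] obtain L where L: "0 \<le> L" and L'': "\<forall>(j::nat) (t::real) (c::real). j \<le> k \<longrightarrow> 0 < c \<longrightarrow> c \<le> 8 \<longrightarrow>
      (1 + \<bar>t\<bar>) ^ j * exp (- t\<^sup>2 / c) \<le> L * (1 / (1 + t\<^sup>2))"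
    by (elim exE conjE) (rule that)
  note L' = L''[rule_format]
  define e where "e = min \<eta> a"
  define Q where "Q = 1 / e ^ Suc R"
  have e: "0 < e" "e \<le> \<eta>" "e \<le> a" using \<eta> a by (auto simp: e_def)
  have Q: "0 \<le> Q" using e by (simp add: Q_def)
  define K where "K = K1 * L + L + Q * (L + K4 * L) + K2 + K3"
  have pt: "cmod (char (distr M borel (W n)) t * of_real (exp (- (1 / B n ^ Suc R * t)\<^sup>2 / 2)) - fourier_approx R n t)
     \<le> K / B n ^ Suc R * (1 / (1 + t\<^sup>2))"
    if near': "\<forall>t. (1 + \<bar>t\<bar>) ^ 3 \<le> \<eta> * B n \<longrightarrow>
     cmod (char (distr M borel (W n)) t - fourier_approx R n t) \<le> K1 * ((1 + \<bar>t\<bar>) ^ 3 / B n) ^ Suc R * exp (- t\<^sup>2 / 2)"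
    and ga': "\<forall>t. \<bar>t\<bar> \<le> a * B n \<longrightarrow> cmod (char (distr M borel (W n)) t) \<le> exp (- t\<^sup>2 / 8)"
    and mid': "\<forall>t. a * B n \<le> \<bar>t\<bar> \<and> \<bar>t\<bar> \<le> B n ^ (R + 3) \<longrightarrow>
     cmod (char (distr M borel (W n)) t) \<le> K2 / B n ^ Suc R * (1 / (1 + t\<^sup>2))"
    and B1: "1 \<le> B n" for n t
  proof -
      define p where "p = B n ^ Suc R"
      define w where "w = 1 / (1 + t\<^sup>2)"
      define c where "c = char (distr M borel (W n)) t"
      define g where "g = exp (- (1 / p * t)\<^sup>2 / 2)"
      define \<psi> where "\<psi> = fourier_approx R n t"
      have p1: "1 \<le> p" unfolding p_def using B1 by (intro one_le_power)
      have w0: "0 \<le> w" by (simp add: w_def add_nonneg_nonneg)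
      have wp: "0 \<le> w / p" using w0 p1 by simp
      have g1: "g \<le> 1" "0 \<le> g" by (simp_all add: g_def)
      have goal: "cmod (c * of_real g - \<psi>) \<le> K * (w / p)"
      proof (cases "(1 + \<bar>t\<bar>) ^ 3 \<le> e * B n")
        case True
        have t3: "(1 + \<bar>t\<bar>) ^ 3 \<le> \<eta> * B n"
          using True mult_right_mono[of e \<eta> "B n"] e B1 by linarith
        have ta: "\<bar>t\<bar> \<le> a * B n"
        proof -
          have "\<bar>t\<bar> \<le> (1 + \<bar>t\<bar>) ^ 1" by simp
          also have "\<dots> \<le> (1 + \<bar>t\<bar>) ^ 3" by (rule power_increasing) auto
          also have "\<dots> \<le> a * B n" using True mult_right_mono[of e a "B n"] e B1 by linarith
          finally show ?thesis .
        qed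
        have 1: "cmod (c - \<psi>) \<le> K1 * L * (w / p)"
        proof -
          have "cmod (c - \<psi>) \<le> K1 * ((1 + \<bar>t\<bar>) ^ 3 / B n) ^ Suc R * exp (- t\<^sup>2 / 2)"
            unfolding c_def \<psi>_def using near' t3 by blast
          also have "\<dots> = K1 / p * ((1 + \<bar>t\<bar>) ^ (3 * Suc R) * exp (- t\<^sup>2 / 2))"
            by (simp only: power_divide power_mult p_def times_divide_eq_left times_divide_eq_right mult.assoc)
          also have "\<dots> \<le> K1 / p * (L * (1 / (1 + t\<^sup>2)))"
            using K1 p1 by (intro mult_left_mono L' k) simp_all
          finally show ?thesis by (simp add: w_def mult_ac)
        qed
        have 2: "cmod c * (1 - g) \<le> L * (w / p)"
        proof -
          have gg: "1 - g \<le> 1 / p * (1 + \<bar>t\<bar>) ^ 2"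
          proof -
            have "1 - g \<le> (1 / p * t)\<^sup>2 / 2" using exp_ge_add_one_self[of "- (1 / p * t)\<^sup>2 / 2"] by (simp add: g_def)
            also have "\<dots> \<le> (1 / p * t)\<^sup>2" by simp
            also have "\<dots> = 1 / p * (1 / p * t\<^sup>2)" by (simp add: power_divide power2_eq_square)
            also have "\<dots> \<le> 1 / p * (1 * (1 + \<bar>t\<bar>) ^ 2)"
            proof (intro mult_left_mono mult_mono)
              have "\<bar>t\<bar>\<^sup>2 \<le> (1 + \<bar>t\<bar>)\<^sup>2" by (rule power_mono) auto
              then show "t\<^sup>2 \<le> (1 + \<bar>t\<bar>)\<^sup>2" by simp
            qed (use p1 in auto)
            finally show ?thesis by simp
          qed
          have "cmod c \<le> exp (- t\<^sup>2 / 8)" unfolding c_def using ga' ta by blast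
          then have "cmod c * (1 - g) \<le> exp (- t\<^sup>2 / 8) * (1 / p * (1 + \<bar>t\<bar>) ^ 2)"
            using gg g1 by (intro mult_mono) auto
          also have "\<dots> = 1 / p * ((1 + \<bar>t\<bar>) ^ 2 * exp (- t\<^sup>2 / 8))" by simp
          also have "\<dots> \<le> 1 / p * (L * (1 / (1 + t\<^sup>2)))" using p1 by (intro mult_left_mono L' k) simp_all
          finally show ?thesis by (simp add: w_def mult_ac)
        qed
        have "c * of_real g - \<psi> = (c - \<psi>) - c * of_real (1 - g)" by (simp add: algebra_simps)
        then have "cmod (c * of_real g - \<psi>) \<le> cmod (c - \<psi>) + cmod (c * of_real (1 - g))"
          using norm_triangle_ineq4 by metis
        also have "cmod (c * of_real (1 - g)) = cmod c * (1 - g)" using g1 by (simp only: norm_mult norm_of_real abs_of_nonneg diff_ge_0_iff_ge)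
        finally have "cmod (c * of_real g - \<psi>) \<le> (K1 * L + L) * (w / p)" using 1 2 by (simp only: distrib_right)
        also have "\<dots> \<le> K * (w / p)"
          unfolding K_def using Q L K4 K2 K3 by (intro mult_right_mono wp) simp
        finally show ?thesis .
      next
        case False
        then have big: "e * B n \<le> (1 + \<bar>t\<bar>) ^ 3" by simp
        \<comment> \<open>Outside the central range this factor may be inserted into any bound with
          Gaussian decay: it carries the wanted rate 1 / p, and its polynomial growth in t is
          harmless.\<close>
        have one: "1 \<le> Q / p * (1 + \<bar>t\<bar>) ^ (3 * Suc R)"
        proof -
          have "(e * B n) ^ Suc R \<le> ((1 + \<bar>t\<bar>) ^ 3) ^ Suc R" by (rule power_mono[OF big]) (use e B1 in simp)
          then have "e ^ Suc R * p \<le> (1 + \<bar>t\<bar>) ^ (3 * Suc R)" by (simp only: power_mult power_mult_distrib p_def)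
          moreover have "0 < e ^ Suc R * p" using e p1 by simp
          ultimately have "1 \<le> (1 + \<bar>t\<bar>) ^ (3 * Suc R) / (e ^ Suc R * p)" by (simp only: le_divide_eq_1_pos)
          then show ?thesis by (simp add: Q_def)
        qed
        have \<psi>: "cmod \<psi> \<le> Q * (K4 * L) * (w / p)"
        proof -
          have "cmod \<psi> \<le> K4 * (1 + \<bar>t\<bar>) ^ (3 * R) * exp (- t\<^sup>2 / 2)" unfolding \<psi>_def by (rule app[OF B1])
          also have "\<dots> \<le> (Q / p * (1 + \<bar>t\<bar>) ^ (3 * Suc R)) * (K4 * (1 + \<bar>t\<bar>) ^ (3 * R) * exp (- t\<^sup>2 / 2))"
            using mult_right_mono[OF one, of "K4 * (1 + \<bar>t\<bar>) ^ (3 * R) * exp (- t\<^sup>2 / 2)"] K4 by simp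
          also have "\<dots> = Q / p * K4 * ((1 + \<bar>t\<bar>) ^ (3 * Suc R + 3 * R) * exp (- t\<^sup>2 / 2))"
            by (simp only: power_add mult_ac)
          also have "\<dots> \<le> Q / p * K4 * (L * (1 / (1 + t\<^sup>2)))"
            using Q p1 K4 by (intro mult_left_mono L' k) simp_all
          finally show ?thesis by (simp add: w_def mult_ac)
        qed
        have cg: "cmod (c * of_real g) \<le> (Q * L + K2 + K3) * (w / p)"
        proof -
          have cgl: "cmod (c * of_real g) = cmod c * g" using g1 by (simp only: norm_mult norm_of_real abs_of_nonneg)
          consider "\<bar>t\<bar> \<le> a * B n" | "a * B n \<le> \<bar>t\<bar>" "\<bar>t\<bar> \<le> B n ^ (R + 3)" | "B n ^ (R + 3) \<le> \<bar>t\<bar>" by linarith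
          then show ?thesis
          proof cases
            case 1
            have "cmod c * g \<le> exp (- t\<^sup>2 / 8) * 1"
              using ga'[rule_format, OF 1] g1 unfolding c_def by (intro mult_mono) simp_all
            also have "\<dots> \<le> (Q / p * (1 + \<bar>t\<bar>) ^ (3 * Suc R)) * exp (- t\<^sup>2 / 8)"
              using mult_right_mono[OF one, of "exp (- t\<^sup>2 / 8)"] by simp
            also have "\<dots> = Q / p * ((1 + \<bar>t\<bar>) ^ (3 * Suc R) * exp (- t\<^sup>2 / 8))" by (simp only: mult.assoc)
            also have "\<dots> \<le> Q / p * (L * (1 / (1 + t\<^sup>2)))" using Q p1 by (intro mult_left_mono L' k) simp_all
            also have "\<dots> = Q * L * (w / p)" by (simp add: w_def)
            also have "\<dots> \<le> (Q * L + K2 + K3) * (w / p)" using K2 K3 by (intro mult_right_mono wp) simp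
            finally show ?thesis unfolding cgl .
          next
            case 2
            have "cmod c * g \<le> cmod c * 1" using g1 by (intro mult_left_mono) auto
            also have "\<dots> \<le> K2 / p * w" using mid' 2 unfolding c_def p_def w_def by (simp only: mult_1_right simp_thms)
            also have "\<dots> \<le> (Q * L + K2 + K3) * (w / p)"
              using mult_right_mono[OF _ wp, of K2 "Q * L + K2 + K3"] Q L K3 by simp
            finally show ?thesis unfolding cgl .
          next
            case 3
            have "cmod c * g \<le> 1 * g" unfolding c_def using g1 by (intro mult_right_mono cmod_char_W_le_1) simp_all
            also have "\<dots> \<le> K3 / p * w" using far[OF B1 3] unfolding g_def p_def w_def by (simp only: mult_1)
            also have "\<dots> \<le> (Q * L + K2 + K3) * (w / p)"
              using mult_right_mono[OF _ wp, of K3 "Q * L + K2 + K3"] Q L K2 by simp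
            finally show ?thesis unfolding cgl .
          qed
        qed
        have "cmod (c * of_real g - \<psi>) \<le> (Q * L + K2 + K3) * (w / p) + Q * (K4 * L) * (w / p)"
          by (rule order_trans[OF norm_triangle_ineq4 add_mono[OF cg \<psi>]])
        also have "\<dots> = ((Q * L + K2 + K3) + Q * (K4 * L)) * (w / p)" by (simp only: distrib_right)
        also have "\<dots> \<le> K * (w / p)"
          unfolding K_def using K1 L by (intro mult_right_mono wp) (simp add: distrib_left)
        finally show ?thesis .
      qed
      have "K * (w / p) = K / p * w" by simp
      then show ?thesis
        using goal unfolding c_def g_def \<psi>_def p_def w_def by metis
  qed
  have "\<forall>\<^sub>F n in sequentially. \<forall>t. cmod (char (distr M borel (W n)) t * of_real (exp (- (1 / B n ^ Suc R * t)\<^sup>2 / 2)) - fourier_approx R n t)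
     \<le> K / B n ^ Suc R * (1 / (1 + t\<^sup>2))"
  proof (rule eventually_mono[OF eventually_conj[OF near eventually_conj[OF ga eventually_conj[OF mid eventually_B[of 1]]]]], elim conjE, rule allI)
    fix n t
    assume "\<forall>t. (1 + \<bar>t\<bar>) ^ 3 \<le> \<eta> * B n \<longrightarrow>
     cmod (char (distr M borel (W n)) t - fourier_approx R n t) \<le> K1 * ((1 + \<bar>t\<bar>) ^ 3 / B n) ^ Suc R * exp (- t\<^sup>2 / 2)"
      "\<forall>t. \<bar>t\<bar> \<le> a * B n \<longrightarrow> cmod (char (distr M borel (W n)) t) \<le> exp (- t\<^sup>2 / 8)"
      "\<forall>t. a * B n \<le> \<bar>t\<bar> \<and> \<bar>t\<bar> \<le> B n ^ (R + 3) \<longrightarrow>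
     cmod (char (distr M borel (W n)) t) \<le> K2 / B n ^ Suc R * (1 / (1 + t\<^sup>2))" "1 \<le> B n"
    then show "cmod (char (distr M borel (W n)) t * of_real (exp (- (1 / B n ^ Suc R * t)\<^sup>2 / 2)) - fourier_approx R n t)
     \<le> K / B n ^ Suc R * (1 / (1 + t\<^sup>2))" by (rule pt)
  qed
  moreover have "0 \<le> K" unfolding K_def using K1 K2 K3 K4 L Q by simp
  ultimately show ?thesis by blast
qed

end

section \<open>Comparison of distribution functions\<close>

lemma (in prob_space) cdf_tail:
  assumes Y[measurable]: "random_variable borel Y" and int: "integrable M (\<lambda>x. (1 + \<bar>Y x\<bar>) ^ k)"
    and K: "expectation (\<lambda>x. (1 + \<bar>Y x\<bar>) ^ k) \<le> K"
  shows "y \<le> 0 \<Longrightarrow> cdf (distr M borel Y) y \<le> K / (1 + \<bar>y\<bar>) ^ k"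
    and "0 \<le> y \<Longrightarrow> 1 - cdf (distr M borel Y) y \<le> K / (1 + \<bar>y\<bar>) ^ k"
proof -
  have mk: "measure M {x\<in>space M. (1 + \<bar>y\<bar>) ^ k \<le> (1 + \<bar>Y x\<bar>) ^ k} \<le> K / (1 + \<bar>y\<bar>) ^ k"
  proof -
    have "measure M {x\<in>space M. (1 + \<bar>y\<bar>) ^ k \<le> (1 + \<bar>Y x\<bar>) ^ k} \<le> expectation (\<lambda>x. (1 + \<bar>Y x\<bar>) ^ k) / (1 + \<bar>y\<bar>) ^ k"
      by (rule integral_Markov_inequality_measure[OF int sets.top]) auto
    also have "\<dots> \<le> K / (1 + \<bar>y\<bar>) ^ k" by (intro divide_right_mono K) auto
    finally show ?thesis .
  qed
  have F: "cdf (distr M borel Y) y = measure M {x\<in>space M. Y x \<le> y}"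
    by (simp add: cdf_def measure_distr vimage_def Int_def conj_commute)
  show "y \<le> 0 \<Longrightarrow> cdf (distr M borel Y) y \<le> K / (1 + \<bar>y\<bar>) ^ k"
    unfolding F by (rule order_trans[OF finite_measure_mono mk]) (auto intro!: power_mono)
  have "1 - measure M {x\<in>space M. Y x \<le> y} = measure M {x\<in>space M. \<not> Y x \<le> y}"
    by (subst prob_neg) auto
  moreover have "0 \<le> y \<Longrightarrow> measure M {x\<in>space M. \<not> Y x \<le> y} \<le> K / (1 + \<bar>y\<bar>) ^ k"
    by (rule order_trans[OF finite_measure_mono mk]) (auto intro!: power_mono)
  ultimately show "0 \<le> y \<Longrightarrow> 1 - cdf (distr M borel Y) y \<le> K / (1 + \<bar>y\<bar>) ^ k"
    unfolding F by simp
qed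

lemma cdf_std_normal_tail:
  "\<exists>K\<ge>0. \<forall>y. (y \<le> 0 \<longrightarrow> cdf std_normal_distribution y \<le> K / (1 + \<bar>y\<bar>) ^ k) \<and>
     (0 \<le> y \<longrightarrow> 1 - cdf std_normal_distribution y \<le> K / (1 + \<bar>y\<bar>) ^ k)"
proof -
  interpret real_distribution std_normal_distribution by (rule real_dist_normal_dist)
  let ?K = "expectation (\<lambda>x. (1 + \<bar>x\<bar>) ^ k)"
  have abs: "integrable std_normal_distribution (\<lambda>x. \<bar>x\<bar> ^ j)" for j
    using integrable_abs[OF integrable_std_normal_distribution_moment[of j]] by (simp add: power_abs)
  have int: "integrable std_normal_distribution (\<lambda>x. (1 + \<bar>x\<bar>) ^ k)"
  proof -
    have "(1 + \<bar>x\<bar>) ^ k = (\<Sum>j\<le>k. of_nat (k choose j) * \<bar>x\<bar> ^ j)" for x :: real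
      using binomial_ring[of "\<bar>x\<bar>" 1 k] by (simp add: add.commute)
    then show ?thesis using abs by (simp add: Bochner_Integration.integrable_sum)
  qed
  have id: "distr std_normal_distribution borel (\<lambda>x. x) = std_normal_distribution"
    by (rule distr_id2) simp
  have "random_variable borel (\<lambda>x::real. x)" by simp
  note t = cdf_tail[OF this int order_refl, unfolded id]
  show ?thesis by (intro exI[of _ ?K] conjI allI impI) (use t in auto)
qed

lemma poly_density_le:
  "\<exists>K\<ge>0. \<forall>x. std_normal_density x * \<bar>poly p x\<bar> \<le> K / (1 + \<bar>x\<bar>) ^ k" for p :: "real poly"
proof -
  let ?q = "map_poly complex_of_real p"
  define d where "d = degree ?q"
  \<comment> \<open>The index runs up to \<open>Suc d\<close>, where the coefficient is 0, so that
    \<open>c\<close> is nonnegative and bounds all vanishing coefficients too.\<close>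
  define c where "c = Max ((\<lambda>i. cmod (coeff ?q i)) ` {..Suc d})"
  have c: "cmod (coeff ?q i) \<le> c" for i
  proof (cases "i \<le> Suc d")
    case True then show ?thesis unfolding c_def by (intro Max_ge) auto
  next
    case False
    have "cmod (coeff ?q (Suc d)) \<le> c" unfolding c_def by (intro Max_ge) auto
    then show ?thesis using False by (simp add: d_def coeff_eq_0)
  qed
  have "\<bar>poly p x\<bar> \<le> (real d + 1) * c * (1 + \<bar>x\<bar>) ^ d" for x
  proof -
    have "poly ?q (of_real x) = of_real (poly p x)"
      by (induction p) (simp_all add: map_poly_pCons)
    then have "\<bar>poly p x\<bar> = cmod (poly ?q (of_real x))" by simp
    also have "\<dots> \<le> (real d + 1) * c * (1 + cmod (of_real x)) ^ d" by (rule cmod_poly_le[OF c]) (simp add: d_def)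
    finally show ?thesis by simp
  qed
  moreover obtain L where L: "0 \<le> L" "\<And>t::real. (1 + \<bar>t\<bar>) ^ (d + k) * exp (- (1/2 * t\<^sup>2)) \<le> L"
  proof -
    have "0 < (1/2::real)" by simp
    from poly_exp_bounded[OF this, of "d + k"] show ?thesis by (elim exE conjE) (rule that, auto)
  qed
  ultimately have *: "std_normal_density x * \<bar>poly p x\<bar> \<le> ((real d + 1) * c * L) / (1 + \<bar>x\<bar>) ^ k" for x
  proof -
    have c0: "0 \<le> (real d + 1) * c" using order_trans[OF norm_ge_zero c[of 0]] by simp
    have "std_normal_density x \<le> exp (- (1/2 * x\<^sup>2))"
    proof -
      have "1 \<le> sqrt (2 * pi)" using pi_gt3 by (simp add: real_le_rsqrt)
      then have "1 / sqrt (2 * pi) \<le> 1" by simp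
      then have "1 / sqrt (2 * pi) * exp (- x\<^sup>2 / 2) \<le> 1 * exp (- x\<^sup>2 / 2)" by (rule mult_right_mono) simp
      then show ?thesis by (simp add: std_normal_density_def)
    qed
    then have "std_normal_density x * \<bar>poly p x\<bar> \<le> exp (- (1/2 * x\<^sup>2)) * ((real d + 1) * c * (1 + \<bar>x\<bar>) ^ d)"
      using \<open>\<And>x. \<bar>poly p x\<bar> \<le> (real d + 1) * c * (1 + \<bar>x\<bar>) ^ d\<close> by (intro mult_mono) auto
    then have "std_normal_density x * \<bar>poly p x\<bar> * (1 + \<bar>x\<bar>) ^ k
       \<le> exp (- (1/2 * x\<^sup>2)) * ((real d + 1) * c * (1 + \<bar>x\<bar>) ^ d) * (1 + \<bar>x\<bar>) ^ k" by (rule mult_right_mono) simp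
    also have "\<dots> = (real d + 1) * c * ((1 + \<bar>x\<bar>) ^ (d + k) * exp (- (1/2 * x\<^sup>2)))"
      by (simp only: power_add mult_ac)
    also have "\<dots> \<le> (real d + 1) * c * L" by (rule mult_left_mono[OF L(2) c0])
    finally show ?thesis by (subst pos_le_divide_eq) auto
  qed
  have "0 \<le> (real d + 1) * c * L" using order_trans[OF norm_ge_zero c[of 0]] L by simp
  then show ?thesis using * by blast
qed

text \<open>The term (i t)^(l + 1) times the Gaussian is the transform of
  \<open>hermite (Suc l)\<close> times the density, whose antiderivative is minus
  \<open>hermite l\<close> times the density; hence the shift of the index and the sign.\<close>

definition edgeworth_coeff :: "nat \<Rightarrow> nat \<Rightarrow> (nat \<Rightarrow> complex) \<Rightarrow> complex" where
  "edgeworth_coeff j i v = (\<Sum>l<3 * j. coeff (exp_coeff v j) (Suc l) * complex_of_real (- coeff (hermite l) i))"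

lemma edgeworth_coeff_poly_fun: "edgeworth_coeff j i \<in> poly_funs"
  unfolding edgeworth_coeff_def[abs_def]
  using poly_fun_coeffs_exp_coeff[of j]
  by (intro poly_funs_sum poly_funs.mult poly_funs.const) (auto simp: poly_fun_coeffs_def)

lemma degree_hermite: "degree (hermite l) \<le> l"
proof (induction l)
  case (Suc l)
  have "degree ([:0, 1:] * hermite l) \<le> Suc l"
    by (rule order_trans[OF degree_mult_le]) (use Suc in simp)
  moreover have "degree (pderiv (hermite l)) \<le> Suc l"
    using Suc by (simp add: degree_pderiv)
  ultimately show ?case unfolding hermite.simps by (rule degree_diff_le)
qed simp

section \<open>The Edgeworth polynomials and the density of the expansion\<close>

context edgeworth_normalized
begin

definition real_coeff :: "nat \<Rightarrow> nat \<Rightarrow> nat \<Rightarrow> real" where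
  "real_coeff j n l = Re (coeff (exp_coeff (vars n) j) l)"

definition H :: "nat \<Rightarrow> nat \<Rightarrow> real poly" where
  "H j n = (\<Sum>l<3 * j. smult (- real_coeff j n (Suc l)) (hermite l))"

text \<open>Written with Hermite polynomials so that antiderivative and Fourier transform can both
  be read off term by term.\<close>

definition dens :: "nat \<Rightarrow> nat \<Rightarrow> real \<Rightarrow> real" where
  "dens R n x = std_normal_density x + (\<Sum>j=1..R. (\<Sum>l<3 * j. real_coeff j n (Suc l) * (poly (hermite (Suc l)) x * std_normal_density x)) / B n ^ j)"

lemma real_coeff: "complex_of_real (real_coeff j n l) = coeff (exp_coeff (vars n) j) l"
proof -
  have "coeff (exp_coeff (vars n) j) l \<in> \<real>"
    unfolding vars_def by (rule Reals_exp_coeff) (rule edgeworth_vars_real | assumption)+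
  then show ?thesis by (simp add: real_coeff_def)
qed

lemma H_coeff: "complex_of_real (coeff (H j n) i) = edgeworth_coeff j i (vars n)"
  by (simp add: H_def edgeworth_coeff_def coeff_sum real_coeff)

lemma degree_H: "degree (H j n) \<le> 3 * j"
  unfolding H_def
proof (intro degree_sum_le order_trans[OF degree_smult_le])
  show "degree (hermite l) \<le> 3 * j" if "l \<in> {..<3 * j}" for l
    using degree_hermite[of l] that by simp
qed simp

lemma real_coeff_bounded: "\<exists>K\<ge>0. \<forall>n l. \<bar>real_coeff j n l\<bar> \<le> K"
proof -
  obtain K where K: "0 \<le> K" "\<And>n l. cmod (coeff (exp_coeff (vars n) j) l) \<le> K" using exp_coeff_bounded[of j] by metis
  have "\<bar>real_coeff j n l\<bar> \<le> K" for n l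
    unfolding real_coeff_def by (rule order_trans[OF abs_Re_le_cmod K(2)])
  with K(1) show ?thesis by blast
qed

lemma H_bounded: "\<exists>K. \<forall>n i. \<bar>coeff (H j n) i\<bar> \<le> K"
proof -
  obtain K where K: "0 \<le> K" "\<And>n l. \<bar>real_coeff j n l\<bar> \<le> K" using real_coeff_bounded by metis
  define h where "h = Max ((\<lambda>(l, i). \<bar>coeff (hermite l) i\<bar>) ` ({..3 * j} \<times> {..Suc (3 * j)}))"
  have h: "\<bar>coeff (hermite l) i\<bar> \<le> h" if "l < 3 * j" for l i
  proof (cases "i \<le> Suc (3 * j)")
    case True then show ?thesis unfolding h_def using that by (intro Max_ge) force+
  next
    case False
    have "\<bar>coeff (hermite l) (Suc (3*j))\<bar> \<le> h" unfolding h_def using that by (intro Max_ge) force+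
    then have "0 \<le> h" by linarith
    moreover have "coeff (hermite l) i = 0" using False that degree_hermite[of l] by (intro coeff_eq_0) linarith
    ultimately show ?thesis by simp
  qed
  have "\<bar>coeff (H j n) i\<bar> \<le> (\<Sum>l<3 * j. K * h)" for n i
  proof -
    have "\<bar>coeff (H j n) i\<bar> \<le> (\<Sum>l<3 * j. \<bar>- real_coeff j n (Suc l) * coeff (hermite l) i\<bar>)"
      unfolding H_def coeff_sum coeff_smult by (rule sum_abs)
    also have "\<dots> \<le> (\<Sum>l<3 * j. K * h)"
      by (rule sum_mono) (auto simp: abs_mult intro!: mult_mono K h)
    finally show ?thesis .
  qed
  then show ?thesis by blast
qed

lemma H_density_le: "\<exists>K\<ge>0. \<forall>n x. std_normal_density x * \<bar>poly (H j n) x\<bar> \<le> K / (1 + \<bar>x\<bar>) ^ k"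
proof -
  obtain K where K: "0 \<le> K" "\<And>n l. \<bar>real_coeff j n l\<bar> \<le> K" using real_coeff_bounded by metis
  have "\<exists>L\<ge>0. \<forall>x. std_normal_density x * \<bar>poly (hermite l) x\<bar> \<le> L / (1 + \<bar>x\<bar>) ^ k" for l
    by (rule poly_density_le)
  then obtain L where L: "\<And>l. 0 \<le> L l" "\<And>l x. std_normal_density x * \<bar>poly (hermite l) x\<bar> \<le> L l / (1 + \<bar>x\<bar>) ^ k"
    by metis
  have "std_normal_density x * \<bar>poly (H j n) x\<bar> \<le> (\<Sum>l<3 * j. K * L l) / (1 + \<bar>x\<bar>) ^ k" for n x
  proof -
    have "\<bar>poly (H j n) x\<bar> \<le> (\<Sum>l<3 * j. \<bar>real_coeff j n (Suc l)\<bar> * \<bar>poly (hermite l) x\<bar>)"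
      unfolding H_def poly_sum poly_smult by (rule order_trans[OF sum_abs]) (simp add: abs_mult)
    then have "std_normal_density x * \<bar>poly (H j n) x\<bar> \<le> std_normal_density x * (\<Sum>l<3 * j. \<bar>real_coeff j n (Suc l)\<bar> * \<bar>poly (hermite l) x\<bar>)"
      by (rule mult_left_mono) simp
    also have "\<dots> = (\<Sum>l<3 * j. \<bar>real_coeff j n (Suc l)\<bar> * (std_normal_density x * \<bar>poly (hermite l) x\<bar>))"
      unfolding sum_distrib_left by (simp only: mult_ac)
    also have "\<dots> \<le> (\<Sum>l<3 * j. K * (L l / (1 + \<bar>x\<bar>) ^ k))"
      by (intro sum_mono mult_mono K L mult_nonneg_nonneg) (auto simp: normal_density_nonneg)
    also have "\<dots> = (\<Sum>l<3 * j. K * L l) / (1 + \<bar>x\<bar>) ^ k"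
      unfolding sum_divide_distrib by simp
    finally show ?thesis .
  qed
  moreover have "0 \<le> (\<Sum>l<3 * j. K * L l)" by (intro sum_nonneg mult_nonneg_nonneg K L)
  ultimately show ?thesis by blast
qed

lemma approx_has_derivative: "(edgeworth_approx B H R n has_real_derivative dens R n x) (at x)"
proof -
  have 1: "((\<lambda>x. std_normal_density x * (poly (H j n) x / B n ^ j)) has_real_derivative
     (\<Sum>l<3 * j. real_coeff j n (Suc l) * (poly (hermite (Suc l)) x * std_normal_density x)) / B n ^ j) (at x)" for j
  proof -
    have eq: "std_normal_density x * (poly (H j n) x / B n ^ j)
      = (\<Sum>l<3 * j. - real_coeff j n (Suc l) * (poly (hermite l) x * std_normal_density x)) / B n ^ j" for x
      by (simp add: H_def poly_sum sum_distrib_left sum_negf mult_ac)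
    have "((\<lambda>x. (\<Sum>l<3 * j. - real_coeff j n (Suc l) * (poly (hermite l) x * std_normal_density x)) / B n ^ j) has_real_derivative
      (\<Sum>l<3 * j. - real_coeff j n (Suc l) * - (poly (hermite (Suc l)) x * std_normal_density x)) / B n ^ j) (at x)"
      by (intro DERIV_cdivide DERIV_sum DERIV_cmult hermite_density_has_derivative)
    then show ?thesis unfolding eq by (simp only: minus_mult_minus)
  qed
  have "((\<lambda>x. cdf std_normal_distribution x + (\<Sum>j=1..R. std_normal_density x * (poly (H j n) x / B n ^ j))) has_real_derivative dens R n x) (at x)"
    unfolding dens_def by (intro DERIV_add cdf_std_normal_has_derivative DERIV_sum 1)
  then show ?thesis unfolding edgeworth_approx_def[abs_def] by (simp only: sum_distrib_left)
qed

lemma continuous_dens: "continuous_on X (dens R n)"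
  unfolding dens_def[abs_def] divide_inverse
  by (intro continuous_intros continuous_std_normal_density continuous_on_poly)

lemma dens_bounded: "\<exists>L\<ge>0. \<forall>n x. 1 \<le> B n \<longrightarrow> \<bar>dens R n x\<bar> \<le> L"
proof -
  obtain K where K: "\<And>j. 0 \<le> K j" "\<And>j n l. \<bar>real_coeff j n l\<bar> \<le> K j" using real_coeff_bounded by metis
  have "\<exists>L\<ge>0. \<forall>x. std_normal_density x * \<bar>poly (hermite l) x\<bar> \<le> L / (1 + \<bar>x\<bar>) ^ 0" for l
    by (rule poly_density_le)
  then obtain L where L: "\<And>l. 0 \<le> L l" "\<And>l x. std_normal_density x * \<bar>poly (hermite l) x\<bar> \<le> L l / (1 + \<bar>x\<bar>) ^ 0"
    by metis
  have "\<bar>dens R n x\<bar> \<le> 1 + (\<Sum>j=1..R. (\<Sum>l<3 * j. K j * L (Suc l)))" if B: "1 \<le> B n" for n x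
  proof -
    have 1: "\<bar>(\<Sum>l<3 * j. real_coeff j n (Suc l) * (poly (hermite (Suc l)) x * std_normal_density x)) / B n ^ j\<bar>
      \<le> (\<Sum>l<3 * j. K j * L (Suc l))" for j
    proof -
      have "\<bar>\<Sum>l<3 * j. real_coeff j n (Suc l) * (poly (hermite (Suc l)) x * std_normal_density x)\<bar> \<le> (\<Sum>l<3 * j. K j * L (Suc l))"
      proof (rule order_trans[OF sum_abs sum_mono])
        fix l
        have "\<bar>poly (hermite (Suc l)) x * std_normal_density x\<bar> = std_normal_density x * \<bar>poly (hermite (Suc l)) x\<bar>"
          by (simp only: abs_mult abs_of_nonneg[OF normal_density_nonneg] mult.commute)
        also have "\<dots> \<le> L (Suc l)" using L(2)[of x "Suc l"] by simp
        finally have 2: "\<bar>poly (hermite (Suc l)) x * std_normal_density x\<bar> \<le> L (Suc l)" .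
        show "\<bar>real_coeff j n (Suc l) * (poly (hermite (Suc l)) x * std_normal_density x)\<bar> \<le> K j * L (Suc l)"
          unfolding abs_mult[of "real_coeff j n (Suc l)"] by (rule mult_mono[OF K(2) 2 K(1) abs_ge_zero])
      qed
      moreover have "1 \<le> B n ^ j" using B by (rule one_le_power)
      ultimately have "\<bar>\<Sum>l<3 * j. real_coeff j n (Suc l) * (poly (hermite (Suc l)) x * std_normal_density x)\<bar> / B n ^ j \<le> (\<Sum>l<3 * j. K j * L (Suc l)) / 1"
        by (intro frac_le) auto
      then show ?thesis using B by (simp add: abs_divide)
    qed
    have "\<bar>dens R n x\<bar> \<le> \<bar>std_normal_density x\<bar> + \<bar>\<Sum>j=1..R. (\<Sum>l<3 * j. real_coeff j n (Suc l) * (poly (hermite (Suc l)) x * std_normal_density x)) / B n ^ j\<bar>"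
      unfolding dens_def by (rule abs_triangle_ineq)
    also have "\<dots> \<le> 1 + (\<Sum>j=1..R. (\<Sum>l<3 * j. K j * L (Suc l)))"
    proof (rule add_mono)
      show "\<bar>std_normal_density x\<bar> \<le> 1" using std_normal_density_le_1 by (simp add: abs_of_nonneg[OF normal_density_nonneg])
    qed (rule order_trans[OF sum_abs sum_mono[OF 1]])
    finally show ?thesis .
  qed
  moreover have "0 \<le> 1 + (\<Sum>j=1..R. (\<Sum>l<3 * j. K j * L (Suc l)))"
    by (intro add_nonneg_nonneg sum_nonneg mult_nonneg_nonneg K L) auto
  ultimately show ?thesis by blast
qed

lemma fourier_approx_eq:
  "fourier_approx R n t = of_real (exp (- t\<^sup>2 / 2)) +
     (\<Sum>j=1..R. \<Sum>l<3 * j. of_real (real_coeff j n (Suc l) / B n ^ j) * (of_real (exp (- t\<^sup>2 / 2)) * (\<i> * of_real t) ^ Suc l))"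
proof -
  have pj: "poly (exp_coeff (vars n) j) z = (\<Sum>l<3 * j. of_real (real_coeff j n (Suc l)) * z ^ Suc l)" if "1 \<le> j" for j z
  proof -
    have "poly (exp_coeff (vars n) j) z = (\<Sum>l\<le>3 * j. coeff (exp_coeff (vars n) j) l * z ^ l)"
      unfolding poly_altdef
      by (rule sum.mono_neutral_left) (use degree_exp_coeff[of "vars n" j] in \<open>auto simp: coeff_eq_0\<close>)
    also have "\<dots> = (\<Sum>l<Suc (3 * j). coeff (exp_coeff (vars n) j) l * z ^ l)" by (simp only: lessThan_Suc_atMost)
    also have "\<dots> = coeff (exp_coeff (vars n) j) 0 * z ^ 0 + (\<Sum>l<3 * j. coeff (exp_coeff (vars n) j) (Suc l) * z ^ Suc l)"
      by (rule sum.lessThan_Suc_shift)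
    finally show ?thesis using that by (simp add: coeff_0_exp_coeff real_coeff)
  qed
  let ?E = "complex_of_real (exp (- t\<^sup>2 / 2))" and ?z = "\<i> * complex_of_real t"
  have trm: "?E * (poly (exp_coeff (vars n) j) ?z * of_real (1 / B n) ^ j)
     = (\<Sum>l<3 * j. of_real (real_coeff j n (Suc l) / B n ^ j) * (?E * ?z ^ Suc l))" if "j \<in> {1..R}" for j
  proof -
    have w: "complex_of_real (1 / B n) ^ j = of_real (1 / B n ^ j)" by (simp add: power_one_over)
    have e: "E * ((of_real c * z) * complex_of_real (1 / x)) = of_real (c / x) * (E * z)" for E z :: complex and c x :: real
      by (simp add: divide_inverse mult_ac)
    have j: "1 \<le> j" using that by simp
    show ?thesis unfolding pj[OF j] w sum_distrib_left sum_distrib_right by (simp only: e)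
  qed
  have "{..R} = insert 0 {1..R}" by auto
  then have "(\<Sum>j\<le>R. poly (exp_coeff (vars n) j) ?z * of_real (1 / B n) ^ j)
    = 1 + (\<Sum>j=1..R. poly (exp_coeff (vars n) j) ?z * of_real (1 / B n) ^ j)" by simp
  then show ?thesis unfolding fourier_approx_def by (simp only: distrib_left sum_distrib_left mult_1_right) (simp only: sum.cong[OF refl trm])
qed

lemma fourier_approx_inverse:
  "integrable lborel (\<lambda>t. fourier_approx R n t * exp (- (\<i> * complex_of_real y) * complex_of_real t))"
  "complex_of_real (2 * pi * dens R n y) = (LINT t|lborel. fourier_approx R n t * exp (- (\<i> * complex_of_real y) * complex_of_real t))"
proof -
  let ?G = "\<lambda>l t. complex_of_real (exp (- t\<^sup>2 / 2)) * (\<i> * complex_of_real t) ^ l * exp (- (\<i> * complex_of_real y) * complex_of_real t)"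
  have eq: "fourier_approx R n t * exp (- (\<i> * complex_of_real y) * complex_of_real t)
    = ?G 0 t + (\<Sum>j=1..R. \<Sum>l<3 * j. of_real (real_coeff j n (Suc l) / B n ^ j) * ?G (Suc l) t)" for t
    unfolding fourier_approx_eq distrib_right sum_distrib_right by (simp only: power_0 mult_1_right mult.assoc)
  have i: "integrable lborel (?G l)" for l by (rule gauss_hermite_integrable)
  show "integrable lborel (\<lambda>t. fourier_approx R n t * exp (- (\<i> * complex_of_real y) * complex_of_real t))"
    unfolding eq by (intro Bochner_Integration.integrable_add Bochner_Integration.integrable_sum integrable_mult_right i)
  have "(LINT t|lborel. fourier_approx R n t * exp (- (\<i> * complex_of_real y) * complex_of_real t))
    = (LINT t|lborel. ?G 0 t) + (\<Sum>j=1..R. \<Sum>l<3 * j. of_real (real_coeff j n (Suc l) / B n ^ j) * (LINT t|lborel. ?G (Suc l) t))"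
  proof -
    have ij: "integrable lborel (\<lambda>t. \<Sum>l<3 * j. of_real (real_coeff j n (Suc l) / B n ^ j) * ?G (Suc l) t)" for j
      by (intro Bochner_Integration.integrable_sum integrable_mult_right i)
    have "(LINT t|lborel. (\<Sum>l<3 * j. of_real (real_coeff j n (Suc l) / B n ^ j) * ?G (Suc l) t))
       = (\<Sum>l<3 * j. of_real (real_coeff j n (Suc l) / B n ^ j) * (LINT t|lborel. ?G (Suc l) t))" for j
      by (subst Bochner_Integration.integral_sum) (intro integrable_mult_right i, simp only: integral_mult_right_zero)
    then have "(LINT t|lborel. (\<Sum>j=1..R. \<Sum>l<3 * j. of_real (real_coeff j n (Suc l) / B n ^ j) * ?G (Suc l) t))
       = (\<Sum>j=1..R. \<Sum>l<3 * j. of_real (real_coeff j n (Suc l) / B n ^ j) * (LINT t|lborel. ?G (Suc l) t))"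
      by (subst Bochner_Integration.integral_sum) (intro ij, simp only:)
    then show ?thesis unfolding eq
      by (subst Bochner_Integration.integral_add) (intro i Bochner_Integration.integrable_sum ij, intro Bochner_Integration.integrable_sum ij, simp only:)
  qed
  also have "\<dots> = complex_of_real (2 * pi * dens R n y)"
  proof -
    have e: "c / x * (2 * pi * h) = 2 * pi * (c * h / x)" for c x h :: real by simp
    have "2 * pi * (poly (hermite 0) y * std_normal_density y) +
       (\<Sum>j=1..R. \<Sum>l<3 * j. real_coeff j n (Suc l) / B n ^ j * (2 * pi * (poly (hermite (Suc l)) y * std_normal_density y)))
      = 2 * pi * dens R n y"
      unfolding dens_def e sum_distrib_left[symmetric] sum_divide_distrib[symmetric] distrib_left[symmetric] by simp
    then show ?thesis unfolding gauss_hermite_fourier of_real_mult[symmetric] of_real_sum[symmetric] of_real_add[symmetric]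
      by (rule arg_cong)
  qed
  finally show "complex_of_real (2 * pi * dens R n y) = (LINT t|lborel. fourier_approx R n t * exp (- (\<i> * complex_of_real y) * complex_of_real t))" ..
qed

end

section \<open>Tail, uniform and weighted bounds for the difference\<close>

context edgeworth_normalized
begin

lemma W_bounded: "\<exists>c. \<forall>x\<in>space M. \<bar>W n x\<bar> \<le> c"
proof -
  obtain c where "\<forall>x\<in>space M. \<bar>S n x\<bar> \<le> c" using S_bounded by blast
  then have "\<bar>W n x\<bar> \<le> (c + \<bar>A n\<bar>) / \<bar>B n\<bar>" if "x \<in> space M" for x
    using that abs_triangle_ineq4[of "S n x" "A n"] unfolding W_def abs_divide
    by (intro divide_right_mono) force+
  then show ?thesis by blast
qed

lemma integrable_W: "integrable M (\<lambda>x. (1 + \<bar>W n x\<bar>) ^ k)"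
proof -
  obtain c where c: "\<forall>x\<in>space M. \<bar>W n x\<bar> \<le> c" using W_bounded by blast
  show ?thesis
    by (rule integrable_const_bound[of _ "(1 + c) ^ k"]) (use c in \<open>auto simp: abs_of_nonneg intro!: AE_I2 power_mono\<close>)
qed

lemma W_moments: "\<exists>K. \<forall>\<^sub>F n in sequentially. expectation (\<lambda>x. (1 + \<bar>W n x\<bar>) ^ k) \<le> K"
proof -
  from moments_bounded[of k] obtain K where K: "\<forall>\<^sub>F n in sequentially. expectation (\<lambda>x. \<bar>S n x / s n\<bar> ^ k) \<le> K" ..
  have "\<forall>\<^sub>F n in sequentially. expectation (\<lambda>x. (1 + \<bar>W n x\<bar>) ^ k) \<le> (2 * (1 + b)) ^ k + 4 ^ k * K"
  proof (rule eventually_mono[OF eventually_conj[OF K eventually_conj[OF eventually_B[of "1 + b"] eventually_s_ge[of 1]]]], elim conjE)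
    fix n assume K: "expectation (\<lambda>x. \<bar>S n x / s n\<bar> ^ k) \<le> K" and B: "1 + b \<le> B n" and s1: "1 \<le> s n"
    have sB: "s n \<le> 2 * B n" using B_le[of n] B by (simp add: abs_le_iff)
    have B1: "1 \<le> B n" using B b_nonneg by linarith
    interpret X: bounded_rv M "S n" by (rule rv)
    have iS: "integrable M (\<lambda>x. \<bar>S n x / s n\<bar> ^ k)"
      using integrable_abs[OF X.integrable_power_X[of k]] by (simp add: power_abs power_divide abs_divide)
    have "expectation (\<lambda>x. (1 + \<bar>W n x\<bar>) ^ k) \<le> expectation (\<lambda>x. (2 * (1 + b)) ^ k + 4 ^ k * \<bar>S n x / s n\<bar> ^ k)"
    proof (rule integral_mono)
      show "integrable M (\<lambda>x. (1 + \<bar>W n x\<bar>) ^ k)" by (rule integrable_W)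
      show "integrable M (\<lambda>x. (2 * (1 + b)) ^ k + 4 ^ k * \<bar>S n x / s n\<bar> ^ k)" using iS by simp
      fix x
      define v where "v = \<bar>S n x / s n\<bar>"
      have v0: "0 \<le> v" by (simp add: v_def)
      have "\<bar>S n x\<bar> = v * s n" using s1 by (simp add: v_def abs_divide)
      also have "\<dots> \<le> v * (2 * B n)" by (rule mult_left_mono[OF sB v0])
      finally have "\<bar>S n x\<bar> / B n \<le> 2 * v" using B1 by (simp add: divide_le_eq)
      moreover have "\<bar>A n\<bar> / B n \<le> b / 1" using A_le B1 b_nonneg by (intro frac_le) auto
      moreover have "\<bar>W n x\<bar> \<le> \<bar>S n x\<bar> / B n + \<bar>A n\<bar> / B n"
        using B1 abs_triangle_ineq4[of "S n x" "A n"] by (simp add: W_def abs_divide add_divide_distrib[symmetric] divide_right_mono)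
      ultimately have le: "1 + \<bar>W n x\<bar> \<le> (1 + b) + 2 * v" by simp
      show "(1 + \<bar>W n x\<bar>) ^ k \<le> (2 * (1 + b)) ^ k + 4 ^ k * \<bar>S n x / s n\<bar> ^ k"
      \<comment> \<open>The sum of two terms is at most twice the larger one.\<close>
      proof (cases "1 + b \<le> 2 * v")
        case True
        then have "(1 + \<bar>W n x\<bar>) ^ k \<le> (4 * v) ^ k" using le by (intro power_mono) auto
        moreover have "0 \<le> (2 * (1 + b)) ^ k" using b_nonneg by simp
        ultimately show ?thesis unfolding v_def[symmetric] power_mult_distrib by linarith
      next
        case False
        then have "(1 + \<bar>W n x\<bar>) ^ k \<le> (2 * (1 + b)) ^ k" using le by (intro power_mono) auto
        moreover have "0 \<le> 4 ^ k * \<bar>S n x / s n\<bar> ^ k" by simp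
        ultimately show ?thesis by linarith
      qed
    qed
    also have "\<dots> = (2 * (1 + b)) ^ k + 4 ^ k * expectation (\<lambda>x. \<bar>S n x / s n\<bar> ^ k)"
      using iS by (simp add: prob_space)
    also have "\<dots> \<le> (2 * (1 + b)) ^ k + 4 ^ k * K" using K by simp
    finally show "expectation (\<lambda>x. (1 + \<bar>W n x\<bar>) ^ k) \<le> (2 * (1 + b)) ^ k + 4 ^ k * K" .
  qed
  then show ?thesis ..
qed

abbreviation F :: "nat \<Rightarrow> real \<Rightarrow> real" where "F n \<equiv> cdf (distr M borel (W n))"
abbreviation \<Psi> :: "nat \<Rightarrow> nat \<Rightarrow> real \<Rightarrow> real" where "\<Psi> R n \<equiv> edgeworth_approx B H R n"

text \<open>Stated for an arbitrary finite \<open>J\<close>, since it is applied both to all terms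
  of the expansion and to the surplus terms alone. The weight is free because the normal density
  beats every polynomial.\<close>

lemma correction_le:
  "\<exists>K\<ge>0. \<forall>n x. 0 < B n \<longrightarrow> \<bar>std_normal_density x * (\<Sum>j\<in>J. poly (H j n) x / B n ^ j)\<bar> \<le> (\<Sum>j\<in>J. K / B n ^ j) / (1 + \<bar>x\<bar>) ^ k"
  if "finite J"
proof -
  have "\<exists>K\<ge>0. \<forall>n x. std_normal_density x * \<bar>poly (H j n) x\<bar> \<le> K / (1 + \<bar>x\<bar>) ^ k" for j by (rule H_density_le)
  then obtain K where K: "\<And>j. 0 \<le> K j" "\<And>j n x. std_normal_density x * \<bar>poly (H j n) x\<bar> \<le> K j / (1 + \<bar>x\<bar>) ^ k" by metis
  define L where "L = (\<Sum>j\<in>J. K j)"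
  have L: "K j \<le> L" if "j \<in> J" for j unfolding L_def by (rule member_le_sum) (use that \<open>finite J\<close> K in auto)
  have "\<bar>std_normal_density x * (\<Sum>j\<in>J. poly (H j n) x / B n ^ j)\<bar> \<le> (\<Sum>j\<in>J. L / B n ^ j) / (1 + \<bar>x\<bar>) ^ k" if B: "0 < B n" for n x
  proof -
    have "\<bar>std_normal_density x * (\<Sum>j\<in>J. poly (H j n) x / B n ^ j)\<bar> \<le> (\<Sum>j\<in>J. \<bar>std_normal_density x * (poly (H j n) x / B n ^ j)\<bar>)"
      unfolding sum_distrib_left by (rule sum_abs)
    also have "\<dots> \<le> (\<Sum>j\<in>J. (L / B n ^ j) / (1 + \<bar>x\<bar>) ^ k)"
    proof (rule sum_mono)
      fix j assume j: "j \<in> J"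
      have "\<bar>std_normal_density x * (poly (H j n) x / B n ^ j)\<bar> = std_normal_density x * \<bar>poly (H j n) x\<bar> / B n ^ j"
        using B by (simp add: abs_mult abs_of_nonneg[OF normal_density_nonneg])
      also have "\<dots> \<le> (L / (1 + \<bar>x\<bar>) ^ k) / B n ^ j"
      proof (intro divide_right_mono order_trans[OF K(2)])
        show "K j \<le> L" by (rule L[OF j])
      qed (use B in auto)
      finally show "\<bar>std_normal_density x * (poly (H j n) x / B n ^ j)\<bar> \<le> (L / B n ^ j) / (1 + \<bar>x\<bar>) ^ k"
        by (simp only: divide_divide_eq_left mult.commute)
    qed
    finally show ?thesis by (simp only: sum_divide_distrib)
  qed
  moreover have "0 \<le> L" unfolding L_def by (intro sum_nonneg K)
  ultimately show ?thesis by blast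
qed

lemma approx_eq: "\<Psi> R n x = cdf std_normal_distribution x + std_normal_density x * (\<Sum>j=1..R. poly (H j n) x / B n ^ j)"
  by (simp add: edgeworth_approx_def)

text \<open>Both functions approach 0 and 1 at rates given by moments. The moment bound
  \<open>K\<close> is a parameter for each n, so the lemma gives one bound for all large n as well
  as some bound for each single n with \<open>0 < B n\<close>.\<close>

lemma difference_tail:
  "\<exists>L\<ge>0. \<forall>n K x. 0 < B n \<longrightarrow> expectation (\<lambda>x. (1 + \<bar>W n x\<bar>) ^ k) \<le> K \<longrightarrow>
     \<bar>F n x - \<Psi> R n x\<bar> \<le> (K + L + (\<Sum>j=1..R. L / B n ^ j)) / (1 + \<bar>x\<bar>) ^ k"
proof -
  from cdf_std_normal_tail[of k] obtain K1 where KK: "0 \<le> K1 \<and> (\<forall>y. (y \<le> 0 \<longrightarrow> cdf std_normal_distribution y \<le> K1 / (1 + \<bar>y\<bar>) ^ k) \<and>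
     (0 \<le> y \<longrightarrow> 1 - cdf std_normal_distribution y \<le> K1 / (1 + \<bar>y\<bar>) ^ k))" by (rule exE)
  from correction_le[of "{1..R}" k] obtain K2 where K2: "0 \<le> K2 \<and> (\<forall>n x. 0 < B n \<longrightarrow> \<bar>std_normal_density x * (\<Sum>j\<in>{1..R}. poly (H j n) x / B n ^ j)\<bar> \<le> (\<Sum>j\<in>{1..R}. K2 / B n ^ j) / (1 + \<bar>x\<bar>) ^ k)"
    by (auto)
  define L where "L = max K1 K2"
  have "\<bar>F n x - \<Psi> R n x\<bar> \<le> (K + L + (\<Sum>j=1..R. L / B n ^ j)) / (1 + \<bar>x\<bar>) ^ k"
    if B: "0 < B n" and E: "expectation (\<lambda>x. (1 + \<bar>W n x\<bar>) ^ k) \<le> K" for n K x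
  proof -
    interpret D: real_distribution "distr M borel (W n)" by (rule real_distribution_distr) simp
    have p: "0 < (1 + \<bar>x\<bar>) ^ k" by simp
    have c: "\<bar>std_normal_density x * (\<Sum>j=1..R. poly (H j n) x / B n ^ j)\<bar> \<le> (\<Sum>j=1..R. L / B n ^ j) / (1 + \<bar>x\<bar>) ^ k"
    proof -
      have "\<bar>std_normal_density x * (\<Sum>j=1..R. poly (H j n) x / B n ^ j)\<bar> \<le> (\<Sum>j=1..R. K2 / B n ^ j) / (1 + \<bar>x\<bar>) ^ k"
        using K2 B by blast
      also have "\<dots> \<le> (\<Sum>j=1..R. L / B n ^ j) / (1 + \<bar>x\<bar>) ^ k"
        using B by (intro divide_right_mono sum_mono) (auto simp: L_def)
      finally show ?thesis .
    qed
    have K1L: "K1 / (1 + \<bar>x\<bar>) ^ k \<le> L / (1 + \<bar>x\<bar>) ^ k" by (rule divide_right_mono) (auto simp: L_def)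
    have "\<bar>F n x - cdf std_normal_distribution x\<bar> \<le> K / (1 + \<bar>x\<bar>) ^ k + L / (1 + \<bar>x\<bar>) ^ k"
    proof (cases "x \<le> 0")
      case True
      have "F n x \<le> K / (1 + \<bar>x\<bar>) ^ k" by (rule cdf_tail(1)[OF W_measurable integrable_W E True])
      moreover have "cdf std_normal_distribution x \<le> L / (1 + \<bar>x\<bar>) ^ k" using KK K1L True by (meson order_trans)
      ultimately show ?thesis using D.cdf_nonneg[of x] cdf_std_normal_bounds(1)[of x] by linarith
    next
      case False
      then have x: "0 \<le> x" by simp
      have "1 - F n x \<le> K / (1 + \<bar>x\<bar>) ^ k" by (rule cdf_tail(2)[OF W_measurable integrable_W E x])
      moreover have "1 - cdf std_normal_distribution x \<le> L / (1 + \<bar>x\<bar>) ^ k" using KK K1L x by (meson order_trans)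
      ultimately show ?thesis using D.cdf_bounded_prob[of x] cdf_std_normal_bounds(2)[of x] by linarith
    qed
    moreover have "\<bar>F n x - \<Psi> R n x\<bar> \<le> \<bar>F n x - cdf std_normal_distribution x\<bar> + \<bar>std_normal_density x * (\<Sum>j=1..R. poly (H j n) x / B n ^ j)\<bar>"
      unfolding approx_eq by linarith
    ultimately have "\<bar>F n x - \<Psi> R n x\<bar> \<le> K / (1 + \<bar>x\<bar>) ^ k + L / (1 + \<bar>x\<bar>) ^ k + (\<Sum>j=1..R. L / B n ^ j) / (1 + \<bar>x\<bar>) ^ k"
      using c by linarith
    then show ?thesis by (simp only: add_divide_distrib)
  qed
  moreover have "0 \<le> L" unfolding L_def using KK by (meson max.coboundedI1)
  ultimately show ?thesis by blast
qed

lemma difference_tail_each: "0 < B n \<Longrightarrow> \<exists>K. \<forall>x. \<bar>F n x - \<Psi> R n x\<bar> \<le> K / (1 + \<bar>x\<bar>) ^ k"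
  using difference_tail[of k R] by blast

lemma difference_tail_uniform: "\<exists>K\<ge>0. \<forall>\<^sub>F n in sequentially. \<forall>x. \<bar>F n x - \<Psi> R n x\<bar> \<le> K / (1 + \<bar>x\<bar>) ^ k"
proof -
  from difference_tail[of k R] obtain L where L: "0 \<le> L \<and> (\<forall>n K x. 0 < B n \<longrightarrow> expectation (\<lambda>x. (1 + \<bar>W n x\<bar>) ^ k) \<le> K \<longrightarrow>
     \<bar>F n x - \<Psi> R n x\<bar> \<le> (K + L + (\<Sum>j=1..R. L / B n ^ j)) / (1 + \<bar>x\<bar>) ^ k)" by (rule exE)
  from W_moments[of k] obtain K where K: "\<forall>\<^sub>F n in sequentially. expectation (\<lambda>x. (1 + \<bar>W n x\<bar>) ^ k) \<le> K" ..
  have "\<forall>\<^sub>F n in sequentially. \<forall>x. \<bar>F n x - \<Psi> R n x\<bar> \<le> (\<bar>K\<bar> + L + real R * L) / (1 + \<bar>x\<bar>) ^ k"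
  proof (rule eventually_mono[OF eventually_conj[OF K eventually_B[of 1]]], elim conjE, rule allI)
    fix n x assume E: "expectation (\<lambda>x. (1 + \<bar>W n x\<bar>) ^ k) \<le> K" and B1: "1 \<le> B n"
    have "\<bar>F n x - \<Psi> R n x\<bar> \<le> (K + L + (\<Sum>j=1..R. L / B n ^ j)) / (1 + \<bar>x\<bar>) ^ k" using L E B1 by simp
    also have "\<dots> \<le> (\<bar>K\<bar> + L + real R * L) / (1 + \<bar>x\<bar>) ^ k"
    proof (intro divide_right_mono add_mono)
      have "(\<Sum>j=1..R. L / B n ^ j) \<le> (\<Sum>j=1..R. L / 1)"
        using L B1 by (intro sum_mono divide_left_mono one_le_power) auto
      then show "(\<Sum>j=1..R. L / B n ^ j) \<le> real R * L" by simp
    qed auto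
    finally show "\<bar>F n x - \<Psi> R n x\<bar> \<le> (\<bar>K\<bar> + L + real R * L) / (1 + \<bar>x\<bar>) ^ k" .
  qed
  moreover have "0 \<le> \<bar>K\<bar> + L + real R * L" using L by simp
  ultimately show ?thesis by blast
qed

text \<open>For |x| > B n the moment tails are already small enough. For the other x smoothing is
  applied from a = - 2 B n, where the tails make both functions small.\<close>

lemma difference_uniform: "\<exists>K\<ge>0. \<forall>\<^sub>F n in sequentially. \<forall>x. \<bar>F n x - \<Psi> R n x\<bar> \<le> K / B n ^ R"
proof -
  from fourier_comparison[of R] obtain K1 where K1: "0 \<le> K1 \<and> (\<forall>\<^sub>F n in sequentially. \<forall>t. cmod (char (distr M borel (W n)) t * of_real (exp (- (1 / B n ^ Suc R * t)\<^sup>2 / 2)) - fourier_approx R n t)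
     \<le> K1 / B n ^ Suc R * (1 / (1 + t\<^sup>2)))" by (rule exE)
  from difference_tail_uniform[of R R] obtain K2 where K2: "0 \<le> K2 \<and> (\<forall>\<^sub>F n in sequentially. \<forall>x. \<bar>F n x - \<Psi> R n x\<bar> \<le> K2 / (1 + \<bar>x\<bar>) ^ R)" by (rule exE)
  from dens_bounded[of R] obtain L where L: "0 \<le> L \<and> (\<forall>n x. 1 \<le> B n \<longrightarrow> \<bar>dens R n x\<bar> \<le> L)" by (rule exE)
  from std_normal_tail[of R] obtain K3 where K3: "0 \<le> K3 \<and> (\<forall>y>0. cdf std_normal_distribution (-y) \<le> K3 / y ^ R \<and> 1 - cdf std_normal_distribution y \<le> K3 / y ^ R)" by (rule exE)
  from W_moments[of R] obtain K4 where K4: "\<forall>\<^sub>F n in sequentially. expectation (\<lambda>x. (1 + \<bar>W n x\<bar>) ^ R) \<le> K4" ..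
  define J where "J = (LINT t|lborel. 1 / (1 + t\<^sup>2 :: real))"
  have J0: "0 \<le> J" unfolding J_def by (rule Bochner_Integration.integral_nonneg) (simp add: add_nonneg_nonneg)
  define K where "K = 2 * K3 + \<bar>K4\<bar> + (\<bar>K4\<bar> + K2) + L + 4 * (K1 * J) + K2"
  have "\<forall>\<^sub>F n in sequentially. \<forall>x. \<bar>F n x - \<Psi> R n x\<bar> \<le> K / B n ^ R"
  proof (rule eventually_mono[OF eventually_conj[OF conjunct2[OF K1] eventually_conj[OF conjunct2[OF K2] eventually_conj[OF K4 eventually_B[of 1]]]]], elim conjE, rule allI)
    fix n x
    assume cmp: "\<forall>t. cmod (char (distr M borel (W n)) t * of_real (exp (- (1 / B n ^ Suc R * t)\<^sup>2 / 2)) - fourier_approx R n t)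
     \<le> K1 / B n ^ Suc R * (1 / (1 + t\<^sup>2))"
      and tl: "\<forall>x. \<bar>F n x - \<Psi> R n x\<bar> \<le> K2 / (1 + \<bar>x\<bar>) ^ R"
      and E: "expectation (\<lambda>x. (1 + \<bar>W n x\<bar>) ^ R) \<le> K4" and B1: "1 \<le> B n"
    have BR: "1 \<le> B n ^ R" using B1 by (rule one_le_power)
    have big: "c / (1 + \<bar>y\<bar>) ^ R \<le> c / B n ^ R" if "B n \<le> \<bar>y\<bar>" "0 \<le> c" for y c
    proof (rule divide_left_mono)
      show "B n ^ R \<le> (1 + \<bar>y\<bar>) ^ R" by (rule power_mono) (use that B1 in auto)
    qed (use that BR in auto)
    show "\<bar>F n x - \<Psi> R n x\<bar> \<le> K / B n ^ R"
    proof (cases "\<bar>x\<bar> \<le> B n")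
      case False
      have "\<bar>F n x - \<Psi> R n x\<bar> \<le> K2 / (1 + \<bar>x\<bar>) ^ R" using tl by blast
      also have "\<dots> \<le> K2 / B n ^ R" by (rule big) (use False K2 in auto)
      also have "\<dots> \<le> K / B n ^ R"
        unfolding K_def using K1 K2 K3 L J0 BR by (intro divide_right_mono) auto
      finally show ?thesis .
    next
      case True
      \<comment> \<open>The ratio \<delta> / \<epsilon> = B n makes the normal tail of size B n^(-
        R). The interval from \<open>a\<close> has length at most 4 B n, which uses up the one extra
        order of the Fourier comparison.\<close>
      define \<epsilon> where "\<epsilon> = 1 / B n ^ Suc R"
      define \<delta> where "\<delta> = 1 / B n ^ R"
      define a where "a = - (2 * B n)"
      have \<delta>1: "0 < \<delta>" "\<delta> \<le> 1" using BR by (auto simp: \<delta>_def)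
      have \<epsilon>0: "0 < \<epsilon>" using B1 by (simp add: \<epsilon>_def)
      have de: "\<delta> / \<epsilon> = B n" using B1 by (simp add: \<delta>_def \<epsilon>_def)
      have main: "\<bar>F n x - \<Psi> R n x\<bar> \<le> 2 * (K3 / B n ^ R) + F n (a + \<delta>) + \<bar>\<Psi> R n a\<bar> + L * \<delta>
         + (x + \<delta> - a) * ((K1 / B n ^ Suc R) * (LINT t|lborel. 1 / (1 + t\<^sup>2)))"
      proof (rule gaussian_smoothing[OF W_measurable \<epsilon>0 \<delta>1(1) approx_has_derivative continuous_dens fourier_approx_inverse(2) fourier_approx_inverse(1)])
        show "cmod (char (distr M borel (W n)) t * complex_of_real (exp (- (\<epsilon> * t)\<^sup>2 / 2)) - fourier_approx R n t)
           \<le> K1 / B n ^ Suc R * (1 / (1 + t\<^sup>2))" for t unfolding \<epsilon>_def using cmp by blast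
        show "\<bar>dens R n y\<bar> \<le> L" for y using L B1 by blast
        show "cdf std_normal_distribution (- (\<delta> / \<epsilon>)) \<le> K3 / B n ^ R" "1 - cdf std_normal_distribution (\<delta> / \<epsilon>) \<le> K3 / B n ^ R"
          unfolding de using K3 B1 by auto
        show "a \<le> x - \<delta>" using True \<delta>1 B1 by (simp add: a_def abs_le_iff)
      qed
      have Fa: "F n y \<le> \<bar>K4\<bar> / B n ^ R" if "y \<le> - B n" for y
      proof -
        have "F n y \<le> \<bar>K4\<bar> / (1 + \<bar>y\<bar>) ^ R" by (rule cdf_tail(1)[OF W_measurable integrable_W]) (use E that B1 in auto)
        also have "\<dots> \<le> \<bar>K4\<bar> / B n ^ R" by (rule big) (use that B1 in auto)
        finally show ?thesis .
      qed
      have 1: "F n (a + \<delta>) \<le> \<bar>K4\<bar> / B n ^ R" by (rule Fa) (use \<delta>1 B1 in \<open>simp add: a_def\<close>)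
      have 2: "\<bar>\<Psi> R n a\<bar> \<le> (\<bar>K4\<bar> + K2) / B n ^ R"
      proof -
        interpret D: real_distribution "distr M borel (W n)" by (rule real_distribution_distr) simp
        have "\<bar>F n a - \<Psi> R n a\<bar> \<le> K2 / (1 + \<bar>a\<bar>) ^ R" using tl by blast
        also have "\<dots> \<le> K2 / B n ^ R" by (rule big) (use K2 B1 in \<open>auto simp: a_def\<close>)
        finally have "\<bar>F n a - \<Psi> R n a\<bar> \<le> K2 / B n ^ R" .
        moreover have "F n a \<le> \<bar>K4\<bar> / B n ^ R" by (rule Fa) (use B1 in \<open>simp add: a_def\<close>)
        ultimately show ?thesis using D.cdf_nonneg[of a] unfolding add_divide_distrib by linarith
      qed
      have 3: "(x + \<delta> - a) * ((K1 / B n ^ Suc R) * J) \<le> 4 * (K1 * J) / B n ^ R"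
      proof -
        have "(x + \<delta> - a) * ((K1 / B n ^ Suc R) * J) \<le> (4 * B n) * ((K1 / B n ^ Suc R) * J)"
          using True \<delta>1 B1 K1 J0 by (intro mult_right_mono) (auto simp: a_def abs_le_iff)
        also have "\<dots> = 4 * (K1 * J) / B n ^ R" using B1 by simp
        finally show ?thesis .
      qed
      have "\<bar>F n x - \<Psi> R n x\<bar> \<le> 2 * K3 / B n ^ R + \<bar>K4\<bar> / B n ^ R + (\<bar>K4\<bar> + K2) / B n ^ R + L / B n ^ R + 4 * (K1 * J) / B n ^ R + K2 / B n ^ R"
      proof -
        have "0 \<le> K2 / B n ^ R" using K2 BR by simp
        moreover have "L * \<delta> = L / B n ^ R" by (simp add: \<delta>_def)
        moreover have "2 * (K3 / B n ^ R) = 2 * K3 / B n ^ R" by simp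
        ultimately show ?thesis using main 1 2 3 unfolding J_def[symmetric] by linarith
      qed
      then show ?thesis unfolding K_def by (simp only: add_divide_distrib)
    qed
  qed
  moreover have "0 \<le> K" unfolding K_def using K1 K2 K3 L J0 by auto
  ultimately show ?thesis by blast
qed

text \<open>The uniform bound of twice the order and the moment bound of twice the weight are interpolated
  geometrically, and the superfluous terms of the expansion are then dropped.\<close>

lemma difference_weighted:
  "\<exists>K\<ge>0. \<forall>\<^sub>F n in sequentially. \<forall>x. \<bar>F n x - \<Psi> r n x\<bar> \<le> K / B n ^ Suc r / (1 + \<bar>x\<bar>) ^ k"
proof -
  define R where "R = 2 * Suc r"
  from difference_uniform[of R] obtain K1 where K1: "0 \<le> K1 \<and> (\<forall>\<^sub>F n in sequentially. \<forall>x. \<bar>F n x - \<Psi> R n x\<bar> \<le> K1 / B n ^ R)" by (rule exE)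
  from difference_tail_uniform[of R "2 * k"] obtain K2 where K2: "0 \<le> K2 \<and> (\<forall>\<^sub>F n in sequentially. \<forall>x. \<bar>F n x - \<Psi> R n x\<bar> \<le> K2 / (1 + \<bar>x\<bar>) ^ (2 * k))" by (rule exE)
  from correction_le[of "{Suc r..R}" k] obtain K3 where K3: "0 \<le> K3 \<and> (\<forall>n x. 0 < B n \<longrightarrow> \<bar>std_normal_density x * (\<Sum>j\<in>{Suc r..R}. poly (H j n) x / B n ^ j)\<bar> \<le> (\<Sum>j\<in>{Suc r..R}. K3 / B n ^ j) / (1 + \<bar>x\<bar>) ^ k)"
    by auto
  define K where "K = (K1 + K2) + real R * K3"
  have "\<forall>\<^sub>F n in sequentially. \<forall>x. \<bar>F n x - \<Psi> r n x\<bar> \<le> K / B n ^ Suc r / (1 + \<bar>x\<bar>) ^ k"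
  proof (rule eventually_mono[OF eventually_conj[OF conjunct2[OF K1] eventually_conj[OF conjunct2[OF K2] eventually_B[of 1]]]], elim conjE, rule allI)
    fix n and x :: real
    assume u: "\<forall>x. \<bar>F n x - \<Psi> R n x\<bar> \<le> K1 / B n ^ R" and t: "\<forall>x. \<bar>F n x - \<Psi> R n x\<bar> \<le> K2 / (1 + \<bar>x\<bar>) ^ (2 * k)" and B1: "1 \<le> B n"
    define p where "p = B n ^ Suc r"
    define w where "w = (1 + \<bar>x\<bar>) ^ k"
    define d where "d = \<bar>F n x - \<Psi> R n x\<bar>"
    have p: "0 < p" using B1 by (simp add: p_def)
    have w: "0 < w" by (simp add: w_def)
    have d0: "0 \<le> d" by (simp add: d_def)
    have "B n ^ R = p\<^sup>2" by (simp only: p_def R_def power_mult[symmetric] mult.commute)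
    then have d1: "d \<le> K1 / p\<^sup>2" using u[rule_format, of x] unfolding d_def by simp
    have d2: "d \<le> K2 / w\<^sup>2" using t unfolding d_def w_def by (simp add: power_mult[symmetric] mult.commute)
    have "d\<^sup>2 \<le> (K1 / p\<^sup>2) * (K2 / w\<^sup>2)" unfolding power2_eq_square[of d] using d0 d1 d2 by (intro mult_mono) linarith+
    also have "\<dots> = K1 * K2 / (p * w)\<^sup>2" by (simp add: power_mult_distrib)
    also have "\<dots> \<le> (K1 + K2)\<^sup>2 / (p * w)\<^sup>2"
    proof (rule divide_right_mono)
      show "K1 * K2 \<le> (K1 + K2)\<^sup>2" using K1 K2 by (simp add: power2_sum)
    qed simp
    also have "\<dots> = ((K1 + K2) / (p * w))\<^sup>2" by (simp only: power_divide)
    finally have "d \<le> (K1 + K2) / (p * w)"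
      by (rule power2_le_imp_le) (use K1 K2 p w in simp)
    then have 1: "d \<le> (K1 + K2) / p / w" by simp
    have 2: "\<bar>\<Psi> R n x - \<Psi> r n x\<bar> \<le> real R * K3 / p / w"
    proof -
      have "{1..R} = {1..r} \<union> {Suc r..R}" by (auto simp: R_def)
      then have "(\<Sum>j=1..R. poly (H j n) x / B n ^ j) = (\<Sum>j=1..r. poly (H j n) x / B n ^ j) + (\<Sum>j\<in>{Suc r..R}. poly (H j n) x / B n ^ j)"
        by (simp only:) (rule sum.union_disjoint, auto)
      then have "\<Psi> R n x - \<Psi> r n x = std_normal_density x * (\<Sum>j\<in>{Suc r..R}. poly (H j n) x / B n ^ j)"
        unfolding approx_eq by (simp add: distrib_left)
      then have "\<bar>\<Psi> R n x - \<Psi> r n x\<bar> \<le> (\<Sum>j\<in>{Suc r..R}. K3 / B n ^ j) / w" using K3 B1 unfolding w_def by simp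
      also have "\<dots> \<le> (real R * K3 / p) / w"
      proof (rule divide_right_mono)
        have "(\<Sum>j\<in>{Suc r..R}. K3 / B n ^ j) \<le> (\<Sum>j\<in>{Suc r..R}. K3 / p)"
          unfolding p_def using K3 B1 by (intro sum_mono divide_left_mono power_increasing) auto
        also have "\<dots> = real (R - r) * (K3 / p)" by simp
        also have "\<dots> \<le> real R * (K3 / p)" using K3 p by (intro mult_right_mono) auto
        finally show "(\<Sum>j\<in>{Suc r..R}. K3 / B n ^ j) \<le> real R * K3 / p" by simp
      qed (use w in simp)
      finally show ?thesis .
    qed
    have "\<bar>F n x - \<Psi> r n x\<bar> \<le> d + \<bar>\<Psi> R n x - \<Psi> r n x\<bar>" unfolding d_def by linarith
    also have "\<dots> \<le> (K1 + K2) / p / w + real R * K3 / p / w" using 1 2 by linarith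
    also have "\<dots> = K / p / w" unfolding K_def by (simp only: add_divide_distrib)
    finally show "\<bar>F n x - \<Psi> r n x\<bar> \<le> K / B n ^ Suc r / (1 + \<bar>x\<bar>) ^ k" unfolding p_def w_def .
  qed
  moreover have "0 \<le> K" unfolding K_def using K1 K2 K3 by simp
  ultimately show ?thesis by blast
qed

text \<open>The definition wants the bound for every n with \<open>0 < B n\<close>. The finitely
  many early n carry their crude moment bound, multiplied by a power of B n that cancels the
  division; they do not affect the limit of \<open>C\<close>.\<close>

lemma difference_master:
  "\<exists>C. C \<longlonglongrightarrow> 0 \<and> (\<forall>n. 0 \<le> C n) \<and> (\<forall>n. 0 < B n \<longrightarrow> (\<forall>x. \<bar>F n x - \<Psi> r n x\<bar> \<le> C n / B n ^ r / (1 + \<bar>x\<bar>) ^ k))"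
proof -
  from difference_weighted[of r k] obtain K where K: "0 \<le> K \<and> (\<forall>\<^sub>F n in sequentially. \<forall>x. \<bar>F n x - \<Psi> r n x\<bar> \<le> K / B n ^ Suc r / (1 + \<bar>x\<bar>) ^ k)" by (rule exE)
  have "\<forall>n. \<exists>L. 0 < B n \<longrightarrow> (\<forall>x. \<bar>F n x - \<Psi> r n x\<bar> \<le> L / (1 + \<bar>x\<bar>) ^ k)"
    using difference_tail_each[of _ r k] by blast
  then obtain L where L: "\<And>n x. 0 < B n \<Longrightarrow> \<bar>F n x - \<Psi> r n x\<bar> \<le> L n / (1 + \<bar>x\<bar>) ^ k" by metis
  have "\<forall>\<^sub>F n in sequentially. (\<forall>x. \<bar>F n x - \<Psi> r n x\<bar> \<le> K / B n ^ Suc r / (1 + \<bar>x\<bar>) ^ k) \<and> 1 \<le> B n"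
    by (rule eventually_mono[OF eventually_conj[OF conjunct2[OF K] eventually_B[of 1]]]) blast
  then obtain N where N: "\<And>n. N \<le> n \<Longrightarrow> (\<forall>x. \<bar>F n x - \<Psi> r n x\<bar> \<le> K / B n ^ Suc r / (1 + \<bar>x\<bar>) ^ k) \<and> 1 \<le> B n"
    unfolding eventually_sequentially by blast
  define C where "C n = (if N \<le> n then K / B n else \<bar>L n\<bar> * \<bar>B n\<bar> ^ r)" for n
  show ?thesis
  proof (intro exI[of _ C] conjI allI impI)
    have "filterlim B at_top sequentially"
      unfolding filterlim_at_top
    proof
      show "\<forall>\<^sub>F n in sequentially. Z \<le> B n" for Z using eventually_B[of Z] by eventually_elim simp
    qed
    then have "(\<lambda>n. K / B n) \<longlonglongrightarrow> 0" by (intro tendsto_divide_0[OF tendsto_const] filterlim_at_top_imp_at_infinity)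
    moreover have "\<forall>\<^sub>F n in sequentially. K / B n = C n"
      unfolding eventually_sequentially C_def by (intro exI[of _ N]) simp
    ultimately show "C \<longlonglongrightarrow> 0" by (rule Lim_transform_eventually)
    show "0 \<le> C n" for n
    proof (cases "N \<le> n")
      case True
      then have "1 \<le> B n" using N by blast
      then show ?thesis using True K by (simp add: C_def)
    qed (simp add: C_def)
    fix n x assume B: "0 < B n"
    show "\<bar>F n x - \<Psi> r n x\<bar> \<le> C n / B n ^ r / (1 + \<bar>x\<bar>) ^ k"
    proof (cases "N \<le> n")
      case True
      then show ?thesis using N[of n] by (simp add: C_def)
    next
      case False
      have "\<bar>F n x - \<Psi> r n x\<bar> \<le> L n / (1 + \<bar>x\<bar>) ^ k" by (rule L[OF B])
      also have "\<dots> \<le> \<bar>L n\<bar> / (1 + \<bar>x\<bar>) ^ k" by (rule divide_right_mono) auto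
      also have "\<dots> = C n / B n ^ r / (1 + \<bar>x\<bar>) ^ k" using False B by (simp add: C_def)
      finally show ?thesis .
    qed
  qed
qed

end

section \<open>Transport distance and integrals of test functions\<close>

lemma integrable_powr_decay:
  fixes q :: real
  assumes "1 < q"
  shows "integrable lborel (\<lambda>x. (1 + \<bar>x\<bar>) powr (- q))"
proof -
  define f where "f x = (1 + x) powr (- q) * indicator {0..} x" for x :: real
  have f[measurable]: "f \<in> borel_measurable borel" unfolding f_def by measurable
  have f0: "0 \<le> f x" for x by (simp add: f_def)
  have fin: "(\<integral>\<^sup>+x. ennreal (f x) \<partial>lborel) < \<infinity>"
  proof -
    have "(\<integral>\<^sup>+x. ennreal ((1 + x) powr (- q)) * indicator {0..} x \<partial>lborel) = ennreal (0 - (1 + 0) powr (1 - q) / (1 - q))"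
    proof (rule nn_integral_FTC_atLeast)
      fix x :: real assume x: "0 \<le> x"
      have "((\<lambda>x. (1 + x) powr (1 - q) / (1 - q)) has_real_derivative ((1 - q) * (1 + x) powr (1 - q - 1)) / (1 - q)) (at x)"
        using x by (intro DERIV_cdivide) (auto intro!: derivative_eq_intros)
      then show "((\<lambda>x. (1 + x) powr (1 - q) / (1 - q)) has_real_derivative (1 + x) powr (- q)) (at x)"
        using assms by simp
      show "0 \<le> (1 + x) powr (- q)" by simp
    next
      have "((\<lambda>x::real. (1 + x) powr (1 - q)) \<longlongrightarrow> 0) at_top"
      proof (rule tendsto_neg_powr)
        show "filterlim (\<lambda>x::real. 1 + x) at_top at_top" by (rule filterlim_tendsto_add_at_top[OF tendsto_const filterlim_ident])
      qed (use assms in simp)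
      from tendsto_divide[OF this tendsto_const[of "1 - q"]] assms
      show "((\<lambda>x. (1 + x) powr (1 - q) / (1 - q)) \<longlongrightarrow> 0) at_top" by simp
    qed measurable
    moreover have "ennreal (f x) = ennreal ((1 + x) powr (- q)) * indicator {0..} x" for x
      by (simp add: f_def indicator_def)
    ultimately show ?thesis by simp
  qed
  have i1: "integrable lborel f" by (rule integrableI_nonneg) (use f0 fin in auto)
  have i2: "integrable lborel (\<lambda>x. f (0 + (-1) * x))" by (rule lborel_integrable_real_affine[OF i1]) simp
  show ?thesis
  proof (rule Bochner_Integration.integrable_bound[OF Bochner_Integration.integrable_add[OF i1 i2]])
    show "AE x in lborel. norm ((1 + \<bar>x\<bar>) powr (- q)) \<le> norm (f x + f (0 + (-1) * x))"
      by (auto simp: f_def indicator_def intro!: AE_I2)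
  qed measurable
qed

lemma integrable_indicator_Icc: "integrable lborel (indicator {a..b} :: real \<Rightarrow> real)" for a b :: real
  by (rule integrable_real_indicator) (auto simp: emeasure_lborel_Icc_eq)

lemma borel_measurable_deriv_real:
  fixes u :: "real \<Rightarrow> real"
  assumes "\<And>y. u differentiable (at y)"
  shows "deriv u \<in> borel_measurable borel"
proof (rule borel_measurable_LIMSEQ_real)
  have cont: "continuous_on UNIV u"
    using assms by (intro continuous_at_imp_continuous_on) (auto intro: differentiable_imp_continuous_within)
  show "(\<lambda>x. (u (x + 1 / real (Suc n)) - u x) / (1 / real (Suc n))) \<in> borel_measurable borel" for n
    by (intro borel_measurable_continuous_onI continuous_intros continuous_on_compose2[OF cont]) auto
  fix x
  have "(u has_real_derivative deriv u x) (at x)" using assms[of x] by (simp add: DERIV_deriv_iff_real_differentiable)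
  then have lim: "((\<lambda>h. (u (x + h) - u x) / h) \<longlongrightarrow> deriv u x) (at 0)" by (simp add: DERIV_def)
  have c: "(\<lambda>n. 1 / real (Suc n)) \<longlonglongrightarrow> 0" by (rule LIMSEQ_Suc[OF lim_1_over_n])
  show "(\<lambda>n. (u (x + 1 / real (Suc n)) - u x) / (1 / real (Suc n))) \<longlonglongrightarrow> deriv u x"
    using tendsto_at_iff_sequentially[THEN iffD1, OF lim, rule_format, of "\<lambda>n. 1 / real (Suc n)"] c
    by (simp add: o_def del: of_nat_Suc)
qed

text \<open>A derivative that merely exists everywhere is integrable in the gauge sense, where the
  fundamental theorem holds; the majorant \<open>g\<close> makes it Lebesgue integrable, so the two
  integrals agree.\<close>

lemma increment_le_integral_deriv:
  fixes u :: "real \<Rightarrow> real"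
  assumes u: "\<And>y. u differentiable (at y)" and ab: "a \<le> b" and g: "set_integrable lborel {a..b} g"
    and le: "AE y in lborel. \<bar>deriv u y\<bar> \<le> g y"
  shows "\<bar>u b - u a\<bar> \<le> (LINT y:{a..b}|lborel. g y)"
proof -
  have [measurable]: "deriv u \<in> borel_measurable borel" by (rule borel_measurable_deriv_real[OF u])
  have i: "set_integrable lborel {a..b} (deriv u)"
    unfolding set_integrable_def
  proof (rule Bochner_Integration.integrable_bound)
    show "integrable lborel (\<lambda>x. indicator {a..b} x *\<^sub>R g x)" using g unfolding set_integrable_def .
    show "AE x in lborel. norm (indicator {a..b} x *\<^sub>R deriv u x) \<le> norm (indicator {a..b} x *\<^sub>R g x)"
      using le by eventually_elim (auto simp: indicator_def)
  qed measurable
  have "(deriv u has_integral (u b - u a)) {a..b}"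
  proof (rule fundamental_theorem_of_calculus[OF ab])
    fix x
    have "(u has_real_derivative deriv u x) (at x)" using u[of x] by (simp add: DERIV_deriv_iff_real_differentiable)
    then show "(u has_vector_derivative deriv u x) (at x within {a..b})"
      by (simp add: has_real_derivative_iff_has_vector_derivative has_vector_derivative_at_within)
  qed
  then have "u b - u a = (LINT y:{a..b}|lborel. deriv u y)"
    using set_borel_integral_eq_integral(2)[OF i] by (simp add: integral_unique)
  also have "\<bar>\<dots>\<bar> \<le> (LINT y|lborel. norm (indicator {a..b} y *\<^sub>R deriv u y))"
    unfolding set_lebesgue_integral_def real_norm_def[symmetric] by (rule integral_norm_bound)
  also have "\<dots> \<le> (LINT y|lborel. indicator {a..b} y *\<^sub>R g y)"
  proof (rule integral_mono_AE)
    show "AE y in lborel. norm (indicator {a..b} y *\<^sub>R deriv u y) \<le> indicator {a..b} y *\<^sub>R g y"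
      using le by eventually_elim (auto simp: indicator_def)
  qed (use i g in \<open>auto simp: set_integrable_def intro!: integrable_norm\<close>)
  finally show ?thesis unfolding set_lebesgue_integral_def .
qed

text \<open>The case \<open>1 < p\<close> is Hoelder's inequality for the derivative, proved from Young's inequality with the
  scaling \<open>(b - a) powr (1 / (p * q))\<close> that balances the two terms.\<close>

lemma transport_test_function_le:
  fixes u :: "real \<Rightarrow> real"
  assumes u: "\<And>y. u differentiable (at y)" and p: "1 \<le> p"
    and d: "if p = 1 then (AE y in lborel. \<bar>deriv u y\<bar> \<le> 1)
       else (\<integral>\<^sup>+ y. ennreal (\<bar>deriv u y\<bar> powr (p / (p - 1))) \<partial>lborel) \<le> 1"
  shows "\<bar>u a - u b\<bar> \<le> \<bar>a - b\<bar> powr (1 / p)"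
proof -
  have [measurable]: "deriv u \<in> borel_measurable borel" by (rule borel_measurable_deriv_real[OF u])
  have main: "\<bar>u b - u a\<bar> \<le> (b - a) powr (1 / p)" if ab: "a < b" for a b
  proof (cases "p = 1")
    case True
    have "\<bar>u b - u a\<bar> \<le> (LINT y:{a..b}|lborel. 1)"
    proof (rule increment_le_integral_deriv[OF u])
      show "set_integrable lborel {a..b} (\<lambda>y. 1::real)"
        unfolding set_integrable_def by (simp add: integrable_indicator_Icc)
    qed (use ab d True in auto)
    then show ?thesis using ab True by (simp add: set_lebesgue_integral_def)
  next
    case False
    then have p1: "1 < p" using p by simp
    define q where "q = p / (p - 1)"
    have q1: "1 < q" using p1 by (simp add: q_def divide_simps)
    have pq: "1 / q + 1 / p = 1" using p1 by (simp add: q_def divide_simps)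
    define l where "l = b - a"
    have l: "0 < l" using ab by (simp add: l_def)
    define c where "c = l powr (1 / (p * q))"
    have c: "0 < c" using l by (simp add: c_def)
    have nn: "(\<integral>\<^sup>+ y. ennreal (\<bar>deriv u y\<bar> powr q) \<partial>lborel) \<le> 1" using d False by (simp add: q_def)
    have iq: "integrable lborel (\<lambda>y. \<bar>deriv u y\<bar> powr q)"
      by (rule integrableI_nonneg) (use nn in \<open>auto intro: le_less_trans\<close>)
    have Iq: "(LINT y|lborel. \<bar>deriv u y\<bar> powr q) \<le> 1"
    proof -
      have "ennreal (LINT y|lborel. \<bar>deriv u y\<bar> powr q) \<le> ennreal 1"
        using nn by (subst nn_integral_eq_integral[symmetric, OF iq]) auto
      then show ?thesis by simp
    qed
    define g where "g y = (c powr q / q) * \<bar>deriv u y\<bar> powr q + (1 / c) powr p / p" for y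
    have young: "\<bar>deriv u y\<bar> \<le> g y" for y
    proof -
      have "(c * \<bar>deriv u y\<bar>) * (1 / c) \<le> (c * \<bar>deriv u y\<bar>) powr q / q + (1 / c) powr p / p"
        by (rule Youngs_inequality) (use q1 p1 pq c in auto)
      then show ?thesis using c by (simp add: g_def powr_mult)
    qed
    have gi: "integrable lborel (\<lambda>y. indicator {a..b} y *\<^sub>R g y)"
    proof -
      have "integrable lborel (\<lambda>y. (c powr q / q) * (indicator {a..b} y *\<^sub>R (\<bar>deriv u y\<bar> powr q)) + (1 / c) powr p / p * indicator {a..b} y)"
        by (intro Bochner_Integration.integrable_add integrable_mult_right integrable_mult_indicator iq) (simp_all add: integrable_indicator_Icc)
      then show ?thesis by (simp add: g_def algebra_simps)
    qed
    have "\<bar>u b - u a\<bar> \<le> (LINT y:{a..b}|lborel. g y)"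
      by (rule increment_le_integral_deriv[OF u]) (use ab gi young in \<open>auto simp: set_integrable_def\<close>)
    also have "\<dots> \<le> (LINT y|lborel. (c powr q / q) * \<bar>deriv u y\<bar> powr q + (1 / c) powr p / p * indicator {a..b} y)"
      unfolding set_lebesgue_integral_def
    proof (rule integral_mono[OF gi])
      show "integrable lborel (\<lambda>y. (c powr q / q) * \<bar>deriv u y\<bar> powr q + (1 / c) powr p / p * indicator {a..b} y)"
        by (intro Bochner_Integration.integrable_add integrable_mult_right iq) (simp_all add: integrable_indicator_Icc)
      fix y
      show "indicator {a..b} y *\<^sub>R g y \<le> (c powr q / q) * \<bar>deriv u y\<bar> powr q + (1 / c) powr p / p * indicator {a..b} y"
        using q1 by (simp add: g_def indicator_def)
    qed
    also have "\<dots> = (c powr q / q) * (LINT y|lborel. \<bar>deriv u y\<bar> powr q) + (1 / c) powr p / p * l"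
    proof -
      have "(LINT y|lborel. (c powr q / q) * \<bar>deriv u y\<bar> powr q + (1 / c) powr p / p * indicator {a..b} y)
        = (LINT y|lborel. (c powr q / q) * \<bar>deriv u y\<bar> powr q) + (LINT y|lborel. (1 / c) powr p / p * indicator {a..b} y)"
        by (intro Bochner_Integration.integral_add integrable_mult_right iq) (simp_all add: integrable_indicator_Icc)
      then show ?thesis using ab by (simp add: l_def)
    qed
    also have "\<dots> \<le> (c powr q / q) * 1 + (1 / c) powr p / p * l"
      using Iq q1 by (intro add_right_mono mult_left_mono) auto
    also have "\<dots> = l powr (1 / p)"
    proof -
      have "c powr q = l powr (1 / p)" using q1 by (simp add: c_def powr_powr)
      moreover have "(1 / c) powr p * l = l powr (1 / p)"
      proof -
        have "1 / c = l powr (- (1 / (p * q)))" by (simp add: c_def powr_minus divide_inverse)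
        moreover have "- (1 / (p * q)) * p = - (1 / q)" using p1 by simp
        ultimately have "(1 / c) powr p = l powr (- (1 / q))" by (simp only: powr_powr)
        then have "(1 / c) powr p * l = l powr (- (1 / q) + 1)"
          by (simp only: powr_add powr_one[OF less_imp_le[OF l]])
        moreover have "- (1 / q) + 1 = 1 / p" using pq by linarith
        ultimately show ?thesis by simp
      qed
      ultimately have "(c powr q / q) * 1 + (1 / c) powr p / p * l = l powr (1 / p) * (1 / q + 1 / p)"
        by (simp add: distrib_left)
      then show ?thesis by (simp only: pq mult_1_right)
    qed
    finally show ?thesis by (simp add: l_def)
  qed
  show ?thesis
  proof (cases a b rule: linorder_cases)
    case less then show ?thesis using main[OF less] by (simp add: abs_minus_commute)
  next
    case greater then show ?thesis using main[OF greater] by simp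
  qed (use p in simp)
qed

text \<open>Admissible test functions are Hoelder continuous of exponent 1 / p with constant
  1.\<close>

lemma transport_dist_le:
  assumes "1 \<le> p" "F \<in> borel_measurable borel" "G \<in> borel_measurable borel"
  shows "transport_dist p F G \<le> (\<integral>\<^sup>+ x. ennreal (\<bar>F x - G x\<bar> powr (1 / p)) \<partial>lborel)"
  unfolding transport_dist_def
proof (rule SUP_least)
  fix u :: "real \<Rightarrow> real"
  assume "u \<in> {u. (\<forall>y. u differentiable (at y)) \<and> (if p = 1 then (AE y in lborel. \<bar>deriv u y\<bar> \<le> 1)
       else (\<integral>\<^sup>+ y. ennreal (\<bar>deriv u y\<bar> powr (p / (p - 1))) \<partial>lborel) \<le> 1)}"
  then have "\<bar>u (F x) - u (G x)\<bar> \<le> \<bar>F x - G x\<bar> powr (1 / p)" for x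
    by (intro transport_test_function_le assms) auto
  then show "(\<integral>\<^sup>+ x. ennreal \<bar>u (F x) - u (G x)\<bar> \<partial>lborel) \<le> (\<integral>\<^sup>+ x. ennreal (\<bar>F x - G x\<bar> powr (1 / p)) \<partial>lborel)"
    by (intro nn_integral_mono ennreal_leI)
qed

text \<open>The signed kernel is 1 on [0, w) for positive w and -1 on [w, 0) for negative w, so
  integration from 0 to w becomes an integral over the whole line whatever the sign of w.\<close>

lemma ae_antiderivative_kernel:
  assumes h: "ae_antiderivative h h'"
  shows "integrable lborel (\<lambda>y. h' y * (indicator {0..} y - indicator {w..} y))"
    and "h w - h 0 = (LINT y|lborel. h' y * (indicator {0..} y - indicator {w..} y))"
proof -
  have S: "set_integrable lborel {a..b} h'" "h b - h a = (LINT x:{a..b}|lborel. h' x)" if "a \<le> b" for a b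
    using h that by (auto simp: ae_antiderivative_def)
  have [measurable]: "h' \<in> borel_measurable borel" using h by (simp add: ae_antiderivative_def)
  have ae: "AE y in lborel. y \<noteq> w" by (rule AE_lborel_singleton)
  have ae0: "AE y in lborel. y \<noteq> (0::real)" by (rule AE_lborel_singleton)
  have "integrable lborel (\<lambda>y. h' y * (indicator {0..} y - indicator {w..} y)) \<and>
    h w - h 0 = (LINT y|lborel. h' y * (indicator {0..} y - indicator {w..} y))"
  proof (cases "0 \<le> w")
    case True
    have eq: "AE y in lborel. h' y * (indicator {0..} y - indicator {w..} y) = indicator {0..w} y *\<^sub>R h' y"
      using ae by eventually_elim (use True in \<open>auto simp: indicator_def\<close>)
    have "integrable lborel (\<lambda>y. h' y * (indicator {0..} y - indicator {w..} y))"
      using S(1)[OF True] unfolding set_integrable_def by (subst integrable_cong_AE[OF _ _ eq]) auto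
    moreover have "(LINT y|lborel. h' y * (indicator {0..} y - indicator {w..} y)) = (LINT y:{0..w}|lborel. h' y)"
      unfolding set_lebesgue_integral_def by (rule integral_cong_AE[OF _ _ eq]) auto
    ultimately show ?thesis using S(2)[OF True] by simp
  next
    case False
    then have w: "w \<le> 0" by simp
    have eq: "AE y in lborel. h' y * (indicator {0..} y - indicator {w..} y) = - (indicator {w..0} y *\<^sub>R h' y)"
      using ae0 by eventually_elim (use False in \<open>auto simp: indicator_def\<close>)
    have "integrable lborel (\<lambda>y. h' y * (indicator {0..} y - indicator {w..} y))"
      using S(1)[OF w] unfolding set_integrable_def by (subst integrable_cong_AE[OF _ _ eq]) auto
    moreover have "(LINT y|lborel. h' y * (indicator {0..} y - indicator {w..} y)) = - (LINT y:{w..0}|lborel. h' y)"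
      unfolding set_lebesgue_integral_def integral_minus[symmetric] by (rule integral_cong_AE[OF _ _ eq]) auto
    ultimately show ?thesis using S(2)[OF w] by simp
  qed
  then show "integrable lborel (\<lambda>y. h' y * (indicator {0..} y - indicator {w..} y))"
    "h w - h 0 = (LINT y|lborel. h' y * (indicator {0..} y - indicator {w..} y))" by auto
qed

text \<open>Integrating the kernel identity against g dM and exchanging the integrals leaves 1 on
  the positive half-line minus the distribution function, because the total mass is 1. With general
  \<open>M\<close> and signed \<open>g\<close> it covers both the law of W n and the signed measure
  of the expansion.\<close>

lemma integral_by_distribution_function:
  fixes g Y :: "'a \<Rightarrow> real"
  assumes sf: "sigma_finite_measure M" and [measurable]: "g \<in> borel_measurable M" "Y \<in> borel_measurable M"
    and gi: "integrable M (\<lambda>x. g x * (1 + \<bar>Y x\<bar>) ^ m)"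
    and h: "ae_antiderivative h h'" and hi: "integrable lborel (\<lambda>y. \<bar>h' y\<bar> / (1 + \<bar>y\<bar>) ^ m)"
    and g1: "(LINT x|M. g x) = 1"
  shows "integrable lborel (\<lambda>y. h' y * (indicator {0..} y - (LINT x|M. g x * indicator {..y} (Y x))))"
    and "(LINT x|M. g x * h (Y x)) = h 0 + (LINT y|lborel. h' y * (indicator {0..} y - (LINT x|M. g x * indicator {..y} (Y x))))"
proof -
  interpret sigma_finite_measure M by fact
  interpret pair_sigma_finite M lborel by unfold_locales
  have [measurable]: "h' \<in> borel_measurable borel" using h by (simp add: ae_antiderivative_def)
  let ?k = "\<lambda>w y. indicator {0..} y - indicator {w..} y :: real"
  \<comment> \<open>The kernel vanishes unless |y| is at most |w|, so the weight can be moved from y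
    to w; this gives the majorant for Fubini.\<close>
  have kle: "\<bar>?k w y\<bar> * (1 + \<bar>y\<bar>) ^ m \<le> (1 + \<bar>w\<bar>) ^ m" for w y
  proof (cases "?k w y = 0")
    case False
    then have ne: "(0 \<le> y) \<noteq> (w \<le> y)" by (auto simp: indicator_def)
    then have "\<bar>?k w y\<bar> = 1" by (auto simp: indicator_def)
    moreover have "\<bar>y\<bar> \<le> \<bar>w\<bar>" using ne by (cases "0 \<le> y") auto
    ultimately show ?thesis by (auto intro!: power_mono)
  qed simp
  have g_int: "integrable M g"
  proof (rule Bochner_Integration.integrable_bound[OF gi])
    show "AE x in M. norm (g x) \<le> norm (g x * (1 + \<bar>Y x\<bar>) ^ m)"
    proof (rule AE_I2)
      fix x
      have "\<bar>g x\<bar> * 1 \<le> \<bar>g x\<bar> * (1 + \<bar>Y x\<bar>) ^ m" by (intro mult_left_mono one_le_power) auto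
      then show "norm (g x) \<le> norm (g x * (1 + \<bar>Y x\<bar>) ^ m)" by (simp add: abs_mult)
    qed
  qed measurable
  have prod: "integrable (M \<Otimes>\<^sub>M lborel) (\<lambda>(x, y). (g x * (1 + \<bar>Y x\<bar>) ^ m) * (\<bar>h' y\<bar> / (1 + \<bar>y\<bar>) ^ m))"
  proof (rule Fubini_integrable)
    have "(LINT y|lborel. norm ((g x * (1 + \<bar>Y x\<bar>) ^ m) * (\<bar>h' y\<bar> / (1 + \<bar>y\<bar>) ^ m)))
      = \<bar>g x * (1 + \<bar>Y x\<bar>) ^ m\<bar> * (LINT y|lborel. \<bar>h' y\<bar> / (1 + \<bar>y\<bar>) ^ m)" for x
      unfolding real_norm_def abs_mult[of "g x * (1 + \<bar>Y x\<bar>) ^ m"] by (subst integral_mult_right_zero) simp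
    then show "integrable M (\<lambda>x. LINT y|lborel. norm (case (x, y) of (x, y) \<Rightarrow> (g x * (1 + \<bar>Y x\<bar>) ^ m) * (\<bar>h' y\<bar> / (1 + \<bar>y\<bar>) ^ m)))"
      using integrable_abs[OF gi] by (simp only: prod.case) (rule integrable_mult_left)
    show "AE x in M. integrable lborel (\<lambda>y. case (x, y) of (x, y) \<Rightarrow> (g x * (1 + \<bar>Y x\<bar>) ^ m) * (\<bar>h' y\<bar> / (1 + \<bar>y\<bar>) ^ m))"
      unfolding prod.case by (intro AE_I2 integrable_mult_right hi)
  qed measurable
  have joint: "integrable (M \<Otimes>\<^sub>M lborel) (\<lambda>(x, y). g x * (h' y * ?k (Y x) y))"
  proof (rule Bochner_Integration.integrable_bound[OF prod])
    have km: "(\<lambda>p. indicator {Y (fst p)..} (snd p) :: real) \<in> borel_measurable (M \<Otimes>\<^sub>M lborel)"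
    proof -
      have "(\<lambda>p. indicator {Y (fst p)..} (snd p) :: real) = (\<lambda>p. if Y (fst p) \<le> snd p then 1 else 0)"
        by (auto simp: indicator_def)
      then show ?thesis by simp
    qed
    then show "(\<lambda>(x, y). g x * (h' y * ?k (Y x) y)) \<in> borel_measurable (M \<Otimes>\<^sub>M lborel)"
      unfolding case_prod_beta by measurable
    have "\<bar>g x * (h' y * ?k (Y x) y)\<bar> \<le> \<bar>(g x * (1 + \<bar>Y x\<bar>) ^ m) * (\<bar>h' y\<bar> / (1 + \<bar>y\<bar>) ^ m)\<bar>" for x y
    proof -
      have p: "0 < (1 + \<bar>y\<bar>) ^ m" by simp
      have "\<bar>?k (Y x) y\<bar> \<le> (1 + \<bar>Y x\<bar>) ^ m / (1 + \<bar>y\<bar>) ^ m" using kle[of y "Y x"] p by (simp only: pos_le_divide_eq)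
      then have "(\<bar>g x\<bar> * \<bar>h' y\<bar>) * \<bar>?k (Y x) y\<bar> \<le> (\<bar>g x\<bar> * \<bar>h' y\<bar>) * ((1 + \<bar>Y x\<bar>) ^ m / (1 + \<bar>y\<bar>) ^ m)"
        by (rule mult_left_mono) simp
      then show ?thesis by (simp add: abs_mult mult_ac)
    qed
    then show "AE p in M \<Otimes>\<^sub>M lborel. norm (case p of (x, y) \<Rightarrow> g x * (h' y * ?k (Y x) y))
      \<le> norm (case p of (x, y) \<Rightarrow> (g x * (1 + \<bar>Y x\<bar>) ^ m) * (\<bar>h' y\<bar> / (1 + \<bar>y\<bar>) ^ m))"
      by (intro AE_I2) (auto split: prod.split)
  qed
  have inner: "(LINT x|M. g x * (h' y * ?k (Y x) y)) = h' y * (indicator {0..} y - (LINT x|M. g x * indicator {..y} (Y x)))" for y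
  proof -
    have gI: "integrable M (\<lambda>x. g x * indicator {..y} (Y x))"
      by (rule Bochner_Integration.integrable_bound[OF g_int]) (auto simp: indicator_def intro!: AE_I2)
    have "(LINT x|M. g x * (h' y * ?k (Y x) y)) = (LINT x|M. h' y * (indicator {0..} y * g x - g x * indicator {..y} (Y x)))"
      by (intro Bochner_Integration.integral_cong refl) (auto simp: indicator_def)
    also have "\<dots> = h' y * (indicator {0..} y * (LINT x|M. g x) - (LINT x|M. g x * indicator {..y} (Y x)))"
      by (simp only: integral_mult_right_zero Bochner_Integration.integral_diff[OF integrable_mult_right[OF g_int] gI])
    finally show ?thesis by (simp only: g1 mult_1_right)
  qed
  show "integrable lborel (\<lambda>y. h' y * (indicator {0..} y - (LINT x|M. g x * indicator {..y} (Y x))))"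
    using integrable_snd[OF joint] unfolding inner .
  have hY: "g x * h (Y x) = h 0 * g x + (LINT y|lborel. g x * (h' y * ?k (Y x) y))" for x
    using ae_antiderivative_kernel(2)[OF h, of "Y x"] by (simp only: integral_mult_right_zero) (simp add: algebra_simps)
  have "(LINT x|M. g x * h (Y x)) = (LINT x|M. h 0 * g x) + (LINT x|M. (LINT y|lborel. g x * (h' y * ?k (Y x) y)))"
    unfolding hY by (rule Bochner_Integration.integral_add[OF integrable_mult_right[OF g_int] integrable_fst[OF joint]])
  also have "(LINT x|M. (LINT y|lborel. g x * (h' y * ?k (Y x) y))) = (LINT y|lborel. (LINT x|M. g x * (h' y * ?k (Y x) y)))"
    by (rule Fubini_integral[symmetric, OF joint])
  finally show "(LINT x|M. g x * h (Y x)) = h 0 + (LINT y|lborel. h' y * (indicator {0..} y - (LINT x|M. g x * indicator {..y} (Y x))))"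
    unfolding inner by (simp only: integral_mult_right_zero g1 mult_1_right)
qed

text \<open>The exceptional point 0 is there for powers of the absolute value; continuity of
  \<open>h\<close> lets the fundamental theorem pass over it.\<close>

lemma ae_antiderivativeI:
  assumes cont: "continuous_on UNIV h" and der: "\<And>x. x \<noteq> 0 \<Longrightarrow> (h has_real_derivative h' x) (at x)"
    and [measurable]: "h' \<in> borel_measurable borel" and bd: "\<And>x. \<bar>h' x\<bar> \<le> K * (1 + \<bar>x\<bar>) ^ k"
  shows "ae_antiderivative h h'"
  unfolding ae_antiderivative_def
proof (intro conjI allI impI)
  show "AE x in lborel. (h has_real_derivative h' x) (at x)"
    using AE_lborel_singleton[of 0] by eventually_elim (rule der)
  fix a b :: real assume ab: "a \<le> b"
  have K: "0 \<le> K" using order_trans[OF abs_ge_zero bd[of 0]] by simp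
  show i: "set_integrable lborel {a..b} h'"
    unfolding set_integrable_def
  proof (rule Bochner_Integration.integrable_bound)
    show "integrable lborel (\<lambda>x. indicator {a..b} x *\<^sub>R (K * (1 + \<bar>x\<bar>) ^ k))"
      using borel_integrable_atLeastAtMost'[of a b "\<lambda>x. K * (1 + \<bar>x\<bar>) ^ k"]
      by (simp add: set_integrable_def continuous_intros)
    show "AE x in lborel. norm (indicator {a..b} x *\<^sub>R h' x) \<le> norm (indicator {a..b} x *\<^sub>R (K * (1 + \<bar>x\<bar>) ^ k))"
      using bd K by (intro AE_I2) (auto simp: indicator_def abs_mult)
  qed measurable
  have "(h' has_integral (h b - h a)) {a..b}"
  proof (rule fundamental_theorem_of_calculus_strong[of "{0}"])
    show "continuous_on {a..b} h" using cont continuous_on_subset by blast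
    show "(h has_vector_derivative h' x) (at x)" if "x \<in> {a..b} - {0}" for x
      using der[of x] that by (simp add: has_real_derivative_iff_has_vector_derivative)
  qed (use ab in auto)
  then show "h b - h a = (LINT x:{a..b}|lborel. h' x)"
    using set_borel_integral_eq_integral(2)[OF i] by (simp add: integral_unique)
qed (use assms in auto)

text \<open>For \<open>q = 0\<close> the truncated exponent \<open>q - 1\<close> is 0, which the
  factor \<open>real q\<close> makes harmless.\<close>

lemma power_antiderivatives:
  fixes q :: nat
  shows "ae_antiderivative (\<lambda>x. x ^ q) (\<lambda>x. real q * x ^ (q - 1))"
    and "ae_antiderivative (\<lambda>x. \<bar>x\<bar> ^ q) (\<lambda>x. real q * \<bar>x\<bar> ^ (q - 1) * sgn x)"
proof -
  have bd: "\<bar>x\<bar> ^ (q - 1) \<le> (1 + \<bar>x\<bar>) ^ q" for x :: real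
  proof -
    have "\<bar>x\<bar> ^ (q - 1) \<le> (1 + \<bar>x\<bar>) ^ (q - 1)" by (intro power_mono) auto
    also have "\<dots> \<le> (1 + \<bar>x\<bar>) ^ q" by (rule power_increasing) auto
    finally show ?thesis .
  qed
  show "ae_antiderivative (\<lambda>x. x ^ q) (\<lambda>x. real q * x ^ (q - 1))"
  proof (rule ae_antiderivativeI)
    show "((\<lambda>x. x ^ q) has_real_derivative real q * x ^ (q - 1)) (at x)" for x :: real
      using DERIV_pow[of q x] by simp
    show "\<bar>real q * x ^ (q - 1)\<bar> \<le> real q * (1 + \<bar>x\<bar>) ^ q" for x :: real
      using bd[of x] by (simp add: abs_mult power_abs mult_left_mono)
  qed (auto intro!: continuous_intros)
  show "ae_antiderivative (\<lambda>x. \<bar>x\<bar> ^ q) (\<lambda>x. real q * \<bar>x\<bar> ^ (q - 1) * sgn x)"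
  proof (rule ae_antiderivativeI)
    show "((\<lambda>x. \<bar>x\<bar> ^ q) has_real_derivative real q * \<bar>x\<bar> ^ (q - 1) * sgn x) (at x)" if "x \<noteq> 0" for x :: real
    proof -
      have "(abs has_real_derivative sgn x) (at x)"
      proof (cases "0 < x")
        case True
        have "((\<lambda>x. x) has_real_derivative 1) (at x)" by (rule DERIV_ident)
        then have "(abs has_real_derivative 1) (at x)"
          by (rule has_field_derivative_transform_within_open[of _ _ _ "{0<..}"]) (use True in auto)
        then show ?thesis using True by simp
      next
        case False
        have "((\<lambda>x. - x) has_real_derivative -1) (at x)" by (auto intro!: derivative_eq_intros)
        then have "(abs has_real_derivative -1) (at x)"
          by (rule has_field_derivative_transform_within_open[of _ _ _ "{..<0}"]) (use False that in auto)
        then show ?thesis using False that by simp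
      qed
      from DERIV_power[OF this, of q] show ?thesis by (simp add: mult_ac)
    qed
    show "\<bar>real q * \<bar>x\<bar> ^ (q - 1) * sgn x\<bar> \<le> real q * (1 + \<bar>x\<bar>) ^ q" for x :: real
      using bd[of x] mult_left_mono[OF bd[of x], of "real q"] by (simp add: abs_mult abs_sgn_eq)
  qed (auto intro!: continuous_intros)
qed

section \<open>The signed measure of the expansion and its integrals\<close>

context edgeworth_normalized
begin

lemma dens_tail: "\<exists>K\<ge>0. \<forall>x. \<bar>dens R n x\<bar> \<le> K / (1 + \<bar>x\<bar>) ^ k"
proof -
  define p where "p = 1 + (\<Sum>j=1..R. smult (1 / B n ^ j) (\<Sum>l<3 * j. smult (real_coeff j n (Suc l)) (hermite (Suc l))))"
  have "dens R n x = std_normal_density x * poly p x" for x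
    unfolding dens_def p_def
    by (simp del: hermite.simps add: poly_sum distrib_left sum_distrib_left sum_divide_distrib divide_inverse mult_ac)
  then have eq: "\<bar>dens R n x\<bar> = std_normal_density x * \<bar>poly p x\<bar>" for x
    by (simp only: abs_mult abs_of_nonneg[OF normal_density_nonneg])
  show ?thesis unfolding eq by (rule poly_density_le)
qed

lemma dens_measurable[measurable]: "dens R n \<in> borel_measurable borel"
  by (rule borel_measurable_continuous_onI[OF continuous_dens])

lemma integrable_dens: "integrable lborel (\<lambda>x. dens R n x * (1 + \<bar>x\<bar>) ^ k)"
proof -
  from dens_tail[of R n "k + 2"] obtain K where K: "0 \<le> K \<and> (\<forall>x. \<bar>dens R n x\<bar> \<le> K / (1 + \<bar>x\<bar>) ^ (k + 2))" by (rule exE)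
  show ?thesis
  proof (rule Bochner_Integration.integrable_bound[OF integrable_mult_right[OF integrable_inverse_1_plus_sq, of K]])
    have "\<bar>dens R n x\<bar> * (1 + \<bar>x\<bar>) ^ k \<le> K * (1 / (1 + x\<^sup>2))" for x
    proof -
      have p: "0 < (1 + \<bar>x\<bar>) ^ k" "0 < (1 + \<bar>x\<bar>)\<^sup>2" by simp_all
      have "\<bar>dens R n x\<bar> * (1 + \<bar>x\<bar>) ^ k \<le> K / (1 + \<bar>x\<bar>) ^ (k + 2) * (1 + \<bar>x\<bar>) ^ k"
        using K p by (intro mult_right_mono) auto
      also have "\<dots> = K / (1 + \<bar>x\<bar>)\<^sup>2" using p by (simp only: power_add) simp
      also have "\<dots> \<le> K / (1 + x\<^sup>2)"
      proof (rule divide_left_mono)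
        show "1 + x\<^sup>2 \<le> (1 + \<bar>x\<bar>)\<^sup>2" by (simp add: power2_sum)
        show "0 < (1 + \<bar>x\<bar>)\<^sup>2 * (1 + x\<^sup>2)" using p by (intro mult_pos_pos add_pos_nonneg) auto
      qed (use K in simp)
      finally show ?thesis by simp
    qed
    then show "AE x in lborel. norm (dens R n x * (1 + \<bar>x\<bar>) ^ k) \<le> norm (K * (1 / (1 + x\<^sup>2)))"
      using K by (intro AE_I2) (simp add: abs_mult add_nonneg_nonneg)
  qed measurable
qed

lemma integrable_dens': "integrable lborel (dens R n)"
  using integrable_dens[of R n 0] by simp

lemma inverse_power_tendsto_0:
  assumes "filterlim (\<lambda>i. \<bar>x i\<bar>) at_top sequentially"
  shows "(\<lambda>i::nat. K / (1 + \<bar>x i\<bar>) ^ 1 :: real) \<longlonglongrightarrow> 0"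
proof -
  have "filterlim (\<lambda>i. 1 + \<bar>x i\<bar>) at_top sequentially"
    by (rule filterlim_tendsto_add_at_top[OF tendsto_const assms])
  then show ?thesis by (auto intro!: tendsto_divide_0[OF tendsto_const] filterlim_at_top_imp_at_infinity)
qed

text \<open>The limits are inherited from the distribution function \<open>F n\<close>, since the
  difference decays like 1 / (1 + |x|).\<close>

lemma approx_limits:
  assumes "0 < B n"
  shows "(\<lambda>i. \<Psi> R n (- real i)) \<longlonglongrightarrow> 0" "(\<lambda>i. \<Psi> R n (real i)) \<longlonglongrightarrow> 1"
proof -
  interpret D: real_distribution "distr M borel (W n)" by (rule real_distribution_distr) simp
  from difference_tail_each[OF assms, of R 1] obtain K where K: "\<And>x. \<bar>F n x - \<Psi> R n x\<bar> \<le> K / (1 + \<bar>x\<bar>) ^ 1" by blast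
  have lo: "(\<lambda>i. F n (- real i) - \<Psi> R n (- real i)) \<longlonglongrightarrow> 0"
  proof (rule Lim_null_comparison[OF always_eventually inverse_power_tendsto_0[of "\<lambda>i. - real i" K]])
    show "filterlim (\<lambda>i. \<bar>- real i\<bar>) at_top sequentially" by (simp add: filterlim_real_sequentially)
    show "\<forall>i. norm (F n (- real i) - \<Psi> R n (- real i)) \<le> K / (1 + \<bar>- real i\<bar>) ^ 1"
      unfolding real_norm_def by (intro allI K)
  qed
  from tendsto_diff[OF D.cdf_lim_neg_infty lo] show "(\<lambda>i. \<Psi> R n (- real i)) \<longlonglongrightarrow> 0" by simp
  have hi: "(\<lambda>i. F n (real i) - \<Psi> R n (real i)) \<longlonglongrightarrow> 0"
  proof (rule Lim_null_comparison[OF always_eventually inverse_power_tendsto_0[of "\<lambda>i. real i" K]])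
    show "filterlim (\<lambda>i. \<bar>real i\<bar>) at_top sequentially" by (simp add: filterlim_real_sequentially)
    show "\<forall>i. norm (F n (real i) - \<Psi> R n (real i)) \<le> K / (1 + \<bar>real i\<bar>) ^ 1"
      unfolding real_norm_def by (intro allI K)
  qed
  from tendsto_diff[OF D.cdf_lim_infty_prob hi] show "(\<lambda>i. \<Psi> R n (real i)) \<longlonglongrightarrow> 1" by simp
qed

lemma dens_increment: "u \<le> v \<Longrightarrow> (LINT x|lborel. dens R n x * indicator {u..v} x) = \<Psi> R n v - \<Psi> R n u"
  using continuous_dens[of UNIV R n]
  by (intro integral_FTC_Icc_real approx_has_derivative) (auto simp: continuous_on_eq_continuous_at)

lemma dens_distribution:
  assumes "0 < B n"
  shows "(LINT x|lborel. dens R n x * indicator {..y} x) = \<Psi> R n y" "(LINT x|lborel. dens R n x) = 1"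
proof -
  have lim: "(\<lambda>i. LINT x|lborel. dens R n x * indicator {- real i..c i} x) \<longlonglongrightarrow> (LINT x|lborel. dens R n x * g x)"
    if "\<And>x. (\<lambda>i. indicator {- real i..c i} x) \<longlonglongrightarrow> (g x :: real)" and [measurable]: "g \<in> borel_measurable borel" for c g
  proof (rule integral_dominated_convergence[where w="\<lambda>x. \<bar>dens R n x\<bar>"])
    show "integrable lborel (\<lambda>x. \<bar>dens R n x\<bar>)" by (rule integrable_abs[OF integrable_dens'])
    show "AE x in lborel. (\<lambda>i. dens R n x * indicator {- real i..c i} x) \<longlonglongrightarrow> dens R n x * g x"
      by (intro AE_I2 tendsto_mult tendsto_const that)
    show "AE x in lborel. norm (dens R n x * indicator {- real i..c i} x) \<le> \<bar>dens R n x\<bar>" for i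
      by (auto simp: indicator_def intro!: AE_I2)
  qed measurable
  have ev: "\<forall>\<^sub>F i in sequentially. c \<le> real i" for c :: real
    using filterlim_real_sequentially by (simp add: filterlim_at_top)
  have "(\<lambda>i. LINT x|lborel. dens R n x * indicator {- real i..y} x) \<longlonglongrightarrow> (LINT x|lborel. dens R n x * indicator {..y} x)"
  proof (rule lim)
    fix x
    have "\<forall>\<^sub>F i in sequentially. (indicator {..y} x :: real) = indicator {- real i..y} x"
      using ev[of "- x"] by eventually_elim (auto simp: indicator_def)
    then show "(\<lambda>i. indicator {- real i..y} x :: real) \<longlonglongrightarrow> indicator {..y} x"
      by (rule Lim_transform_eventually[OF tendsto_const])
  qed simp
  moreover have "(\<lambda>i. LINT x|lborel. dens R n x * indicator {- real i..y} x) \<longlonglongrightarrow> \<Psi> R n y - 0"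
  proof (rule Lim_transform_eventually)
    show "(\<lambda>i. \<Psi> R n y - \<Psi> R n (- real i)) \<longlonglongrightarrow> \<Psi> R n y - 0"
      by (intro tendsto_diff tendsto_const approx_limits assms)
    show "\<forall>\<^sub>F i in sequentially. \<Psi> R n y - \<Psi> R n (- real i) = (LINT x|lborel. dens R n x * indicator {- real i..y} x)"
      using ev[of "- y"] by eventually_elim (subst dens_increment, auto)
  qed
  ultimately show "(LINT x|lborel. dens R n x * indicator {..y} x) = \<Psi> R n y" using LIMSEQ_unique by fastforce
  have "(\<lambda>i. LINT x|lborel. dens R n x * indicator {- real i..real i} x) \<longlonglongrightarrow> (LINT x|lborel. dens R n x * 1)"
  proof (rule lim)
    fix x :: real
    have "\<forall>\<^sub>F i in sequentially. (1 :: real) = indicator {- real i..real i} x"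
      using ev[of "- x"] ev[of x] by eventually_elim (auto simp: indicator_def)
    then show "(\<lambda>i. indicator {- real i..real i} x :: real) \<longlonglongrightarrow> 1"
      by (rule Lim_transform_eventually[OF tendsto_const])
  qed simp
  moreover have "(\<lambda>i. LINT x|lborel. dens R n x * indicator {- real i..real i} x) \<longlonglongrightarrow> 1 - 0"
  proof -
    have "(\<lambda>i. LINT x|lborel. dens R n x * indicator {- real i..real i} x) = (\<lambda>i. \<Psi> R n (real i) - \<Psi> R n (- real i))"
      by (intro ext, subst dens_increment) auto
    then show ?thesis by (simp only:) (intro tendsto_diff approx_limits assms)
  qed
  ultimately show "(LINT x|lborel. dens R n x) = 1" using LIMSEQ_unique by fastforce
qed

text \<open>Both integrals have the same representation with \<open>h 0\<close> in front, because
  both measures have total mass 1. The constants cancel, and what remains is the integral of h'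
  against the difference of the distribution functions.\<close>

lemma expectation_difference:
  assumes B: "0 < B n" and h: "ae_antiderivative h h'" and hi: "integrable lborel (\<lambda>y. \<bar>h' y\<bar> / (1 + \<bar>y\<bar>) ^ m)"
    and c: "\<And>x. \<bar>F n x - \<Psi> R n x\<bar> \<le> c / (1 + \<bar>x\<bar>) ^ m"
  shows "\<bar>expectation (\<lambda>x. h (W n x)) - (LINT x|lborel. h x * deriv (\<Psi> R n) x)\<bar> \<le> c * (LINT y|lborel. \<bar>h' y\<bar> / (1 + \<bar>y\<bar>) ^ m)"
proof -
  have [measurable]: "h' \<in> borel_measurable borel" using h by (simp add: ae_antiderivative_def)
  have Feq: "expectation (\<lambda>x. 1 * indicator {..y} (W n x)) = F n y" for y
  proof -
    have "F n y = measure M (W n -` {..y} \<inter> space M)" by (simp add: cdf_def measure_distr)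
    also have "\<dots> = expectation (indicator (W n -` {..y} \<inter> space M))" by simp
    also have "\<dots> = expectation (\<lambda>x. 1 * indicator {..y} (W n x))"
      by (intro Bochner_Integration.integral_cong) (auto simp: indicator_def)
    finally show ?thesis by simp
  qed
  have one: "expectation (\<lambda>x. 1) = (1::real)" by (simp add: prob_space)
  have i1: "integrable M (\<lambda>x. 1 * (1 + \<bar>W n x\<bar>) ^ m)" using integrable_W by simp
  note 1 = integral_by_distribution_function[OF sigma_finite_measure_axioms borel_measurable_const W_measurable i1 h hi one, unfolded Feq]
  have id: "(\<lambda>x::real. x) \<in> borel_measurable lborel" by simp
  have dm: "dens R n \<in> borel_measurable lborel" by simp
  note 2 = integral_by_distribution_function[OF lborel.sigma_finite_measure_axioms dm id integrable_dens h hi dens_distribution(2)[OF B], unfolded dens_distribution(1)[OF B]]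
  have dd: "deriv (\<Psi> R n) x = dens R n x" for x by (rule DERIV_imp_deriv[OF approx_has_derivative])
  have d1: "expectation (\<lambda>x. h (W n x)) - (LINT x|lborel. h x * deriv (\<Psi> R n) x)
     = (LINT y|lborel. h' y * (indicator {0..} y - F n y)) - (LINT y|lborel. h' y * (indicator {0..} y - \<Psi> R n y))"
    using 1(2) 2(2) unfolding dd by (simp add: mult.commute)
  have d2: "(LINT y|lborel. h' y * (indicator {0..} y - F n y)) - (LINT y|lborel. h' y * (indicator {0..} y - \<Psi> R n y))
     = (LINT y|lborel. h' y * (indicator {0..} y - F n y) - h' y * (indicator {0..} y - \<Psi> R n y))"
    by (rule Bochner_Integration.integral_diff[symmetric, OF 1(1) 2(1)])
  have d3: "\<bar>LINT y|lborel. h' y * (indicator {0..} y - F n y) - h' y * (indicator {0..} y - \<Psi> R n y)\<bar>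
      \<le> (LINT y|lborel. c * (\<bar>h' y\<bar> / (1 + \<bar>y\<bar>) ^ m))"
    unfolding real_norm_def[symmetric]
  proof (rule norm_integral_le_integral)
    show "integrable lborel (\<lambda>y. h' y * (indicator {0..} y - F n y) - h' y * (indicator {0..} y - \<Psi> R n y))"
      by (rule Bochner_Integration.integrable_diff[OF 1(1) 2(1)])
    show "integrable lborel (\<lambda>y. c * (norm (h' y) / (1 + norm y) ^ m))" using integrable_mult_right[OF hi, of c] by simp
    fix y
    have "h' y * (indicator {0..} y - F n y) - h' y * (indicator {0..} y - \<Psi> R n y) = - (h' y * (F n y - \<Psi> R n y))"
      by (simp add: right_diff_distrib)
    then have "norm (h' y * (indicator {0..} y - F n y) - h' y * (indicator {0..} y - \<Psi> R n y)) = \<bar>h' y\<bar> * \<bar>F n y - \<Psi> R n y\<bar>"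
      by (simp only: real_norm_def abs_minus_cancel abs_mult)
    also have "\<dots> \<le> \<bar>h' y\<bar> * (c / (1 + \<bar>y\<bar>) ^ m)" by (rule mult_left_mono[OF c]) simp
    finally show "norm (h' y * (indicator {0..} y - F n y) - h' y * (indicator {0..} y - \<Psi> R n y)) \<le> c * (norm (h' y) / (1 + norm y) ^ m)"
      by (simp add: mult.commute)
  qed
  show ?thesis unfolding d1 d2 by (rule order_trans[OF d3]) (simp only: integral_mult_right_zero order_refl)
qed

lemma power_weight:
  assumes "q < m"
  shows "integrable lborel (\<lambda>y. \<bar>real q * y ^ (q - 1)\<bar> / (1 + \<bar>y\<bar>) ^ m)"
    "integrable lborel (\<lambda>y. \<bar>real q * \<bar>y\<bar> ^ (q - 1) * sgn y\<bar> / (1 + \<bar>y\<bar>) ^ m)"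
    "(LINT y|lborel. \<bar>real q * y ^ (q - 1)\<bar> / (1 + \<bar>y\<bar>) ^ m) \<le> real m * (LINT t|lborel. 1 / (1 + t\<^sup>2))"
    "(LINT y|lborel. \<bar>real q * \<bar>y\<bar> ^ (q - 1) * sgn y\<bar> / (1 + \<bar>y\<bar>) ^ m) \<le> real m * (LINT t|lborel. 1 / (1 + t\<^sup>2))"
proof -
  let ?b = "\<lambda>y::real. real q * \<bar>y\<bar> ^ (q - 1) / (1 + \<bar>y\<bar>) ^ m"
  have b: "?b y \<le> real m * (1 / (1 + y\<^sup>2))" for y
  proof (cases "q = 0")
    case True then show ?thesis by (simp add: add_nonneg_nonneg)
  next
    case False
    have "\<bar>y\<bar> ^ (q - 1) * (1 + y\<^sup>2) \<le> (1 + \<bar>y\<bar>) ^ (q - 1) * (1 + \<bar>y\<bar>)\<^sup>2"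
      by (intro mult_mono power_mono) (auto simp: power2_sum add_nonneg_nonneg)
    also have "\<dots> = (1 + \<bar>y\<bar>) ^ (q - 1 + 2)" by (simp only: power_add)
    \<comment> \<open>As q is positive, q - 1 + 2 = q + 1, which is at most m because
      \<open>q < m\<close>.\<close>
    also have "\<dots> \<le> (1 + \<bar>y\<bar>) ^ m" by (rule power_increasing) (use assms False in auto)
    finally have "\<bar>y\<bar> ^ (q - 1) * (1 + y\<^sup>2) \<le> (1 + \<bar>y\<bar>) ^ m" .
    moreover have p: "0 < 1 + y\<^sup>2" "0 < (1 + \<bar>y\<bar>) ^ m" by (simp_all add: add_pos_nonneg)
    ultimately have "\<bar>y\<bar> ^ (q - 1) / (1 + \<bar>y\<bar>) ^ m \<le> 1 / (1 + y\<^sup>2)" by (simp add: divide_simps mult.commute)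
    then have "real q * (\<bar>y\<bar> ^ (q - 1) / (1 + \<bar>y\<bar>) ^ m) \<le> real m * (1 / (1 + y\<^sup>2))"
      using assms p by (intro mult_mono) auto
    then show ?thesis by simp
  qed
  have I: "integrable lborel (\<lambda>y. real m * (1 / (1 + y\<^sup>2)))" by (intro integrable_mult_right integrable_inverse_1_plus_sq)
  have main: "integrable lborel (\<lambda>y. f y) \<and> (LINT y|lborel. f y) \<le> real m * (LINT t|lborel. 1 / (1 + t\<^sup>2))"
    if [measurable]: "f \<in> borel_measurable borel" and f: "\<And>y. 0 \<le> f y" "\<And>y. f y \<le> ?b y" for f
  proof
    show i: "integrable lborel f"
    proof (rule Bochner_Integration.integrable_bound[OF I])
      show "AE y in lborel. norm (f y) \<le> norm (real m * (1 / (1 + y\<^sup>2)))"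
        using f b by (intro AE_I2) (metis abs_ge_self abs_of_nonneg order_trans real_norm_def)
    qed measurable
    have "(LINT y|lborel. f y) \<le> (LINT y|lborel. real m * (1 / (1 + y\<^sup>2)))"
      by (rule integral_mono[OF i I]) (rule order_trans[OF f(2) b])
    then show "(LINT y|lborel. f y) \<le> real m * (LINT t|lborel. 1 / (1 + t\<^sup>2))" by (simp only: integral_mult_right_zero)
  qed
  have 1: "\<bar>real q * y ^ (q - 1)\<bar> / (1 + \<bar>y\<bar>) ^ m \<le> ?b y" for y :: real by (simp add: abs_mult power_abs)
  have 2: "\<bar>real q * \<bar>y\<bar> ^ (q - 1) * sgn y\<bar> / (1 + \<bar>y\<bar>) ^ m \<le> ?b y" for y :: real
    by (intro divide_right_mono) (auto simp: abs_mult abs_sgn_eq)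
  show "integrable lborel (\<lambda>y. \<bar>real q * y ^ (q - 1)\<bar> / (1 + \<bar>y\<bar>) ^ m)"
    "(LINT y|lborel. \<bar>real q * y ^ (q - 1)\<bar> / (1 + \<bar>y\<bar>) ^ m) \<le> real m * (LINT t|lborel. 1 / (1 + t\<^sup>2))"
    using main[OF _ _ 1] by auto
  show "integrable lborel (\<lambda>y. \<bar>real q * \<bar>y\<bar> ^ (q - 1) * sgn y\<bar> / (1 + \<bar>y\<bar>) ^ m)"
    "(LINT y|lborel. \<bar>real q * \<bar>y\<bar> ^ (q - 1) * sgn y\<bar> / (1 + \<bar>y\<bar>) ^ m) \<le> real m * (LINT t|lborel. 1 / (1 + t\<^sup>2))"
    using main[OF _ _ 2] by auto
qed

lemma approx_measurable[measurable]: "\<Psi> R n \<in> borel_measurable borel"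
  by (rule borel_measurable_continuous_onI, rule continuous_at_imp_continuous_on)
    (auto intro: DERIV_isCont approx_has_derivative)

lemma F_measurable[measurable]: "F n \<in> borel_measurable borel"
proof -
  interpret D: real_distribution "distr M borel (W n)" by (rule real_distribution_distr) simp
  show ?thesis by (rule borel_measurable_mono) (auto simp: mono_def D.cdf_nondecreasing)
qed

lemma weighted_powr:
  assumes c: "0 \<le> c" and q: "0 < q" and d: "\<bar>d\<bar> \<le> c / (1 + \<bar>x\<bar>) ^ m"
  shows "\<bar>d\<bar> powr q \<le> c powr q * (1 + \<bar>x\<bar>) powr (- (real m * q))"
proof -
  have p: "0 < 1 + \<bar>x\<bar>" by simp
  have "\<bar>d\<bar> powr q \<le> (c / (1 + \<bar>x\<bar>) ^ m) powr q" using d q by (intro powr_mono2) auto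
  also have "\<dots> = (c * (1 + \<bar>x\<bar>) powr (- real m)) powr q"
    using p by (simp add: powr_realpow powr_minus divide_inverse)
  also have "\<dots> = c powr q * (1 + \<bar>x\<bar>) powr (- (real m * q))" using c by (simp add: powr_mult powr_powr)
  finally show ?thesis .
qed

text \<open>The p-th power of the weight is integrable because m p > 1, and the p-th root restores
  the factor B n^(- R); eventually s n is at most 2 B n.\<close>

lemma Lp_difference:
  assumes p: "1 / real m < p" and C: "C \<longlonglongrightarrow> 0" "\<And>n. 0 \<le> C n"
    and m: "\<And>n x. 0 < B n \<Longrightarrow> \<bar>F n x - \<Psi> R n x\<bar> \<le> C n / B n ^ R / (1 + \<bar>x\<bar>) ^ m" and m0: "0 < m"
  shows "(\<lambda>n. (LINT x|lborel. \<bar>F n x - \<Psi> R n x\<bar> powr p) powr (1 / p)) \<in> o(\<lambda>n. 1 / s n ^ R)"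
proof (rule landau_o.smallI)
  have p0: "0 < p" using p m0 by (meson divide_pos_pos less_trans of_nat_0_less_iff zero_less_one)
  have mp: "1 < real m * p" using p m0 by (simp add: divide_less_eq mult.commute)
  define I where "I = (LINT x|lborel. (1 + \<bar>x\<bar>) powr (- (real m * p)))"
  have I0: "0 \<le> I" unfolding I_def by (rule Bochner_Integration.integral_nonneg) simp
  define J where "J = I powr (1 / p) * 2 ^ R"
  fix e :: real assume e: "0 < e"
  have "(\<lambda>n. C n * J) \<longlonglongrightarrow> 0" using tendsto_mult_right[OF C(1), of J] by simp
  then have ev: "\<forall>\<^sub>F n in sequentially. C n * J < e" using e by (rule order_tendstoD)
  show "\<forall>\<^sub>F n in sequentially. norm ((LINT x|lborel. \<bar>F n x - \<Psi> R n x\<bar> powr p) powr (1 / p)) \<le> e * norm (1 / s n ^ R)"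
  proof (rule eventually_mono[OF eventually_conj[OF ev eventually_conj[OF eventually_B[of "1 + b"] eventually_s_ge[of 1]]]], elim conjE)
    fix n assume CJ: "C n * J < e" and Bb: "1 + b \<le> B n" and s1: "1 \<le> s n"
    have B1: "1 \<le> B n" using Bb b_nonneg by linarith
    have sB: "s n \<le> 2 * B n" using B_le[of n] Bb by (simp add: abs_le_iff)
    define c where "c = C n / B n ^ R"
    have c0: "0 \<le> c" using C(2) B1 by (simp add: c_def)
    have le: "(LINT x|lborel. \<bar>F n x - \<Psi> R n x\<bar> powr p) \<le> c powr p * I"
    proof -
      have "(LINT x|lborel. \<bar>F n x - \<Psi> R n x\<bar> powr p) \<le> (LINT x|lborel. c powr p * (1 + \<bar>x\<bar>) powr (- (real m * p)))"
      proof (rule integral_mono')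
        show "integrable lborel (\<lambda>x. c powr p * (1 + \<bar>x\<bar>) powr (- (real m * p)))"
          by (intro integrable_mult_right integrable_powr_decay mp)
        show "\<bar>F n x - \<Psi> R n x\<bar> powr p \<le> c powr p * (1 + \<bar>x\<bar>) powr (- (real m * p))" for x
          by (rule weighted_powr[OF c0 p0]) (use m[of n x] B1 in \<open>simp add: c_def\<close>)
      qed simp
      then show ?thesis by (simp only: integral_mult_right_zero I_def)
    qed
    have "(LINT x|lborel. \<bar>F n x - \<Psi> R n x\<bar> powr p) powr (1 / p) \<le> (c powr p * I) powr (1 / p)"
    proof (rule powr_mono2)
      show "0 \<le> (LINT x|lborel. \<bar>F n x - \<Psi> R n x\<bar> powr p)" by (rule Bochner_Integration.integral_nonneg) simp
    qed (use p0 le in auto)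
    also have "\<dots> = c * I powr (1 / p)"
      using c0 p0 I0 by (simp add: powr_mult powr_powr)
    also have "\<dots> \<le> e * (1 / s n ^ R)"
    proof -
      have sp: "0 < s n ^ R" "0 < B n ^ R" using s1 B1 by auto
      have "s n ^ R \<le> 2 ^ R * B n ^ R" unfolding power_mult_distrib[symmetric] using sB s1 by (intro power_mono) auto
      then have "1 / B n ^ R \<le> 2 ^ R * (1 / s n ^ R)" using sp by (simp add: divide_simps mult.commute)
      then have "C n * I powr (1 / p) * (1 / B n ^ R) \<le> C n * I powr (1 / p) * (2 ^ R * (1 / s n ^ R))"
        using C(2) by (intro mult_left_mono) auto
      also have "\<dots> = (C n * J) * (1 / s n ^ R)" by (simp add: J_def)
      also have "\<dots> \<le> e * (1 / s n ^ R)" using CJ sp by (intro mult_right_mono) auto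
      finally show ?thesis by (simp add: c_def)
    qed
    finally show "norm ((LINT x|lborel. \<bar>F n x - \<Psi> R n x\<bar> powr p) powr (1 / p)) \<le> e * norm (1 / s n ^ R)"
      using s1 by simp
  qed
qed

text \<open>The exponent 1 / p turns the rate B n^(- R) into B n^(- R / p) and the weight into (1 +
  |x|)^(- m / p), which is integrable because m / p > 1.\<close>

lemma transport_difference:
  assumes p: "1 \<le> p" "p < real m - 1" and C: "C \<longlonglongrightarrow> 0" "\<And>n. 0 \<le> C n"
    and m: "\<And>n x. 0 < B n \<Longrightarrow> \<bar>F n x - \<Psi> R n x\<bar> \<le> C n / B n ^ R / (1 + \<bar>x\<bar>) ^ m"
  shows "(\<lambda>n. transport_dist p (F n) (\<Psi> R n) * ennreal (B n powr (real R / p))) \<longlonglongrightarrow> 0"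
proof -
  have mp: "1 < real m * (1 / p)" using p by (simp add: less_divide_eq)
  define I where "I = (LINT x|lborel. (1 + \<bar>x\<bar>) powr (- (real m * (1 / p))))"
  have iI: "integrable lborel (\<lambda>x. (1 + \<bar>x\<bar>) powr (- (real m * (1 / p))))" by (rule integrable_powr_decay[OF mp])
  have "\<forall>\<^sub>F n in sequentially. transport_dist p (F n) (\<Psi> R n) * ennreal (B n powr (real R / p)) \<le> ennreal (C n powr (1 / p) * I)"
  proof (rule eventually_mono[OF eventually_B[of 1]], elim conjE)
    fix n assume B1: "1 \<le> B n"
    define c where "c = C n / B n ^ R"
    have c0: "0 \<le> c" using C(2) B1 by (simp add: c_def)
    have "transport_dist p (F n) (\<Psi> R n) \<le> (\<integral>\<^sup>+ x. ennreal (\<bar>F n x - \<Psi> R n x\<bar> powr (1 / p)) \<partial>lborel)"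
      by (rule transport_dist_le[OF p(1)]) measurable
    also have "\<dots> \<le> (\<integral>\<^sup>+ x. ennreal (c powr (1 / p) * (1 + \<bar>x\<bar>) powr (- (real m * (1 / p)))) \<partial>lborel)"
    proof (intro nn_integral_mono ennreal_leI weighted_powr[OF c0])
      show "0 < 1 / p" using p by simp
      show "\<bar>F n x - \<Psi> R n x\<bar> \<le> c / (1 + \<bar>x\<bar>) ^ m" for x using m[of n x] B1 by (simp add: c_def)
    qed
    also have "\<dots> = ennreal (c powr (1 / p) * I)"
    proof -
      have "(\<integral>\<^sup>+ x. ennreal (c powr (1 / p) * (1 + \<bar>x\<bar>) powr (- (real m * (1 / p)))) \<partial>lborel)
        = ennreal (LINT x|lborel. c powr (1 / p) * (1 + \<bar>x\<bar>) powr (- (real m * (1 / p))))"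
        by (rule nn_integral_eq_integral[OF integrable_mult_right[OF iI]]) simp
      then show ?thesis by (simp only: integral_mult_right_zero I_def)
    qed
    finally have "transport_dist p (F n) (\<Psi> R n) * ennreal (B n powr (real R / p)) \<le> ennreal (c powr (1 / p) * I) * ennreal (B n powr (real R / p))"
      by (rule mult_right_mono) simp
    also have "\<dots> = ennreal ((c powr (1 / p) * I) * B n powr (real R / p))"
      by (rule ennreal_mult''[symmetric]) simp
    also have "(c powr (1 / p) * I) * B n powr (real R / p) = C n powr (1 / p) * I"
    proof -
      have "c powr (1 / p) = C n powr (1 / p) / B n powr (real R / p)"
        using C(2) B1 by (simp add: c_def powr_divide powr_realpow[symmetric] powr_powr)
      then show ?thesis using B1 by simp
    qed
    finally show "transport_dist p (F n) (\<Psi> R n) * ennreal (B n powr (real R / p)) \<le> ennreal (C n powr (1 / p) * I)" .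
  qed
  moreover have "(\<lambda>n. ennreal (C n powr (1 / p) * I)) \<longlonglongrightarrow> ennreal (0 powr (1 / p) * I)"
    by (intro tendsto_ennrealI tendsto_mult tendsto_const tendsto_powr2[OF C(1)] always_eventually) (use C(2) p in auto)
  ultimately show ?thesis
    by (intro tendsto_sandwich[where f="\<lambda>_. 0" and g="\<lambda>n. transport_dist p (F n) (\<Psi> R n) * ennreal (B n powr (real R / p))"]) auto
qed

end

theorem (in edgeworth_sequence) edgeworth_expansions_hold:
  assumes "3 \<le> m"
  shows "edgeworth_expansions m 1 M S"
  unfolding edgeworth_expansions_def
proof (intro conjI allI exI[of _ "\<lambda>j. 3 * j"] exI[of _ edgeworth_coeff] impI)
  show "expectation (S n) = 0" for n by (rule S_mean)
  show "filterlim (l2_norm_seq M S) at_top sequentially" using s_top by (simp add: s_eq)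
  show "edgeworth_coeff j i \<in> poly_funs" for j i by (rule edgeworth_coeff_poly_fun)
  fix A B :: "nat \<Rightarrow> real" assume AB: "Bseq A \<and> Bseq (\<lambda>n. B n - l2_norm_seq M S n)"
  obtain b1 where b1: "\<And>n. norm (A n) \<le> b1" using AB by (meson BseqE)
  obtain b2 where b2: "\<And>n. norm (B n - l2_norm_seq M S n) \<le> b2" using AB by (meson BseqE)
  interpret N: edgeworth_normalized M S s r0 C0 A B "max b1 b2"
  proof
    show "\<bar>A n\<bar> \<le> max b1 b2" for n using b1[of n] by simp
    show "\<bar>B n - s n\<bar> \<le> max b1 b2" for n using b2[of n] by (simp add: s_eq)
  qed
  let ?J = "LINT t|lborel. 1 / (1 + t\<^sup>2 :: real)"
  have J0: "0 \<le> ?J" by (rule Bochner_Integration.integral_nonneg) (simp add: add_nonneg_nonneg)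
  have Wd: "(\<lambda>x. (S n x - A n) / B n) = N.W n" for n by (simp add: N.W_def fun_eq_iff)
  show "\<exists>H :: nat \<Rightarrow> nat \<Rightarrow> real poly.
            (\<forall>j\<in>{1..m-2}.
               (\<forall>n. degree (H j n) \<le> 3 * j) \<and>
               (\<forall>n. \<forall>i\<le>3 * j. complex_of_real (coeff (H j n) i) = edgeworth_coeff j i (edgeworth_vars M S A B n)) \<and>
               (\<exists>K. \<forall>n i. \<bar>coeff (H j n) i\<bar> \<le> K)) \<and>
            (\<forall>r\<in>{1..m-2}.
               (let W = (\<lambda>n x. (S n x - A n) / B n);
                    F = (\<lambda>n. cdf (distr M borel (W n)));
                    \<Psi> = edgeworth_approx B H r
                in
                  (\<exists>C. C \<longlonglongrightarrow> 0 \<and>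
                     (\<forall>n. 0 < B n \<longrightarrow>
                        (\<forall>x. \<bar>F n x - \<Psi> n x\<bar> \<le> C n / B n ^ r / (1 + \<bar>x\<bar>) ^ m))) \<and>
                  (\<forall>p. 1 / real m < p \<longrightarrow>
                     (\<lambda>n. (LINT x|lborel. \<bar>F n x - \<Psi> n x\<bar> powr p) powr (1 / p))
                       \<in> o(\<lambda>n. 1 / l2_norm_seq M S n ^ r)) \<and>
                  (\<forall>p. 1 \<le> p \<and> p < real m - 1 \<longrightarrow>
                     (\<lambda>n. transport_dist p (F n) (\<Psi> n) * ennreal (B n powr (real r / p)))
                       \<longlonglongrightarrow> 0) \<and>
                  (\<exists>C. C \<longlonglongrightarrow> 0 \<and>
                     (\<forall>n. 0 < B n \<longrightarrow>
                        (\<forall>h h'. ae_antiderivative h h' \<and>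
                           integrable lborel (\<lambda>x. \<bar>h' x\<bar> / (1 + \<bar>x\<bar>) ^ m) \<longrightarrow>
                           \<bar>(LINT x|M. h (W n x)) - (LINT x|lborel. h x * deriv (\<Psi> n) x)\<bar>
                             \<le> C n * (LINT x|lborel. \<bar>h' x\<bar> / (1 + \<bar>x\<bar>) ^ m) / B n ^ r) \<and>
                        (\<forall>q<m.
                           \<bar>(LINT x|M. W n x ^ q) - (LINT x|lborel. x ^ q * deriv (\<Psi> n) x)\<bar>
                             \<le> 1 * C n / B n ^ r \<and>
                           \<bar>(LINT x|M. \<bar>W n x\<bar> ^ q) - (LINT x|lborel. \<bar>x\<bar> ^ q * deriv (\<Psi> n) x)\<bar>
                             \<le> 1 * C n / B n ^ r)))))"
    unfolding Let_def Wd s_eq[symmetric]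
  proof (rule exI[of _ N.H], intro conjI ballI allI impI)
    fix j n
    show "degree (N.H j n) \<le> 3 * j" by (rule N.degree_H)
    show "complex_of_real (coeff (N.H j n) i) = edgeworth_coeff j i (edgeworth_vars M S A B n)" for i
      using N.H_coeff[of j n i] by (simp add: N.vars_def)
    show "\<exists>K. \<forall>n i. \<bar>coeff (N.H j n) i\<bar> \<le> K" by (rule N.H_bounded)
  next
    fix r
    obtain C where C: "C \<longlonglongrightarrow> 0" "\<And>n. 0 \<le> C n"
      "\<And>n x. 0 < B n \<Longrightarrow> \<bar>N.F n x - N.\<Psi> r n x\<bar> \<le> C n / B n ^ r / (1 + \<bar>x\<bar>) ^ m"
      using N.difference_master[of r m] by auto
    show "\<exists>C. C \<longlonglongrightarrow> 0 \<and> (\<forall>n. 0 < B n \<longrightarrow> (\<forall>x. \<bar>N.F n x - N.\<Psi> r n x\<bar> \<le> C n / B n ^ r / (1 + \<bar>x\<bar>) ^ m))"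
      using C by blast
    show "(\<lambda>n. (LINT x|lborel. \<bar>N.F n x - N.\<Psi> r n x\<bar> powr p) powr (1 / p)) \<in> o(\<lambda>n. 1 / s n ^ r)" if "1 / real m < p" for p
      by (rule N.Lp_difference[OF that C]) (use assms in auto)
    show "(\<lambda>n. transport_dist p (N.F n) (N.\<Psi> r n) * ennreal (B n powr (real r / p))) \<longlonglongrightarrow> 0" if "1 \<le> p \<and> p < real m - 1" for p
      by (rule N.transport_difference[OF conjunct1[OF that] conjunct2[OF that] C])
    \<comment> \<open>The 1 covers general test functions, and m times the integral covers the
      weighted integrals of the derivatives of all powers of order below m. One null sequence thus
      serves both, and the constant of the moment estimates can be 1.\<close>
    define C' where "C' n = C n * (1 + real m * ?J)" for n
    have C'0: "C' \<longlonglongrightarrow> 0" using tendsto_mult_right[OF C(1), of "1 + real m * ?J"] by (simp add: C'_def[abs_def])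
    have CC': "C n \<le> C' n" "C n * (real m * ?J) \<le> C' n" for n
      using mult_nonneg_nonneg[OF C(2)[of n] mult_nonneg_nonneg[OF of_nat_0_le_iff[of m] J0]] C(2)[of n] by (simp_all add: C'_def distrib_left)
    have E: "\<bar>expectation (\<lambda>x. h (N.W n x)) - (LINT x|lborel. h x * deriv (N.\<Psi> r n) x)\<bar> \<le> C n / B n ^ r * (LINT y|lborel. \<bar>h' y\<bar> / (1 + \<bar>y\<bar>) ^ m)"
      if "0 < B n" "ae_antiderivative h h'" "integrable lborel (\<lambda>x. \<bar>h' x\<bar> / (1 + \<bar>x\<bar>) ^ m)" for n h h'
      by (rule N.expectation_difference[OF that C(3)[OF that(1)]])
    have Q: "\<bar>expectation (\<lambda>x. h (N.W n x)) - (LINT x|lborel. h x * deriv (N.\<Psi> r n) x)\<bar> \<le> 1 * C' n / B n ^ r"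
      if B: "0 < B n" and h: "ae_antiderivative h h'" "integrable lborel (\<lambda>x. \<bar>h' x\<bar> / (1 + \<bar>x\<bar>) ^ m)"
        and I: "(LINT y|lborel. \<bar>h' y\<bar> / (1 + \<bar>y\<bar>) ^ m) \<le> real m * ?J" for n h h'
    proof -
      have "C n / B n ^ r * (LINT y|lborel. \<bar>h' y\<bar> / (1 + \<bar>y\<bar>) ^ m) \<le> C n / B n ^ r * (real m * ?J)"
        using C(2) B by (intro mult_left_mono I) simp
      also have "\<dots> = C n * (real m * ?J) / B n ^ r" by simp
      also have "\<dots> \<le> C' n / B n ^ r" using CC'(2) B by (intro divide_right_mono) auto
      finally show ?thesis using E[OF B h] by simp
    qed
    show "\<exists>C. C \<longlonglongrightarrow> 0 \<and>
                     (\<forall>n. 0 < B n \<longrightarrow>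
                        (\<forall>h h'. ae_antiderivative h h' \<and>
                           integrable lborel (\<lambda>x. \<bar>h' x\<bar> / (1 + \<bar>x\<bar>) ^ m) \<longrightarrow>
                           \<bar>(LINT x|M. h (N.W n x)) - (LINT x|lborel. h x * deriv (N.\<Psi> r n) x)\<bar>
                             \<le> C n * (LINT x|lborel. \<bar>h' x\<bar> / (1 + \<bar>x\<bar>) ^ m) / B n ^ r) \<and>
                        (\<forall>q<m.
                           \<bar>(LINT x|M. N.W n x ^ q) - (LINT x|lborel. x ^ q * deriv (N.\<Psi> r n) x)\<bar>
                             \<le> 1 * C n / B n ^ r \<and>
                           \<bar>(LINT x|M. \<bar>N.W n x\<bar> ^ q) - (LINT x|lborel. \<bar>x\<bar> ^ q * deriv (N.\<Psi> r n) x)\<bar>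
                             \<le> 1 * C n / B n ^ r))"
    proof (rule exI[of _ C'], intro conjI allI impI C'0)
      fix n h h' assume B: "0 < B n" and h: "ae_antiderivative h h' \<and> integrable lborel (\<lambda>x. \<bar>h' x\<bar> / (1 + \<bar>x\<bar>) ^ m)"
      let ?I = "LINT x|lborel. \<bar>h' x\<bar> / (1 + \<bar>x\<bar>) ^ m"
      have I0: "0 \<le> ?I" by (rule Bochner_Integration.integral_nonneg) simp
      have "C n / B n ^ r * ?I \<le> C' n / B n ^ r * ?I" using CC'(1) B I0 by (intro mult_right_mono divide_right_mono) auto
      then show "\<bar>(LINT x|M. h (N.W n x)) - (LINT x|lborel. h x * deriv (N.\<Psi> r n) x)\<bar> \<le> C' n * ?I / B n ^ r"
        using E[OF B conjunct1[OF h] conjunct2[OF h]] by simp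
    next
      fix n q :: nat assume B: "0 < B n" and q: "q < m"
      show "\<bar>(LINT x|M. N.W n x ^ q) - (LINT x|lborel. x ^ q * deriv (N.\<Psi> r n) x)\<bar> \<le> 1 * C' n / B n ^ r"
        by (rule Q[OF B power_antiderivatives(1) N.power_weight(1)[OF q] N.power_weight(3)[OF q]])
      show "\<bar>(LINT x|M. \<bar>N.W n x\<bar> ^ q) - (LINT x|lborel. \<bar>x\<bar> ^ q * deriv (N.\<Psi> r n) x)\<bar> \<le> 1 * C' n / B n ^ r"
        by (rule Q[OF B power_antiderivatives(2) N.power_weight(2)[OF q] N.power_weight(4)[OF q]])
    qed
  qed
qed

section \<open>The maximal ergodic inequality\<close>

text \<open>Invariance pulls a null set back to a null set, and there are only countably many times.
  This turns almost sure hypotheses into hypotheses along one forward orbit.\<close>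

lemma AE_orbit:
  assumes \<theta>: "\<theta> \<in> measurable P P" "distr P P \<theta> = P" and Q: "AE \<omega> in P. Q \<omega>"
  shows "AE \<omega> in P. \<forall>j. Q ((\<theta> ^^ j) \<omega>)"
proof -
  have "AE \<omega> in P. Q ((\<theta> ^^ j) \<omega>)" for j
  proof (induction j)
    case (Suc j)
    have "AE \<omega> in distr P P \<theta>. Q ((\<theta> ^^ j) \<omega>)" by (subst \<theta>(2)) (rule Suc)
    from AE_distrD[OF \<theta>(1) this] show ?case by (simp only: funpow_Suc_right o_apply)
  qed (use Q in simp)
  then show ?thesis by (simp add: AE_all_countable)
qed

text \<open>The maximum of 0 and the first n ergodic sums of \<open>g\<close>, in the recursive form
  on which Garsia's proof of the maximal ergodic theorem rests.\<close>

primrec max_prefix :: "('w \<Rightarrow> 'w) \<Rightarrow> ('w \<Rightarrow> real) \<Rightarrow> nat \<Rightarrow> 'w \<Rightarrow> real" where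
  "max_prefix \<theta> g 0 \<omega> = 0"
| "max_prefix \<theta> g (Suc n) \<omega> = max 0 (g \<omega> + max_prefix \<theta> g n (\<theta> \<omega>))"

lemma max_prefix_nonneg: "0 \<le> max_prefix \<theta> g n \<omega>"
  by (cases n) auto

lemma max_prefix_Suc_mono: "max_prefix \<theta> g n \<omega> \<le> max_prefix \<theta> g (Suc n) \<omega>"
proof (induction n arbitrary: \<omega>)
  case (Suc n)
  have "max_prefix \<theta> g n (\<theta> \<omega>) \<le> max_prefix \<theta> g (Suc n) (\<theta> \<omega>)" by (rule Suc)
  then show ?case by (simp only: max_prefix.simps(2)[of \<theta> g "Suc n"] max_prefix.simps(2)[of \<theta> g n \<omega>])
qed simp

lemma max_prefix_mono: "n \<le> m \<Longrightarrow> max_prefix \<theta> g n \<omega> \<le> max_prefix \<theta> g m \<omega>"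
  by (rule lift_Suc_mono_le[of "\<lambda>n. max_prefix \<theta> g n \<omega>"]) (rule max_prefix_Suc_mono)

lemma sum_le_max_prefix: "(\<Sum>j<n. g ((\<theta> ^^ j) \<omega>)) \<le> max_prefix \<theta> g n \<omega>"
proof (induction n arbitrary: \<omega>)
  case (Suc n)
  have "(\<Sum>j<Suc n. g ((\<theta> ^^ j) \<omega>)) = g \<omega> + (\<Sum>j<n. g ((\<theta> ^^ j) (\<theta> \<omega>)))"
    by (simp only: sum.lessThan_Suc_shift funpow_Suc_right o_apply) simp
  then show ?case using Suc[of "\<theta> \<omega>"] by (simp del: sum.lessThan_Suc)
qed simp

lemma max_prefix_le: "(\<And>\<omega>. g \<omega> \<le> 1) \<Longrightarrow> max_prefix \<theta> g n \<omega> \<le> real n"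
proof (induction n arbitrary: \<omega>)
  case (Suc n)
  from Suc.IH[OF Suc.prems, of "\<theta> \<omega>"] Suc.prems[of \<omega>] show ?case by simp
qed simp

text \<open>Garsia's argument: where the maximum is positive it equals g plus the previous maximum
  at the shifted point, and elsewhere it is 0, hence no larger than that previous maximum.
  Integrating and using invariance, the previous maximum cancels against the larger current
  one.\<close>

lemma (in prob_space) maximal_ergodic:
  assumes \<theta>[measurable]: "\<theta> \<in> measurable M M" and inv: "distr M M \<theta> = M"
    and g[measurable]: "g \<in> borel_measurable M" and g1: "\<And>\<omega>. \<bar>g \<omega>\<bar> \<le> 1"
  shows "0 \<le> expectation (\<lambda>\<omega>. g \<omega> * indicator {\<omega>. 0 < max_prefix \<theta> g n \<omega>} \<omega>)"
proof (cases n)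
  case (Suc m)
  have meas[measurable]: "max_prefix \<theta> g k \<in> borel_measurable M" for k
  proof (induction k)
    case (Suc k)
    note [measurable] = Suc
    show ?case unfolding max_prefix.simps[abs_def] by measurable
  qed (simp add: max_prefix.simps(1)[abs_def])
  have int: "integrable M (max_prefix \<theta> g k)" for k
    using g1 max_prefix_le[of g \<theta> k] max_prefix_nonneg[of \<theta> g k]
    by (intro integrable_const_bound[of _ "real k"]) (auto simp: abs_le_iff)
  have int': "integrable M (\<lambda>\<omega>. max_prefix \<theta> g m (\<theta> \<omega>))"
    by (rule integrable_distr[OF \<theta>]) (simp add: inv int)
  have intg: "integrable M (\<lambda>\<omega>. g \<omega> * indicator {\<omega>. 0 < max_prefix \<theta> g n \<omega>} \<omega>)"
    using g1 by (intro integrable_const_bound[of _ 1]) (auto simp: indicator_def)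
  have "expectation (max_prefix \<theta> g n) \<le> expectation (\<lambda>\<omega>. g \<omega> * indicator {\<omega>. 0 < max_prefix \<theta> g n \<omega>} \<omega> + max_prefix \<theta> g m (\<theta> \<omega>))"
  proof (rule integral_mono[OF int Bochner_Integration.integrable_add[OF intg int']])
    show "max_prefix \<theta> g n \<omega> \<le> g \<omega> * indicator {\<omega>. 0 < max_prefix \<theta> g n \<omega>} \<omega> + max_prefix \<theta> g m (\<theta> \<omega>)" for \<omega>
      using max_prefix_nonneg[of \<theta> g m "\<theta> \<omega>"] unfolding Suc by (auto simp: indicator_def)
  qed
  also have "\<dots> = expectation (\<lambda>\<omega>. g \<omega> * indicator {\<omega>. 0 < max_prefix \<theta> g n \<omega>} \<omega>) + expectation (\<lambda>\<omega>. max_prefix \<theta> g m (\<theta> \<omega>))"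
    by (rule Bochner_Integration.integral_add[OF intg int'])
  also have "expectation (\<lambda>\<omega>. max_prefix \<theta> g m (\<theta> \<omega>)) = expectation (max_prefix \<theta> g m)"
    using integral_distr[OF \<theta>, of "max_prefix \<theta> g m"] by (simp add: inv)
  finally have 1: "expectation (max_prefix \<theta> g n) \<le> expectation (\<lambda>\<omega>. g \<omega> * indicator {\<omega>. 0 < max_prefix \<theta> g n \<omega>} \<omega>) + expectation (max_prefix \<theta> g m)" .
  have "expectation (max_prefix \<theta> g m) \<le> expectation (max_prefix \<theta> g n)"
    unfolding Suc by (rule integral_mono[OF int int]) (rule max_prefix_Suc_mono)
  with 1 show ?thesis by simp
qed simp

text \<open>The maximal inequality for the indicator of A minus 1/2. The set \<open>D\<close>, where
  the frequency of visits to A ever exceeds 1/2, satisfies prob D / 2 \<le> prob (A \<inter>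
  D).\<close>

lemma (in prob_space) frequent_visits_prob:
  assumes \<theta>[measurable]: "\<theta> \<in> measurable M M" and inv: "distr M M \<theta> = M" and A[measurable]: "A \<in> sets M"
  shows "\<exists>D\<in>sets M. prob D \<le> 2 * prob A \<and>
    (\<forall>\<omega>\<in>space M - D. \<forall>n. 2 * (\<Sum>j<n. indicator A ((\<theta> ^^ j) \<omega>)) \<le> real n)"
proof -
  define g :: "'a \<Rightarrow> real" where "g \<omega> = indicator A \<omega> - 1 / 2" for \<omega>
  have g[measurable]: "g \<in> borel_measurable M" by (simp add: g_def[abs_def])
  have g1: "\<bar>g \<omega>\<bar> \<le> 1" for \<omega> by (simp add: g_def indicator_def)
  have [measurable]: "max_prefix \<theta> g k \<in> borel_measurable M" for k
  proof (induction k)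
    case (Suc k)
    note [measurable] = Suc
    show ?case unfolding max_prefix.simps[abs_def] by measurable
  qed (simp add: max_prefix.simps(1)[abs_def])
  define D where "D n = {\<omega>\<in>space M. 0 < max_prefix \<theta> g n \<omega>}" for n
  have [measurable]: "D n \<in> sets M" for n by (simp add: D_def)
  have D: "prob (D n) \<le> 2 * prob A" for n
  proof -
    have "0 \<le> expectation (\<lambda>\<omega>. g \<omega> * indicator {\<omega>. 0 < max_prefix \<theta> g n \<omega>} \<omega>)"
      by (rule maximal_ergodic[OF \<theta> inv g g1])
    also have "\<dots> = expectation (\<lambda>\<omega>. indicator (A \<inter> D n) \<omega> - 1 / 2 * indicator (D n) \<omega>)"
      by (intro Bochner_Integration.integral_cong) (auto simp: g_def D_def indicator_def)
    also have "\<dots> = prob (A \<inter> D n) - 1 / 2 * prob (D n)"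
      by (subst Bochner_Integration.integral_diff) (auto simp: integrable_indicator_iff emeasure_eq_measure)
    also have "prob (A \<inter> D n) \<le> prob A" by (rule finite_measure_mono) auto
    finally show ?thesis by simp
  qed
  have inc: "incseq D"
    using max_prefix_mono[of _ _ \<theta> g] by (auto simp: incseq_def D_def intro: less_le_trans)
  have "(\<lambda>n. prob (D n)) \<longlonglongrightarrow> prob (\<Union>n. D n)"
    by (rule finite_Lim_measure_incseq[OF _ inc]) auto
  then have "prob (\<Union>n. D n) \<le> 2 * prob A" by (rule LIMSEQ_le_const2) (use D in auto)
  moreover have "2 * (\<Sum>j<n. indicator A ((\<theta> ^^ j) \<omega>)) \<le> real n" if "\<omega> \<in> space M - (\<Union>n. D n)" for \<omega> n
  proof -
    have "(\<Sum>j<n. g ((\<theta> ^^ j) \<omega>)) \<le> max_prefix \<theta> g n \<omega>" by (rule sum_le_max_prefix)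
    also have "\<dots> \<le> 0" using that by (auto simp: D_def not_less)
    finally show ?thesis by (simp add: g_def sum_subtractf)
  qed
  ultimately show ?thesis by (intro bexI[of _ "\<Union>n. D n"]) auto
qed

text \<open>The bad sets decrease to a null set, so the exceptional sets, at most twice as large,
  have a null intersection; off it some level R works for all n at once.\<close>

lemma (in prob_space) AE_frequent_visits:
  assumes \<theta>: "\<theta> \<in> measurable M M" "distr M M \<theta> = M"
    and A: "\<And>R::nat. A R \<in> sets M" "decseq A" "AE \<omega> in M. \<exists>R. \<omega> \<notin> A R"
  shows "AE \<omega> in M. \<exists>R. \<forall>n. 2 * (\<Sum>j<n. indicator (A R) ((\<theta> ^^ j) \<omega>)) \<le> real n"
proof -
  have "\<forall>R. \<exists>D\<in>sets M. prob D \<le> 2 * prob (A R) \<and>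
    (\<forall>\<omega>\<in>space M - D. \<forall>n. 2 * (\<Sum>j<n. indicator (A R) ((\<theta> ^^ j) \<omega>)) \<le> real n)"
    using frequent_visits_prob[OF \<theta> A(1)] by blast
  then obtain D where D: "\<And>R. D R \<in> sets M" "\<And>R. prob (D R) \<le> 2 * prob (A R)"
    and v: "\<And>R \<omega> n. \<omega> \<in> space M - D R \<Longrightarrow> 2 * (\<Sum>j<n. indicator (A R) ((\<theta> ^^ j) \<omega>)) \<le> real n" by metis
  have "prob (\<Inter>R. A R) = 0"
  proof -
    have "AE \<omega> in M. \<omega> \<notin> (\<Inter>R. A R)" using A(3) by auto
    then show ?thesis using A(1) by (simp add: prob_eq_0 sets.countable_INT')
  qed
  then have lim: "(\<lambda>R. 2 * prob (A R)) \<longlonglongrightarrow> 2 * 0"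
    using finite_Lim_measure_decseq[of A] A by (intro tendsto_mult tendsto_const) auto
  have DI: "(\<Inter>R. D R) \<in> sets M" using D(1) by blast
  have "prob (\<Inter>R. D R) \<le> 2 * prob (A R)" for R
    by (rule order_trans[OF finite_measure_mono D(2)]) (use D(1) in auto)
  then have "prob (\<Inter>R. D R) \<le> 2 * 0" by (intro LIMSEQ_le_const[OF lim]) auto
  then have "prob (\<Inter>R. D R) = 0" by (simp add: measure_le_0_iff)
  then have "AE \<omega> in M. \<omega> \<notin> (\<Inter>R. D R)" using DI by (simp add: prob_eq_0)
  then show ?thesis using AE_space by eventually_elim (use v in blast)
qed

section \<open>Operators on normed spaces of functions\<close>

lemma fun_subspace_add: "fun_subspace A V \<Longrightarrow> g \<in> V \<Longrightarrow> h \<in> V \<Longrightarrow> (\<lambda>x. g x + h x) \<in> V"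
  by (simp add: fun_subspace_def)

lemma fun_subspace_scale: "fun_subspace A V \<Longrightarrow> g \<in> V \<Longrightarrow> (\<lambda>x. a * g x) \<in> V"
  by (simp add: fun_subspace_def)

lemma dual_space_add: "\<nu> \<in> dual_space V N \<Longrightarrow> g \<in> V \<Longrightarrow> h \<in> V \<Longrightarrow> \<nu> (\<lambda>x. g x + h x) = \<nu> g + \<nu> h"
  by (simp add: dual_space_def)

lemma dual_space_scale: "\<nu> \<in> dual_space V N \<Longrightarrow> g \<in> V \<Longrightarrow> \<nu> (\<lambda>x. a * g x) = a * \<nu> g"
  by (simp add: dual_space_def)

text \<open>Rescaling to norm 1 asks only for homogeneity of the composed norm, so the lemma serves
  operators and functionals alike. A zero norm forces g = 0, which is covered by the scalar
  0.\<close>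

lemma op_norm_le_imp:
  assumes V: "fun_subspace A V" and N: "is_norm_on V N"
    and hom: "\<And>a g. g \<in> V \<Longrightarrow> N' (F (\<lambda>x. a * g x)) = cmod a * N' (F g)"
    and le: "op_norm V N N' F \<le> ennreal c" and c: "0 \<le> c" and g: "g \<in> V"
  shows "N' (F g) \<le> c * N g"
proof (cases "N g = 0")
  case True
  then have "g = (\<lambda>x. 0)" using N g by (simp add: is_norm_on_def)
  then have "N' (F g) = 0" using hom[OF g, of 0] by simp
  then show ?thesis using True by simp
next
  case False
  then have pos: "0 < N g" using N g by (simp add: is_norm_on_def less_le)
  define a where "a = complex_of_real (1 / N g)"
  have a: "cmod a = 1 / N g" unfolding a_def norm_of_real using pos by simp
  have "(\<lambda>x. a * g x) \<in> V" using V g by (simp add: fun_subspace_def)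
  moreover have "N (\<lambda>x. a * g x) \<le> 1" using N g pos a by (simp add: is_norm_on_def)
  ultimately have "ennreal (N' (F (\<lambda>x. a * g x))) \<le> op_norm V N N' F"
    unfolding op_norm_def by (intro SUP_upper) auto
  also have "\<dots> \<le> ennreal c" by (rule le)
  finally have "N' (F (\<lambda>x. a * g x)) \<le> c" using c by simp
  then show ?thesis using pos by (simp add: hom[OF g] a divide_le_eq)
qed

lemma dual_norm_bound:
  assumes V: "fun_subspace A V" and N: "is_norm_on V N" and \<nu>: "\<nu> \<in> dual_space V N" and g: "g \<in> V"
  shows "cmod (\<nu> g) \<le> dual_norm V N \<nu> * N g"
proof (rule op_norm_le_imp[where N'=cmod and F=\<nu>, OF V N _ _ _ g])
  show "op_norm V N cmod \<nu> \<le> ennreal (dual_norm V N \<nu>)"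
    using \<nu> by (simp add: dual_norm_def dual_space_def)
  show "cmod (\<nu> (\<lambda>x. a * g x)) = cmod a * cmod (\<nu> g)" if "g \<in> V" for a g
    using \<nu> that by (simp add: dual_space_def norm_mult)
qed (simp add: dual_norm_def enn2real_nonneg)

section \<open>Transfer operators along one orbit\<close>

text \<open>One forward orbit with the required properties assumed at each of its points, which
  makes the rest of the dynamical argument deterministic. Domination of the supremum by
  \<open>N1\<close> makes elements of \<open>B\<close> bounded, so that duality applies to
  them.\<close>

locale fibre_orbit =
  fixes \<theta> :: "'w \<Rightarrow> 'w" and E :: "'w \<Rightarrow> 'x::metric_space set" and T :: "'w \<Rightarrow> 'x \<Rightarrow> 'x"
    and \<mu> :: "'w \<Rightarrow> 'x measure" and L :: "'w \<Rightarrow> ('x \<Rightarrow> complex) \<Rightarrow> 'x \<Rightarrow> complex"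
    and B :: "'w \<Rightarrow> ('x \<Rightarrow> complex) set" and N1 :: "'w \<Rightarrow> ('x \<Rightarrow> complex) \<Rightarrow> real"
    and f :: "'w \<Rightarrow> 'x \<Rightarrow> real" and \<omega> :: 'w
  assumes prob_fibre: "\<And>j. prob_space (\<mu> ((\<theta> ^^ j) \<omega>))"
    and sets_fibre: "\<And>j. sets (\<mu> ((\<theta> ^^ j) \<omega>)) = sets (restrict_space borel (E ((\<theta> ^^ j) \<omega>)))"
    and T_measurable: "\<And>j. T ((\<theta> ^^ j) \<omega>) \<in> measurable (\<mu> ((\<theta> ^^ j) \<omega>)) (\<mu> ((\<theta> ^^ Suc j) \<omega>))"
    and duality_1: "\<And>j g k. g \<in> bounded_fibre_functions E \<mu> ((\<theta> ^^ j) \<omega>) \<Longrightarrow>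
      k \<in> bounded_fibre_functions E \<mu> ((\<theta> ^^ Suc j) \<omega>) \<Longrightarrow>
      (LINT x|\<mu> ((\<theta> ^^ j) \<omega>). g x * k (T ((\<theta> ^^ j) \<omega>) x))
        = (LINT y|\<mu> ((\<theta> ^^ Suc j) \<omega>). k y * L ((\<theta> ^^ j) \<omega>) g y)"
    and subspace: "\<And>j. fun_subspace (E ((\<theta> ^^ j) \<omega>)) (B ((\<theta> ^^ j) \<omega>))"
    and B_measurable: "\<And>j. B ((\<theta> ^^ j) \<omega>) \<subseteq> borel_measurable (\<mu> ((\<theta> ^^ j) \<omega>))"
    and N1_sup: "\<And>j g x. g \<in> B ((\<theta> ^^ j) \<omega>) \<Longrightarrow> x \<in> E ((\<theta> ^^ j) \<omega>) \<Longrightarrow> cmod (g x) \<le> N1 ((\<theta> ^^ j) \<omega>) g"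
    and L_mem: "\<And>j g. g \<in> B ((\<theta> ^^ j) \<omega>) \<Longrightarrow> L ((\<theta> ^^ j) \<omega>) g \<in> B ((\<theta> ^^ Suc j) \<omega>)"
    and L_linear: "\<And>j. linear_map_on (B ((\<theta> ^^ j) \<omega>)) (L ((\<theta> ^^ j) \<omega>))"
    and exp_mult_mem: "\<And>j z g. g \<in> B ((\<theta> ^^ j) \<omega>) \<Longrightarrow>
      (\<lambda>x. g x * exp (z * complex_of_real (f ((\<theta> ^^ j) \<omega>) x))) \<in> B ((\<theta> ^^ j) \<omega>)"
    and f_mem: "\<And>j. ext0 (E ((\<theta> ^^ j) \<omega>)) (\<lambda>x. complex_of_real (f ((\<theta> ^^ j) \<omega>) x)) \<in> B ((\<theta> ^^ j) \<omega>)"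
    and one_mem: "\<And>j. ext0 (E ((\<theta> ^^ j) \<omega>)) (\<lambda>x. 1) \<in> B ((\<theta> ^^ j) \<omega>)"
begin

abbreviation w :: "nat \<Rightarrow> 'w" where "w j \<equiv> (\<theta> ^^ j) \<omega>"

abbreviation twisted :: "complex \<Rightarrow> nat \<Rightarrow> nat \<Rightarrow> ('x \<Rightarrow> complex) \<Rightarrow> 'x \<Rightarrow> complex" where
  "twisted z j n \<equiv> twisted_iter \<theta> L f z n (w j)"

lemma w_add: "(\<theta> ^^ n) (w j) = w (j + n)"
  by (simp add: funpow_add[symmetric] add.commute del: funpow.simps flip: o_apply[of "\<theta> ^^ n"])

lemma space_fibre: "space (\<mu> (w j)) = E (w j)"
  using sets_eq_imp_space_eq[OF sets_fibre[of j]] by (simp add: space_restrict_space)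

lemma bounded_fibre: "g \<in> B (w j) \<Longrightarrow> g \<in> bounded_fibre_functions E \<mu> (w j)"
  using B_measurable[of j] subspace[of j] N1_sup[of g j]
  by (auto simp: bounded_fibre_functions_def fun_subspace_def intro!: boundedI)

lemma f_measurable: "f (w j) \<in> borel_measurable (\<mu> (w j))"
proof -
  have [measurable]: "ext0 (E (w j)) (\<lambda>x. complex_of_real (f (w j) x)) \<in> borel_measurable (\<mu> (w j))"
    using f_mem B_measurable by blast
  have "(\<lambda>x. Re (ext0 (E (w j)) (\<lambda>x. complex_of_real (f (w j) x)) x)) \<in> borel_measurable (\<mu> (w j))"
    by measurable
  then show ?thesis by (rule subst[OF measurable_cong, rotated]) (simp add: space_fibre ext0_def)
qed

lemma f_bounded: "\<exists>b. \<forall>x\<in>E (w j). \<bar>f (w j) x\<bar> \<le> b"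
  using N1_sup[OF f_mem] by (intro exI[of _ "N1 (w j) (ext0 (E (w j)) (\<lambda>x. complex_of_real (f (w j) x)))"]) (auto simp: ext0_def)

lemma iter_measurable: "fibre_iter \<theta> T n \<omega> \<in> measurable (\<mu> \<omega>) (\<mu> (w n))"
proof (induction n)
  case (Suc n)
  from measurable_compose[OF Suc T_measurable[of n]] show ?case
    unfolding fibre_iter.simps[abs_def] .
qed (simp add: fibre_iter.simps[abs_def])

lemma iter_mem: "x \<in> E \<omega> \<Longrightarrow> fibre_iter \<theta> T n \<omega> x \<in> E (w n)"
  using measurable_space[OF iter_measurable, of x n] space_fibre[of 0] space_fibre[of n] by simp

lemma birkhoff_measurable[measurable]: "birkhoff_sum \<theta> T f \<omega> n \<in> borel_measurable (\<mu> \<omega>)"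
  unfolding birkhoff_sum_def[abs_def]
  by (intro borel_measurable_sum measurable_compose[OF iter_measurable f_measurable])

lemma birkhoff_bounded: "\<exists>b. \<forall>x\<in>space (\<mu> \<omega>). \<bar>birkhoff_sum \<theta> T f \<omega> n x\<bar> \<le> b"
proof -
  obtain b where b: "\<And>j x. x \<in> E (w j) \<Longrightarrow> \<bar>f (w j) x\<bar> \<le> b j" using f_bounded by metis
  have "\<bar>birkhoff_sum \<theta> T f \<omega> n x\<bar> \<le> (\<Sum>j<n. b j)" if "x \<in> space (\<mu> \<omega>)" for x
    unfolding birkhoff_sum_def
    using that space_fibre[of 0] by (intro order_trans[OF sum_abs] sum_mono b iter_mem) simp
  then show ?thesis by blast
qed

lemma bounded_rv_birkhoff: "bounded_rv (\<mu> \<omega>) (birkhoff_sum \<theta> T f \<omega> n)"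
proof -
  interpret prob_space "\<mu> \<omega>" using prob_fibre[of 0] by simp
  show ?thesis by unfold_locales (use birkhoff_bounded in auto)
qed

lemma twisted_mem: "g \<in> B (w j) \<Longrightarrow> twisted z j n g \<in> B (w (j + n))"
proof (induction n)
  case (Suc n)
  then have "L (w (j + n)) (\<lambda>x. twisted z j n g x * exp (z * complex_of_real (f (w (j + n)) x))) \<in> B (w (Suc (j + n)))"
    by (intro L_mem exp_mult_mem)
  then show ?case by (simp only: twisted_iter.simps(2) twisted_op_def w_add add_Suc_right)
qed simp

lemma twisted_add: "twisted z j (n + m) g = twisted z (j + n) m (twisted z j n g)"
proof (induction m)
  case (Suc m)
  show ?case by (simp only: add_Suc_right twisted_iter.simps(2) Suc w_add add.assoc)
qed simp

lemma twisted_scale: "g \<in> B (w j) \<Longrightarrow> twisted z j n (\<lambda>x. a * g x) = (\<lambda>x. a * twisted z j n g x)"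
proof (induction n)
  case (Suc n)
  have "(\<lambda>x. twisted z j n g x * exp (z * complex_of_real (f (w (j + n)) x))) \<in> B (w (j + n))"
    by (intro exp_mult_mem twisted_mem Suc.prems)
  then have "L (w (j + n)) (\<lambda>x. a * (twisted z j n g x * exp (z * complex_of_real (f (w (j + n)) x))))
    = (\<lambda>x. a * L (w (j + n)) (\<lambda>x. twisted z j n g x * exp (z * complex_of_real (f (w (j + n)) x))) x)"
    using L_linear[of "j + n"] by (simp add: linear_map_on_def)
  then show ?case by (simp only: twisted_iter.simps(2) Suc.IH[OF Suc.prems] twisted_op_def w_add mult.assoc)
qed simp

lemma duality:
  assumes g: "g \<in> B \<omega>" and k: "k \<in> bounded_fibre_functions E \<mu> (w n)"
  shows "(LINT x|\<mu> \<omega>. g x * exp (z * complex_of_real (birkhoff_sum \<theta> T f \<omega> n x)) * k (fibre_iter \<theta> T n \<omega> x))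
    = (LINT y|\<mu> (w n). k y * twisted z 0 n g y)"
  using k
proof (induction n arbitrary: k)
  case 0
  show ?case by (simp add: birkhoff_sum_def mult.commute)
next
  case (Suc n)
  \<comment> \<open>The last twist and the last map are moved from the operator onto the test
    function, which stays bounded because f is bounded on each fibre.\<close>
  define k' where "k' = ext0 (E (w n)) (\<lambda>y. exp (z * complex_of_real (f (w n) y)) * k (T (w n) y))"
  have k: "k \<in> borel_measurable (\<mu> (w (Suc n)))" "bounded (k ` E (w (Suc n)))"
    using Suc.prems by (auto simp: bounded_fibre_functions_def)
  have k': "k' \<in> bounded_fibre_functions E \<mu> (w n)"
  proof -
    have [measurable]: "f (w n) \<in> borel_measurable (\<mu> (w n))" "(\<lambda>y. k (T (w n) y)) \<in> borel_measurable (\<mu> (w n))"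
      by (rule f_measurable, rule measurable_compose[OF T_measurable k(1)])
    have "(\<lambda>y. exp (z * complex_of_real (f (w n) y)) * k (T (w n) y)) \<in> borel_measurable (\<mu> (w n))"
      by measurable
    then have "k' \<in> borel_measurable (\<mu> (w n))"
      by (rule subst[OF measurable_cong, rotated]) (simp add: space_fibre ext0_def k'_def)
    moreover have "bounded (k' ` E (w n))"
    proof -
      obtain b where b: "\<forall>x\<in>E (w n). \<bar>f (w n) x\<bar> \<le> b" using f_bounded by blast
      obtain c where c: "\<And>y. y \<in> E (w (Suc n)) \<Longrightarrow> cmod (k y) \<le> c" using k(2) by (auto simp: bounded_iff)
      have "cmod (k' y) \<le> exp (cmod z * b) * c" if y: "y \<in> E (w n)" for y
      proof -
        have "T (w n) y \<in> E (w (Suc n))"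
          using measurable_space[OF T_measurable[of n]] y space_fibre by blast
        then have "cmod (k (T (w n) y)) \<le> c" by (rule c)
        moreover have "cmod (exp (z * complex_of_real (f (w n) y))) \<le> exp (cmod z * b)"
          using b y by (intro order_trans[OF norm_exp]) (auto simp: norm_mult intro!: mult_left_mono)
        ultimately show ?thesis using y by (simp add: k'_def ext0_def norm_mult mult_mono)
      qed
      then show ?thesis by (auto intro!: boundedI)
    qed
    ultimately show ?thesis by (simp add: bounded_fibre_functions_def k'_def ext0_def)
  qed
  have "(LINT x|\<mu> \<omega>. g x * exp (z * complex_of_real (birkhoff_sum \<theta> T f \<omega> (Suc n) x)) * k (fibre_iter \<theta> T (Suc n) \<omega> x))
    = (LINT x|\<mu> \<omega>. g x * exp (z * complex_of_real (birkhoff_sum \<theta> T f \<omega> n x)) * k' (fibre_iter \<theta> T n \<omega> x))"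
  proof (rule Bochner_Integration.integral_cong[OF refl])
    fix x assume "x \<in> space (\<mu> \<omega>)"
    then have "fibre_iter \<theta> T n \<omega> x \<in> E (w n)" using iter_mem space_fibre[of 0] by simp
    then show "g x * exp (z * complex_of_real (birkhoff_sum \<theta> T f \<omega> (Suc n) x)) * k (fibre_iter \<theta> T (Suc n) \<omega> x)
      = g x * exp (z * complex_of_real (birkhoff_sum \<theta> T f \<omega> n x)) * k' (fibre_iter \<theta> T n \<omega> x)"
      by (simp add: k'_def ext0_def birkhoff_sum_def distrib_left exp_add mult_ac)
  qed
  also have "\<dots> = (LINT y|\<mu> (w n). k' y * twisted z 0 n g y)" by (rule Suc.IH[OF k'])
  also have "\<dots> = (LINT y|\<mu> (w n). (twisted z 0 n g y * exp (z * complex_of_real (f (w n) y))) * k (T (w n) y))"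
    by (intro Bochner_Integration.integral_cong refl) (simp add: k'_def ext0_def space_fibre mult_ac)
  also have "\<dots> = (LINT y|\<mu> (w (Suc n)). k y * L (w n) (\<lambda>y. twisted z 0 n g y * exp (z * complex_of_real (f (w n) y))) y)"
  proof (rule duality_1[OF bounded_fibre[OF exp_mult_mem] Suc.prems])
    show "twisted z 0 n g \<in> B (w n)" using twisted_mem[of g 0 z n] g by simp
  qed
  finally show ?case by (simp add: twisted_op_def)
qed

abbreviation one :: "nat \<Rightarrow> 'x \<Rightarrow> complex" where "one j \<equiv> ext0 (E (w j)) (\<lambda>x. 1)"

lemma mgf_birkhoff: "mgf (\<mu> \<omega>) (birkhoff_sum \<theta> T f \<omega> n) z = (LINT y|\<mu> (w n). twisted z 0 n (one 0) y)"
proof -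
  have "mgf (\<mu> \<omega>) (birkhoff_sum \<theta> T f \<omega> n) z
    = (LINT x|\<mu> \<omega>. one 0 x * exp (z * complex_of_real (birkhoff_sum \<theta> T f \<omega> n x)) * one n (fibre_iter \<theta> T n \<omega> x))"
    unfolding mgf_def
  proof (intro Bochner_Integration.integral_cong refl)
    fix x assume "x \<in> space (\<mu> \<omega>)"
    then have "x \<in> E \<omega>" "fibre_iter \<theta> T n \<omega> x \<in> E (w n)" using iter_mem space_fibre[of 0] by simp_all
    then show "exp (z * complex_of_real (birkhoff_sum \<theta> T f \<omega> n x))
      = one 0 x * exp (z * complex_of_real (birkhoff_sum \<theta> T f \<omega> n x)) * one n (fibre_iter \<theta> T n \<omega> x)"
      by (simp add: ext0_def)
  qed
  also have "\<dots> = (LINT y|\<mu> (w n). one n y * twisted z 0 n (one 0) y)"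
    by (rule duality) (use one_mem[of 0] bounded_fibre[OF one_mem] in auto)
  also have "\<dots> = (LINT y|\<mu> (w n). twisted z 0 n (one 0) y)"
    by (intro Bochner_Integration.integral_cong refl) (simp add: ext0_def space_fibre)
  finally show ?thesis .
qed

lemma mgf_centered:
  "mgf (\<mu> \<omega>) (centered_sum \<theta> T \<mu> f \<omega> n) z
    = exp (- z * complex_of_real (LINT x|\<mu> \<omega>. birkhoff_sum \<theta> T f \<omega> n x)) * mgf (\<mu> \<omega>) (birkhoff_sum \<theta> T f \<omega> n) z"
  unfolding mgf_def centered_sum_def
  by (simp only: of_real_diff right_diff_distrib exp_diff divide_inverse exp_minus mult_minus_left
      integral_mult_left_zero mult.commute[of "inverse _"])

end

section \<open>Holomorphy of pairings in the perturbation parameter\<close>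

lemma holomorphic_onI_quotient_bound:
  fixes \<phi> :: "complex \<Rightarrow> complex"
  assumes U: "open U"
    and q: "\<And>z. z \<in> U \<Longrightarrow> \<exists>d m. (m \<longlongrightarrow> 0) (at z) \<and> (\<forall>w\<in>U. cmod ((\<phi> w - \<phi> z) / (w - z) - d) \<le> c * m w)"
  shows "\<phi> holomorphic_on U"
  unfolding holomorphic_on_def
proof
  fix z assume z: "z \<in> U"
  obtain d m where m: "(m \<longlongrightarrow> 0) (at z)" and d: "\<forall>w\<in>U. cmod ((\<phi> w - \<phi> z) / (w - z) - d) \<le> c * m w"
    using q[OF z] by (elim exE conjE) (rule that)
  have "((\<lambda>w. (\<phi> w - \<phi> z) / (w - z) - d) \<longlongrightarrow> 0) (at z)"
  proof (rule Lim_null_comparison[OF _ tendsto_mult_right_zero[OF m, of c]])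
    show "\<forall>\<^sub>F w in at z. norm ((\<phi> w - \<phi> z) / (w - z) - d) \<le> c * m w"
      by (rule eventually_mono[OF eventually_at_in_open'[OF U z]]) (rule bspec[OF d])
  qed
  then have "(\<phi> has_field_derivative d) (at z)"
    unfolding has_field_derivative_iff by (rule LIM_zero_cancel)
  then have "(\<phi> has_field_derivative d) (at z within U)" by (rule has_field_derivative_at_within)
  then show "\<phi> field_differentiable at z within U" unfolding field_differentiable_def by (rule exI)
qed

lemma dual_space_apply_holomorphic:
  assumes V: "fun_subspace A V" "is_norm_on V N" and \<nu>: "\<nu> \<in> dual_space V N"
    and F: "analytic_into V N U F" and U: "open U"
  shows "(\<lambda>z. \<nu> (F z)) holomorphic_on U"
proof (rule holomorphic_onI_quotient_bound[OF U, where c="dual_norm V N \<nu>"])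
  fix z assume z: "z \<in> U"
  obtain D where D: "D \<in> V" "((\<lambda>w. N (\<lambda>x. (F w x - F z x) / (w - z) - D x)) \<longlongrightarrow> 0) (at z)"
    using F z by (auto simp: analytic_into_def)
  have FV: "F w \<in> V" if "w \<in> U" for w using F that by (simp add: analytic_into_def)
  have "cmod ((\<nu> (F w) - \<nu> (F z)) / (w - z) - \<nu> D) \<le> dual_norm V N \<nu> * N (\<lambda>x. (F w x - F z x) / (w - z) - D x)"
    if w: "w \<in> U" for w
  proof -
    let ?a = "inverse (w - z)"
    have m: "(\<lambda>x. ?a * F w x) \<in> V" "(\<lambda>x. - ?a * F z x) \<in> V" "(\<lambda>x. - 1 * D x) \<in> V"
      by (rule fun_subspace_scale[OF V(1) FV[OF w]], rule fun_subspace_scale[OF V(1) FV[OF z]], rule fun_subspace_scale[OF V(1) D(1)])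
    have m2: "(\<lambda>x. ?a * F w x + - ?a * F z x) \<in> V" by (rule fun_subspace_add[OF V(1) m(1,2)])
    have m3: "(\<lambda>x. (?a * F w x + - ?a * F z x) + - 1 * D x) \<in> V" by (rule fun_subspace_add[OF V(1) m2 m(3)])
    have eq: "(\<lambda>x. (?a * F w x + - ?a * F z x) + - 1 * D x) = (\<lambda>x. (F w x - F z x) / (w - z) - D x)"
      by (simp add: divide_inverse algebra_simps)
    have "\<nu> (\<lambda>x. (?a * F w x + - ?a * F z x) + - 1 * D x) = (?a * \<nu> (F w) + - ?a * \<nu> (F z)) + - 1 * \<nu> D"
      by (simp only: dual_space_add[OF \<nu> m2 m(3)] dual_space_add[OF \<nu> m(1,2)] dual_space_scale[OF \<nu> FV[OF w]]
          dual_space_scale[OF \<nu> FV[OF z]] dual_space_scale[OF \<nu> D(1)])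
    also have "\<dots> = (\<nu> (F w) - \<nu> (F z)) / (w - z) - \<nu> D" by (simp add: divide_inverse algebra_simps)
    finally show ?thesis using dual_norm_bound[OF V \<nu> m3] unfolding eq by simp
  qed
  then show "\<exists>d m. (m \<longlongrightarrow> 0) (at z) \<and>
      (\<forall>w\<in>U. cmod ((\<nu> (F w) - \<nu> (F z)) / (w - z) - d) \<le> dual_norm V N \<nu> * m w)"
    by (intro exI[of _ "\<nu> D"] exI[of _ "\<lambda>w. N (\<lambda>x. (F w x - F z x) / (w - z) - D x)"] conjI ballI D(2))
qed

text \<open>Membership has to be known before \<open>dual_norm\<close> bounds anything: for an
  unbounded functional \<open>enn2real\<close> would return 0.\<close>

lemma dual_space_combination:
  assumes V: "fun_subspace A V" "is_norm_on V N" and \<nu>: "\<nu>1 \<in> dual_space V N" "\<nu>2 \<in> dual_space V N" "\<nu>3 \<in> dual_space V N"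
  shows "(\<lambda>g. (\<nu>1 g - \<nu>2 g) / a - \<nu>3 g) \<in> dual_space V N"
proof -
  let ?c = "(dual_norm V N \<nu>1 + dual_norm V N \<nu>2) / cmod a + dual_norm V N \<nu>3"
  have "cmod ((\<nu>1 g - \<nu>2 g) / a - \<nu>3 g) \<le> ?c" if g: "g \<in> V" "N g \<le> 1" for g
  proof -
    have n: "cmod (\<nu> g) \<le> dual_norm V N \<nu>" if "\<nu> \<in> dual_space V N" for \<nu>
      using order_trans[OF dual_norm_bound[OF V that g(1)] mult_left_mono[OF g(2)]] by (simp add: dual_norm_def enn2real_nonneg)
    have "cmod ((\<nu>1 g - \<nu>2 g) / a) \<le> (dual_norm V N \<nu>1 + dual_norm V N \<nu>2) / cmod a"
      unfolding norm_divide
      by (rule divide_right_mono[OF order_trans[OF norm_triangle_ineq4 add_mono[OF n[OF \<nu>(1)] n[OF \<nu>(2)]]]]) simp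
    then show ?thesis by (intro order_trans[OF norm_triangle_ineq4] add_mono n[OF \<nu>(3)])
  qed
  then have "op_norm V N cmod (\<lambda>g. (\<nu>1 g - \<nu>2 g) / a - \<nu>3 g) \<le> ennreal ?c"
    unfolding op_norm_def by (intro SUP_least ennreal_leI) auto
  then have "op_norm V N cmod (\<lambda>g. (\<nu>1 g - \<nu>2 g) / a - \<nu>3 g) < \<infinity>" by (rule order.strict_trans1) simp
  then show ?thesis
    using \<nu> by (simp add: dual_space_def diff_divide_distrib add_divide_distrib algebra_simps)
qed

lemma dual_space_eval_holomorphic:
  assumes V: "fun_subspace A V" "is_norm_on V N" and g: "g \<in> V"
    and F: "analytic_into (dual_space V N) (dual_norm V N) U F" and U: "open U"
  shows "(\<lambda>z. F z g) holomorphic_on U"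
proof (rule holomorphic_onI_quotient_bound[OF U, where c="N g"])
  fix z assume z: "z \<in> U"
  obtain D where D: "D \<in> dual_space V N" "((\<lambda>w. dual_norm V N (\<lambda>g. (F w g - F z g) / (w - z) - D g)) \<longlongrightarrow> 0) (at z)"
    using F z by (auto simp: analytic_into_def)
  have FV: "F w \<in> dual_space V N" if "w \<in> U" for w using F that by (simp add: analytic_into_def)
  have "cmod ((F w g - F z g) / (w - z) - D g) \<le> N g * dual_norm V N (\<lambda>g. (F w g - F z g) / (w - z) - D g)" if "w \<in> U" for w
    using dual_norm_bound[OF V dual_space_combination[OF V FV[OF that] FV[OF z] D(1)] g] by (simp only: mult.commute)
  then show "\<exists>d m. (m \<longlongrightarrow> 0) (at z) \<and> (\<forall>w\<in>U. cmod ((F w g - F z g) / (w - z) - d) \<le> N g * m w)"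
    by (intro exI[of _ "D g"] exI[of _ "\<lambda>w. dual_norm V N (\<lambda>g. (F w g - F z g) / (w - z) - D g)"] conjI ballI D(2))
qed

text \<open>The Taylor estimate of order 0 on half the radius: the change is at most 4 M |z| /
  r.\<close>

lemma holomorphic_near_value_at_0:
  assumes f: "f holomorphic_on ball 0 r" and r: "0 < r" and M: "\<And>z. z \<in> ball 0 r \<Longrightarrow> cmod (f z) \<le> M"
    and M0: "0 < M" and z: "cmod z \<le> r / 4" "cmod z \<le> r / (32 * M)"
  shows "cmod (f z - f 0) \<le> 1 / 8"
proof -
  have "cmod (f z - (\<Sum>j\<le>0. (deriv ^^ j) f 0 / fact j * z ^ j)) \<le> 2 * M * (cmod z / (r / 2)) ^ Suc 0"
  proof (rule taylor_remainder_bound)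
    show "f holomorphic_on cball 0 (r / 2)" by (rule holomorphic_on_subset[OF f]) (use r in auto)
    show "cmod (f w) \<le> M" if "cmod w \<le> r / 2" for w by (rule M) (use that r in auto)
  qed (use r z in auto)
  then have "cmod (f z - f 0) \<le> 4 * M * cmod z / r" by simp
  also have "\<dots> \<le> 4 * M * (r / (32 * M)) / r" using z(2) M0 r by (intro divide_right_mono mult_left_mono) auto
  also have "\<dots> = 1 / 8" using M0 r by simp
  finally show ?thesis .
qed

text \<open>Eigenvalues, eigenfunctions and functionals are taken at every point of the orbit with
  the single bound \<open>K\<close>, which is what makes the radius of the logarithm independent of
  n. The spectral estimate concerns the iterates started at \<omega>.\<close>

locale fibre_perturbation = fibre_orbit \<theta> E T \<mu> L B N1 f \<omega>
  for \<theta> :: "'w \<Rightarrow> 'w" and E :: "'w \<Rightarrow> 'x::metric_space set" and T \<mu> L B N1 f \<omega> +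
  fixes N :: "'w \<Rightarrow> ('x \<Rightarrow> complex) \<Rightarrow> real" and r0 :: real and lam :: "'w \<Rightarrow> complex \<Rightarrow> complex"
    and h :: "'w \<Rightarrow> complex \<Rightarrow> 'x \<Rightarrow> complex" and \<nu> :: "'w \<Rightarrow> complex \<Rightarrow> ('x \<Rightarrow> complex) \<Rightarrow> complex"
    and K C \<delta> :: real
  assumes r0: "0 < r0" and C: "0 < C" and \<delta>: "0 < \<delta>" "\<delta> < 1"
    and N_norm: "\<And>j. is_norm_on (B (w j)) (N (w j))"
    and lam_analytic: "\<And>j. lam (w j) analytic_on ball 0 r0"
    and h_analytic: "\<And>j. analytic_into (B (w j)) (N (w j)) (ball 0 r0) (h (w j))"
    and nu_analytic: "\<And>j. analytic_into (dual_space (B (w j)) (N (w j))) (dual_norm (B (w j)) (N (w j))) (ball 0 r0) (\<nu> (w j))"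
    and lam_0: "\<And>j. lam (w j) 0 = 1"
    and h_0: "\<And>j. h (w j) 0 = one j"
    and nu_0: "\<And>j g. g \<in> B (w j) \<Longrightarrow> \<nu> (w j) 0 g = (LINT x|\<mu> (w j). g x)"
    and lam_nonzero: "\<And>j z. z \<in> ball 0 r0 \<Longrightarrow> lam (w j) z \<noteq> 0"
    and lam_le: "\<And>j z. z \<in> ball 0 r0 \<Longrightarrow> cmod (lam (w j) z) \<le> K"
    and h_le: "\<And>j z. z \<in> ball 0 r0 \<Longrightarrow> N (w j) (h (w j) z) \<le> K"
    and nu_le: "\<And>j z. z \<in> ball 0 r0 \<Longrightarrow> dual_norm (B (w j)) (N (w j)) (\<nu> (w j) z) \<le> K"
    and spectral: "\<And>n z. z \<in> ball 0 r0 \<Longrightarrow> 1 \<le> n \<Longrightarrow> op_norm (B \<omega>) (N \<omega>) (N (w n))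
        (\<lambda>g x. inverse (\<Prod>j<n. lam (w j) z) * twisted z 0 n g x - \<nu> \<omega> z g * h (w n) z x) \<le> ennreal (C * \<delta> ^ n)"
begin

lemma zero_mem_ball: "0 \<in> ball 0 r0" using r0 by simp

lemma K_nonneg: "0 \<le> K"
  using lam_le[OF zero_mem_ball, of 0] norm_ge_zero[of "lam (w 0) 0"] by (rule order_trans[rotated])

lemma N_one_le: "N (w j) (one j) \<le> K"
  using h_le[OF zero_mem_ball, of j] by (simp add: h_0)

lemma nu_mem: "z \<in> ball 0 r0 \<Longrightarrow> \<nu> (w j) z \<in> dual_space (B (w j)) (N (w j))"
  using nu_analytic[of j] by (simp add: analytic_into_def)

lemma N_nonneg: "g \<in> B (w j) \<Longrightarrow> 0 \<le> N (w j) g"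
  using N_norm[of j] by (simp add: is_norm_on_def)

lemma nu_apply_le: "z \<in> ball 0 r0 \<Longrightarrow> g \<in> B (w j) \<Longrightarrow> cmod (\<nu> (w j) z g) \<le> K * N (w j) g"
  by (rule order_trans[OF dual_norm_bound[OF subspace N_norm nu_mem] mult_right_mono[OF nu_le N_nonneg]])

lemma mgf_birkhoff_nu: "mgf (\<mu> \<omega>) (birkhoff_sum \<theta> T f \<omega> n) z = \<nu> (w n) 0 (twisted z 0 n (one 0))"
  using nu_0[of "twisted z 0 n (one 0)" n] twisted_mem[OF one_mem[of 0], of z n] by (simp add: mgf_birkhoff)

lemma mgf_birkhoff_le: "cmod (mgf (\<mu> \<omega>) (birkhoff_sum \<theta> T f \<omega> n) z) \<le> K * N (w n) (twisted z 0 n (one 0))"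
  unfolding mgf_birkhoff_nu using twisted_mem[OF one_mem[of 0], of z n]
  by (intro nu_apply_le zero_mem_ball) simp

text \<open>What remains of the generating function after division by the eigenvalues: the rank-one
  part applied to 1 and integrated against the invariant measure, which is
  \<open>\<nu> (w n) 0\<close>.\<close>

definition amplitude :: "nat \<Rightarrow> complex \<Rightarrow> complex" where
  "amplitude n z = \<nu> \<omega> z (one 0) * \<nu> (w n) 0 (h (w n) z)"

lemma amplitude_holomorphic: "amplitude n holomorphic_on ball 0 r0"
  unfolding amplitude_def[abs_def]
  using dual_space_eval_holomorphic[OF subspace[of 0] N_norm[of 0] one_mem[of 0] nu_analytic[of 0] open_ball]
  by (intro holomorphic_on_mult dual_space_apply_holomorphic[OF subspace N_norm nu_mem[OF zero_mem_ball] h_analytic open_ball]) simp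

lemma h_mem: "z \<in> ball 0 r0 \<Longrightarrow> h (w n) z \<in> B (w n)"
  using h_analytic[of n] by (simp add: analytic_into_def)

lemma amplitude_le:
  assumes z: "z \<in> ball 0 r0"
  shows "cmod (amplitude n z) \<le> (K * K) * (K * K)"
proof -
  have "cmod (\<nu> (w j) y g) \<le> K * K" if "y \<in> ball 0 r0" "g \<in> B (w j)" "N (w j) g \<le> K" for j y g
    by (rule order_trans[OF nu_apply_le[OF that(1,2)] mult_left_mono[OF that(3) K_nonneg]])
  from this[OF z one_mem N_one_le, of 0] this[OF zero_mem_ball h_mem[OF z] h_le[OF z], of n]
  show ?thesis unfolding amplitude_def norm_mult by (intro mult_mono) (auto simp: K_nonneg)
qed

lemma integral_one: "(LINT x|\<mu> (w j). one j x) = 1"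
proof -
  interpret prob_space "\<mu> (w j)" by (rule prob_fibre)
  have "(LINT x|\<mu> (w j). one j x) = (LINT x|\<mu> (w j). 1)"
    by (intro Bochner_Integration.integral_cong refl) (simp add: ext0_def space_fibre)
  then show ?thesis by (simp add: prob_space)
qed

lemma amplitude_0: "amplitude n 0 = 1"
  using nu_0[OF one_mem[of 0]] nu_0[OF one_mem[of n]] integral_one[of 0] integral_one[of n]
  by (simp add: amplitude_def h_0)

text \<open>The spectral estimate is applied to the constant function 1 and the result paired with
  the invariant measure; each of the two costs a factor \<open>K\<close>.\<close>

lemma normalized_mgf_near_amplitude:
  assumes z: "z \<in> ball 0 r0" and n: "1 \<le> n"
  shows "cmod (inverse (\<Prod>j<n. lam (w j) z) * mgf (\<mu> \<omega>) (birkhoff_sum \<theta> T f \<omega> n) z - amplitude n z) \<le> K * (C * \<delta> ^ n * K)"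
proof -
  let ?a = "inverse (\<Prod>j<n. lam (w j) z)"
  let ?F = "\<lambda>g x. ?a * twisted z 0 n g x - \<nu> \<omega> z g * h (w n) z x"
  have V: "fun_subspace (E \<omega>) (B \<omega>)" "is_norm_on (B \<omega>) (N \<omega>)" "one 0 \<in> B \<omega>" "\<nu> \<omega> z \<in> dual_space (B \<omega>) (N \<omega>)"
    using subspace[of 0] N_norm[of 0] one_mem[of 0] nu_mem[OF z, of 0] by simp_all
  have mem: "(\<lambda>x. ?a * twisted z 0 n g x) \<in> B (w n)" "(\<lambda>x. - \<nu> \<omega> z g * h (w n) z x) \<in> B (w n)" if "g \<in> B \<omega>" for g
    using fun_subspace_scale[OF subspace[of n], of "twisted z 0 n g"] twisted_mem[of g 0 z n] that
      fun_subspace_scale[OF subspace h_mem[OF z], of "- \<nu> \<omega> z g" n] by simp_all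
  have memF: "?F g \<in> B (w n)" if "g \<in> B \<omega>" for g
  proof -
    have "(\<lambda>x. ?a * twisted z 0 n g x + - \<nu> \<omega> z g * h (w n) z x) \<in> B (w n)"
      by (rule fun_subspace_add[OF subspace mem[OF that]])
    then show ?thesis by simp
  qed
  have "N (w n) (?F (one 0)) \<le> C * \<delta> ^ n * N \<omega> (one 0)"
  proof (rule op_norm_le_imp[OF V(1,2) _ spectral[OF z n] _ V(3)])
    fix a g assume g: "g \<in> B \<omega>"
    have "?F (\<lambda>x. a * g x) = (\<lambda>x. a * ?F g x)"
      using twisted_scale[of g 0 z n a] g V(4) by (simp add: dual_space_def algebra_simps)
    then show "N (w n) (?F (\<lambda>x. a * g x)) = cmod a * N (w n) (?F g)"
      using N_norm[of n] memF[OF g] by (simp add: is_norm_on_def)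
  qed (use C \<delta> in simp)
  also have "\<dots> \<le> C * \<delta> ^ n * K" using N_one_le[of 0] C \<delta> by (intro mult_left_mono) auto
  finally have "N (w n) (?F (one 0)) \<le> C * \<delta> ^ n * K" .
  then have "cmod (\<nu> (w n) 0 (?F (one 0))) \<le> K * (C * \<delta> ^ n * K)"
    by (intro order_trans[OF nu_apply_le[OF zero_mem_ball memF[OF V(3)]] mult_left_mono] K_nonneg)
  moreover have "\<nu> (w n) 0 (?F (one 0)) = ?a * \<nu> (w n) 0 (twisted z 0 n (one 0)) - amplitude n z"
  proof -
    have "\<nu> (w n) 0 (\<lambda>x. ?a * twisted z 0 n (one 0) x + - \<nu> \<omega> z (one 0) * h (w n) z x)
      = \<nu> (w n) 0 (\<lambda>x. ?a * twisted z 0 n (one 0) x) + \<nu> (w n) 0 (\<lambda>x. - \<nu> \<omega> z (one 0) * h (w n) z x)"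
      by (rule dual_space_add[OF nu_mem[OF zero_mem_ball] mem[OF V(3)]])
    also have "\<nu> (w n) 0 (\<lambda>x. ?a * twisted z 0 n (one 0) x) = ?a * \<nu> (w n) 0 (twisted z 0 n (one 0))"
      using dual_space_scale[OF nu_mem[OF zero_mem_ball, of n]] twisted_mem[OF one_mem[of 0], of z n] by simp
    also have "\<nu> (w n) 0 (\<lambda>x. - \<nu> \<omega> z (one 0) * h (w n) z x) = - \<nu> \<omega> z (one 0) * \<nu> (w n) 0 (h (w n) z)"
      by (rule dual_space_scale[OF nu_mem[OF zero_mem_ball] h_mem[OF z]])
    finally show ?thesis by (simp add: amplitude_def)
  qed
  ultimately show ?thesis by (simp add: mgf_birkhoff_nu)
qed

end

section \<open>The logarithm of the generating function near zero\<close>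

lemma Ln_near_1:
  assumes "cmod (w - 1) \<le> 1 / 4"
  shows "w \<notin> \<real>\<^sub>\<le>\<^sub>0" "exp (Ln w) = w" "cmod (Ln w) \<le> 1 / 2"
proof -
  have re: "0 < Re w" using assms abs_Re_le_cmod[of "w - 1"] by simp
  then show "w \<notin> \<real>\<^sub>\<le>\<^sub>0" by (auto simp: complex_nonpos_Reals_iff)
  show "exp (Ln w) = w" using re by (intro exp_Ln) auto
  show "cmod (Ln w) \<le> 1 / 2" using norm_Ln_le[of "w - 1"] assms by simp
qed

context fibre_perturbation
begin

text \<open>The generating function is the product of n eigenvalues and one factor close to
  \<open>amplitude\<close>. On one ball all of them are within 1/4 of 1, so each has a principal
  logarithm of size at most 1/2, and n + 1 such terms sum to at most n.\<close>

lemma log_mgf_birkhoff: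
  "\<exists>r>0. \<forall>\<^sub>F n in sequentially. \<exists>G. G holomorphic_on ball 0 r \<and> G 0 = 0 \<and>
     (\<forall>z\<in>ball 0 r. exp (G z) = mgf (\<mu> \<omega>) (birkhoff_sum \<theta> T f \<omega> n) z \<and> cmod (G z) \<le> real n)"
proof -
  define M where "M = 1 + K + (K * K) * (K * K)"
  have M: "1 \<le> M" "K \<le> M" "(K * K) * (K * K) \<le> M" using K_nonneg by (simp_all add: M_def)
  \<comment> \<open>On this ball a function bounded by M differs by at most 1/8 from its value at 0.
    For \<open>q\<close> two such errors add up, one from \<open>amplitude\<close> and one from the
    spectral estimate, to the 1/4 needed for the logarithm.\<close>
  define r where "r = r0 / (32 * M)"
  have r: "0 < r" "r \<le> r0 / 32"
    using r0 M(1) by (simp_all add: r_def divide_le_eq mult_le_cancel_left1)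
  have sub: "ball 0 r \<subseteq> ball (0::complex) r0" using r r0 by auto
  have near: "cmod (\<phi> z - \<phi> 0) \<le> 1 / 8"
    if "\<phi> holomorphic_on ball 0 r0" "\<And>z. z \<in> ball 0 r0 \<Longrightarrow> cmod (\<phi> z) \<le> M" "z \<in> ball 0 r" for \<phi> z
    by (rule holomorphic_near_value_at_0[OF that(1) r0 that(2)]) (use that(3) r M r0 in \<open>auto simp: r_def\<close>)
  have lam_holo: "lam (w j) holomorphic_on ball 0 r0" for j by (rule analytic_imp_holomorphic[OF lam_analytic])
  have lam_near: "cmod (lam (w j) z - 1) \<le> 1 / 8" if "z \<in> ball 0 r" for j z
    using near[OF lam_holo order_trans[OF lam_le M(2)] that, of j] by (simp only: lam_0)
  have amp_near: "cmod (amplitude n z - 1) \<le> 1 / 8" if "z \<in> ball 0 r" for n z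
    using near[OF amplitude_holomorphic order_trans[OF amplitude_le M(3)] that, of n] by (simp only: amplitude_0)
  have "(\<lambda>n. K * (C * \<delta> ^ n * K)) \<longlonglongrightarrow> K * (C * 0 * K)"
    by (intro tendsto_mult tendsto_const LIMSEQ_power_zero) (use \<delta> in auto)
  then have "\<forall>\<^sub>F n in sequentially. K * (C * \<delta> ^ n * K) < 1 / 8" by (rule order_tendstoD) simp
  then have "\<forall>\<^sub>F n in sequentially. \<exists>G. G holomorphic_on ball 0 r \<and> G 0 = 0 \<and>
     (\<forall>z\<in>ball 0 r. exp (G z) = mgf (\<mu> \<omega>) (birkhoff_sum \<theta> T f \<omega> n) z \<and> cmod (G z) \<le> real n)"
  proof (rule eventually_mono[OF eventually_conj[OF _ eventually_ge_at_top[of 1]]], elim conjE)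
    fix n :: nat assume small: "K * (C * \<delta> ^ n * K) < 1 / 8" and n: "1 \<le> n"
    interpret X: bounded_rv "\<mu> \<omega>" "birkhoff_sum \<theta> T f \<omega> n" by (rule bounded_rv_birkhoff)
    define q where "q z = inverse (\<Prod>j<n. lam (w j) z) * mgf (\<mu> \<omega>) (birkhoff_sum \<theta> T f \<omega> n) z" for z
    have q_near: "cmod (q z - 1) \<le> 1 / 4" if z: "z \<in> ball 0 r" for z
    proof -
      have "q z - 1 = (q z - amplitude n z) + (amplitude n z - 1)" by simp
      then have "cmod (q z - 1) \<le> cmod (q z - amplitude n z) + cmod (amplitude n z - 1)"
        by (simp only: norm_triangle_ineq)
      then show ?thesis
        using normalized_mgf_near_amplitude[of z n] sub z n small amp_near[OF z, of n] by (auto simp: q_def)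
    qed
    have lam4: "cmod (lam (w j) z - 1) \<le> 1 / 4" if "z \<in> ball 0 r" for j z using lam_near[OF that, of j] by simp
    have q_holo: "q holomorphic_on ball 0 r"
      unfolding q_def[abs_def]
      by (intro holomorphic_on_mult holomorphic_on_inverse holomorphic_on_prod X.mgf_holomorphic
          holomorphic_on_subset[OF lam_holo sub]) (use lam_nonzero sub in auto)
    define G where "G z = (\<Sum>j<n. Ln (lam (w j) z)) + Ln (q z)" for z
    have "G holomorphic_on ball 0 r"
      unfolding G_def[abs_def]
      by (intro holomorphic_on_add holomorphic_on_sum holomorphic_on_Ln' q_holo holomorphic_on_subset[OF lam_holo sub]
          Ln_near_1(1)[OF q_near] Ln_near_1(1)[OF lam4])
    moreover have "q 0 = 1" by (simp add: q_def lam_0 X.mgf_0)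
    then have "G 0 = 0" by (simp add: G_def lam_0)
    moreover have "exp (G z) = mgf (\<mu> \<omega>) (birkhoff_sum \<theta> T f \<omega> n) z" if z: "z \<in> ball 0 r" for z
    proof -
      have "exp (G z) = (\<Prod>j<n. lam (w j) z) * q z"
        by (simp only: G_def exp_add exp_sum[OF finite_lessThan] Ln_near_1(2)[OF q_near[OF z]] Ln_near_1(2)[OF lam4[OF z]])
      moreover have "(\<Prod>j<n. lam (w j) z) \<noteq> 0" using lam_nonzero sub z by auto
      ultimately show ?thesis by (simp add: q_def)
    qed
    moreover have "cmod (G z) \<le> real n" if z: "z \<in> ball 0 r" for z
    proof -
      have "cmod (G z) \<le> (\<Sum>j<n. 1 / 2) + 1 / 2"
        unfolding G_def
        by (intro order_trans[OF norm_triangle_ineq] add_mono order_trans[OF norm_sum] sum_mono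
            Ln_near_1(3)[OF q_near[OF z]] Ln_near_1(3)[OF lam4[OF z]])
      also have "\<dots> \<le> real n" using n by simp
      finally show ?thesis .
    qed
    ultimately show "\<exists>G. G holomorphic_on ball 0 r \<and> G 0 = 0 \<and>
     (\<forall>z\<in>ball 0 r. exp (G z) = mgf (\<mu> \<omega>) (birkhoff_sum \<theta> T f \<omega> n) z \<and> cmod (G z) \<le> real n)"
      by (intro exI[of _ G] conjI ballI)
  qed
  then show ?thesis using r(1) by (intro exI[of _ r] conjI)
qed

text \<open>Centring subtracts z times the mean, and the mean is the derivative of the logarithm at
  0; Cauchy's inequality on the circle of radius r / 2 bounds it by 2 n / r.\<close>

lemma log_mgf_centered:
  "\<exists>r>0. \<forall>\<^sub>F n in sequentially. \<exists>G. G holomorphic_on ball 0 r \<and> G 0 = 0 \<and>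
     (\<forall>z\<in>ball 0 r. exp (G z) = mgf (\<mu> \<omega>) (centered_sum \<theta> T \<mu> f \<omega> n) z \<and> cmod (G z) \<le> 3 * real n)"
proof -
  from log_mgf_birkhoff obtain r where r: "0 < r" and ev: "\<forall>\<^sub>F n in sequentially. \<exists>G. G holomorphic_on ball 0 r \<and> G 0 = 0 \<and>
     (\<forall>z\<in>ball 0 r. exp (G z) = mgf (\<mu> \<omega>) (birkhoff_sum \<theta> T f \<omega> n) z \<and> cmod (G z) \<le> real n)"
    by (elim exE conjE) (rule that)
  have "\<forall>\<^sub>F n in sequentially. \<exists>G. G holomorphic_on ball 0 r \<and> G 0 = 0 \<and>
     (\<forall>z\<in>ball 0 r. exp (G z) = mgf (\<mu> \<omega>) (centered_sum \<theta> T \<mu> f \<omega> n) z \<and> cmod (G z) \<le> 3 * real n)"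
  proof (rule eventually_mono[OF ev], elim exE conjE)
    fix n G assume holo: "G holomorphic_on ball 0 r" and G0: "G 0 = 0"
      and GG: "\<forall>z\<in>ball 0 r. exp (G z) = mgf (\<mu> \<omega>) (birkhoff_sum \<theta> T f \<omega> n) z \<and> cmod (G z) \<le> real n"
    have eG: "exp (G z) = mgf (\<mu> \<omega>) (birkhoff_sum \<theta> T f \<omega> n) z" and nG: "cmod (G z) \<le> real n" if "z \<in> ball 0 r" for z
      using bspec[OF GG that] by auto
    interpret X: bounded_rv "\<mu> \<omega>" "birkhoff_sum \<theta> T f \<omega> n" by (rule bounded_rv_birkhoff)
    define m where "m = (LINT x|\<mu> \<omega>. birkhoff_sum \<theta> T f \<omega> n x)"
    have "(deriv ^^ 1) G 0 = complex_of_real m"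
    proof -
      have "(G has_field_derivative deriv G 0) (at 0)" by (rule holomorphic_derivI[OF holo]) (use r in auto)
      from DERIV_fun_exp[OF this] have "((\<lambda>z. exp (G z)) has_field_derivative deriv G 0) (at 0)" by (simp add: G0)
      then have "(mgf (\<mu> \<omega>) (birkhoff_sum \<theta> T f \<omega> n) has_field_derivative deriv G 0) (at 0)"
        by (rule has_field_derivative_transform_within_open[OF _ open_ball[of 0 r]]) (use r eG in auto)
      then have "deriv (mgf (\<mu> \<omega>) (birkhoff_sum \<theta> T f \<omega> n)) 0 = deriv G 0" by (rule DERIV_imp_deriv)
      then show ?thesis using X.higher_deriv_mgf[of 1 0] by (simp add: m_def)
    qed
    moreover have "cmod ((deriv ^^ 1) G 0) \<le> fact 1 * real n / (r / 2) ^ 1"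
    proof (rule Cauchy_inequality)
      show "G holomorphic_on ball 0 (r / 2)" by (rule holomorphic_on_subset[OF holo]) (use r in auto)
      show "continuous_on (cball 0 (r / 2)) G"
        by (rule holomorphic_on_imp_continuous_on[OF holomorphic_on_subset[OF holo]]) (use r in auto)
      show "cmod (G x) \<le> real n" if "norm (0 - x) = r / 2" for x by (rule nG) (use that r in auto)
    qed (use r in auto)
    ultimately have m: "\<bar>m\<bar> \<le> 2 * real n / r" by (simp add: mult.commute)
    have "cmod (G z - z * complex_of_real m) \<le> 3 * real n" if z: "z \<in> ball 0 r" for z
    proof -
      have "cmod (z * complex_of_real m) \<le> r * (2 * real n / r)"
        unfolding norm_mult norm_of_real using z m r by (intro mult_mono) auto
      then have "cmod (z * complex_of_real m) \<le> 2 * real n" using r by simp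
      then show ?thesis using norm_triangle_ineq4[of "G z" "z * complex_of_real m"] nG[OF z] by linarith
    qed
    moreover have "exp (G z - z * complex_of_real m) = mgf (\<mu> \<omega>) (centered_sum \<theta> T \<mu> f \<omega> n) z" if z: "z \<in> ball 0 r" for z
      by (simp only: mgf_centered eG[OF z, symmetric] m_def[symmetric] exp_diff divide_inverse exp_minus[symmetric] mult_minus_left mult.commute)
    ultimately show "\<exists>G. G holomorphic_on ball 0 r \<and> G 0 = 0 \<and>
     (\<forall>z\<in>ball 0 r. exp (G z) = mgf (\<mu> \<omega>) (centered_sum \<theta> T \<mu> f \<omega> n) z \<and> cmod (G z) \<le> 3 * real n)"
      by (intro exI[of _ "\<lambda>z. G z - z * complex_of_real m"] conjI ballI holomorphic_intros holo) (simp add: G0)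
  qed
  then show ?thesis using r by (intro exI[of _ r] conjI)
qed

end

section \<open>Contraction at high frequencies\<close>

context fibre_orbit
begin

lemma twisted_norm_bound:
  assumes "is_norm_on (B (w j)) (Nn (w j))" "is_norm_on (B (w (j + n))) (Nn (w (j + n)))"
    and "twisted_norm \<theta> L f B Nn z n (w j) \<le> ennreal c" "0 \<le> c" and g: "g \<in> B (w j)"
  shows "Nn (w (j + n)) (twisted z j n g) \<le> c * Nn (w j) g"
proof (rule op_norm_le_imp[where N'="Nn (w (j + n))" and F="twisted z j n", OF subspace assms(1) _ _ assms(4) g])
  show "op_norm (B (w j)) (Nn (w j)) (Nn (w (j + n))) (twisted z j n) \<le> ennreal c"
    using assms(3) by (simp only: twisted_norm_def w_add)
  show "Nn (w (j + n)) (twisted z j n (\<lambda>x. a * g x)) = cmod a * Nn (w (j + n)) (twisted z j n g)" if "g \<in> B (w j)" for a g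
    using assms(2) twisted_mem[OF that, of z n] by (simp add: twisted_scale[OF that] is_norm_on_def)
qed

lemma integral_le_N1:
  assumes g: "g \<in> B (w j)"
  shows "cmod (LINT x|\<mu> (w j). g x) \<le> N1 (w j) g"
proof -
  interpret prob_space "\<mu> (w j)" by (rule prob_fibre)
  have [measurable]: "g \<in> borel_measurable (\<mu> (w j))" using g B_measurable by blast
  have le: "cmod (g x) \<le> N1 (w j) g" if "x \<in> space (\<mu> (w j))" for x
    using N1_sup[OF g] that by (simp add: space_fibre)
  have "integrable (\<mu> (w j)) (\<lambda>x. cmod (g x))"
    by (rule integrable_const_bound[of _ "N1 (w j) g"]) (use le in auto)
  then have "(LINT x|\<mu> (w j). cmod (g x)) \<le> (LINT x|\<mu> (w j). N1 (w j) g)"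
    by (intro integral_mono le) auto
  then show ?thesis by (intro order_trans[OF integral_norm_bound]) (simp add: prob_space)
qed

text \<open>Greedy choice of disjoint contracting blocks: from the current time wait for the next time in
  \<open>J\<close> at bounded cost, apply the contracting block there, and repeat. A block uses up at most
  \<open>\<beta>\<close> times of \<open>J\<close>.\<close>

lemma contraction_by_blocks:
  assumes norm: "\<And>j. is_norm_on (B (w j)) (Nn (w j))"
    and gap: "\<And>j n g. g \<in> B (w j) \<Longrightarrow> Nn (w (j + n)) (twisted z j n g) \<le> C * Nn (w j) g" and C: "0 < C"
    and block: "\<And>j g. j \<in> J \<Longrightarrow> g \<in> B (w j) \<Longrightarrow> Nn (w (j + len j)) (twisted z j (len j) g) \<le> \<kappa> * Nn (w j) g"
    and len: "\<And>j. j \<in> J \<Longrightarrow> 1 \<le> len j \<and> real (len j) \<le> \<beta>" and \<beta>: "0 < \<beta>"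
    and \<kappa>: "0 \<le> \<kappa>" "C * \<kappa> \<le> exp (- 1)"
    and g: "g \<in> B (w j)"
  shows "Nn (w (j + n)) (twisted z j n g) \<le> C * exp (1 - real (card (J \<inter> {j..<j + n})) / \<beta>) * Nn (w j) g"
  using g
proof (induction n arbitrary: j g rule: less_induct)
  case (less n)
  have N0: "0 \<le> Nn (w i) h" if "h \<in> B (w i)" for i h using norm[of i] that by (simp add: is_norm_on_def)
  let ?c = "card (J \<inter> {j..<j + n})"
  \<comment> \<open>With so few times of \<open>J\<close> the claimed factor is at least
    \<open>C\<close>, and the bound for waiting periods is enough.\<close>
  have easy: ?case if "real ?c \<le> \<beta>"
  proof -
    have "1 \<le> exp (1 - real ?c / \<beta>)" using that \<beta> by simp
    then have "C * 1 * Nn (w j) g \<le> C * exp (1 - real ?c / \<beta>) * Nn (w j) g"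
      using C N0[OF less.prems] by (intro mult_right_mono mult_left_mono) auto
    then show ?thesis using gap[OF less.prems, of n] by simp
  qed
  show ?case
  proof (cases "J \<inter> {j..<j + n} = {}")
    case True
    then show ?thesis using \<beta> by (intro easy) simp
  next
    case False
    define i where "i = Min (J \<inter> {j..<j + n})"
    have i: "i \<in> J" "j \<le> i" "i < j + n" using Min_in[OF _ False] by (auto simp: i_def)
    have sub: "J \<inter> {j..<j + n} \<subseteq> J \<inter> {i..<j + n}" using Min_le[of "J \<inter> {j..<j + n}"] by (auto simp: i_def)
    define p where "p = i - j"
    have p: "i = j + p" using i by (simp add: p_def)
    show ?thesis
    proof (cases "i + len i \<le> j + n")
      case False
      \<comment> \<open>The first block does not fit into the remaining time, so the number of times
        of \<open>J\<close> is at most its length.\<close>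
      have "?c \<le> card {i..<j + n}" by (rule card_mono) (use sub in auto)
      also have "\<dots> \<le> len i" using False by simp
      finally show ?thesis using len[OF i(1)] by (intro easy) linarith
    next
      case True
      define k where "k = n - (p + len i)"
      have n: "n = (p + len i) + k" using True by (simp add: k_def p)
      have kn: "k < n" using n len[OF i(1)] by simp
      define g1 where "g1 = twisted z j p g"
      define g2 where "g2 = twisted z i (len i) g1"
      have g1: "g1 \<in> B (w i)" using twisted_mem[OF less.prems] by (simp add: g1_def p)
      have g2: "g2 \<in> B (w (i + len i))" using twisted_mem[OF g1] by (simp add: g2_def)
      have eq: "twisted z j n g = twisted z (i + len i) k g2"
        unfolding n twisted_add g2_def g1_def p by (simp only: add.assoc)
      have jn: "j + n = i + len i + k" using n p by simp
      let ?d = "card (J \<inter> {i + len i..<i + len i + k})"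
      have "?c \<le> card ({i..<i + len i} \<union> (J \<inter> {i + len i..<i + len i + k}))"
        by (rule card_mono) (use sub jn in auto)
      also have "\<dots> \<le> len i + ?d" using card_Un_le[of "{i..<i + len i}" "J \<inter> {i + len i..<i + len i + k}"] by simp
      finally have "real ?c \<le> \<beta> + real ?d" using len[OF i(1)] by linarith
      then have "real ?c / \<beta> \<le> (\<beta> + real ?d) / \<beta>" by (intro divide_right_mono) (use \<beta> in auto)
      then have cd: "real ?c / \<beta> \<le> 1 + real ?d / \<beta>" using \<beta> by (simp add: add_divide_distrib)
      have "Nn (w (j + n)) (twisted z j n g) \<le> C * exp (1 - real ?d / \<beta>) * Nn (w (i + len i)) g2"
        unfolding eq jn by (rule less.IH[OF kn g2])
      also have "\<dots> \<le> C * exp (1 - real ?d / \<beta>) * (\<kappa> * (C * Nn (w j) g))"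
      proof (rule mult_left_mono)
        have "Nn (w (i + len i)) g2 \<le> \<kappa> * Nn (w i) g1" unfolding g2_def by (rule block[OF i(1) g1])
        also have "\<dots> \<le> \<kappa> * (C * Nn (w j) g)"
          using gap[OF less.prems, of p] \<kappa> by (intro mult_left_mono) (simp_all add: g1_def p)
        finally show "Nn (w (i + len i)) g2 \<le> \<kappa> * (C * Nn (w j) g)" .
      qed (use C in simp)
      also have "\<dots> = C * exp (1 - real ?d / \<beta>) * (C * \<kappa>) * Nn (w j) g" by simp
      \<comment> \<open>A waiting period and a block together gain exp (- 1), in exchange for at
        most \<beta> times of \<open>J\<close>.\<close>
      also have "\<dots> \<le> C * exp (1 - real ?d / \<beta>) * exp (- 1) * Nn (w j) g"
        using \<kappa> C N0[OF less.prems] by (intro mult_right_mono mult_left_mono) auto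
      also have "\<dots> = C * exp (- (real ?d / \<beta>)) * Nn (w j) g" 
      proof -
        have "exp (1 - x) * exp (- 1) = exp (- x)" for x :: real by (simp flip: exp_add)
        then show ?thesis by (metis mult.assoc)
      qed
      also have "\<dots> \<le> C * exp (1 - real ?c / \<beta>) * Nn (w j) g"
        using cd C N0[OF less.prems] by (intro mult_right_mono mult_left_mono) auto
      finally show ?thesis .
    qed
  qed
qed

text \<open>A good time starts a block of length about \<rho> ln |u|. This is at most R ln |u|, yet
  for large |u| long enough that its contraction, of order exp(- ln |u| / R^2), beats the constant
  of a waiting period. Good times fill at least half of every initial segment, which gives n / (2 R
  ln |u|) in the exponent; the factor 1 + |u| is the loss in passing from \<open>Nt\<close> back to
  \<open>N1\<close>.\<close>

lemma mgf_high_frequency: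
  fixes Nt :: "real \<Rightarrow> 'w \<Rightarrow> ('x \<Rightarrow> complex) \<Rightarrow> real" and \<rho> \<gamma> :: "'w \<Rightarrow> real"
  assumes Nt_norm: "\<And>j t. t \<noteq> 0 \<Longrightarrow> is_norm_on (B (w j)) (Nt t (w j))"
    and comparison: "\<And>j t g. t \<noteq> 0 \<Longrightarrow> g \<in> B (w j) \<Longrightarrow>
      c1 * Nt t (w j) g \<le> N1 (w j) g \<and> N1 (w j) g \<le> c2 * (1 + \<bar>t\<bar>) * Nt t (w j) g"
    and bound: "\<And>j t n. t \<noteq> 0 \<Longrightarrow> 1 \<le> n \<Longrightarrow>
      twisted_norm \<theta> L f B (Nt t) (\<i> * complex_of_real t) n (w j) \<le> ennreal C"
    and pos: "0 < c1" "0 < c2" "0 < C" and R: "1 \<le> R"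
    and good: "\<And>j. j \<in> J \<Longrightarrow> 1 / R \<le> \<rho> (w j) \<and> \<rho> (w j) \<le> R \<and> 1 / R \<le> \<gamma> (w j)"
    and high: "\<And>j t. j \<in> J \<Longrightarrow> R \<le> \<bar>t\<bar> \<Longrightarrow>
      twisted_norm \<theta> L f B (Nt t) (\<i> * complex_of_real t) (nat \<lfloor>\<rho> (w j) * ln \<bar>t\<bar>\<rfloor>) (w j)
        \<le> ennreal (exp (- real (nat \<lfloor>\<rho> (w j) * ln \<bar>t\<bar>\<rfloor>) * \<gamma> (w j)))"
    and visits: "\<And>n. real n \<le> 2 * real (card (J \<inter> {..<n}))"
  shows "\<exists>U A. 1 < U \<and> 0 \<le> A \<and> (\<forall>u n. U \<le> \<bar>u\<bar> \<longrightarrow>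
    cmod (mgf (\<mu> \<omega>) (birkhoff_sum \<theta> T f \<omega> n) (\<i> * complex_of_real u)) \<le> A * (1 + \<bar>u\<bar>) * exp (- real n / (2 * (R * ln \<bar>u\<bar>))))"
proof -
  \<comment> \<open>The waiting bound must also cover n = 0, where the operator is the
    identity.\<close>
  define D where "D = max 1 C"
  have D: "1 \<le> D" "C \<le> D" by (simp_all add: D_def)
  \<comment> \<open>A lower bound for ln |u| that meets two demands: 2 R makes every block nonempty,
    and R (R (ln D + 1) + 1) makes D \<kappa> at most exp (- 1).\<close>
  define V where "V = R * (R * (ln D + 1) + 2)"
  have V: "2 * R \<le> V" "R * (R * (ln D + 1) + 1) \<le> V"
  proof -
    have "0 \<le> R * (R * (ln D + 1))" using R D by (intro mult_nonneg_nonneg) auto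
    then show "2 * R \<le> V" by (simp add: V_def distrib_left)
    show "R * (R * (ln D + 1) + 1) \<le> V" unfolding V_def using R by (intro mult_left_mono) auto
  qed
  define U where "U = max R (exp V)"
  define A where "A = c2 * (D * exp 1) * (N1 (w 0) (one 0) / c1)"
  have V0: "0 < V" using V(1) R by linarith
  have U: "1 < U" using V0 by (simp add: U_def less_max_iff_disj)
  have nt0: "0 \<le> Nt t (w j) g" if "t \<noteq> 0" "g \<in> B (w j)" for t j g
    using Nt_norm[OF that(1), of j] that(2) by (simp add: is_norm_on_def)
  have N10: "0 \<le> N1 (w 0) (one 0)"
  proof -
    have "0 \<le> c1 * Nt 1 (w 0) (one 0)" using pos nt0[OF _ one_mem[of 0], of 1] by simp
    also have "\<dots> \<le> N1 (w 0) (one 0)" using comparison[OF _ one_mem[of 0], of 1] by simp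
    finally show ?thesis .
  qed
  have A: "0 \<le> A" unfolding A_def using pos D N10 by (intro mult_nonneg_nonneg divide_nonneg_pos) auto
  have "cmod (mgf (\<mu> \<omega>) (birkhoff_sum \<theta> T f \<omega> n) (\<i> * complex_of_real u)) \<le> A * (1 + \<bar>u\<bar>) * exp (- real n / (2 * (R * ln \<bar>u\<bar>)))"
    if u: "U \<le> \<bar>u\<bar>" for u n
  proof -
    have u0: "u \<noteq> 0" and uR: "R \<le> \<bar>u\<bar>" using u U by (auto simp: U_def)
    have lnu: "V \<le> ln \<bar>u\<bar>"
    proof -
      have "exp V \<le> \<bar>u\<bar>" using u by (simp add: U_def)
      then show ?thesis using u0 by (simp add: ln_ge_iff)
    qed
    define \<beta> where "\<beta> = R * ln \<bar>u\<bar>"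
    have l0: "0 < ln \<bar>u\<bar>" using lnu V0 by linarith
    have \<beta>: "0 < \<beta>" using R l0 by (simp add: \<beta>_def)
    define len where "len j = nat \<lfloor>\<rho> (w j) * ln \<bar>u\<bar>\<rfloor>" for j
    define \<kappa> where "\<kappa> = exp (- ((ln \<bar>u\<bar> / R - 1) / R))"
    let ?z = "\<i> * complex_of_real u"
    have len_lower: "ln \<bar>u\<bar> / R - 1 \<le> real (len j)" if "j \<in> J" for j
    proof -
      have "1 / R * ln \<bar>u\<bar> \<le> \<rho> (w j) * ln \<bar>u\<bar>" using good[OF that] l0 by (intro mult_right_mono) auto
      then show ?thesis unfolding len_def by simp linarith
    qed
    have len1: "1 \<le> ln \<bar>u\<bar> / R - 1" using V(1) lnu R by (simp add: le_divide_eq)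
    have "Nt u (w (0 + n)) (twisted ?z 0 n (one 0))
      \<le> D * exp (1 - real (card (J \<inter> {0..<0 + n})) / \<beta>) * Nt u (w 0) (one 0)"
    proof (rule contraction_by_blocks[where len=len and \<kappa>=\<kappa>])
      show "Nt u (w (j + n)) (twisted ?z j n g) \<le> D * Nt u (w j) g" if g: "g \<in> B (w j)" for j n g
      proof (cases "n = 0")
        case True
        then show ?thesis using mult_right_mono[OF D(1) nt0[OF u0 g]] by simp
      next
        case False
        then have "Nt u (w (j + n)) (twisted ?z j n g) \<le> C * Nt u (w j) g"
          by (intro twisted_norm_bound Nt_norm u0 bound g) (use pos in auto)
        also have "\<dots> \<le> D * Nt u (w j) g" by (rule mult_right_mono[OF D(2) nt0[OF u0 g]])
        finally show ?thesis .
      qed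
      show "Nt u (w (j + len j)) (twisted ?z j (len j) g) \<le> \<kappa> * Nt u (w j) g" if j: "j \<in> J" and g: "g \<in> B (w j)" for j g
      proof -
        have "Nt u (w (j + len j)) (twisted ?z j (len j) g) \<le> exp (- real (len j) * \<gamma> (w j)) * Nt u (w j) g"
          by (intro twisted_norm_bound Nt_norm u0 g) (use high[OF j uR] in \<open>simp_all add: len_def\<close>)
        also have "\<dots> \<le> \<kappa> * Nt u (w j) g"
        proof (rule mult_right_mono[OF _ nt0[OF u0 g]])
          have "(ln \<bar>u\<bar> / R - 1) * (1 / R) \<le> real (len j) * \<gamma> (w j)"
            using good[OF j] len_lower[OF j] len1 R by (intro mult_mono) auto
          then show "exp (- real (len j) * \<gamma> (w j)) \<le> \<kappa>" by (simp add: \<kappa>_def)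
        qed
        finally show ?thesis .
      qed
      show "1 \<le> len j \<and> real (len j) \<le> \<beta>" if "j \<in> J" for j
      proof
        show "1 \<le> len j" using len_lower[OF that] len1 by linarith
        have "\<rho> (w j) * ln \<bar>u\<bar> \<le> \<beta>" unfolding \<beta>_def using good[OF that] l0 by (intro mult_right_mono) auto
        moreover have "0 \<le> \<rho> (w j) * ln \<bar>u\<bar>"
          using good[OF that] R l0 by (intro mult_nonneg_nonneg) (auto intro: order_trans[of 0 "1 / R"])
        ultimately show "real (len j) \<le> \<beta>" unfolding len_def by linarith
      qed
      show "D * \<kappa> \<le> exp (- 1)"
      proof -
        have "R * (ln D + 1) \<le> ln \<bar>u\<bar> / R - 1" using V(2) lnu R by (simp add: le_divide_eq mult.commute algebra_simps)
        then have "ln D + 1 \<le> (ln \<bar>u\<bar> / R - 1) / R" using R by (simp add: le_divide_eq mult.commute)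
        then have "exp (ln D) * \<kappa> \<le> exp (- 1)" unfolding \<kappa>_def exp_add[symmetric] by simp
        then show ?thesis using D by simp
      qed
    qed (use u0 Nt_norm D \<beta> one_mem[of 0] in \<open>auto simp: \<kappa>_def\<close>)
    then have main: "Nt u (w n) (twisted ?z 0 n (one 0)) \<le> D * exp (1 - real (card (J \<inter> {..<n})) / \<beta>) * Nt u (w 0) (one 0)"
      by (simp add: atLeast0LessThan)
    have e: "exp (1 - real (card (J \<inter> {..<n})) / \<beta>) \<le> exp 1 * exp (- real n / (2 * \<beta>))"
    proof -
      have "real n / (2 * \<beta>) \<le> real (card (J \<inter> {..<n})) / \<beta>"
        using visits[of n] \<beta> by (simp add: divide_simps mult.commute)
      then show ?thesis unfolding exp_add[symmetric] by simp
    qed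
    have tw: "twisted ?z 0 n (one 0) \<in> B (w n)" using twisted_mem[OF one_mem[of 0], of ?z n] by simp
    have "cmod (mgf (\<mu> \<omega>) (birkhoff_sum \<theta> T f \<omega> n) ?z) \<le> N1 (w n) (twisted ?z 0 n (one 0))"
      unfolding mgf_birkhoff by (rule integral_le_N1[OF tw])
    also have "\<dots> \<le> c2 * (1 + \<bar>u\<bar>) * Nt u (w n) (twisted ?z 0 n (one 0))"
      by (rule conjunct2[OF comparison[OF u0 tw]])
    also have "\<dots> \<le> c2 * (1 + \<bar>u\<bar>) * (D * (exp 1 * exp (- real n / (2 * \<beta>))) * (N1 (w 0) (one 0) / c1))"
    proof (rule mult_left_mono[OF order_trans[OF main]])
      have "c1 * Nt u (w 0) (one 0) \<le> N1 (w 0) (one 0)" by (rule conjunct1[OF comparison[OF u0 one_mem]])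
      then have le: "Nt u (w 0) (one 0) \<le> N1 (w 0) (one 0) / c1" using pos by (simp add: le_divide_eq mult.commute)
      show "D * exp (1 - real (card (J \<inter> {..<n})) / \<beta>) * Nt u (w 0) (one 0)
        \<le> D * (exp 1 * exp (- real n / (2 * \<beta>))) * (N1 (w 0) (one 0) / c1)"
        by (rule mult_mono[OF mult_left_mono[OF e] le]) (use D nt0[OF u0 one_mem, of 0] in \<open>auto intro!: mult_nonneg_nonneg\<close>)
    qed (use pos in simp)
    also have "\<dots> = A * (1 + \<bar>u\<bar>) * exp (- real n / (2 * \<beta>))" by (simp add: A_def)
    finally show ?thesis by (simp add: \<beta>_def)
  qed
  then show ?thesis using U A by (intro exI[of _ U] exI[of _ A]) simp
qed

end

section \<open>Decay of the characteristic function faster than every power\<close>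

lemma exp_decay_beats_power:
  fixes c :: real
  assumes "0 < c"
  shows "\<forall>\<^sub>F x in at_top. x ^ m * exp (- c * x) \<le> 1"
proof -
  have "((\<lambda>x. x ^ m * exp (- c * x)) \<longlongrightarrow> 0) at_top" using assms by real_asymp
  then have "\<forall>\<^sub>F x in at_top. x ^ m * exp (- c * x) < 1" by (rule order_tendstoD) simp
  then show ?thesis by (rule eventually_mono) simp
qed

lemma stretched_exp_beats_power:
  fixes c \<alpha> d :: real
  assumes "0 < c" "0 < \<alpha>"
  shows "\<forall>\<^sub>F n in sequentially. (d * real n) ^ k * exp (- c * real n powr \<alpha>) \<le> 1"
proof -
  have "(\<lambda>n. d ^ k * (real n powr real k * exp (- c * real n powr \<alpha>))) \<longlonglongrightarrow> d ^ k * 0"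
    by (intro tendsto_mult tendsto_const) (use assms in real_asymp)
  then have "\<forall>\<^sub>F n in sequentially. d ^ k * (real n powr real k * exp (- c * real n powr \<alpha>)) < 1"
    by (rule order_tendstoD) simp
  then show ?thesis
    by (rule eventually_mono[OF eventually_conj[OF _ eventually_gt_at_top[of 0]]])
      (auto simp: power_mult_distrib powr_realpow mult.assoc)
qed

context fibre_perturbation
begin

lemma mgf_le_of_twisted_norm:
  assumes "twisted_norm \<theta> L f B N z n \<omega> \<le> ennreal c" "0 \<le> c"
  shows "cmod (mgf (\<mu> \<omega>) (birkhoff_sum \<theta> T f \<omega> n) z) \<le> K * (c * K)"
proof -
  have "N (w (0 + n)) (twisted z 0 n (one 0)) \<le> c * N (w 0) (one 0)"
    by (rule twisted_norm_bound[OF N_norm N_norm _ assms(2) one_mem]) (use assms(1) in simp)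
  also have "\<dots> \<le> c * K" by (rule mult_left_mono[OF N_one_le assms(2)])
  finally have le: "N (w n) (twisted z 0 n (one 0)) \<le> c * K" by simp
  show ?thesis by (rule order_trans[OF mgf_birkhoff_le mult_left_mono[OF le K_nonneg]])
qed

text \<open>From a to U the frequencies lie in one of the compact ranges of \<open>low\<close>, and
  the stretched exponential in n beats powers of s n because (s n)^2 is at most d n. Above U the
  restriction |u| \<le> s^p enters through the crude bound ln |u| \<le> (p + 1) s, which already
  makes n / (2 R ln |u|) at least a multiple of s. Centring changes only the phase on the imaginary
  axis.\<close>

lemma char_decay:
  fixes s :: "nat \<Rightarrow> real"
  assumes s: "filterlim s at_top sequentially" "0 < d" "\<forall>\<^sub>F n in sequentially. (s n)\<^sup>2 \<le> d * real n"
    and high: "\<exists>U A R. 1 < U \<and> 0 \<le> A \<and> 1 \<le> R \<and> (\<forall>u n. U \<le> \<bar>u\<bar> \<longrightarrow>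
      cmod (mgf (\<mu> \<omega>) (birkhoff_sum \<theta> T f \<omega> n) (\<i> * complex_of_real u)) \<le> A * (1 + \<bar>u\<bar>) * exp (- real n / (2 * (R * ln \<bar>u\<bar>))))"
    and \<alpha>: "0 < \<alpha>" and low: "\<And>i::nat. \<exists>c C'. 0 < c \<and> 0 \<le> C' \<and> (\<forall>t n. 1 / real (Suc i) \<le> \<bar>t\<bar> \<and> \<bar>t\<bar> \<le> real (Suc i) \<and> 1 \<le> n \<longrightarrow>
      twisted_norm \<theta> L f B N (\<i> * complex_of_real t) n \<omega> \<le> ennreal (C' * exp (- c * real n powr \<alpha>)))"
    and a: "0 < a"
  shows "\<exists>K'. \<forall>\<^sub>F n in sequentially. \<forall>u. a \<le> \<bar>u\<bar> \<and> \<bar>u\<bar> \<le> s n ^ p \<longrightarrow>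
    cmod (mgf (\<mu> \<omega>) (centered_sum \<theta> T \<mu> f \<omega> n) (\<i> * complex_of_real u)) \<le> K' / s n ^ k"
proof -
  from high obtain U A R where U: "1 < U" and A: "0 \<le> A" and R: "1 \<le> R"
    and hi: "\<forall>u n. U \<le> \<bar>u\<bar> \<longrightarrow> cmod (mgf (\<mu> \<omega>) (birkhoff_sum \<theta> T f \<omega> n) (\<i> * complex_of_real u)) \<le> A * (1 + \<bar>u\<bar>) * exp (- real n / (2 * (R * ln \<bar>u\<bar>)))"
    by (elim exE conjE) (rule that)
  obtain i where i: "U < real i" "1 / a < real i" using reals_Archimedean2[of "max U (1 / a)"] by auto
  have ia: "1 / real (Suc i) \<le> a" "U \<le> real (Suc i)" using i a U by (simp_all add: divide_simps mult.commute add.commute distrib_left)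
  from low[of i] obtain c C' where c: "0 < c" "0 \<le> C'" and lo: "\<forall>t n. 1 / real (Suc i) \<le> \<bar>t\<bar> \<and> \<bar>t\<bar> \<le> real (Suc i) \<and> 1 \<le> n \<longrightarrow>
      twisted_norm \<theta> L f B N (\<i> * complex_of_real t) n \<omega> \<le> ennreal (C' * exp (- c * real n powr \<alpha>))"
    by (elim exE conjE) (rule that)
  \<comment> \<open>Chosen so that e s n times 2 R ln |u| is at most (s n)^2 / d, hence at most
    n.\<close>
  define e where "e = 1 / (d * (2 * (R * real (Suc p))))"
  have e: "0 < e" using s(2) R by (simp add: e_def)
  define K' where "K' = K * (C' * K) + 2 * A"
  have ev_s: "\<forall>\<^sub>F n in sequentially. 1 \<le> s n" using s(1) by (simp add: filterlim_at_top)
  have ev_hi: "\<forall>\<^sub>F n in sequentially. s n ^ (p + k) * exp (- e * s n) \<le> 1"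
    by (rule eventually_compose_filterlim[OF exp_decay_beats_power[OF e] s(1)])
  have ev_lo: "\<forall>\<^sub>F n in sequentially. (d * real n) ^ k * exp (- c * real n powr \<alpha>) \<le> 1"
    by (rule stretched_exp_beats_power[OF c(1) \<alpha>])
  have "\<forall>\<^sub>F n in sequentially. \<forall>u. a \<le> \<bar>u\<bar> \<and> \<bar>u\<bar> \<le> s n ^ p \<longrightarrow>
    cmod (mgf (\<mu> \<omega>) (centered_sum \<theta> T \<mu> f \<omega> n) (\<i> * complex_of_real u)) \<le> K' / s n ^ k"
  proof (rule eventually_mono[OF eventually_conj[OF eventually_conj[OF s(3) eventually_ge_at_top[of 1]] eventually_conj[OF ev_s eventually_conj[OF ev_hi ev_lo]]]],
      elim conjE, intro allI impI, elim conjE)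
    fix n :: nat and u :: real
    assume sn: "(s n)\<^sup>2 \<le> d * real n" and n: "1 \<le> n" and s1: "1 \<le> s n" and h: "s n ^ (p + k) * exp (- e * s n) \<le> 1"
      and l: "(d * real n) ^ k * exp (- c * real n powr \<alpha>) \<le> 1" and au: "a \<le> \<bar>u\<bar>" and us: "\<bar>u\<bar> \<le> s n ^ p"
    have sk: "0 < s n ^ k" using s1 by simp
    have nn: "0 \<le> K * (C' * K)" using K_nonneg c(2) by simp
    have "cmod (mgf (\<mu> \<omega>) (birkhoff_sum \<theta> T f \<omega> n) (\<i> * complex_of_real u)) \<le> K' / s n ^ k"
    proof (cases "U \<le> \<bar>u\<bar>")
      case False
      have "cmod (mgf (\<mu> \<omega>) (birkhoff_sum \<theta> T f \<omega> n) (\<i> * complex_of_real u)) \<le> K * ((C' * exp (- c * real n powr \<alpha>)) * K)"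
        by (rule mgf_le_of_twisted_norm[OF lo[rule_format]]) (use False au ia n c in auto)
      also have "\<dots> = K * (C' * K) * exp (- c * real n powr \<alpha>)" by simp
      also have "\<dots> \<le> K * (C' * K) * (1 / s n ^ k)"
      proof (rule mult_left_mono[OF _ nn])
        have "s n \<le> (s n)\<^sup>2" using s1 by (simp add: power2_eq_square)
        then have "s n ^ k \<le> (d * real n) ^ k" using sn s1 by (intro power_mono) auto
        then have "s n ^ k * exp (- c * real n powr \<alpha>) \<le> (d * real n) ^ k * exp (- c * real n powr \<alpha>)"
          by (intro mult_right_mono) auto
        then have "s n ^ k * exp (- c * real n powr \<alpha>) \<le> 1" using l by linarith
        then show "exp (- c * real n powr \<alpha>) \<le> 1 / s n ^ k" using sk by (simp add: le_divide_eq mult.commute)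
      qed
      also have "\<dots> \<le> K' / s n ^ k" using A sk by (simp add: K'_def divide_right_mono)
      finally show ?thesis .
    next
      case True
      have u1: "1 < \<bar>u\<bar>" using True U by linarith
      have lu: "0 < ln \<bar>u\<bar>" using u1 by simp
      have "ln \<bar>u\<bar> \<le> ln (s n ^ p)" using us u1 by (subst ln_le_cancel_iff) (use s1 in auto)
      also have "\<dots> = real p * ln (s n)" using s1 by (simp add: ln_realpow)
      also have "\<dots> \<le> real (Suc p) * s n" using s1 ln_le_minus_one[of "s n"] by (intro mult_mono) auto
      finally have lnu: "ln \<bar>u\<bar> \<le> real (Suc p) * s n" .
      have "e * s n \<le> real n / (2 * (R * ln \<bar>u\<bar>))"
      proof -
        have "e * s n * (2 * (R * ln \<bar>u\<bar>)) \<le> e * s n * (2 * (R * (real (Suc p) * s n)))"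
          using lnu R e s1 by (intro mult_left_mono) auto
        also have "\<dots> = (s n)\<^sup>2 / d" using R by (simp add: e_def power2_eq_square del: of_nat_Suc)
        also have "\<dots> \<le> real n" using sn s(2) by (simp add: divide_le_eq mult.commute)
        finally show ?thesis using R lu by (simp add: le_divide_eq)
      qed
      then have "exp (- real n / (2 * (R * ln \<bar>u\<bar>))) \<le> exp (- e * s n)" by simp
      then have "A * (1 + \<bar>u\<bar>) * exp (- real n / (2 * (R * ln \<bar>u\<bar>))) \<le> A * (2 * s n ^ p) * exp (- e * s n)"
        using A us u1 by (intro mult_mono mult_left_mono) auto
      also have "\<dots> \<le> 2 * A * (1 / s n ^ k)"
      proof -
        have "s n ^ p * exp (- e * s n) \<le> 1 / s n ^ k"
          using h sk by (simp add: le_divide_eq power_add mult_ac)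
        from mult_left_mono[OF this, of "2 * A"] A show ?thesis by (simp add: mult_ac)
      qed
      also have "\<dots> \<le> K' / s n ^ k" using nn sk by (simp add: K'_def divide_right_mono)
      finally show ?thesis using hi True by (meson order_trans)
    qed
    moreover have "cmod (exp (- (\<i> * complex_of_real u) * complex_of_real (LINT x|\<mu> \<omega>. birkhoff_sum \<theta> T f \<omega> n x))) = 1"
      by (simp only: norm_exp_eq_Re) simp
    ultimately show "cmod (mgf (\<mu> \<omega>) (centered_sum \<theta> T \<mu> f \<omega> n) (\<i> * complex_of_real u)) \<le> K' / s n ^ k"
      by (simp only: mgf_centered norm_mult mult_1)
  qed
  then show ?thesis by (rule exI)
qed

lemma edgeworth_sequence_centered:
  assumes var: "(\<lambda>n. (LINT x|\<mu> \<omega>. (centered_sum \<theta> T \<mu> f \<omega> n x)\<^sup>2) / real n) \<longlonglongrightarrow> \<sigma>\<^sup>2" and \<sigma>: "0 < \<sigma>"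
    and high: "\<exists>U A R. 1 < U \<and> 0 \<le> A \<and> 1 \<le> R \<and> (\<forall>u n. U \<le> \<bar>u\<bar> \<longrightarrow>
      cmod (mgf (\<mu> \<omega>) (birkhoff_sum \<theta> T f \<omega> n) (\<i> * complex_of_real u)) \<le> A * (1 + \<bar>u\<bar>) * exp (- real n / (2 * (R * ln \<bar>u\<bar>))))"
    and \<alpha>: "0 < \<alpha>" and low: "\<And>i::nat. \<exists>c C'. 0 < c \<and> 0 \<le> C' \<and> (\<forall>t n. 1 / real (Suc i) \<le> \<bar>t\<bar> \<and> \<bar>t\<bar> \<le> real (Suc i) \<and> 1 \<le> n \<longrightarrow>
      twisted_norm \<theta> L f B N (\<i> * complex_of_real t) n \<omega> \<le> ennreal (C' * exp (- c * real n powr \<alpha>)))"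
  shows "\<exists>r C0. edgeworth_sequence (\<mu> \<omega>) (centered_sum \<theta> T \<mu> f \<omega>) (l2_norm_seq (\<mu> \<omega>) (centered_sum \<theta> T \<mu> f \<omega>)) r C0"
proof -
  interpret P: prob_space "\<mu> \<omega>" using prob_fibre[of 0] by simp
  define S where "S = centered_sum \<theta> T \<mu> f \<omega>"
  define s where "s = l2_norm_seq (\<mu> \<omega>) S"
  have sq: "(s n)\<^sup>2 = (LINT x|\<mu> \<omega>. (S n x)\<^sup>2)" for n
    by (simp add: s_def l2_norm_seq_def integral_nonneg_AE)
  have lim: "(\<lambda>n. (s n)\<^sup>2 / real n) \<longlonglongrightarrow> \<sigma>\<^sup>2" using var by (simp only: sq S_def)
  have e: "\<forall>\<^sub>F n in sequentially. (s n)\<^sup>2 / real n < 2 * \<sigma>\<^sup>2" "\<forall>\<^sub>F n in sequentially. \<sigma>\<^sup>2 / 2 < (s n)\<^sup>2 / real n"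
    using \<sigma> by (intro order_tendstoD[OF lim]; simp)+
  have ev1: "\<forall>\<^sub>F n in sequentially. (s n)\<^sup>2 \<le> 2 * \<sigma>\<^sup>2 * real n"
    by (rule eventually_mono[OF eventually_conj[OF e(1) eventually_gt_at_top[of 0]]]) (auto simp: divide_less_eq)
  have ev2: "\<forall>\<^sub>F n in sequentially. \<sigma>\<^sup>2 / 2 * real n \<le> (s n)\<^sup>2"
    by (rule eventually_mono[OF eventually_conj[OF e(2) eventually_gt_at_top[of 0]]]) (auto simp: less_divide_eq)
  have s0: "0 \<le> s n" for n by (simp add: s_def l2_norm_seq_def)
  have top: "filterlim s at_top sequentially"
  proof -
    have "filterlim (\<lambda>n. \<sigma> * sqrt (real n / 2)) at_top sequentially" using \<sigma> by real_asymp
    then show ?thesis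
    proof (rule filterlim_at_top_mono)
      show "\<forall>\<^sub>F n in sequentially. \<sigma> * sqrt (real n / 2) \<le> s n"
      proof (rule eventually_mono[OF ev2])
        fix n assume "\<sigma>\<^sup>2 / 2 * real n \<le> (s n)\<^sup>2"
        then have "(\<sigma> * sqrt (real n / 2))\<^sup>2 \<le> (s n)\<^sup>2" by (simp add: power_mult_distrib)
        then show "\<sigma> * sqrt (real n / 2) \<le> s n" by (rule power2_le_imp_le[OF _ s0])
      qed
    qed
  qed
  from log_mgf_centered[folded S_def] obtain r where r: "0 < r" and G: "\<forall>\<^sub>F n in sequentially. \<exists>G. G holomorphic_on ball 0 r \<and> G 0 = 0 \<and>
     (\<forall>z\<in>ball 0 r. exp (G z) = mgf (\<mu> \<omega>) (S n) z \<and> cmod (G z) \<le> 3 * real n)"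
    by (elim exE conjE) (rule that)
  have bs: "integrable (\<mu> \<omega>) (birkhoff_sum \<theta> T f \<omega> n)" for n
    using bounded_rv.integrable_power_X[OF bounded_rv_birkhoff, of n 1] by simp
  have "edgeworth_sequence (\<mu> \<omega>) S s r (6 / \<sigma>\<^sup>2)"
  proof
    show "S n \<in> borel_measurable (\<mu> \<omega>)" for n
      unfolding S_def centered_sum_def[abs_def] by measurable
    show "\<exists>b. \<forall>x\<in>space (\<mu> \<omega>). \<bar>S n x\<bar> \<le> b" for n
    proof -
      obtain b where b: "\<forall>x\<in>space (\<mu> \<omega>). \<bar>birkhoff_sum \<theta> T f \<omega> n x\<bar> \<le> b" using birkhoff_bounded by blast
      show ?thesis
        unfolding S_def centered_sum_def
        by (rule exI[of _ "b + \<bar>LINT y|\<mu> \<omega>. birkhoff_sum \<theta> T f \<omega> n y\<bar>"])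
          (use b in \<open>auto intro!: order_trans[OF abs_triangle_ineq4] add_right_mono\<close>)
    qed
    show "P.expectation (S n) = 0" for n
      using bs[of n] unfolding S_def centered_sum_def[abs_def] by (simp add: P.prob_space)
    show "s = l2_norm_seq (\<mu> \<omega>) S" by (rule s_def)
    show "filterlim s at_top sequentially" by (rule top)
    show "\<forall>\<^sub>F n in sequentially. \<exists>G. G holomorphic_on ball 0 r \<and> G 0 = 0 \<and>
       (\<forall>z\<in>ball 0 r. exp (G z) = mgf (\<mu> \<omega>) (S n) z \<and> cmod (G z) \<le> 6 / \<sigma>\<^sup>2 * (s n)\<^sup>2)"
    proof (rule eventually_mono[OF eventually_conj[OF G ev2]], elim conjE exE)
      fix n G assume n: "\<sigma>\<^sup>2 / 2 * real n \<le> (s n)\<^sup>2" and "G holomorphic_on ball 0 r" "G 0 = 0"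
        and GG: "\<forall>z\<in>ball 0 r. exp (G z) = mgf (\<mu> \<omega>) (S n) z \<and> cmod (G z) \<le> 3 * real n"
      \<comment> \<open>The logarithm has size at most 3 n, and eventually n is at most 2 s^2 /
        \<sigma>^2; this is the origin of the constant.\<close>
      have "6 / \<sigma>\<^sup>2 * (\<sigma>\<^sup>2 / 2 * real n) \<le> 6 / \<sigma>\<^sup>2 * (s n)\<^sup>2" by (rule mult_left_mono[OF n]) simp
      then have "3 * real n \<le> 6 / \<sigma>\<^sup>2 * (s n)\<^sup>2" using \<sigma> by simp
      then show "\<exists>G. G holomorphic_on ball 0 r \<and> G 0 = 0 \<and>
         (\<forall>z\<in>ball 0 r. exp (G z) = mgf (\<mu> \<omega>) (S n) z \<and> cmod (G z) \<le> 6 / \<sigma>\<^sup>2 * (s n)\<^sup>2)"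
        using GG by (intro exI[of _ G] conjI ballI \<open>G holomorphic_on ball 0 r\<close> \<open>G 0 = 0\<close>) (auto intro: order_trans)
    qed
    show "\<exists>K'. \<forall>\<^sub>F n in sequentially. \<forall>u. a \<le> \<bar>u\<bar> \<and> \<bar>u\<bar> \<le> s n ^ p \<longrightarrow>
       cmod (mgf (\<mu> \<omega>) (S n) (\<i> * complex_of_real u)) \<le> K' / s n ^ k" if "0 < a" for a p k
      unfolding S_def by (rule char_decay[OF top _ ev1 high \<alpha> low that]) (use \<sigma> in simp)
  qed (use r in simp_all)
  then show ?thesis unfolding s_def S_def by (intro exI)
qed

end

section \<open>Random dynamical systems\<close>

text \<open>The system provides measurability of the skew product on the bundle; it passes to a
  fibre map through the inclusion of the fibre.\<close>

lemma fibre_map_measurable: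
  assumes sys: "random_dynamical_system P \<theta> E T \<mu> \<mu>tot" and \<omega>: "\<omega> \<in> space P" "\<theta> \<omega> \<in> space P"
  shows "T \<omega> \<in> measurable (\<mu> \<omega>) (\<mu> (\<theta> \<omega>))"
proof -
  let ?F = "\<lambda>(\<omega>, x). (\<theta> \<omega>, T \<omega> x)" and ?M = "restrict_space borel (E \<omega>)"
  have F: "?F \<in> measurable (fibre_bundle P E) (fibre_bundle P E)" and TE: "T \<omega> ` E \<omega> \<subseteq> E (\<theta> \<omega>)"
    and sets: "sets (\<mu> \<omega>) = sets ?M" "sets (\<mu> (\<theta> \<omega>)) = sets (restrict_space borel (E (\<theta> \<omega>)))"
    using sys \<omega> unfolding random_dynamical_system_def by blast+
  have "Pair \<omega> \<in> measurable ?M (fibre_bundle P E)"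
    unfolding fibre_bundle_def
  proof (rule measurable_restrict_space2)
    show "Pair \<omega> \<in> space ?M \<rightarrow> Sigma (space P) E" using \<omega> by (auto simp: space_restrict_space)
    show "Pair \<omega> \<in> measurable ?M (P \<Otimes>\<^sub>M borel)" by (rule measurable_restrict_space1[OF measurable_Pair1'[OF \<omega>(1)]])
  qed
  from measurable_compose[OF this F] have "(\<lambda>x. (\<theta> \<omega>, T \<omega> x)) \<in> measurable ?M (P \<Otimes>\<^sub>M borel)"
    by (simp add: fibre_bundle_def measurable_restrict_space2_iff)
  from measurable_compose[OF this measurable_snd] have "T \<omega> \<in> measurable ?M borel" by simp
  then have "T \<omega> \<in> measurable ?M (restrict_space borel (E (\<theta> \<omega>)))"
    by (rule measurable_restrict_space2[rotated]) (use TE in \<open>auto simp: space_restrict_space\<close>)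
  then show ?thesis by (simp only: measurable_cong_sets[OF sets])
qed

lemma AE_fibre_perturbation:
  assumes sys: "random_dynamical_system P \<theta> E T \<mu> \<mu>tot"
    and transfer: "transfer_operators P \<theta> E T \<mu> L"
    and spaces: "fibre_banach_spaces P E \<mu> B N"
    and transfer_continuous: "continuous_transfer P \<theta> L B N"
    and observable: "admissible_observable P E B N f"
    and perturbation: "complex_perturbation P \<theta> E \<mu> L B N f"
    and norm_1_sup: "\<And>\<omega> g x. \<omega> \<in> space P \<Longrightarrow> g \<in> B \<omega> \<Longrightarrow> x \<in> E \<omega> \<Longrightarrow> cmod (g x) \<le> N1 \<omega> g"
  shows "\<exists>r0 lam h \<nu> K C \<delta>. AE \<omega> in P. fibre_perturbation \<theta> E T \<mu> L B N1 f \<omega> N r0 lam h \<nu> K C \<delta>"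
proof -
  have \<theta>: "\<theta> \<in> measurable P P" "distr P P \<theta> = P"
    using sys by (auto simp: random_dynamical_system_def ergodic_automorphism_def)
  from perturbation[unfolded complex_perturbation_def] obtain r0 lam h \<nu> K C \<delta>
    where r0: "0 < r0" and C: "0 < C" and \<delta>: "0 < \<delta>" "\<delta> < 1" and pert: "AE \<omega> in P.
           lam \<omega> analytic_on ball 0 r0 \<and>
           analytic_into (B \<omega>) (N \<omega>) (ball 0 r0) (h \<omega>) \<and>
           analytic_into (dual_space (B \<omega>) (N \<omega>)) (dual_norm (B \<omega>) (N \<omega>)) (ball 0 r0) (\<nu> \<omega>) \<and>
           lam \<omega> 0 = 1 \<and>
           h \<omega> 0 = ext0 (E \<omega>) (\<lambda>x. 1) \<and>
           (\<forall>g\<in>B \<omega>. \<nu> \<omega> 0 g = (LINT x|\<mu> \<omega>. g x)) \<and>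
           (\<forall>z\<in>ball 0 r0.
              lam \<omega> z \<noteq> 0 \<and> \<nu> \<omega> z (h \<omega> z) = 1 \<and>
              cmod (lam \<omega> z) \<le> K \<and> N \<omega> (h \<omega> z) \<le> K \<and> dual_norm (B \<omega>) (N \<omega>) (\<nu> \<omega> z) \<le> K \<and>
              (\<forall>n\<ge>1. op_norm (B \<omega>) (N \<omega>) (N ((\<theta> ^^ n) \<omega>))
                 (\<lambda>g x. inverse (\<Prod>j<n. lam ((\<theta> ^^ j) \<omega>) z) * twisted_iter \<theta> L f z n \<omega> g x
                        - \<nu> \<omega> z g * h ((\<theta> ^^ n) \<omega>) z x)
                 \<le> ennreal (C * \<delta> ^ n)))"
    by (elim exE conjE) (rule that)
  note pert_orbit = AE_orbit[OF \<theta> pert]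
  note transfer_orbit = AE_orbit[OF \<theta> transfer[unfolded transfer_operators_def]]
  note continuous_orbit = AE_orbit[OF \<theta> transfer_continuous[unfolded continuous_transfer_def]]
  note obs = observable[unfolded admissible_observable_def, THEN conjunct2]
  note ob = obs[THEN conjunct2, THEN conjunct1]
  from obs[THEN conjunct1] obtain K1 where "AE \<omega> in P. ext0 (E \<omega>) (\<lambda>x. complex_of_real (f \<omega> x)) \<in> B \<omega> \<and>
        N \<omega> (ext0 (E \<omega>) (\<lambda>x. complex_of_real (f \<omega> x))) \<le> K1" by (elim exE) (rule that)
  note f_orbit = AE_orbit[OF \<theta> this]
  note ob_orbit = AE_orbit[OF \<theta> ob]
  have "AE \<omega> in P. fibre_perturbation \<theta> E T \<mu> L B N1 f \<omega> N r0 lam h \<nu> K C \<delta>"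
  proof (rule eventually_mono[OF eventually_conj[OF eventually_conj[OF eventually_conj[OF AE_orbit[OF \<theta> AE_space] pert_orbit] eventually_conj[OF transfer_orbit continuous_orbit]]
        eventually_conj[OF f_orbit ob_orbit]]], elim conjE)
    fix \<omega>
    let ?w = "\<lambda>j. (\<theta> ^^ j) \<omega>"
    assume sp: "\<forall>j. ?w j \<in> space P"
      and p: "\<forall>j. lam (?w j) analytic_on ball 0 r0 \<and>
           analytic_into (B (?w j)) (N (?w j)) (ball 0 r0) (h (?w j)) \<and>
           analytic_into (dual_space (B (?w j)) (N (?w j))) (dual_norm (B (?w j)) (N (?w j))) (ball 0 r0) (\<nu> (?w j)) \<and>
           lam (?w j) 0 = 1 \<and>
           h (?w j) 0 = ext0 (E (?w j)) (\<lambda>x. 1) \<and>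
           (\<forall>g\<in>B (?w j). \<nu> (?w j) 0 g = (LINT x|\<mu> (?w j). g x)) \<and>
           (\<forall>z\<in>ball 0 r0.
              lam (?w j) z \<noteq> 0 \<and> \<nu> (?w j) z (h (?w j) z) = 1 \<and>
              cmod (lam (?w j) z) \<le> K \<and> N (?w j) (h (?w j) z) \<le> K \<and> dual_norm (B (?w j)) (N (?w j)) (\<nu> (?w j) z) \<le> K \<and>
              (\<forall>n\<ge>1. op_norm (B (?w j)) (N (?w j)) (N ((\<theta> ^^ n) (?w j)))
                 (\<lambda>g x. inverse (\<Prod>i<n. lam ((\<theta> ^^ i) (?w j)) z) * twisted_iter \<theta> L f z n (?w j) g x
                        - \<nu> (?w j) z g * h ((\<theta> ^^ n) (?w j)) z x)
                 \<le> ennreal (C * \<delta> ^ n)))"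
      and tr: "\<forall>j. \<forall>g\<in>bounded_fibre_functions E \<mu> (?w j). integrable (\<mu> (\<theta> (?w j))) (L (?w j) g) \<and>
        (\<forall>k\<in>bounded_fibre_functions E \<mu> (\<theta> (?w j)).
           (LINT x|\<mu> (?w j). g x * k (T (?w j) x)) = (LINT y|\<mu> (\<theta> (?w j)). k y * L (?w j) g y))"
      and ct: "\<forall>j. L (?w j) ` B (?w j) \<subseteq> B (\<theta> (?w j)) \<and> linear_map_on (B (?w j)) (L (?w j)) \<and>
        op_norm (B (?w j)) (N (?w j)) (N (\<theta> (?w j))) (L (?w j)) < \<infinity>"
      and fm: "\<forall>j. ext0 (E (?w j)) (\<lambda>x. complex_of_real (f (?w j) x)) \<in> B (?w j) \<and>
        N (?w j) (ext0 (E (?w j)) (\<lambda>x. complex_of_real (f (?w j) x))) \<le> K1"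
      and em: "\<forall>j z. \<forall>g\<in>B (?w j). (\<lambda>x. g x * exp (z * complex_of_real (f (?w j) x))) \<in> B (?w j)"
    have wS: "?w (Suc j) = \<theta> (?w j)" for j by simp
    note pj = p[THEN spec]
    note z = pj[THEN conjunct2, THEN conjunct2, THEN conjunct2, THEN conjunct2, THEN conjunct2, THEN conjunct2, THEN bspec]
    have h0: "h (?w j) 0 = ext0 (E (?w j)) (\<lambda>x. 1)" for j
      by (rule pj[THEN conjunct2, THEN conjunct2, THEN conjunct2, THEN conjunct2, THEN conjunct1])
    have ha: "analytic_into (B (?w j)) (N (?w j)) (ball 0 r0) (h (?w j))" for j
      by (rule pj[THEN conjunct2, THEN conjunct1])
    have orbit: "fibre_orbit \<theta> E T \<mu> L B N1 f \<omega>"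
    proof (rule fibre_orbit.intro)
      fix j
      show "prob_space (\<mu> (?w j))" "sets (\<mu> (?w j)) = sets (restrict_space borel (E (?w j)))"
        using sys sp unfolding random_dynamical_system_def by blast+
      show "T (?w j) \<in> measurable (\<mu> (?w j)) (\<mu> (?w (Suc j)))"
        unfolding wS by (rule fibre_map_measurable[OF sys]) (use sp[THEN spec, of j] sp[THEN spec, of "Suc j"] in auto)
      show "(LINT x|\<mu> (?w j). g x * k (T (?w j) x)) = (LINT y|\<mu> (?w (Suc j)). k y * L (?w j) g y)"
        if "g \<in> bounded_fibre_functions E \<mu> (?w j)" "k \<in> bounded_fibre_functions E \<mu> (?w (Suc j))" for g k
        using that(2) unfolding wS by (rule tr[THEN spec, THEN bspec, OF that(1), THEN conjunct2, THEN bspec])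
      show "fun_subspace (E (?w j)) (B (?w j))" "B (?w j) \<subseteq> borel_measurable (\<mu> (?w j))"
        using spaces sp unfolding fibre_banach_spaces_def by blast+
      show "cmod (g x) \<le> N1 (?w j) g" if "g \<in> B (?w j)" "x \<in> E (?w j)" for g x
        by (rule norm_1_sup[OF sp[THEN spec] that])
      show "L (?w j) g \<in> B (?w (Suc j))" if "g \<in> B (?w j)" for g
        unfolding wS by (rule subsetD[OF ct[THEN spec, THEN conjunct1] imageI[OF that]])
      show "linear_map_on (B (?w j)) (L (?w j))" by (rule ct[THEN spec, THEN conjunct2, THEN conjunct1])
      show "(\<lambda>x. g x * exp (z * complex_of_real (f (?w j) x))) \<in> B (?w j)" if "g \<in> B (?w j)" for g z
        by (rule em[THEN spec, THEN spec, THEN bspec, OF that])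
      show "ext0 (E (?w j)) (\<lambda>x. complex_of_real (f (?w j) x)) \<in> B (?w j)" by (rule fm[THEN spec, THEN conjunct1])
      show "ext0 (E (?w j)) (\<lambda>x. 1) \<in> B (?w j)"
        using ha[of j] r0 unfolding analytic_into_def h0[of j, symmetric] by simp
    qed
    interpret fibre_orbit \<theta> E T \<mu> L B N1 f \<omega> by (rule orbit)
    show "fibre_perturbation \<theta> E T \<mu> L B N1 f \<omega> N r0 lam h \<nu> K C \<delta>"
    proof (rule fibre_perturbation.intro[OF orbit fibre_perturbation_axioms.intro])
      show "0 < r0" "0 < C" "0 < \<delta>" "\<delta> < 1" by (rule r0 C \<delta>)+
      fix j
      show "is_norm_on (B (?w j)) (N (?w j))"
        using spaces sp unfolding fibre_banach_spaces_def by blast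
      show "lam (?w j) analytic_on ball 0 r0" by (rule pj[THEN conjunct1])
      show "analytic_into (B (?w j)) (N (?w j)) (ball 0 r0) (h (?w j))" by (rule ha)
      show "analytic_into (dual_space (B (?w j)) (N (?w j))) (dual_norm (B (?w j)) (N (?w j))) (ball 0 r0) (\<nu> (?w j))"
        by (rule pj[THEN conjunct2, THEN conjunct2, THEN conjunct1])
      show "lam (?w j) 0 = 1" by (rule pj[THEN conjunct2, THEN conjunct2, THEN conjunct2, THEN conjunct1])
      show "h (?w j) 0 = ext0 (E (?w j)) (\<lambda>x. 1)" by (rule h0)
      show "\<nu> (?w j) 0 g = (LINT x|\<mu> (?w j). g x)" if "g \<in> B (?w j)" for g
        by (rule pj[THEN conjunct2, THEN conjunct2, THEN conjunct2, THEN conjunct2, THEN conjunct2, THEN conjunct1, THEN bspec, OF that])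
      fix y :: complex assume y: "y \<in> ball 0 r0"
      show "lam (?w j) y \<noteq> 0" by (rule z[OF y, THEN conjunct1])
      show "cmod (lam (?w j) y) \<le> K" by (rule z[OF y, THEN conjunct2, THEN conjunct2, THEN conjunct1])
      show "N (?w j) (h (?w j) y) \<le> K" by (rule z[OF y, THEN conjunct2, THEN conjunct2, THEN conjunct2, THEN conjunct1])
      show "dual_norm (B (?w j)) (N (?w j)) (\<nu> (?w j) y) \<le> K"
        by (rule z[OF y, THEN conjunct2, THEN conjunct2, THEN conjunct2, THEN conjunct2, THEN conjunct1])
      show "op_norm (B \<omega>) (N \<omega>) (N (?w n))
        (\<lambda>g x. inverse (\<Prod>j<n. lam (?w j) y) * twisted y 0 n g x - \<nu> \<omega> y g * h (?w n) y x) \<le> ennreal (C * \<delta> ^ n)" if "1 \<le> n" for n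
        using z[OF y, of 0, THEN conjunct2, THEN conjunct2, THEN conjunct2, THEN conjunct2, THEN conjunct2, THEN spec, THEN mp, OF that]
        by (simp only: funpow_0)
    qed
  qed
  then show ?thesis by (intro exI)
qed

text \<open>As \<rho> and \<gamma> are positive and all three variables are finite, the sets where
  one of them is out of the range given by R decrease to a null set. A single number bounds all of
  them, so one set of times serves every condition of the block argument.\<close>

lemma AE_frequent_contraction:
  fixes \<rho> \<gamma> b :: "'w \<Rightarrow> real"
  assumes "prob_space P" and \<theta>: "\<theta> \<in> measurable P P" "distr P P \<theta> = P"
    and [measurable]: "\<rho> \<in> borel_measurable P" "\<gamma> \<in> borel_measurable P" "b \<in> borel_measurable P"
    and pos: "AE \<omega> in P. 0 < \<rho> \<omega> \<and> 0 < \<gamma> \<omega> \<and> 0 < b \<omega>"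
  shows "AE \<omega> in P. \<exists>R J. 1 \<le> R \<and> (\<forall>n. real n \<le> 2 * real (card (J \<inter> {..<n}))) \<and>
    (\<forall>j\<in>J. 1 / R \<le> \<rho> ((\<theta> ^^ j) \<omega>) \<and> \<rho> ((\<theta> ^^ j) \<omega>) \<le> R \<and> 1 / R \<le> \<gamma> ((\<theta> ^^ j) \<omega>) \<and> b ((\<theta> ^^ j) \<omega>) \<le> R)"
proof -
  interpret prob_space P by fact
  define good where "good R \<omega> \<longleftrightarrow> 1 / real (Suc R) \<le> \<rho> \<omega> \<and> \<rho> \<omega> \<le> real (Suc R) \<and> 1 / real (Suc R) \<le> \<gamma> \<omega> \<and> b \<omega> \<le> real (Suc R)" for R \<omega>
  define A where "A R = {\<omega>\<in>space P. \<not> good R \<omega>}" for R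
  have "AE \<omega> in P. \<exists>R. \<forall>n. 2 * (\<Sum>j<n. indicator (A R) ((\<theta> ^^ j) \<omega>)) \<le> real n"
  proof (rule AE_frequent_visits[OF \<theta>])
    show "A R \<in> sets P" for R unfolding A_def good_def by measurable
    have "good R \<omega> \<Longrightarrow> R \<le> R' \<Longrightarrow> good R' \<omega>" for R R' \<omega>
    proof -
      assume "good R \<omega>" "R \<le> R'"
      moreover have "1 / real (Suc R') \<le> 1 / real (Suc R)" using \<open>R \<le> R'\<close> by (intro divide_left_mono) auto
      ultimately show "good R' \<omega>" unfolding good_def by auto
    qed
    then show "decseq A" unfolding decseq_def A_def by blast
    show "AE \<omega> in P. \<exists>R. \<omega> \<notin> A R"
    proof (rule eventually_mono[OF pos])
      fix \<omega> assume p: "0 < \<rho> \<omega> \<and> 0 < \<gamma> \<omega> \<and> 0 < b \<omega>"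
      obtain R where R: "max (max (1 / \<rho> \<omega>) (\<rho> \<omega>)) (max (1 / \<gamma> \<omega>) (b \<omega>)) < real R" using reals_Archimedean2 by blast
      have "1 / real (Suc R) \<le> x" if "0 < x" "1 / x < real R" for x
        using that by (simp add: divide_simps mult.commute) (simp add: distrib_right distrib_left)
      then have "good R \<omega>" using p R unfolding good_def by auto
      then show "\<exists>R. \<omega> \<notin> A R" by (auto simp: A_def)
    qed
  qed
  moreover have "AE \<omega> in P. \<forall>j. (\<theta> ^^ j) \<omega> \<in> space P" by (rule AE_orbit[OF \<theta> AE_space])
  ultimately show ?thesis
  proof (eventually_elim, elim exE)
    fix \<omega> R assume v: "\<forall>n. 2 * (\<Sum>j<n. indicator (A R) ((\<theta> ^^ j) \<omega>)) \<le> real n" and sp: "\<forall>j. (\<theta> ^^ j) \<omega> \<in> space P"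
    define J where "J = {j. good R ((\<theta> ^^ j) \<omega>)}"
    have "real n \<le> 2 * real (card (J \<inter> {..<n}))" for n
    proof -
      \<comment> \<open>Each time before n is either bad or in \<open>J\<close>, so bad times and
        times in \<open>J\<close> together number n.\<close>
      have "(\<Sum>j<n. indicator (A R) ((\<theta> ^^ j) \<omega>)) + real (card (J \<inter> {..<n})) = (\<Sum>j<n. indicator (A R) ((\<theta> ^^ j) \<omega>) + indicator J j)"
      proof -
        have "(\<Sum>j<n. indicator J j) = real (card (J \<inter> {..<n}))"
          using sum.inter_restrict[of "{..<n}" "\<lambda>_. 1 :: real" J] by (simp add: indicator_def Int_commute)
        then show ?thesis by (simp add: sum.distrib)
      qed
      also have "\<dots> = (\<Sum>j<n. 1 :: real)" using sp by (intro sum.cong) (auto simp: J_def A_def indicator_def)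
      finally show ?thesis using v[THEN spec, of n] by simp
    qed
    then show "\<exists>R J. 1 \<le> R \<and> (\<forall>n. real n \<le> 2 * real (card (J \<inter> {..<n}))) \<and>
      (\<forall>j\<in>J. 1 / R \<le> \<rho> ((\<theta> ^^ j) \<omega>) \<and> \<rho> ((\<theta> ^^ j) \<omega>) \<le> R \<and> 1 / R \<le> \<gamma> ((\<theta> ^^ j) \<omega>) \<and> b ((\<theta> ^^ j) \<omega>) \<le> R)"
      by (intro exI[of _ "real (Suc R)"] exI[of _ J] conjI allI ballI) (auto simp: J_def good_def)
  qed
qed

text \<open>The exceptional null set of the hypothesis depends on the compact set. Countably many
  symmetric pairs of intervals exhaust the punctured line, and every range from a to U lies in one
  of them.\<close>

lemma AE_low_frequency:
  assumes "decay_assumption P \<theta> L B N f"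
  shows "\<exists>\<alpha>>0. AE \<omega> in P. \<forall>i. \<exists>c C'. 0 < c \<and> 0 \<le> C' \<and> (\<forall>t n. 1 / real (Suc i) \<le> \<bar>t\<bar> \<and> \<bar>t\<bar> \<le> real (Suc i) \<and> 1 \<le> n \<longrightarrow>
      twisted_norm \<theta> L f B N (\<i> * complex_of_real t) n \<omega> \<le> ennreal (C' * exp (- c * real n powr \<alpha>)))"
proof -
  from assms[unfolded decay_assumption_def, THEN conjunct2] obtain \<alpha> :: real where \<alpha>: "0 < \<alpha>"
    and dec: "\<forall>K::real set. compact K \<and> 0 \<notin> K \<longrightarrow>
           (\<exists>c>0. \<exists>C\<in>borel_measurable P. AE \<omega> in P. 0 < C \<omega> \<and>
              (\<forall>t\<in>K. \<forall>n\<ge>1. twisted_norm \<theta> L f B N (\<i> * complex_of_real t) n \<omega>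
                 \<le> ennreal (C \<omega> * exp (- c * real n powr \<alpha>))))"
    by (elim exE conjE) (rule that)
  have "AE \<omega> in P. \<exists>c C'. 0 < c \<and> 0 \<le> C' \<and> (\<forall>t n. 1 / real (Suc i) \<le> \<bar>t\<bar> \<and> \<bar>t\<bar> \<le> real (Suc i) \<and> 1 \<le> n \<longrightarrow>
      twisted_norm \<theta> L f B N (\<i> * complex_of_real t) n \<omega> \<le> ennreal (C' * exp (- c * real n powr \<alpha>)))" for i
  proof -
    define K where "K = cball (0::real) (real (Suc i)) - ball 0 (1 / real (Suc i))"
    have K: "compact K \<and> 0 \<notin> K" unfolding K_def by (simp add: compact_diff)
    have tK: "t \<in> K" if "1 / real (Suc i) \<le> \<bar>t\<bar>" "\<bar>t\<bar> \<le> real (Suc i)" for t using that by (simp add: K_def)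
    from dec[THEN spec, THEN mp, OF K] obtain c C where c: "0 < c" and C: "AE \<omega> in P. 0 < C \<omega> \<and>
              (\<forall>t\<in>K. \<forall>n\<ge>1. twisted_norm \<theta> L f B N (\<i> * complex_of_real t) n \<omega>
                 \<le> ennreal (C \<omega> * exp (- c * real n powr \<alpha>)))"
      by (elim exE conjE bexE) (rule that)
    show ?thesis
    proof (rule eventually_mono[OF C], elim conjE)
      fix \<omega> assume pos: "0 < C \<omega>" and le: "\<forall>t\<in>K. \<forall>n\<ge>1. twisted_norm \<theta> L f B N (\<i> * complex_of_real t) n \<omega>
                 \<le> ennreal (C \<omega> * exp (- c * real n powr \<alpha>))"
      show "\<exists>c C'. 0 < c \<and> 0 \<le> C' \<and> (\<forall>t n. 1 / real (Suc i) \<le> \<bar>t\<bar> \<and> \<bar>t\<bar> \<le> real (Suc i) \<and> 1 \<le> n \<longrightarrow>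
      twisted_norm \<theta> L f B N (\<i> * complex_of_real t) n \<omega> \<le> ennreal (C' * exp (- c * real n powr \<alpha>)))"
      proof (rule exI[of _ c], rule exI[of _ "C \<omega>"], intro conjI allI impI c less_imp_le[OF pos], elim conjE)
        fix t :: real and n :: nat assume t: "1 / real (Suc i) \<le> \<bar>t\<bar>" "\<bar>t\<bar> \<le> real (Suc i)" and "1 \<le> n"
        then show "twisted_norm \<theta> L f B N (\<i> * complex_of_real t) n \<omega> \<le> ennreal (C \<omega> * exp (- c * real n powr \<alpha>))"
          by (intro le[THEN bspec, OF tK[OF t], THEN spec, THEN mp])
      qed
    qed
  qed
  then have "AE \<omega> in P. \<forall>i. \<exists>c C'. 0 < c \<and> 0 \<le> C' \<and> (\<forall>t n. 1 / real (Suc i) \<le> \<bar>t\<bar> \<and> \<bar>t\<bar> \<le> real (Suc i) \<and> 1 \<le> n \<longrightarrow>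
      twisted_norm \<theta> L f B N (\<i> * complex_of_real t) n \<omega> \<le> ennreal (C' * exp (- c * real n powr \<alpha>)))"
    unfolding AE_all_countable by (rule allI)
  then show ?thesis using \<alpha> by (intro exI[of _ \<alpha>] conjI)
qed

theorem proposition55:
  fixes P :: "'w measure" and \<theta> :: "'w \<Rightarrow> 'w"
    and E :: "'w \<Rightarrow> 'x::metric_space set" and T :: "'w \<Rightarrow> 'x \<Rightarrow> 'x"
    and \<mu> :: "'w \<Rightarrow> 'x measure" and \<mu>tot :: "('w \<times> 'x) measure"
    and L :: "'w \<Rightarrow> ('x \<Rightarrow> complex) \<Rightarrow> 'x \<Rightarrow> complex"
    and B :: "'w \<Rightarrow> ('x \<Rightarrow> complex) set"
    and N N1 :: "'w \<Rightarrow> ('x \<Rightarrow> complex) \<Rightarrow> real"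
    and Nt :: "real \<Rightarrow> 'w \<Rightarrow> ('x \<Rightarrow> complex) \<Rightarrow> real"
    and f :: "'w \<Rightarrow> 'x \<Rightarrow> real"
    and \<rho> \<gamma> b :: "'w \<Rightarrow> real"
    and \<sigma> c1 c2 C :: real
  assumes system: "random_dynamical_system P \<theta> E T \<mu> \<mu>tot"
    and transfer: "transfer_operators P \<theta> E T \<mu> L"
    and spaces: "fibre_banach_spaces P E \<mu> B N"
    and transfer_continuous: "continuous_transfer P \<theta> L B N"
    and observable: "admissible_observable P E B N f"
    and perturbation: "complex_perturbation P \<theta> E \<mu> L B N f"
    and decay: "decay_assumption P \<theta> L B N f"
    and variance_limit: "AE \<omega> in P.
      (\<lambda>n. (LINT x|\<mu> \<omega>. (centered_sum \<theta> T \<mu> f \<omega> n x)\<^sup>2) / real n) \<longlonglongrightarrow> \<sigma>\<^sup>2"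
    and sigma_pos: "0 < \<sigma>"
    and norm_1: "\<And>\<omega>. \<omega> \<in> space P \<Longrightarrow> is_norm_on (B \<omega>) (N1 \<omega>)"
    and norm_1_sup: "\<And>\<omega> g x. \<omega> \<in> space P \<Longrightarrow> g \<in> B \<omega> \<Longrightarrow> x \<in> E \<omega> \<Longrightarrow> cmod (g x) \<le> N1 \<omega> g"
    and norm_t: "\<And>\<omega> t. \<omega> \<in> space P \<Longrightarrow> t \<noteq> 0 \<Longrightarrow> is_norm_on (B \<omega>) (Nt t \<omega>)"
    and constants_pos: "0 < c1" "0 < c2" "0 < C"
    and norm_comparison: "AE \<omega> in P. \<forall>t. t \<noteq> 0 \<longrightarrow> (\<forall>g\<in>B \<omega>.
      c1 * Nt t \<omega> g \<le> N1 \<omega> g \<and> N1 \<omega> g \<le> c2 * (1 + \<bar>t\<bar>) * Nt t \<omega> g)"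
    and norm_t_bound: "AE \<omega> in P. \<forall>t. t \<noteq> 0 \<longrightarrow> (\<forall>n\<ge>1.
      twisted_norm \<theta> L f B (Nt t) (\<i> * complex_of_real t) n \<omega> \<le> ennreal C)"
    and random_variables: "\<rho> \<in> borel_measurable P" "\<gamma> \<in> borel_measurable P" "b \<in> borel_measurable P"
    and positive: "AE \<omega> in P. 0 < \<rho> \<omega> \<and> 0 < \<gamma> \<omega> \<and> 0 < b \<omega>"
    and high_frequency: "AE \<omega> in P. \<forall>t. b \<omega> \<le> \<bar>t\<bar> \<longrightarrow>
      (let n = nat \<lfloor>\<rho> \<omega> * ln \<bar>t\<bar>\<rfloor> in
         twisted_norm \<theta> L f B (Nt t) (\<i> * complex_of_real t) n \<omega> \<le> ennreal (exp (- real n * \<gamma> \<omega>)))"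
  shows "\<exists>R :: nat \<Rightarrow> real. AE \<omega> in P. \<forall>m\<ge>3.
    (let S = centered_sum \<theta> T \<mu> f \<omega>; s = l2_norm_seq (\<mu> \<omega>) S in
       (\<forall>c>0. \<forall>D>0.
          (\<lambda>n. LINT t:{t. c * s n \<le> \<bar>t\<bar> \<and> \<bar>t\<bar> \<le> D * s n ^ (m - 2)}|lborel.
                 cmod (nth_vector_derivative m (normalized_char (\<mu> \<omega>) S n) t / complex_of_real t))
            \<in> o(\<lambda>n. 1 / s n ^ (m - 2))) \<and>
       edgeworth_expansions m (R m) (\<mu> \<omega>) S)"
proof (rule exI[of _ "\<lambda>_. 1"])
  interpret P: prob_space P
    using system by (simp add: random_dynamical_system_def ergodic_automorphism_def)
  have \<theta>: "\<theta> \<in> measurable P P" "distr P P \<theta> = P"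
    using system by (auto simp: random_dynamical_system_def ergodic_automorphism_def)
  have "\<exists>r0 lam h \<nu> K C' \<delta>. AE \<omega> in P. fibre_perturbation \<theta> E T \<mu> L B N1 f \<omega> N r0 lam h \<nu> K C' \<delta>"
    by (rule AE_fibre_perturbation[OF system transfer spaces transfer_continuous observable perturbation]) (rule norm_1_sup)
  then obtain r0 lam h \<nu> K C' \<delta> where pert: "AE \<omega> in P. fibre_perturbation \<theta> E T \<mu> L B N1 f \<omega> N r0 lam h \<nu> K C' \<delta>"
    by (elim exE) (rule that)
  from AE_low_frequency[OF decay] obtain \<alpha> where \<alpha>: "0 < \<alpha>"
    and low: "AE \<omega> in P. \<forall>i. \<exists>c C'. 0 < c \<and> 0 \<le> C' \<and> (\<forall>t n. 1 / real (Suc i) \<le> \<bar>t\<bar> \<and> \<bar>t\<bar> \<le> real (Suc i) \<and> 1 \<le> n \<longrightarrow>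
      twisted_norm \<theta> L f B N (\<i> * complex_of_real t) n \<omega> \<le> ennreal (C' * exp (- c * real n powr \<alpha>)))"
    by (elim exE conjE) (rule that)
  note visits = AE_frequent_contraction[OF P.prob_space_axioms \<theta> random_variables positive]
  note comparison = AE_orbit[OF \<theta> norm_comparison]
  note bound = AE_orbit[OF \<theta> norm_t_bound]
  note high = AE_orbit[OF \<theta> high_frequency[unfolded Let_def]]
  show "AE \<omega> in P. \<forall>m\<ge>3.
    (let S = centered_sum \<theta> T \<mu> f \<omega>; s = l2_norm_seq (\<mu> \<omega>) S in
       (\<forall>c>0. \<forall>D>0.
          (\<lambda>n. LINT t:{t. c * s n \<le> \<bar>t\<bar> \<and> \<bar>t\<bar> \<le> D * s n ^ (m - 2)}|lborel.
                 cmod (nth_vector_derivative m (normalized_char (\<mu> \<omega>) S n) t / complex_of_real t))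
            \<in> o(\<lambda>n. 1 / s n ^ (m - 2))) \<and>
       edgeworth_expansions m 1 (\<mu> \<omega>) S)"
  proof (rule eventually_mono[OF eventually_conj[OF eventually_conj[OF eventually_conj[OF pert low] eventually_conj[OF visits comparison]]
        eventually_conj[OF eventually_conj[OF bound high] eventually_conj[OF AE_orbit[OF \<theta> AE_space] variance_limit]]]], elim conjE)
    fix \<omega>
    let ?w = "\<lambda>j. (\<theta> ^^ j) \<omega>"
    assume fp: "fibre_perturbation \<theta> E T \<mu> L B N1 f \<omega> N r0 lam h \<nu> K C' \<delta>"
      and low: "\<forall>i. \<exists>c C'. 0 < c \<and> 0 \<le> C' \<and> (\<forall>t n. 1 / real (Suc i) \<le> \<bar>t\<bar> \<and> \<bar>t\<bar> \<le> real (Suc i) \<and> 1 \<le> n \<longrightarrow>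
      twisted_norm \<theta> L f B N (\<i> * complex_of_real t) n \<omega> \<le> ennreal (C' * exp (- c * real n powr \<alpha>)))"
      and vis: "\<exists>R J. 1 \<le> R \<and> (\<forall>n. real n \<le> 2 * real (card (J \<inter> {..<n}))) \<and>
        (\<forall>j\<in>J. 1 / R \<le> \<rho> (?w j) \<and> \<rho> (?w j) \<le> R \<and> 1 / R \<le> \<gamma> (?w j) \<and> b (?w j) \<le> R)"
      and cmp: "\<forall>j t. t \<noteq> 0 \<longrightarrow> (\<forall>g\<in>B (?w j). c1 * Nt t (?w j) g \<le> N1 (?w j) g \<and> N1 (?w j) g \<le> c2 * (1 + \<bar>t\<bar>) * Nt t (?w j) g)"
      and bd: "\<forall>j t. t \<noteq> 0 \<longrightarrow> (\<forall>n\<ge>1. twisted_norm \<theta> L f B (Nt t) (\<i> * complex_of_real t) n (?w j) \<le> ennreal C)"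
      and hi: "\<forall>j t. b (?w j) \<le> \<bar>t\<bar> \<longrightarrow> twisted_norm \<theta> L f B (Nt t) (\<i> * complex_of_real t) (nat \<lfloor>\<rho> (?w j) * ln \<bar>t\<bar>\<rfloor>) (?w j)
        \<le> ennreal (exp (- real (nat \<lfloor>\<rho> (?w j) * ln \<bar>t\<bar>\<rfloor>) * \<gamma> (?w j)))"
      and sp: "\<forall>j. ?w j \<in> space P"
      and var: "(\<lambda>n. (LINT x|\<mu> \<omega>. (centered_sum \<theta> T \<mu> f \<omega> n x)\<^sup>2) / real n) \<longlonglongrightarrow> \<sigma>\<^sup>2"
    interpret fibre_perturbation \<theta> E T \<mu> L B N1 f \<omega> N r0 lam h \<nu> K C' \<delta> by (rule fp)
    from vis obtain R J where R: "1 \<le> R" and v: "\<forall>n. real n \<le> 2 * real (card (J \<inter> {..<n}))"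
      and J: "\<forall>j\<in>J. 1 / R \<le> \<rho> (?w j) \<and> \<rho> (?w j) \<le> R \<and> 1 / R \<le> \<gamma> (?w j) \<and> b (?w j) \<le> R"
      by (elim exE conjE) (rule that)
    \<comment> \<open>On \<open>J\<close> the level \<open>R\<close> also bounds \<open>b\<close>,
      so the contraction hypothesis holds at every time of \<open>J\<close> from |t| = R on.\<close>
    have "\<exists>U A. 1 < U \<and> 0 \<le> A \<and> (\<forall>u n. U \<le> \<bar>u\<bar> \<longrightarrow>
      cmod (mgf (\<mu> \<omega>) (birkhoff_sum \<theta> T f \<omega> n) (\<i> * complex_of_real u)) \<le> A * (1 + \<bar>u\<bar>) * exp (- real n / (2 * (R * ln \<bar>u\<bar>))))"
    proof (rule mgf_high_frequency[where Nt=Nt and \<rho>=\<rho> and \<gamma>=\<gamma> and J=J])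
      fix j and t :: real assume t: "t \<noteq> 0"
      show "is_norm_on (B (?w j)) (Nt t (?w j))" by (rule norm_t[OF sp[THEN spec] t])
      show "c1 * Nt t (?w j) g \<le> N1 (?w j) g \<and> N1 (?w j) g \<le> c2 * (1 + \<bar>t\<bar>) * Nt t (?w j) g" if "g \<in> B (?w j)" for g
        by (rule cmp[THEN spec, THEN spec, THEN mp, OF t, THEN bspec, OF that])
      show "twisted_norm \<theta> L f B (Nt t) (\<i> * complex_of_real t) n (?w j) \<le> ennreal C" if "1 \<le> n" for n
        by (rule bd[THEN spec, THEN spec, THEN mp, OF t, THEN spec, THEN mp, OF that])
    next
      fix j and t :: real assume j: "j \<in> J" and "R \<le> \<bar>t\<bar>"
      then have "b (?w j) \<le> \<bar>t\<bar>" using J by (meson order_trans)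
      then show "twisted_norm \<theta> L f B (Nt t) (\<i> * complex_of_real t) (nat \<lfloor>\<rho> (?w j) * ln \<bar>t\<bar>\<rfloor>) (?w j)
        \<le> ennreal (exp (- real (nat \<lfloor>\<rho> (?w j) * ln \<bar>t\<bar>\<rfloor>) * \<gamma> (?w j)))"
        by (rule hi[THEN spec, THEN spec, THEN mp])
    qed (use constants_pos R v J in auto)
    then have "\<exists>U A R. 1 < U \<and> 0 \<le> A \<and> 1 \<le> R \<and> (\<forall>u n. U \<le> \<bar>u\<bar> \<longrightarrow>
      cmod (mgf (\<mu> \<omega>) (birkhoff_sum \<theta> T f \<omega> n) (\<i> * complex_of_real u)) \<le> A * (1 + \<bar>u\<bar>) * exp (- real n / (2 * (R * ln \<bar>u\<bar>))))"
      using R by blast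
    from edgeworth_sequence_centered[OF var sigma_pos this \<alpha> low[THEN spec]] obtain r C0
      where es: "edgeworth_sequence (\<mu> \<omega>) (centered_sum \<theta> T \<mu> f \<omega>) (l2_norm_seq (\<mu> \<omega>) (centered_sum \<theta> T \<mu> f \<omega>)) r C0"
      by (elim exE) (rule that)
    show "\<forall>m\<ge>3.
    (let S = centered_sum \<theta> T \<mu> f \<omega>; s = l2_norm_seq (\<mu> \<omega>) S in
       (\<forall>c>0. \<forall>D>0.
          (\<lambda>n. LINT t:{t. c * s n \<le> \<bar>t\<bar> \<and> \<bar>t\<bar> \<le> D * s n ^ (m - 2)}|lborel.
                 cmod (nth_vector_derivative m (normalized_char (\<mu> \<omega>) S n) t / complex_of_real t))
            \<in> o(\<lambda>n. 1 / s n ^ (m - 2))) \<and>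
       edgeworth_expansions m 1 (\<mu> \<omega>) S)"
      unfolding Let_def
      by (intro allI impI conjI edgeworth_sequence.char_derivative_integral_small[OF es] edgeworth_sequence.edgeworth_expansions_hold[OF es])
  qed
qed

end
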